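(* Let $\Bbbk$ be an algebraically closed field of characteristic $0$, let $N\ge1$, $n\ge2$ be integers and $\mu,\lambda\in\{1,-1\}$. (1) If $(n,\lambda)\neq(2,1)$, or if $(n,\lambda,\mu)=(2,1,-1)$ and $N$ is even, then $$\mathrm{Aut}_{\mathrm{Hopf}}(A_{Nn}^{\mu\lambda})=\{\Psi_\xi^{s,t},\ \Phi_\xi^{s,t}\},$$ where the parameters run over all $s\in\{1,\dots,N\}$, $t\in\{1,\dots,n-1\}$ with $t$ odd and $\gcd(2s+t,N)=1=\gcd(n,t)$, and all $\xi\in\Bbbk$ with $\xi^{2N}=1=\xi^4$ if $n$ is even, $\xi^2=1$ if $n$ is odd. The composition is given by the relations $$\Psi_{\xi_1}^{s_1,t_1}\Psi_{\xi_2}^{s_2,t_2}=\Psi_{\xi_1^{2s_2+1}\xi_2}^{s_1(2s_2+t_2)+s_2t_1,\,t_1t_2},\qquad \Phi_{\xi_1}^{s_1,t_1}\Phi_{\xi_2}^{s_2,t_2}=\Psi_{\xi_1^{2s_2-1}\xi_2}^{s_1(2s_2+t_2)+s_2t_1,\,t_1t_2},$$ $$\Psi_{\xi_1}^{s_1,t_1}\Phi_{\xi_2}^{s_2,t_2}=\Phi_{\xi_1^{2s_2-1}\xi_2}^{s_1(2s_2+t_2)+s_2t_1,\,t_1t_2},\qquad \Phi_{\xi_1}^{s_1,t_1}\Psi_{\xi_2}^{s_2,t_2}=\Phi_{\xi_1^{2s_2+1}\xi_2}^{s_1(2s_2+t_2)+s_2t_1,\,t_1t_2}.$$ (2) If $(n,\lambda)=(2,1)$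 and it is not the case that both $\mu=-1$ and $N$ is even, then $$\mathrm{Aut}_{\mathrm{Hopf}}(A_{Nn}^{\mu\lambda})=\{\Psi_\xi^{s,1},\ \Phi_\xi^{s,1},\ \Gamma_s^{\zeta_1,\zeta_2}\},$$ where the parameters run over all $s\in\{1,\dots,N\}$ with $\gcd(2s+1,N)=1$, all $\xi\in\Bbbk$ with $\xi^{2N}=1=\xi^4$, and all $\zeta_1,\zeta_2\in\Bbbk$ with $\zeta_1^4=\zeta_2^4=\mu=1$ if $N$ is even, $\zeta_1^2=\zeta_2^2=\mu$ if $N$ is odd. The composition is given by the four relations in (1) (with $t_1=t_2=1$) together with $$\Gamma^{a_1,a_2}_{s_1}\Gamma^{b_1,b_2}_{s_2}=\begin{cases}\Psi_{a_2^{2s_2+1}b_1}^{s_1(2s_2+1)+s_2,\,1}, & a_1^{2s_2}a_1b_2=1,\ (a_1b_2)^2=1,\\ \Phi_{a_2^{2s_2-1}b_1}^{s_1(2s_2+1)+s_2,\,1}, & a_1^{2s_2}a_1b_2=-1,\ (a_1b_2)^2=1,\\ \Gamma_{s_1(2s_2+1)+s_2}^{-b_1a_1^{2s_2}a_1b_2,\,-(a_1a_2)^{2s_2+1}b_2}, & (a_1b_2)^2=-1,\end{cases}$$ $$\Gamma^{\zeta_1,\zeta_2}_{s_1}\Psi_\xi^{s_2,1}=\Gamma^{\zeta_1^{2s_2+1}\xi,\,\zeta_2^{2s_2+1}}_{s_1(2s_2+1)+s_2},\qquad \Psi_\xi^{s_2,1}\Gamma^{\zeta_1,\zeta_2}_{s_1}=\Gamma^{\zeta_1,\,\xi^{2s_1+1}\zeta_2}_{s_1(2s_2+1)+s_2},$$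 $$\Phi_\xi^{s_2,1}\Gamma^{\zeta_1,\zeta_2}_{s_1}=\Gamma^{-\zeta_1,\,\xi^{2s_1-1}\zeta_2^{-1}}_{s_1(2s_2+1)+s_2},\qquad \Gamma^{\zeta_1,\zeta_2}_{s_1}\Phi_\xi^{s_2,1}=\Gamma^{\xi\zeta_1^{-(2s_2+1)},\,-\zeta_2^{2s_2+1}}_{s_1(2s_2+1)+s_2}.$$
   Context: The Suzuki Hopf algebra $A_{Nn}^{\mu\lambda}$ over $\Bbbk$ is the unital associative algebra generated by $x_{11},x_{12},x_{21},x_{22}$ with relations $$x_{11}^2=x_{22}^2,\quad x_{12}^2=x_{21}^2,\quad \chi_{21}^n=\lambda\chi_{12}^n,\quad \chi_{11}^n=\chi_{22}^n,\quad x_{11}^{2N}+\mu x_{12}^{2N}=1,$$ $$x_{ij}x_{kl}=0\ \text{ whenever } i+j+k+l \text{ is odd},$$ where for $m\ge 1$ the symbols $\chi_{ij}^m$ (superscript is not a power) denote the alternating words with $m$ letters: $\chi_{11}^m=x_{11}x_{22}x_{11}\cdots$, $\chi_{22}^m=x_{22}x_{11}x_{22}\cdots$, $\chi_{12}^m=x_{12}x_{21}x_{12}\cdots$, $\chi_{21}^m=x_{21}x_{12}x_{21}\cdots$. The Hopf structure is $\Delta(x_{ij})=x_{i1}\otimes x_{1j}+x_{i2}\otimes x_{2j}$, $\varepsilon(x_{ij})=\delta_{ij}$, $S(x_{ij})=x_{ji}^{4N-1}$. It has dimension $4Nn$, with basis $\{x_{11}^s\chi_{22}^t,\ x_{12}^s\chi_{21}^t\mid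 1\le s\le 2N,\ 0\le t\le n-1\}$ (where $\chi^0$ is the empty word). $\mathrm{Aut}_{\mathrm{Hopf}}(H)$ is the group of Hopf algebra automorphisms of $H$ under composition ($fg$ means $f\circ g$). The maps $\Psi,\Phi,\Gamma$ are the algebra maps determined on generators by the following formulas, for integers $s,t\ge1$ and nonzero scalars $\xi,\zeta_1,\zeta_2\in\Bbbk$ (the same formulas define the maps when the indices $s,t$ obtained in the composition relations lie outside $\{1,\dots,N\}$, $\{1,\dots,n-1\}$): $$\Psi_\xi^{s,t}:\ x_{11}\mapsto x_{11}^{2s}\chi_{11}^t,\ x_{22}\mapsto x_{11}^{2s}\chi_{22}^t,\ x_{12}\mapsto \xi x_{12}^{2s}\chi_{12}^t,\ x_{21}\mapsto \xi^{-1}x_{12}^{2s}\chi_{21}^t;$$ $$\Phi_\xi^{s,t}:\ x_{11}\mapsto x_{11}^{2s}\chi_{22}^t,\ x_{22}\mapsto x_{11}^{2s}\chi_{11}^t,\ x_{12}\mapsto \xi x_{12}^{2s}\chi_{21}^t,\ x_{21}\mapsto \xi^{-1}x_{12}^{2s}\chi_{12}^t;$$ and, for $n=2$, $\lambda=1$, $$\Gamma^{\zeta_1,\zeta_2}_s(x_{11})=\tfrac12\left[x_{11}^{2s}(x_{11}+x_{22})+x_{12}^{2s}(\zeta_2x_{12}+\zeta_2^{-1}x_{21})\right],$$ $$\Gamma^{\zeta_1,\zeta_2}_s(x_{22})=\tfrac12\left[x_{11}^{2s}(x_{11}+x_{22})-x_{12}^{2s}(\zeta_2x_{12}+\zeta_2^{-1}x_{21})\right],$$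 $$\Gamma^{\zeta_1,\zeta_2}_s(x_{12})=\tfrac{\zeta_1}2\left[x_{11}^{2s}(x_{11}-x_{22})-x_{12}^{2s}(\zeta_2x_{12}-\zeta_2^{-1}x_{21})\right],$$ $$\Gamma^{\zeta_1,\zeta_2}_s(x_{21})=\tfrac{\zeta_1^{-1}}2\left[x_{11}^{2s}(x_{11}-x_{22})+x_{12}^{2s}(\zeta_2x_{12}-\zeta_2^{-1}x_{21})\right].$$ *)

theory Defs
  imports
    "HOL-Library.Poly_Mapping"
    "HOL-Computational_Algebra.Polynomial"
    "HOL-Algebra.Module"
    "HOL-Algebra.QuotRing"
    "HOL-Algebra.Bij"
begin

section \<open>Algebras over a field\<close>

text \<open>
  The ground field is a type \<open>'k\<close> of class \<^class>\<open>field\<close>; a \<open>'k\<close>-algebra is given by a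
  \<^type>\<open>module_scheme\<close> record, i.e. a ring record with a scalar multiplication by elements of \<open>'k\<close>.
\<close>

definition alg_hom ::
  "('k, 'a, 'm) module_scheme \<Rightarrow> ('k, 'b, 'l) module_scheme \<Rightarrow> ('a \<Rightarrow> 'b) set" where
  "alg_hom A B =
    {h \<in> ring_hom A B. \<forall>c. \<forall>x \<in> carrier A. h (c \<odot>\<^bsub>A\<^esub> x) = c \<odot>\<^bsub>B\<^esub> h x}"

definition field_alg :: "('k::field, 'k) module" where
  "field_alg = \<lparr>carrier = UNIV, mult = (*), one = 1, zero = 0, add = (+), smult = (*)\<rparr>"

definition op_alg :: "('k, 'a, 'm) module_scheme \<Rightarrow> ('k, 'a, 'm) module_scheme" where
  "op_alg A = A\<lparr>mult := \<lambda>x y. y \<otimes>\<^bsub>A\<^esub> x\<rparr>"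

definition quot_alg :: "('k, 'a, 'm) module_scheme \<Rightarrow> 'a set \<Rightarrow> ('k, 'a set) module" where
  "quot_alg A I =
    \<lparr>carrier = carrier (A Quot I), mult = mult (A Quot I), one = one (A Quot I),
     zero = zero (A Quot I), add = add (A Quot I),
     smult = \<lambda>c X. \<Union>x\<in>X. I +>\<^bsub>A\<^esub> (c \<odot>\<^bsub>A\<^esub> x)\<rparr>"

definition pm_scale :: "'k::field \<Rightarrow> ('a \<Rightarrow>\<^sub>0 'k) \<Rightarrow> ('a \<Rightarrow>\<^sub>0 'k)" (infixr \<open>\<cdot>\<close> 75) where
  "c \<cdot> p = Poly_Mapping.map ((*) c) p"


subsection \<open>Free algebras\<close>

text \<open>
  \<open>'g word\<close> is the free monoid on \<open>'g\<close>, written additively, so that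
  \<open>'g word \<Rightarrow>\<^sub>0 'k\<close> with the convolution product of \<^theory>\<open>HOL-Library.Poly_Mapping\<close> is the free
  associative unital \<open>'k\<close>-algebra on \<open>'g\<close>.
\<close>

datatype 'g word = Word (letters: "'g list")

instantiation word :: (type) monoid_add
begin

definition zero_word :: "'a word" where
  "zero_word = Word []"

definition plus_word :: "'a word \<Rightarrow> 'a word \<Rightarrow> 'a word" where
  "plus_word u v = Word (letters u @ letters v)"

instance
  by standard (simp_all add: zero_word_def plus_word_def)

end

definition free_alg :: "('k::field, 'g word \<Rightarrow>\<^sub>0 'k) module" where
  "free_alg = \<lparr>carrier = UNIV, mult = (*), one = 1, zero = 0, add = (+), smult = (\<cdot>)\<rparr>"

text \<open>The algebra map from the free algebra to \<open>B\<close> that sends each generator \<open>l\<close> to \<open>g l\<close>.\<close>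

definition free_lift ::
  "('k::field, 'b, 'm) module_scheme \<Rightarrow> ('g \<Rightarrow> 'b) \<Rightarrow> ('g word \<Rightarrow>\<^sub>0 'k) \<Rightarrow> 'b" where
  "free_lift B g p =
    (\<Oplus>\<^bsub>B\<^esub>w\<in>Poly_Mapping.keys p.
       Poly_Mapping.lookup p w \<odot>\<^bsub>B\<^esub> foldr (\<lambda>l b. g l \<otimes>\<^bsub>B\<^esub> b) (letters w) \<one>\<^bsub>B\<^esub>)"

text \<open>
  The map that \<^const>\<open>free_lift\<close> induces on the quotient of the free algebra by an ideal \<open>I\<close>.
  It is the algebra map determined by \<open>g\<close> whenever the elements \<open>g l\<close> satisfy the relations in \<open>I\<close>;
  otherwise \<^const>\<open>free_lift\<close> is not constant on cosets and the values are unspecified.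
\<close>

definition quot_lift ::
  "('g word \<Rightarrow>\<^sub>0 'k::field) set \<Rightarrow> ('k, 'b, 'm) module_scheme \<Rightarrow> ('g \<Rightarrow> 'b) \<Rightarrow>
     ('g word \<Rightarrow>\<^sub>0 'k) set \<Rightarrow> 'b" where
  "quot_lift I B g =
    (\<lambda>X\<in>carrier (quot_alg free_alg I). the_elem (free_lift B g ` X))"


subsection \<open>Tensor products\<close>

text \<open>
  \<open>A \<otimes> B\<close> is the free vector space on \<open>carrier A \<times> carrier B\<close>, with the product
  \<open>(a, b) (a', b') = (a a', b b')\<close>, modulo the subspace spanned by the bilinearity relations
  (which is a two-sided ideal when \<open>A\<close> and \<open>B\<close> are algebras).
\<close>

definition pre_tensor ::
  "('k::field, 'a, 'm) module_scheme \<Rightarrow> ('k, 'b, 'l) module_scheme \<Rightarrow>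
     ('k, 'a \<times> 'b \<Rightarrow>\<^sub>0 'k) module" where
  "pre_tensor A B =
    \<lparr>carrier = {p. Poly_Mapping.keys p \<subseteq> carrier A \<times> carrier B},
     mult = \<lambda>p q. \<Sum>(a, b)\<in>Poly_Mapping.keys p. \<Sum>(a', b')\<in>Poly_Mapping.keys q.
       Poly_Mapping.single (a \<otimes>\<^bsub>A\<^esub> a', b \<otimes>\<^bsub>B\<^esub> b')
         (Poly_Mapping.lookup p (a, b) * Poly_Mapping.lookup q (a', b')),
     one = Poly_Mapping.single (\<one>\<^bsub>A\<^esub>, \<one>\<^bsub>B\<^esub>) 1,
     zero = 0, add = (+), smult = (\<cdot>)\<rparr>"

definition bilinearity_rels ::
  "('k::field, 'a, 'm) module_scheme \<Rightarrow> ('k, 'b, 'l) module_scheme \<Rightarrow> ('a \<times> 'b \<Rightarrow>\<^sub>0 'k) set" where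
  "bilinearity_rels A B =
    {Poly_Mapping.single (a \<oplus>\<^bsub>A\<^esub> a', b) 1
       - Poly_Mapping.single (a, b) 1 - Poly_Mapping.single (a', b) 1
      | a a' b. a \<in> carrier A \<and> a' \<in> carrier A \<and> b \<in> carrier B}
    \<union> {Poly_Mapping.single (a, b \<oplus>\<^bsub>B\<^esub> b') 1
       - Poly_Mapping.single (a, b) 1 - Poly_Mapping.single (a, b') 1
      | a b b'. a \<in> carrier A \<and> b \<in> carrier B \<and> b' \<in> carrier B}
    \<union> {Poly_Mapping.single (c \<odot>\<^bsub>A\<^esub> a, b) 1 - c \<cdot> Poly_Mapping.single (a, b) 1
      | c a b. a \<in> carrier A \<and> b \<in> carrier B}
    \<union> {Poly_Mapping.single (a, c \<odot>\<^bsub>B\<^esub> b) 1 - c \<cdot> Poly_Mapping.single (a, b) 1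
      | c a b. a \<in> carrier A \<and> b \<in> carrier B}"

definition tensor_null ::
  "('k::field, 'a, 'm) module_scheme \<Rightarrow> ('k, 'b, 'l) module_scheme \<Rightarrow> ('a \<times> 'b \<Rightarrow>\<^sub>0 'k) set" where
  "tensor_null A B = Modules.module.span (\<cdot>) (bilinearity_rels A B)"

definition tensor_alg ::
  "('k::field, 'a, 'm) module_scheme \<Rightarrow> ('k, 'b, 'l) module_scheme \<Rightarrow>
     ('k, ('a \<times> 'b \<Rightarrow>\<^sub>0 'k) set) module" where
  "tensor_alg A B = quot_alg (pre_tensor A B) (tensor_null A B)"

definition pure_tensor ::
  "('k::field, 'a, 'm) module_scheme \<Rightarrow> ('k, 'b, 'l) module_scheme \<Rightarrow> 'a \<Rightarrow> 'b \<Rightarrow>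
     ('a \<times> 'b \<Rightarrow>\<^sub>0 'k) set" where
  "pure_tensor A B a b = tensor_null A B +>\<^bsub>pre_tensor A B\<^esub> Poly_Mapping.single (a, b) 1"

text \<open>The map \<open>f \<otimes> g : A \<otimes> B \<rightarrow> C \<otimes> D\<close> for linear maps \<open>f : A \<rightarrow> C\<close> and \<open>g : B \<rightarrow> D\<close>.\<close>

definition tensor_map ::
  "('k::field, 'a, 'm) module_scheme \<Rightarrow> ('k, 'b, 'l) module_scheme \<Rightarrow>
   ('k, 'c, 'r) module_scheme \<Rightarrow> ('k, 'd, 's) module_scheme \<Rightarrow>
   ('a \<Rightarrow> 'c) \<Rightarrow> ('b \<Rightarrow> 'd) \<Rightarrow> ('a \<times> 'b \<Rightarrow>\<^sub>0 'k) set \<Rightarrow> ('c \<times> 'd \<Rightarrow>\<^sub>0 'k) set" where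
  "tensor_map A B C D f g =
    (\<lambda>X\<in>carrier (tensor_alg A B).
       \<Union>p\<in>X. tensor_null C D +>\<^bsub>pre_tensor C D\<^esub>
         (\<Sum>(a, b)\<in>Poly_Mapping.keys p.
            Poly_Mapping.single (f a, g b) (Poly_Mapping.lookup p (a, b))))"


section \<open>Hopf algebra automorphisms\<close>

record (overloaded) ('k, 'a) hopf_alg = "('k, 'a) module" +
  comult :: "'a \<Rightarrow> ('a \<times> 'a \<Rightarrow>\<^sub>0 'k) set"
  counit :: "'a \<Rightarrow> 'k"
  antipode :: "'a \<Rightarrow> 'a"

text \<open>
  As in \<^theory>\<open>HOL-Algebra.Bij\<close>, automorphisms are extensional functions on the carrier, and the
  product of the automorphism group is composition.
\<close>

definition hopf_auto :: "('k::field, 'a) hopf_alg \<Rightarrow> ('a \<Rightarrow> 'a) set" where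
  "hopf_auto H =
    {f \<in> alg_hom H H \<inter> Bij (carrier H). \<forall>a\<in>carrier H.
       comult H (f a) = tensor_map H H H H f f (comult H a) \<and>
       counit H (f a) = counit H a \<and>
       antipode H (f a) = f (antipode H a)}"

definition Aut_Hopf :: "('k::field, 'a) hopf_alg \<Rightarrow> ('a \<Rightarrow> 'a) monoid" where
  "Aut_Hopf H = BijGroup (carrier H) \<lparr>carrier := hopf_auto H\<rparr>"


section \<open>The Suzuki Hopf algebras\<close>

datatype idx = One | Two

fun idx_nat :: "idx \<Rightarrow> nat" where
  "idx_nat One = 1"
| "idx_nat Two = 2"

fun swap :: "idx \<Rightarrow> idx" where
  "swap One = Two"
| "swap Two = One"

type_synonym 'k sfree = "(idx \<times> idx) word \<Rightarrow>\<^sub>0 'k"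

definition gx :: "idx \<Rightarrow> idx \<Rightarrow> 'k::field sfree" where
  "gx i j = Poly_Mapping.single (Word [(i, j)]) 1"

abbreviation x11 :: "'k::field sfree" where "x11 \<equiv> gx One One"
abbreviation x12 :: "'k::field sfree" where "x12 \<equiv> gx One Two"
abbreviation x21 :: "'k::field sfree" where "x21 \<equiv> gx Two One"
abbreviation x22 :: "'k::field sfree" where "x22 \<equiv> gx Two Two"

text \<open>\<open>chi i j m\<close> is the alternating word with \<open>m\<close> letters that starts with \<open>gx i j\<close>.\<close>

fun chi :: "idx \<Rightarrow> idx \<Rightarrow> nat \<Rightarrow> 'k::field sfree" where
  "chi i j 0 = 1"
| "chi i j (Suc m) = gx i j * chi (swap i) (swap j) m"

definition suzuki_rels :: "nat \<Rightarrow> nat \<Rightarrow> 'k::field \<Rightarrow> 'k \<Rightarrow> 'k sfree set" where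
  "suzuki_rels N n \<mu> lam =
    {x11^2 - x22^2, x12^2 - x21^2,
     chi Two One n - lam \<cdot> chi One Two n, chi One One n - chi Two Two n,
     x11^(2*N) + \<mu> \<cdot> x12^(2*N) - 1}
    \<union> {gx i j * gx k l | i j k l. odd (idx_nat i + idx_nat j + idx_nat k + idx_nat l)}"

definition suzuki_ideal :: "nat \<Rightarrow> nat \<Rightarrow> 'k::field \<Rightarrow> 'k \<Rightarrow> 'k sfree set" where
  "suzuki_ideal N n \<mu> lam = Idl\<^bsub>free_alg\<^esub> (suzuki_rels N n \<mu> lam)"

definition suzuki_alg :: "nat \<Rightarrow> nat \<Rightarrow> 'k::field \<Rightarrow> 'k \<Rightarrow> ('k, 'k sfree set) module" where
  "suzuki_alg N n \<mu> lam = quot_alg free_alg (suzuki_ideal N n \<mu> lam)"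

definition suzuki_class :: "nat \<Rightarrow> nat \<Rightarrow> 'k::field \<Rightarrow> 'k \<Rightarrow> 'k sfree \<Rightarrow> 'k sfree set" where
  "suzuki_class N n \<mu> lam p = suzuki_ideal N n \<mu> lam +>\<^bsub>free_alg\<^esub> p"

definition suzuki_comult ::
  "nat \<Rightarrow> nat \<Rightarrow> 'k::field \<Rightarrow> 'k \<Rightarrow> 'k sfree set \<Rightarrow> ('k sfree set \<times> 'k sfree set \<Rightarrow>\<^sub>0 'k) set" where
  "suzuki_comult N n \<mu> lam =
    (let A = suzuki_alg N n \<mu> lam; x = (\<lambda>i j. suzuki_class N n \<mu> lam (gx i j)) in
     quot_lift (suzuki_ideal N n \<mu> lam) (tensor_alg A A)
       (\<lambda>(i, j). pure_tensor A A (x i One) (x One j)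
                 \<oplus>\<^bsub>tensor_alg A A\<^esub> pure_tensor A A (x i Two) (x Two j)))"

definition suzuki_counit :: "nat \<Rightarrow> nat \<Rightarrow> 'k::field \<Rightarrow> 'k \<Rightarrow> 'k sfree set \<Rightarrow> 'k" where
  "suzuki_counit N n \<mu> lam =
    quot_lift (suzuki_ideal N n \<mu> lam) field_alg (\<lambda>(i, j). if i = j then 1 else 0)"

text \<open>The antipode is anti-multiplicative, hence an algebra map to the opposite algebra.\<close>

definition suzuki_antipode :: "nat \<Rightarrow> nat \<Rightarrow> 'k::field \<Rightarrow> 'k \<Rightarrow> 'k sfree set \<Rightarrow> 'k sfree set" where
  "suzuki_antipode N n \<mu> lam =
    quot_lift (suzuki_ideal N n \<mu> lam) (op_alg (suzuki_alg N n \<mu> lam))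
      (\<lambda>(i, j). suzuki_class N n \<mu> lam (gx j i ^ (4*N - 1)))"

definition suzuki :: "nat \<Rightarrow> nat \<Rightarrow> 'k::field \<Rightarrow> 'k \<Rightarrow> ('k, 'k sfree set) hopf_alg" where
  "suzuki N n \<mu> lam =
    (let A = suzuki_alg N n \<mu> lam in
     \<lparr>carrier = carrier A, mult = mult A, one = one A, zero = zero A, add = add A, smult = smult A,
      comult = suzuki_comult N n \<mu> lam, counit = suzuki_counit N n \<mu> lam,
      antipode = suzuki_antipode N n \<mu> lam\<rparr>)"


subsection \<open>The maps \<open>\<Psi>\<close>, \<open>\<Phi>\<close> and \<open>\<Gamma>\<close>\<close>

text \<open>
  The algebra endomorphism with \<open>x\<^sub>1\<^sub>1 \<mapsto> a\<close>, \<open>x\<^sub>2\<^sub>2 \<mapsto> b\<close>, \<open>x\<^sub>1\<^sub>2 \<mapsto> c\<close>, \<open>x\<^sub>2\<^sub>1 \<mapsto> d\<close>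
  (note the order), the images being given by representatives in the free algebra.
\<close>

definition suzuki_endo ::
  "nat \<Rightarrow> nat \<Rightarrow> 'k::field \<Rightarrow> 'k \<Rightarrow> 'k sfree \<Rightarrow> 'k sfree \<Rightarrow> 'k sfree \<Rightarrow> 'k sfree \<Rightarrow>
     'k sfree set \<Rightarrow> 'k sfree set" where
  "suzuki_endo N n \<mu> lam a b c d =
    quot_lift (suzuki_ideal N n \<mu> lam) (suzuki_alg N n \<mu> lam)
      (\<lambda>l. suzuki_class N n \<mu> lam
         (case l of (One, One) \<Rightarrow> a | (Two, Two) \<Rightarrow> b | (One, Two) \<Rightarrow> c | (Two, One) \<Rightarrow> d))"

definition suzuki_Psi ::
  "nat \<Rightarrow> nat \<Rightarrow> 'k::field \<Rightarrow> 'k \<Rightarrow> nat \<Rightarrow> nat \<Rightarrow> 'k \<Rightarrow> 'k sfree set \<Rightarrow> 'k sfree set" where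
  "suzuki_Psi N n \<mu> lam s t \<xi> = suzuki_endo N n \<mu> lam
    (x11^(2*s) * chi One One t)
    (x11^(2*s) * chi Two Two t)
    (\<xi> \<cdot> (x12^(2*s) * chi One Two t))
    (inverse \<xi> \<cdot> (x12^(2*s) * chi Two One t))"

definition suzuki_Phi ::
  "nat \<Rightarrow> nat \<Rightarrow> 'k::field \<Rightarrow> 'k \<Rightarrow> nat \<Rightarrow> nat \<Rightarrow> 'k \<Rightarrow> 'k sfree set \<Rightarrow> 'k sfree set" where
  "suzuki_Phi N n \<mu> lam s t \<xi> = suzuki_endo N n \<mu> lam
    (x11^(2*s) * chi Two Two t)
    (x11^(2*s) * chi One One t)
    (\<xi> \<cdot> (x12^(2*s) * chi Two One t))
    (inverse \<xi> \<cdot> (x12^(2*s) * chi One Two t))"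

definition suzuki_Gamma ::
  "nat \<Rightarrow> nat \<Rightarrow> 'k::field \<Rightarrow> 'k \<Rightarrow> nat \<Rightarrow> 'k \<Rightarrow> 'k \<Rightarrow> 'k sfree set \<Rightarrow> 'k sfree set" where
  "suzuki_Gamma N n \<mu> lam s \<zeta>\<^sub>1 \<zeta>\<^sub>2 = suzuki_endo N n \<mu> lam
    ((1/2) \<cdot> (x11^(2*s) * (x11 + x22) + x12^(2*s) * (\<zeta>\<^sub>2 \<cdot> x12 + inverse \<zeta>\<^sub>2 \<cdot> x21)))
    ((1/2) \<cdot> (x11^(2*s) * (x11 + x22) - x12^(2*s) * (\<zeta>\<^sub>2 \<cdot> x12 + inverse \<zeta>\<^sub>2 \<cdot> x21)))
    ((\<zeta>\<^sub>1/2) \<cdot> (x11^(2*s) * (x11 - x22) - x12^(2*s) * (\<zeta>\<^sub>2 \<cdot> x12 - inverse \<zeta>\<^sub>2 \<cdot> x21)))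
    ((inverse \<zeta>\<^sub>1/2) \<cdot> (x11^(2*s) * (x11 - x22) + x12^(2*s) * (\<zeta>\<^sub>2 \<cdot> x12 - inverse \<zeta>\<^sub>2 \<cdot> x21)))"

end

theory Submission
  imports Defs
begin

text \<open>
  Two-dimensional representations \<open>gfam fl w 1 r\<close>, with \<open>w\<close> and \<open>r\<close> running over roots of
  \<open>1\<close>, \<open>\<mu>\<close> and \<open>\<lambda>\<close>, separate the elements of the algebra: Fourier inversion over these roots
  yields functionals dual to the spanning set \<open>x\<^sub>i\<^sub>j\<^sup>2\<^sup>s \<chi>\<^sub>i\<^sub>j\<^sup>t\<close>. Hence relations, and identities between
  endomorphisms, may be checked on \<open>2 \<times> 2\<close> matrices.

  For fixed \<open>s\<close> and \<open>t\<close> the matrix \<open>e = (x\<^sub>i\<^sub>j\<^sup>2\<^sup>s \<chi>\<^sub>i\<^sub>j\<^sup>t)\<close> is comultiplicative, and each of \<open>\<Psi>\<close>, \<open>\<Phi>\<close>, \<open>\<Gamma>\<close>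
  sends the matrix of generators to \<open>P e Q\<close> with \<open>P Q = Q P = 1\<close>; such a map respects the coalgebra
  structure and the antipode. Conversely, let \<open>f\<close> be a Hopf automorphism. By duality the coefficients
  of the \<open>f(x\<^sub>i\<^sub>j)\<close> along \<open>e\<close>, \<open>0 < t < n\<close>, multiply like matrix units; they do not all vanish, because the
  elements with \<open>t \<in> {0, n}\<close> span a cocommutative subcoalgebra. A system of \<open>2 \<times> 2\<close> matrix units has
  the form \<open>P\<^sub>i\<^sub>k Q\<^sub>l\<^sub>j\<close> and leaves no room for another pair \<open>(s, t)\<close>, so \<open>f\<close> is of the form \<open>P e Q\<close>.
  The relations at the points then force \<open>t\<close> to be odd and \<open>P\<close> to be diagonal (\<open>\<Psi>\<close>) or
  antidiagonal (\<open>\<Phi>\<close>), unless \<open>n = 2\<close> and \<open>\<lambda> = 1\<close> (\<open>\<Gamma>\<close>), and bijectivity gives the coprimality conditions.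
\<close>

text \<open>The structure maps and the maps \<Psi>, \<Phi>, \<Gamma> are given through
  \<open>the_elem\<close> on cosets, so nothing can be computed with them until the images are known
  to satisfy the relations; testing relations at points supplies this. Letters of different parity
  annihilate each other, so the points form two blocks. A point of a block is a pair
  \<open>(w, r)\<close>, where \<open>w^(2*N)\<close> is 1 or \<mu> and \<open>r^n\<close> is 1 or
  \<lambda>. In these coordinates \<Psi> raises \<open>w\<close> to the power \<open>2*s+t\<close>
  and \<open>r\<close> to the power \<open>t\<close>, up to a twist by \<xi>, and \<Phi> also
  exchanges the two letters of a block; composition and inversion thereby become arithmetic of
  exponents. The map \<Gamma> is of another kind: it exchanges the diagonal points of ratio -1 with
  half of the off-diagonal points, which the relations permit only for \<open>n = 2\<close> and
  \<lambda> = 1. The exchange has to match \<open>w^(2*N) = 1\<close> with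
  \<open>w^(2*N) = \<mu>\<close>, so its parameters are fourth roots of unity with
  \<open>z^(2*N) = \<mu>\<close>. There are none if \<open>N\<close> is even and \<mu> = -1, and
  this is the exceptional case of the first part.\<close>

text \<open>Reduces additive identities to monomials. The bound \<open>S\<close> on the keys carries
  the carrier conditions along when the index set is
  \<open>carrier A \<times> carrier B\<close>.\<close>

lemma pm_induct [consumes 1, case_names zero single add]:
  fixes p :: "'a \<Rightarrow>\<^sub>0 'b::comm_monoid_add"
  assumes "Poly_Mapping.keys p \<subseteq> S" and "P 0"
    and "\<And>w c. w \<in> S \<Longrightarrow> P (Poly_Mapping.single w c)"
    and add: "\<And>p q. Poly_Mapping.keys p \<subseteq> S \<Longrightarrow> Poly_Mapping.keys q \<subseteq> S \<Longrightarrow> P p \<Longrightarrow> P q \<Longrightarrow> P (p + q)"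
  shows "P p"
proof -
  let ?m = "\<lambda>w. Poly_Mapping.single w (Poly_Mapping.lookup p w)"
  have "P (\<Sum>w\<in>T. ?m w) \<and> Poly_Mapping.keys (\<Sum>w\<in>T. ?m w) \<subseteq> S" if "finite T" "T \<subseteq> S" for T
    using that
  proof (induction T rule: finite_induct)
    case empty
    then show ?case using assms(2) by simp
  next
    case (insert w T)
    have k: "Poly_Mapping.keys (?m w) \<subseteq> S" using insert.prems by simp
    have "P (?m w)" using assms(3) insert.prems by blast
    then have "P (?m w + (\<Sum>w\<in>T. ?m w))" using insert k add by blast
    moreover have "Poly_Mapping.keys (?m w + (\<Sum>w\<in>T. ?m w)) \<subseteq> S"
      using Poly_Mapping.keys_add[of "?m w" "\<Sum>w\<in>T. ?m w"] k insert by blast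
    ultimately show ?case using insert by simp
  qed
  moreover have "p = (\<Sum>w\<in>Poly_Mapping.keys p. ?m w)"
  proof (rule poly_mapping_eqI)
    fix k
    have "Poly_Mapping.lookup (\<Sum>w\<in>Poly_Mapping.keys p. ?m w) k
        = (\<Sum>w\<in>Poly_Mapping.keys p. if w = k then Poly_Mapping.lookup p k else 0)"
      by (simp add: lookup_sum lookup_single when_def cong: if_cong)
    also have "\<dots> = Poly_Mapping.lookup p k"
      by (simp add: in_keys_iff)
    finally show "Poly_Mapping.lookup p k = Poly_Mapping.lookup (\<Sum>w\<in>Poly_Mapping.keys p. ?m w) k" ..
  qed
  ultimately show ?thesis using assms(1) finite_keys by metis
qed

section \<open>Scalar multiples of finitely supported functions\<close>

lemma lookup_pm_scale [simp]: "Poly_Mapping.lookup (c \<cdot> p) w = c * Poly_Mapping.lookup p w"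
  by (simp add: pm_scale_def Poly_Mapping.map.rep_eq when_def)

lemma pm_scale_add_right: "c \<cdot> (p + q) = c \<cdot> p + c \<cdot> q"
  by (rule poly_mapping_eqI) (simp add: lookup_add algebra_simps)

lemma pm_scale_add_left: "(c + d) \<cdot> p = c \<cdot> p + d \<cdot> p"
  by (rule poly_mapping_eqI) (simp add: lookup_add algebra_simps)

lemma pm_scale_scale: "c \<cdot> d \<cdot> p = (c * d) \<cdot> p"
  by (rule poly_mapping_eqI) (simp add: algebra_simps)

lemma pm_scale_one [simp]: "1 \<cdot> p = p"
  by (rule poly_mapping_eqI) simp

lemma pm_scale_zero [simp]: "c \<cdot> 0 = 0"
  by (rule poly_mapping_eqI) simp

lemma pm_scale_zero_left [simp]: "0 \<cdot> p = 0"
  by (rule poly_mapping_eqI) simp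

lemma pm_scale_single [simp]: "c \<cdot> Poly_Mapping.single w d = Poly_Mapping.single w (c * d)"
  by (rule poly_mapping_eqI) (simp add: lookup_single when_def)

lemma pm_scale_diff: "c \<cdot> (p - q) = c \<cdot> p - c \<cdot> q"
  by (rule poly_mapping_eqI) (simp add: lookup_minus algebra_simps)

lemma pm_scale_eq_mult: "c \<cdot> p = Poly_Mapping.single 0 c * (p :: 'a::monoid_add \<Rightarrow>\<^sub>0 'k::field)"
  by (simp add: pm_scale_def mult_map_scale_conv_mult)

lemma single_zero_commute:
  "p * Poly_Mapping.single 0 c = Poly_Mapping.single 0 c * (p :: 'a::monoid_add \<Rightarrow>\<^sub>0 'k::field)"
proof -
  have "Poly_Mapping.keys p \<subseteq> UNIV" by simp
  then show ?thesis
    by (induction p rule: pm_induct) (simp_all add: mult_single mult.commute algebra_simps)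
qed

lemma pm_scale_mult_left: "(c \<cdot> p) * q = c \<cdot> (p * (q :: 'a::monoid_add \<Rightarrow>\<^sub>0 'k::field))"
  by (simp add: pm_scale_eq_mult mult.assoc)

lemma pm_scale_mult_right: "p * (c \<cdot> q) = c \<cdot> (p * (q :: 'a::monoid_add \<Rightarrow>\<^sub>0 'k::field))"
  by (metis pm_scale_eq_mult mult.assoc single_zero_commute)

interpretation pm: Modules.module "(\<cdot>) :: 'k::field \<Rightarrow> ('a \<Rightarrow>\<^sub>0 'k) \<Rightarrow> _"
  by unfold_locales (simp_all add: pm_scale_add_right pm_scale_add_left pm_scale_scale)

section \<open>Associative algebras\<close>

text \<open>Scalars range over the whole type \<open>'k\<close>, as in \<open>alg_hom\<close> and
  \<open>quot_alg\<close>, so the base field does not appear as a ring record.\<close>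

locale kalg = ring B for B :: "('k::field, 'b, 'm) module_scheme" (structure) +
  assumes smult_closed [simp, intro]: "x \<in> carrier B \<Longrightarrow> c \<odot> x \<in> carrier B"
    and smult_r_distr: "x \<in> carrier B \<Longrightarrow> y \<in> carrier B \<Longrightarrow> c \<odot> (x \<oplus> y) = c \<odot> x \<oplus> c \<odot> y"
    and smult_l_distr: "x \<in> carrier B \<Longrightarrow> (c + d) \<odot> x = c \<odot> x \<oplus> d \<odot> x"
    and smult_smult: "x \<in> carrier B \<Longrightarrow> c \<odot> (d \<odot> x) = (c * d) \<odot> x"
    and smult_one [simp]: "x \<in> carrier B \<Longrightarrow> 1 \<odot> x = x"
    and smult_mult_l: "x \<in> carrier B \<Longrightarrow> y \<in> carrier B \<Longrightarrow> (c \<odot> x) \<otimes> y = c \<odot> (x \<otimes> y)"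
    and smult_mult_r: "x \<in> carrier B \<Longrightarrow> y \<in> carrier B \<Longrightarrow> x \<otimes> (c \<odot> y) = c \<odot> (x \<otimes> y)"
begin

lemma smult_zero [simp]: "x \<in> carrier B \<Longrightarrow> 0 \<odot> x = \<zero>"
  by (metis add.r_cancel_one' smult_closed smult_l_distr add_0)

lemma smult_r_zero [simp]: "c \<odot> \<zero> = \<zero>"
  by (metis add.r_cancel_one' smult_closed smult_r_distr r_zero zero_closed)

abbreviation word_val :: "('g \<Rightarrow> 'b) \<Rightarrow> 'g list \<Rightarrow> 'b" where
  "word_val g w \<equiv> foldr (\<lambda>l b. g l \<otimes> b) w \<one>"

lemma word_val_closed [simp, intro]: "(\<And>l. g l \<in> carrier B) \<Longrightarrow> word_val g w \<in> carrier B"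
  by (induction w) auto

lemma word_val_append: "(\<And>l. g l \<in> carrier B) \<Longrightarrow> word_val g (u @ v) = word_val g u \<otimes> word_val g v"
  by (induction u) (auto simp: m_assoc)

context
  fixes g :: "'g \<Rightarrow> 'b"
  assumes g: "\<And>l. g l \<in> carrier B"
begin

text \<open>Summing over a common finite superset of two supports makes additivity a termwise
  matter.\<close>

lemma free_lift_superset:
  assumes "finite S" "Poly_Mapping.keys p \<subseteq> S"
  shows "free_lift B g p = (\<Oplus>w\<in>S. Poly_Mapping.lookup p w \<odot> word_val g (letters w))"
  unfolding free_lift_def
  using assms g by (intro add.finprod_mono_neutral_cong_left) (auto simp: in_keys_iff)

lemma free_lift_closed [simp, intro]: "free_lift B g p \<in> carrier B"
  unfolding free_lift_def using g by (intro finsum_closed) auto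

lemma free_lift_zero [simp]: "free_lift B g 0 = \<zero>"
  by (simp add: free_lift_def)

lemma free_lift_single: "free_lift B g (Poly_Mapping.single w c) = c \<odot> word_val g (letters w)"
  using free_lift_superset[of "{w}" "Poly_Mapping.single w c"] g by simp

lemma free_lift_add: "free_lift B g (p + q) = free_lift B g p \<oplus> free_lift B g q"
proof -
  let ?S = "Poly_Mapping.keys p \<union> Poly_Mapping.keys q"
  have "free_lift B g (p + q) = (\<Oplus>w\<in>?S. Poly_Mapping.lookup (p + q) w \<odot> word_val g (letters w))"
    by (rule free_lift_superset) (use Poly_Mapping.keys_add[of p q] in auto)
  also have "\<dots> = (\<Oplus>w\<in>?S. Poly_Mapping.lookup p w \<odot> word_val g (letters w)
                       \<oplus> Poly_Mapping.lookup q w \<odot> word_val g (letters w))"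
    by (intro finsum_cong') (use g in \<open>auto simp: lookup_add smult_l_distr\<close>)
  also have "\<dots> = free_lift B g p \<oplus> free_lift B g q"
    using g by (subst finsum_addf) (auto simp: free_lift_superset[of ?S])
  finally show ?thesis .
qed

lemma free_lift_scale: "free_lift B g (c \<cdot> p) = c \<odot> free_lift B g p"
proof -
  have "Poly_Mapping.keys p \<subseteq> UNIV" by simp
  then show ?thesis
    by (induction p rule: pm_induct)
      (use g in \<open>auto simp: free_lift_single smult_smult pm_scale_add_right free_lift_add smult_r_distr\<close>)
qed

lemma free_lift_mult: "free_lift B g (p * q) = free_lift B g p \<otimes> free_lift B g q"
proof -
  have *: "free_lift B g (Poly_Mapping.single w c * q) = free_lift B g (Poly_Mapping.single w c) \<otimes> free_lift B g q" for w c
  proof -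
    have "Poly_Mapping.keys q \<subseteq> UNIV" by simp
    then show ?thesis
      by (induction q rule: pm_induct)
        (use g in \<open>auto simp: mult_single free_lift_single free_lift_add distrib_left r_distr plus_word_def
          word_val_append smult_mult_l smult_mult_r smult_smult mult.commute simp del: foldr_append\<close>)
  qed
  have "Poly_Mapping.keys p \<subseteq> UNIV" by simp
  then show ?thesis
    by (induction p rule: pm_induct) (auto simp: * free_lift_add distrib_right l_distr)
qed

lemma free_lift_one [simp]: "free_lift B g 1 = \<one>"
  using free_lift_single[of 0 1, unfolded single_one] g by (simp add: zero_word_def)

lemma free_lift_gen [simp]: "free_lift B g (Poly_Mapping.single (Word [l]) 1) = g l"
  using free_lift_single[of "Word [l]" 1] g by simp

lemma free_lift_hom: "free_lift B g \<in> alg_hom free_alg B"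
  by (auto simp: alg_hom_def free_alg_def ring_hom_def free_lift_add free_lift_mult free_lift_scale)

end

lemma minus_eq_zeroD:
  assumes "x \<in> carrier B" "y \<in> carrier B" "x \<ominus> y = \<zero>"
  shows "x = y"
proof -
  have "x = (x \<ominus> y) \<oplus> y" using assms(1,2) by (simp add: minus_eq a_assoc l_neg)
  then show ?thesis using assms by simp
qed

lemma smult_eq_one_mult: "x \<in> carrier B \<Longrightarrow> c \<odot> x = (c \<odot> \<one>) \<otimes> x"
  by (simp add: smult_mult_l)

end

lemma alg_homD:
  assumes "h \<in> alg_hom A B"
  shows "x \<in> carrier A \<Longrightarrow> h x \<in> carrier B"
    and "x \<in> carrier A \<Longrightarrow> y \<in> carrier A \<Longrightarrow> h (x \<otimes>\<^bsub>A\<^esub> y) = h x \<otimes>\<^bsub>B\<^esub> h y"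
    and "x \<in> carrier A \<Longrightarrow> y \<in> carrier A \<Longrightarrow> h (x \<oplus>\<^bsub>A\<^esub> y) = h x \<oplus>\<^bsub>B\<^esub> h y"
    and "h \<one>\<^bsub>A\<^esub> = \<one>\<^bsub>B\<^esub>"
    and "x \<in> carrier A \<Longrightarrow> h (c \<odot>\<^bsub>A\<^esub> x) = c \<odot>\<^bsub>B\<^esub> h x"
  using assms by (auto simp: alg_hom_def ring_hom_def)

lemma alg_homI:
  assumes "\<And>x. x \<in> carrier A \<Longrightarrow> h x \<in> carrier B"
    and "\<And>x y. x \<in> carrier A \<Longrightarrow> y \<in> carrier A \<Longrightarrow> h (x \<otimes>\<^bsub>A\<^esub> y) = h x \<otimes>\<^bsub>B\<^esub> h y"
    and "\<And>x y. x \<in> carrier A \<Longrightarrow> y \<in> carrier A \<Longrightarrow> h (x \<oplus>\<^bsub>A\<^esub> y) = h x \<oplus>\<^bsub>B\<^esub> h y"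
    and "h \<one>\<^bsub>A\<^esub> = \<one>\<^bsub>B\<^esub>"
    and "\<And>x c. x \<in> carrier A \<Longrightarrow> h (c \<odot>\<^bsub>A\<^esub> x) = c \<odot>\<^bsub>B\<^esub> h x"
  shows "h \<in> alg_hom A B"
  using assms by (auto simp: alg_hom_def ring_hom_def)

lemma alg_hom_zero:
  assumes "h \<in> alg_hom A B" "kalg A" "kalg B"
  shows "h \<zero>\<^bsub>A\<^esub> = \<zero>\<^bsub>B\<^esub>"
proof -
  interpret A: kalg A by fact
  interpret B: kalg B by fact
  show ?thesis using assms(1) alg_homD(1,5)[OF assms(1), of "\<zero>\<^bsub>A\<^esub>"] A.smult_zero[of "\<zero>\<^bsub>A\<^esub>"] B.smult_zero
    by (metis A.zero_closed)
qed

lemma alg_hom_minus: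
  assumes "h \<in> alg_hom A B" "kalg A" "kalg B" "x \<in> carrier A" "y \<in> carrier A"
  shows "h (x \<ominus>\<^bsub>A\<^esub> y) = h x \<ominus>\<^bsub>B\<^esub> h y"
proof -
  interpret A: kalg A by fact
  interpret B: kalg B by fact
  have "h (x \<ominus>\<^bsub>A\<^esub> y) \<oplus>\<^bsub>B\<^esub> h y = h x"
    using assms alg_homD(3)[OF assms(1), of "x \<ominus>\<^bsub>A\<^esub> y" y]
    by (simp add: A.minus_eq A.a_assoc A.l_neg)
  then show ?thesis
    using alg_homD(1)[OF assms(1)] assms(4,5)
    by (metis A.minus_closed B.add.inv_solve_right a_minus_def)
qed

lemma alg_hom_compose:
  assumes "f \<in> alg_hom A B" "g \<in> alg_hom B C"
  shows "g \<circ> f \<in> alg_hom A C"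
  by (rule alg_homI) (simp_all add: alg_homD[OF assms(1)] alg_homD[OF assms(2)])

lemma free_alg_simps [simp]:
  "carrier free_alg = UNIV" "mult free_alg = (*)" "one free_alg = 1" "zero free_alg = 0"
  "add free_alg = (+)" "smult free_alg = (\<cdot>)"
  by (simp_all add: free_alg_def)

lemma kalg_free_alg: "kalg (free_alg :: ('k::field, 'g word \<Rightarrow>\<^sub>0 'k) module)"
proof -
  have "ring (free_alg :: ('k::field, 'g word \<Rightarrow>\<^sub>0 'k) module)"
  proof (rule ringI)
    show "abelian_group (free_alg :: ('k::field, 'g word \<Rightarrow>\<^sub>0 'k) module)"
    proof (rule abelian_groupI)
      show "\<exists>y\<in>carrier free_alg. y \<oplus>\<^bsub>free_alg\<^esub> x = \<zero>\<^bsub>free_alg\<^esub>" for x :: "'g word \<Rightarrow>\<^sub>0 'k"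
        by (auto intro: exI[of _ "- x"])
    qed (simp_all add: ac_simps)
    show "Group.monoid (free_alg :: ('k::field, 'g word \<Rightarrow>\<^sub>0 'k) module)"
      by (rule monoidI) (simp_all add: mult.assoc)
  qed (simp_all add: distrib_left distrib_right)
  then show ?thesis
    by (rule kalg.intro)
      (unfold_locales, simp_all add: pm_scale_add_right pm_scale_add_left pm_scale_scale pm_scale_mult_left pm_scale_mult_right)
qed

lemma free_alg_minus [simp]: "p \<ominus>\<^bsub>free_alg\<^esub> q = p - q"
proof -
  interpret kalg "free_alg :: ('k::field, 'g word \<Rightarrow>\<^sub>0 'k) module" by (rule kalg_free_alg)
  have "\<ominus>\<^bsub>free_alg\<^esub> q = - q" by (rule minus_equality) auto
  then show ?thesis by (simp add: a_minus_def)
qed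

text \<open>Words are built from the front, so left multiplication by letters suffices. In this form
  the spanning property can be checked one generator at a time.\<close>

lemma word_induct:
  fixes p :: "'g word \<Rightarrow>\<^sub>0 'k::field"
  assumes one: "P 1"
    and gen: "\<And>l p. P p \<Longrightarrow> P (Poly_Mapping.single (Word [l]) 1 * p)"
    and add: "\<And>p q. P p \<Longrightarrow> P q \<Longrightarrow> P (p + q)"
    and scale: "\<And>c p. P p \<Longrightarrow> P (c \<cdot> p)"
  shows "P p"
proof -
  have w: "P (Poly_Mapping.single w 1)" for w
  proof (cases w)
    case (Word ls)
    have "P (Poly_Mapping.single (Word ls) 1)"
    proof (induction ls)
      case Nil
      then show ?case using one by (simp flip: zero_word_def)
    next
      case (Cons l ls)
      then show ?case using gen[OF Cons.IH, of l] by (simp add: mult_single plus_word_def)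
    qed
    then show ?thesis using Word by simp
  qed
  have "Poly_Mapping.keys p \<subseteq> UNIV" by simp
  then show ?thesis
  proof (induction p rule: pm_induct)
    case zero
    then show ?case using scale[OF one, of 0] by simp
  next
    case (single w c)
    then show ?case using scale[OF w, of c w] by simp
  qed (use add in auto)
qed

lemma alg_hom_free_eqI:
  assumes "h \<in> alg_hom free_alg B" "h' \<in> alg_hom free_alg B"
    and "\<And>l. h (Poly_Mapping.single (Word [l]) 1) = h' (Poly_Mapping.single (Word [l]) 1)"
  shows "h p = h' p"
proof (induction p rule: word_induct)
  case 1
  then show ?case using alg_homD(4)[OF assms(1)] alg_homD(4)[OF assms(2)] by simp
next
  case (2 l p)
  then show ?case using alg_homD(2)[OF assms(1)] alg_homD(2)[OF assms(2)] assms(3) by simp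
next
  case (3 p q)
  then show ?case using alg_homD(3)[OF assms(1)] alg_homD(3)[OF assms(2)] by simp
next
  case (4 c p)
  then show ?case using alg_homD(5)[OF assms(1)] alg_homD(5)[OF assms(2)] by simp
qed

subsection \<open>Quotients\<close>

locale kalg_ideal = kalg B + ideal I B for I and B :: "('k::field, 'b, 'm) module_scheme" (structure)
begin

abbreviation QA where "QA \<equiv> quot_alg B I"

lemma smult_in_ideal: "x \<in> I \<Longrightarrow> c \<odot> x \<in> I"
  using smult_eq_one_mult[of x c] I_l_closed[of x "c \<odot> \<one>"] a_Hcarr by auto

lemma carrier_quot_alg: "carrier QA = (\<lambda>x. I +> x) ` carrier B"
  by (auto simp: quot_alg_def FactRing_def A_RCOSETS_def')

lemma coset_closed [simp, intro]: "x \<in> carrier B \<Longrightarrow> I +> x \<in> carrier QA"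
  by (auto simp: carrier_quot_alg)

lemma coset_eq_iff:
  assumes "x \<in> carrier B" "y \<in> carrier B"
  shows "I +> x = I +> y \<longleftrightarrow> x \<ominus> y \<in> I"
  using quotient_eq_iff_same_a_r_cos[OF is_ideal assms] by simp

lemma quot_mult: "x \<in> carrier B \<Longrightarrow> y \<in> carrier B \<Longrightarrow> (I +> x) \<otimes>\<^bsub>QA\<^esub> (I +> y) = I +> (x \<otimes> y)"
  by (simp add: quot_alg_def FactRing_def rcoset_mult_add)

lemma quot_add: "x \<in> carrier B \<Longrightarrow> y \<in> carrier B \<Longrightarrow> (I +> x) \<oplus>\<^bsub>QA\<^esub> (I +> y) = I +> (x \<oplus> y)"
  by (simp add: quot_alg_def FactRing_def a_rcos_sum)

lemma quot_one: "\<one>\<^bsub>QA\<^esub> = I +> \<one>"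
  by (simp add: quot_alg_def FactRing_def)

lemma quot_zero: "\<zero>\<^bsub>QA\<^esub> = I"
  by (simp add: quot_alg_def FactRing_def)

lemma quot_zero': "\<zero>\<^bsub>QA\<^esub> = I +> \<zero>"
  by (simp add: quot_zero a_subset)

lemma quot_smult:
  assumes "x \<in> carrier B"
  shows "c \<odot>\<^bsub>QA\<^esub> (I +> x) = I +> (c \<odot> x)"
proof -
  \<comment> \<open>The scalar multiple is defined as a union over all representatives; it is a
    single coset because each representative contributes the same one.\<close>
  have e: "I +> (c \<odot> y) = I +> (c \<odot> x)" if y: "y \<in> I +> x" for y
  proof -
    have yc: "y \<in> carrier B" using y assms a_r_coset_subset_G[OF a_subset] by blast
    have "I +> y = I +> x" using y assms a_repr_independence[OF y] a_subgroup additive_subgroup.a_subgroup by metis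
    then have d: "y \<ominus> x \<in> I" using coset_eq_iff yc assms by blast
    have "c \<odot> y = c \<odot> (y \<ominus> x) \<oplus> c \<odot> x"
      using yc assms by (simp flip: smult_r_distr add: minus_eq a_assoc l_neg)
    then have "c \<odot> y \<ominus> c \<odot> x = c \<odot> (y \<ominus> x)"
      using yc assms by (simp add: minus_eq a_assoc r_neg)
    then show ?thesis using coset_eq_iff smult_in_ideal[OF d] yc assms by simp
  qed
  have "c \<odot>\<^bsub>QA\<^esub> (I +> x) = (\<Union>y\<in>I +> x. I +> (c \<odot> y))" by (simp add: quot_alg_def)
  also have "\<dots> = (\<Union>y\<in>I +> x. I +> (c \<odot> x))" by (rule SUP_cong[OF refl]) (rule e)
  also have "\<dots> = I +> (c \<odot> x)" using a_rcos_self[OF assms] by blast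
  finally show ?thesis .
qed

lemma cosetE:
  assumes "X \<in> carrier QA"
  obtains x where "x \<in> carrier B" "X = I +> x"
  using assms by (auto simp: carrier_quot_alg)

lemma kalg_quot: "kalg QA"
proof -
  note quot = quot_mult quot_add quot_smult quot_one quot_zero'
  note [simp del] = a_coset_add_zero
  have "ring QA"
  proof (rule ringI)
    show "abelian_group QA"
    proof (rule abelian_groupI)
      fix X assume "X \<in> carrier QA"
      then obtain x where x: "x \<in> carrier B" "X = I +> x" by (rule cosetE)
      then have "(I +> \<ominus> x) \<oplus>\<^bsub>QA\<^esub> X = \<zero>\<^bsub>QA\<^esub>" by (simp add: quot l_neg)
      then show "\<exists>Y\<in>carrier QA. Y \<oplus>\<^bsub>QA\<^esub> X = \<zero>\<^bsub>QA\<^esub>" using x by blast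
    qed ((elim cosetE)?, simp add: quot a_ac)+
    show "Group.monoid QA"
      by (rule monoidI) ((elim cosetE)?, simp add: quot m_assoc)+
  qed ((elim cosetE)?, simp add: quot l_distr r_distr)+
  then show ?thesis
    by (rule kalg.intro)
      (unfold_locales, ((elim cosetE)?, simp add: quot smult_r_distr smult_l_distr smult_smult
         smult_mult_l smult_mult_r)+)
qed

end

text \<open>Turns vanishing on the defining relations into vanishing on the ideal that they
  generate.\<close>

lemma ideal_kernel:
  assumes "h \<in> alg_hom A B" "kalg A" "kalg B"
  shows "ideal {x \<in> carrier A. h x = \<zero>\<^bsub>B\<^esub>} A"
proof -
  have "ring_hom_ring A B h"
    using assms by (intro ring_hom_ringI2) (auto simp: alg_hom_def kalg_def)
  then show ?thesis
    using ring_hom_ring.kernel_is_ideal[of A B h] by (simp add: a_kernel_def')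
qed

subsection \<open>Maps out of a quotient of a free algebra\<close>

text \<open>\<open>the_elem\<close> is meaningful only if the coset has a singleton image, and
  vanishing on \<open>I\<close> provides this.\<close>

lemma quot_lift_coset:
  assumes "ideal I free_alg" "kalg B" "\<And>l. g l \<in> carrier B"
    and "\<And>p. p \<in> I \<Longrightarrow> free_lift B g p = \<zero>\<^bsub>B\<^esub>"
  shows "quot_lift I B g (I +>\<^bsub>free_alg\<^esub> p) = free_lift B g p"
proof -
  interpret F: kalg_ideal I free_alg
    using assms(1) kalg_free_alg by (simp add: kalg_ideal_def)
  interpret B: kalg B by fact
  note hom = B.free_lift_hom[of g, OF assms(3)]
  have *: "free_lift B g q = free_lift B g p" if q: "q \<in> I +>\<^bsub>free_alg\<^esub> p" for q
  proof -
    have "I +>\<^bsub>free_alg\<^esub> q = I +>\<^bsub>free_alg\<^esub> p"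
      using F.a_repr_independence[OF q] F.a_subgroup by simp
    then have "q - p \<in> I" using F.coset_eq_iff by simp
    then have "free_lift B g (q \<ominus>\<^bsub>free_alg\<^esub> p) = \<zero>\<^bsub>B\<^esub>" using assms(4) by simp
    then have "free_lift B g q \<ominus>\<^bsub>B\<^esub> free_lift B g p = \<zero>\<^bsub>B\<^esub>"
      using alg_hom_minus[OF hom kalg_free_alg assms(2)] by simp
    then show ?thesis using B.minus_eq_zeroD B.free_lift_closed[of g, OF assms(3)] by simp
  qed
  have "free_lift B g ` (I +>\<^bsub>free_alg\<^esub> p) = (\<lambda>_. free_lift B g p) ` (I +>\<^bsub>free_alg\<^esub> p)"
    by (rule image_cong[OF refl]) (rule *)
  also have "\<dots> = {free_lift B g p}" using F.a_rcos_self[of p] by auto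
  finally have "free_lift B g ` (I +>\<^bsub>free_alg\<^esub> p) = {free_lift B g p}" .
  then show ?thesis by (simp add: quot_lift_def)
qed

lemma quot_lift_hom:
  assumes "ideal I free_alg" "kalg B" "\<And>l. g l \<in> carrier B"
    and "\<And>p. p \<in> I \<Longrightarrow> free_lift B g p = \<zero>\<^bsub>B\<^esub>"
  shows "quot_lift I B g \<in> alg_hom (quot_alg free_alg I) B"
proof -
  interpret F: kalg_ideal I free_alg
    using assms(1) kalg_free_alg by (simp add: kalg_ideal_def)
  interpret B: kalg B by fact
  note L = quot_lift_coset[OF assms]
  note hom = alg_homD[OF B.free_lift_hom[of g, OF assms(3)]]
  show ?thesis
  proof (rule alg_homI)
    show "quot_lift I B g \<one>\<^bsub>F.QA\<^esub> = \<one>\<^bsub>B\<^esub>"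
      using L[of 1] hom(4) by (simp add: F.quot_one)
  next
    fix X Y assume "X \<in> carrier F.QA" "Y \<in> carrier F.QA"
    then obtain p q where "X = I +>\<^bsub>free_alg\<^esub> p" "Y = I +>\<^bsub>free_alg\<^esub> q" by (auto simp: F.carrier_quot_alg)
    then show "quot_lift I B g (X \<otimes>\<^bsub>F.QA\<^esub> Y) = quot_lift I B g X \<otimes>\<^bsub>B\<^esub> quot_lift I B g Y"
      and "quot_lift I B g (X \<oplus>\<^bsub>F.QA\<^esub> Y) = quot_lift I B g X \<oplus>\<^bsub>B\<^esub> quot_lift I B g Y"
      using hom(2,3) by (simp_all add: F.quot_mult F.quot_add L)
  next
    fix X assume "X \<in> carrier F.QA"
    then obtain p where "X = I +>\<^bsub>free_alg\<^esub> p" by (auto simp: F.carrier_quot_alg)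
    then show "quot_lift I B g X \<in> carrier B"
      and "\<And>c. quot_lift I B g (c \<odot>\<^bsub>F.QA\<^esub> X) = c \<odot>\<^bsub>B\<^esub> quot_lift I B g X"
      using hom(1,5) by (simp_all add: F.quot_smult L)
  qed
qed

lemma kalg_op_alg:
  assumes "kalg B" shows "kalg (op_alg B)"
proof -
  interpret B: kalg B by fact
  have "ring (op_alg B)"
  proof (rule ringI)
    show "abelian_group (op_alg B)"
      by (rule abelian_groupI) (auto simp: op_alg_def B.a_ac intro: B.l_neg)
    show "Group.monoid (op_alg B)"
      by (rule monoidI) (auto simp: op_alg_def B.m_assoc)
  qed (auto simp: op_alg_def B.l_distr B.r_distr)
  then show ?thesis
    by (rule kalg.intro)
      (unfold_locales, simp_all add: op_alg_def B.smult_r_distr B.smult_l_distr B.smult_smult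
        B.smult_mult_l B.smult_mult_r)
qed

lemma kalg_field_alg: "kalg field_alg"
proof -
  have "ring (field_alg :: ('k::field, 'k) module)"
  proof (rule ringI)
    show "abelian_group (field_alg :: ('k::field, 'k) module)"
    proof (rule abelian_groupI)
      show "\<exists>y\<in>carrier field_alg. y \<oplus>\<^bsub>field_alg\<^esub> x = \<zero>\<^bsub>field_alg\<^esub>" for x :: 'k
        by (auto simp: field_alg_def intro: exI[of _ "- x"])
    qed (simp_all add: field_alg_def ac_simps)
    show "Group.monoid (field_alg :: ('k::field, 'k) module)"
      by (rule monoidI) (simp_all add: field_alg_def mult.assoc)
  qed (simp_all add: field_alg_def distrib_left distrib_right)
  then show ?thesis
    by (rule kalg.intro) (unfold_locales, simp_all add: field_alg_def distrib_left distrib_right ac_simps)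
qed

section \<open>The tensor product of two algebras\<close>

definition linear_form :: "('k::field, 'a, 'm) module_scheme \<Rightarrow> ('a \<Rightarrow> 'k) \<Rightarrow> bool" where
  "linear_form A \<phi> \<longleftrightarrow>
    (\<forall>x\<in>carrier A. \<forall>y\<in>carrier A. \<phi> (x \<oplus>\<^bsub>A\<^esub> y) = \<phi> x + \<phi> y) \<and>
    (\<forall>c. \<forall>x\<in>carrier A. \<phi> (c \<odot>\<^bsub>A\<^esub> x) = c * \<phi> x)"

locale tensor2 = A: kalg A + B: kalg B
  for A :: "('k::field, 'a, 'm) module_scheme" and B :: "('k, 'b, 'l) module_scheme"
begin

abbreviation PT where "PT \<equiv> pre_tensor A B"
abbreviation TN where "TN \<equiv> tensor_null A B"
abbreviation TA where "TA \<equiv> tensor_alg A B"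
abbreviation pure (infixl \<open>\<bullet>\<close> 72) where "a \<bullet> b \<equiv> pure_tensor A B a b"
abbreviation pmult (infixl \<open>\<star>\<close> 70) where "p \<star> q \<equiv> p \<otimes>\<^bsub>PT\<^esub> q"

lemma PT_simps [simp]:
  "p \<in> carrier PT \<longleftrightarrow> Poly_Mapping.keys p \<subseteq> carrier A \<times> carrier B"
  "one PT = Poly_Mapping.single (\<one>\<^bsub>A\<^esub>, \<one>\<^bsub>B\<^esub>) 1" "zero PT = 0" "add PT = (+)" "smult PT = (\<cdot>)"
  by (simp_all add: pre_tensor_def)

definition ppr :: "'a \<times> 'b \<Rightarrow> 'a \<times> 'b \<Rightarrow> 'a \<times> 'b" where
  "ppr x y = (fst x \<otimes>\<^bsub>A\<^esub> fst y, snd x \<otimes>\<^bsub>B\<^esub> snd y)"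

lemma pmult_superset:
  assumes "finite S" "Poly_Mapping.keys p \<subseteq> S" "finite T" "Poly_Mapping.keys q \<subseteq> T"
  shows "p \<star> q = (\<Sum>x\<in>S. \<Sum>y\<in>T. Poly_Mapping.single (ppr x y) (Poly_Mapping.lookup p x * Poly_Mapping.lookup q y))"
proof -
  have "p \<star> q = (\<Sum>x\<in>Poly_Mapping.keys p. \<Sum>y\<in>Poly_Mapping.keys q.
      Poly_Mapping.single (ppr x y) (Poly_Mapping.lookup p x * Poly_Mapping.lookup q y))"
    by (simp add: pre_tensor_def ppr_def case_prod_beta)
  also have "\<dots> = (\<Sum>x\<in>Poly_Mapping.keys p. \<Sum>y\<in>T.
      Poly_Mapping.single (ppr x y) (Poly_Mapping.lookup p x * Poly_Mapping.lookup q y))"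
    by (intro sum.cong refl sum.mono_neutral_left) (use assms in \<open>auto simp: in_keys_iff\<close>)
  also have "\<dots> = (\<Sum>x\<in>S. \<Sum>y\<in>T.
      Poly_Mapping.single (ppr x y) (Poly_Mapping.lookup p x * Poly_Mapping.lookup q y))"
    by (intro sum.mono_neutral_left) (use assms in \<open>auto simp: in_keys_iff\<close>)
  finally show ?thesis .
qed

lemma pmult_zero [simp]: "0 \<star> q = 0" "p \<star> 0 = 0"
  by (simp_all add: pre_tensor_def)

lemma pmult_add_left: "(p + q) \<star> r = p \<star> r + q \<star> r"
proof -
  let ?S = "Poly_Mapping.keys p \<union> Poly_Mapping.keys q" and ?T = "Poly_Mapping.keys r"
  have k: "Poly_Mapping.keys (p + q) \<subseteq> ?S" using Poly_Mapping.keys_add[of p q] by simp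
  show ?thesis
    using pmult_superset[of ?S "p + q" ?T r] pmult_superset[of ?S p ?T r] pmult_superset[of ?S q ?T r] k
    by (simp add: lookup_add distrib_right single_add sum.distrib)
qed

lemma pmult_add_right: "r \<star> (p + q) = r \<star> p + r \<star> q"
proof -
  let ?S = "Poly_Mapping.keys p \<union> Poly_Mapping.keys q" and ?T = "Poly_Mapping.keys r"
  have k: "Poly_Mapping.keys (p + q) \<subseteq> ?S" using Poly_Mapping.keys_add[of p q] by simp
  show ?thesis
    using pmult_superset[of ?T r ?S "p + q"] pmult_superset[of ?T r ?S p] pmult_superset[of ?T r ?S q] k
    by (simp add: lookup_add distrib_left single_add sum.distrib)
qed

lemma pmult_single: "Poly_Mapping.single x c \<star> Poly_Mapping.single y d = Poly_Mapping.single (ppr x y) (c * d)"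
  using pmult_superset[of "{x}" "Poly_Mapping.single x c" "{y}" "Poly_Mapping.single y d"] by simp

lemma pmult_scale: "(c \<cdot> p) \<star> q = c \<cdot> (p \<star> q)" "p \<star> (c \<cdot> q) = c \<cdot> (p \<star> q)"
proof -
  have s: "(c \<cdot> Poly_Mapping.single x d) \<star> q = c \<cdot> (Poly_Mapping.single x d \<star> q)"
    "Poly_Mapping.single x d \<star> (c \<cdot> q) = c \<cdot> (Poly_Mapping.single x d \<star> q)" for x d
  proof -
    have "Poly_Mapping.keys q \<subseteq> UNIV" by simp
    then have "(c \<cdot> Poly_Mapping.single x d) \<star> q = c \<cdot> (Poly_Mapping.single x d \<star> q) \<and>
       Poly_Mapping.single x d \<star> (c \<cdot> q) = c \<cdot> (Poly_Mapping.single x d \<star> q)"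
      by (induction q rule: pm_induct) (simp_all add: pmult_single pmult_add_right pm_scale_add_right mult.left_commute mult.assoc)
    then show "(c \<cdot> Poly_Mapping.single x d) \<star> q = c \<cdot> (Poly_Mapping.single x d \<star> q)"
    "Poly_Mapping.single x d \<star> (c \<cdot> q) = c \<cdot> (Poly_Mapping.single x d \<star> q)" by auto
  qed
  have "Poly_Mapping.keys p \<subseteq> UNIV" by simp
  then have "(c \<cdot> p) \<star> q = c \<cdot> (p \<star> q) \<and> p \<star> (c \<cdot> q) = c \<cdot> (p \<star> q)"
    by (induction p rule: pm_induct) (simp_all add: s pmult_add_left pm_scale_add_right del: pm_scale_single)
  then show "(c \<cdot> p) \<star> q = c \<cdot> (p \<star> q)" "p \<star> (c \<cdot> q) = c \<cdot> (p \<star> q)" by auto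
qed

lemma pmult_minus: "(p - q) \<star> r = p \<star> r - q \<star> r" "r \<star> (p - q) = r \<star> p - r \<star> q"
  using pmult_add_left[of "p - q" q r] pmult_add_right[of r "p - q" q] by (simp_all add: algebra_simps)

lemma ppr_closed: "x \<in> carrier A \<times> carrier B \<Longrightarrow> y \<in> carrier A \<times> carrier B \<Longrightarrow> ppr x y \<in> carrier A \<times> carrier B"
  by (auto simp: ppr_def)

lemma pmult_closed:
  assumes "p \<in> carrier PT" "q \<in> carrier PT" shows "p \<star> q \<in> carrier PT"
proof -
  have "Poly_Mapping.keys (p \<star> q) \<subseteq> (\<Union>x\<in>Poly_Mapping.keys p. \<Union>y\<in>Poly_Mapping.keys q. {ppr x y})"
    unfolding pmult_superset[OF finite_keys subset_refl finite_keys subset_refl]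
    by (intro order_trans[OF Poly_Mapping.keys_sum] UN_mono subset_refl) auto
  also have "\<dots> \<subseteq> carrier A \<times> carrier B"
  proof (intro UN_least)
    fix x y assume "x \<in> Poly_Mapping.keys p" "y \<in> Poly_Mapping.keys q"
    then have "ppr x y \<in> carrier A \<times> carrier B" using assms[unfolded PT_simps] by (intro ppr_closed) (erule (1) subsetD[rotated])+
    then show "{ppr x y} \<subseteq> carrier A \<times> carrier B" by blast
  qed
  finally show ?thesis by simp
qed

lemma pmult_assoc:
  assumes "p \<in> carrier PT" "q \<in> carrier PT" "r \<in> carrier PT"
  shows "p \<star> q \<star> r = p \<star> (q \<star> r)"
proof -
  let ?C = "carrier A \<times> carrier B"
  let ?s = Poly_Mapping.single
  have a: "ppr (ppr x y) z = ppr x (ppr y z)" if "x \<in> ?C" "y \<in> ?C" "z \<in> ?C" for x y z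
    using that by (auto simp: ppr_def A.m_assoc B.m_assoc)
  have 1: "?s x c \<star> ?s y d \<star> r = ?s x c \<star> (?s y d \<star> r)" if "x \<in> ?C" "y \<in> ?C" for x y c d
    using assms(3)[unfolded PT_simps]
    by (induction r rule: pm_induct) (simp_all add: pmult_single pmult_add_right a that mult.assoc)
  have 2: "?s x c \<star> q \<star> r = ?s x c \<star> (q \<star> r)" if "x \<in> ?C" for x c
    using assms(2)[unfolded PT_simps]
    by (induction q rule: pm_induct) (simp_all add: pmult_add_right pmult_add_left 1 that)
  show ?thesis
    using assms(1)[unfolded PT_simps]
    by (induction p rule: pm_induct) (simp_all add: pmult_add_left 2)
qed

lemma pmult_one:
  assumes "p \<in> carrier PT" shows "\<one>\<^bsub>PT\<^esub> \<star> p = p" "p \<star> \<one>\<^bsub>PT\<^esub> = p"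
  using assms[unfolded PT_simps]
  by (induction p rule: pm_induct) (auto simp: pmult_single pmult_add_right pmult_add_left ppr_def)

lemma kalg_PT: "kalg PT"
proof -
  have keys: "Poly_Mapping.keys (p + q) \<subseteq> S" if "Poly_Mapping.keys p \<subseteq> S" "Poly_Mapping.keys q \<subseteq> S"
    for p q :: "'a \<times> 'b \<Rightarrow>\<^sub>0 'k" and S using Poly_Mapping.keys_add[of p q] that by blast
  have keys_scale: "Poly_Mapping.keys (c \<cdot> p) \<subseteq> S" if "Poly_Mapping.keys p \<subseteq> S" for p :: "'a \<times> 'b \<Rightarrow>\<^sub>0 'k" and c S
    using that by (auto simp: in_keys_iff)
  have "ring PT"
  proof (rule ringI)
    show "abelian_group PT"
    proof (rule abelian_groupI)
      fix p assume "p \<in> carrier PT"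
      then show "\<exists>q\<in>carrier PT. q \<oplus>\<^bsub>PT\<^esub> p = \<zero>\<^bsub>PT\<^esub>"
        by (intro bexI[of _ "- p"]) (auto simp: in_keys_iff)
    qed (simp_all add: ac_simps keys)
    show "Group.monoid PT"
      by (rule monoidI) (simp_all only: pmult_closed pmult_assoc pmult_one, simp)
  qed (simp_all add: pmult_add_left pmult_add_right)
  then show ?thesis
    by (rule kalg.intro) (unfold_locales, simp_all add: pm_scale_add_right pm_scale_add_left
        pm_scale_scale pmult_scale keys_scale)
qed

lemma span_closed_pmult:
  assumes "\<And>y. y \<in> R \<Longrightarrow> F y \<in> pm.span R"
    and "\<And>x y. F (x + y) = F x + F y" "\<And>c x. F (c \<cdot> x) = c \<cdot> F x"
    and "y \<in> pm.span R"
  shows "F y \<in> pm.span R"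
proof -
  have "pm.span R \<subseteq> {y. F y \<in> pm.span R}"
  proof (rule pm.span_minimal)
    have "F 0 = 0" using assms(3)[of 0 0] by simp
    then show "pm.subspace {y. F y \<in> pm.span R}"
      by (intro pm.subspaceI) (simp_all add: assms(2,3) pm.span_add pm.span_scale pm.span_zero)
  qed (use assms(1) in auto)
  then show ?thesis using assms(4) by auto
qed

lemma bil_rels_cases:
  assumes "y \<in> bilinearity_rels A B"
  obtains
    (1) a a' b where "a \<in> carrier A" "a' \<in> carrier A" "b \<in> carrier B"
      "y = Poly_Mapping.single (a \<oplus>\<^bsub>A\<^esub> a', b) 1 - Poly_Mapping.single (a, b) 1 - Poly_Mapping.single (a', b) 1"
  | (2) a b b' where "a \<in> carrier A" "b \<in> carrier B" "b' \<in> carrier B"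
      "y = Poly_Mapping.single (a, b \<oplus>\<^bsub>B\<^esub> b') 1 - Poly_Mapping.single (a, b) 1 - Poly_Mapping.single (a, b') 1"
  | (3) c a b where "a \<in> carrier A" "b \<in> carrier B"
      "y = Poly_Mapping.single (c \<odot>\<^bsub>A\<^esub> a, b) 1 - c \<cdot> Poly_Mapping.single (a, b) 1"
  | (4) c a b where "a \<in> carrier A" "b \<in> carrier B"
      "y = Poly_Mapping.single (a, c \<odot>\<^bsub>B\<^esub> b) 1 - c \<cdot> Poly_Mapping.single (a, b) 1"
  using assms unfolding bilinearity_rels_def by fast

lemma bil_relsI:
  "a \<in> carrier A \<Longrightarrow> a' \<in> carrier A \<Longrightarrow> b \<in> carrier B \<Longrightarrow>
    Poly_Mapping.single (a \<oplus>\<^bsub>A\<^esub> a', b) 1 - Poly_Mapping.single (a, b) 1 - Poly_Mapping.single (a', b) 1 \<in> bilinearity_rels A B"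
  "a \<in> carrier A \<Longrightarrow> b \<in> carrier B \<Longrightarrow> b' \<in> carrier B \<Longrightarrow>
    Poly_Mapping.single (a, b \<oplus>\<^bsub>B\<^esub> b') 1 - Poly_Mapping.single (a, b) 1 - Poly_Mapping.single (a, b') 1 \<in> bilinearity_rels A B"
  "a \<in> carrier A \<Longrightarrow> b \<in> carrier B \<Longrightarrow>
    Poly_Mapping.single (c \<odot>\<^bsub>A\<^esub> a, b) 1 - c \<cdot> Poly_Mapping.single (a, b) 1 \<in> bilinearity_rels A B"
  "a \<in> carrier A \<Longrightarrow> b \<in> carrier B \<Longrightarrow>
    Poly_Mapping.single (a, c \<odot>\<^bsub>B\<^esub> b) 1 - c \<cdot> Poly_Mapping.single (a, b) 1 \<in> bilinearity_rels A B"
  unfolding bilinearity_rels_def by blast+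

text \<open>Distributivity in the factor concerned carries each of the four kinds of relation to one
  of the same kind. This makes their span a two-sided ideal.\<close>

lemma rels_pmult:
  assumes y: "y \<in> bilinearity_rels A B" and x: "x \<in> carrier A \<times> carrier B"
  shows "Poly_Mapping.single x 1 \<star> y \<in> bilinearity_rels A B"
    and "y \<star> Poly_Mapping.single x 1 \<in> bilinearity_rels A B"
proof -
  obtain u v where uv: "x = (u, v)" "u \<in> carrier A" "v \<in> carrier B" using x by auto
  note [simp] = pmult_minus pmult_scale pmult_single ppr_def uv A.r_distr A.l_distr B.r_distr B.l_distr
    A.smult_mult_l A.smult_mult_r B.smult_mult_l B.smult_mult_r
  note [simp del] = pm_scale_single
  show "Poly_Mapping.single x 1 \<star> y \<in> bilinearity_rels A B"
    using y by (cases rule: bil_rels_cases) (simp_all add: bil_relsI)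
  show "y \<star> Poly_Mapping.single x 1 \<in> bilinearity_rels A B"
    using y by (cases rule: bil_rels_cases) (simp_all add: bil_relsI)
qed

lemma TN_pmult:
  assumes "y \<in> TN" "p \<in> carrier PT"
  shows "p \<star> y \<in> TN" and "y \<star> p \<in> TN"
proof -
  note TN = tensor_null_def
  have s: "Poly_Mapping.single x c \<star> y \<in> TN" "y \<star> Poly_Mapping.single x c \<in> TN" if x: "x \<in> carrier A \<times> carrier B" for x c
  proof -
    have "Poly_Mapping.single x 1 \<star> y \<in> TN" unfolding TN
      by (rule span_closed_pmult[where F = "\<lambda>y. Poly_Mapping.single x 1 \<star> y"])
        (use rels_pmult(1)[OF _ x] assms(1) in \<open>auto simp: pmult_add_right pmult_scale TN intro: pm.span_base\<close>)
    then have "c \<cdot> (Poly_Mapping.single x 1 \<star> y) \<in> TN" unfolding TN by (rule pm.span_scale)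
    then show "Poly_Mapping.single x c \<star> y \<in> TN" using pmult_scale(1)[of c "Poly_Mapping.single x 1" y] by simp
    have "y \<star> Poly_Mapping.single x 1 \<in> TN" unfolding TN
      by (rule span_closed_pmult[where F = "\<lambda>y. y \<star> Poly_Mapping.single x 1"])
        (use rels_pmult(2)[OF _ x] assms(1) in \<open>auto simp: pmult_add_left pmult_scale TN intro: pm.span_base\<close>)
    then have "c \<cdot> (y \<star> Poly_Mapping.single x 1) \<in> TN" unfolding TN by (rule pm.span_scale)
    then show "y \<star> Poly_Mapping.single x c \<in> TN" using pmult_scale(2)[of y c "Poly_Mapping.single x 1"] by simp
  qed
  show "p \<star> y \<in> TN" using assms(2)[unfolded PT_simps]
    by (induction p rule: pm_induct) (auto simp: s pmult_add_left TN intro: pm.span_add pm.span_zero s[unfolded TN])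
  show "y \<star> p \<in> TN" using assms(2)[unfolded PT_simps]
    by (induction p rule: pm_induct) (auto simp: s pmult_add_right TN intro: pm.span_add pm.span_zero s[unfolded TN])
qed

lemma PT_closed:
  assumes "Poly_Mapping.keys p \<subseteq> C" "Poly_Mapping.keys q \<subseteq> C"
  shows "Poly_Mapping.keys (p + q) \<subseteq> C" "Poly_Mapping.keys (p - q) \<subseteq> C" "Poly_Mapping.keys (c \<cdot> p) \<subseteq> C"
proof -
  have "Poly_Mapping.keys (p - q) \<subseteq> Poly_Mapping.keys p \<union> Poly_Mapping.keys q"
    by (auto simp: in_keys_iff lookup_minus)
  then show "Poly_Mapping.keys (p - q) \<subseteq> C" using assms by blast
  show "Poly_Mapping.keys (p + q) \<subseteq> C" using assms Poly_Mapping.keys_add[of p q] by blast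
  have "Poly_Mapping.keys (c \<cdot> p) \<subseteq> Poly_Mapping.keys p" by (auto simp: in_keys_iff)
  then show "Poly_Mapping.keys (c \<cdot> p) \<subseteq> C" using assms by blast
qed

lemma TN_carrier: "TN \<subseteq> carrier PT"
proof -
  show ?thesis unfolding tensor_null_def
  proof (rule pm.span_minimal)
    show "bilinearity_rels A B \<subseteq> carrier PT"
    proof
      fix y assume "y \<in> bilinearity_rels A B"
      then show "y \<in> carrier PT"
        by (cases rule: bil_rels_cases) (simp_all add: PT_closed)
    qed
    show "pm.subspace (carrier PT)" by (rule pm.subspaceI) (simp_all add: PT_closed)
  qed
qed

lemma PT_minus: 
  assumes "q \<in> carrier PT" shows "p \<ominus>\<^bsub>PT\<^esub> q = p - q"
proof -
  interpret P: kalg PT by (rule kalg_PT)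
  have q: "- q \<in> carrier PT" using assms by (auto simp: in_keys_iff)
  have "\<ominus>\<^bsub>PT\<^esub> q = - q" by (rule P.minus_equality) (use assms q in auto)
  then show ?thesis by (simp add: a_minus_def)
qed

lemma TN_ideal: "kalg_ideal TN PT"
proof -
  interpret P: kalg PT by (rule kalg_PT)
  have uminus: "\<ominus>\<^bsub>PT\<^esub> x = - x" if "x \<in> TN" for x
  proof (rule P.minus_equality)
    show "x \<in> carrier PT" using that TN_carrier by blast
    then show "- x \<in> carrier PT" by (simp add: keys_def)
  qed simp
  have "subgroup TN (add_monoid PT)"
  proof (rule P.add.subgroupI)
    show "TN \<noteq> {}" using pm.span_zero by (auto simp: tensor_null_def)
    show "\<ominus>\<^bsub>PT\<^esub> x \<in> TN" if "x \<in> TN" for x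
      using uminus[OF that] pm.span_neg that by (simp add: tensor_null_def)
  qed (use TN_carrier in \<open>auto simp: tensor_null_def intro: pm.span_add\<close>)
  then have "ideal TN PT"
    by (intro idealI P.ring_axioms TN_pmult)
  then show ?thesis using kalg_PT by (simp add: kalg_ideal_def)
qed

sublocale T: kalg_ideal TN PT
  rewrites "quot_alg PT TN \<equiv> TA"
  by (rule TN_ideal) (simp add: tensor_alg_def)

lemma kalg_TA: "kalg TA"
  by (rule T.kalg_quot)

lemma pure_closed [simp, intro]: "a \<in> carrier A \<Longrightarrow> b \<in> carrier B \<Longrightarrow> a \<bullet> b \<in> carrier TA"
  unfolding pure_tensor_def by (rule T.coset_closed) simp

lemma pure_mult:
  "a \<in> carrier A \<Longrightarrow> b \<in> carrier B \<Longrightarrow> a' \<in> carrier A \<Longrightarrow> b' \<in> carrier B \<Longrightarrow>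
    (a \<bullet> b) \<otimes>\<^bsub>TA\<^esub> (a' \<bullet> b') = (a \<otimes>\<^bsub>A\<^esub> a') \<bullet> (b \<otimes>\<^bsub>B\<^esub> b')"
  unfolding pure_tensor_def by (subst T.quot_mult) (simp_all add: pmult_single ppr_def)

lemma pure_one: "\<one>\<^bsub>TA\<^esub> = \<one>\<^bsub>A\<^esub> \<bullet> \<one>\<^bsub>B\<^esub>"
  by (simp add: T.quot_one pure_tensor_def)

lemma TA_coset_eqI:
  assumes "p \<in> carrier PT" "q \<in> carrier PT" "p - q \<in> bilinearity_rels A B"
  shows "TN +>\<^bsub>PT\<^esub> p = TN +>\<^bsub>PT\<^esub> q"
  using T.coset_eq_iff[OF assms(1,2)] assms by (simp add: PT_minus tensor_null_def pm.span_base)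

lemma pure_add_l:
  assumes "a \<in> carrier A" "a' \<in> carrier A" "b \<in> carrier B"
  shows "(a \<oplus>\<^bsub>A\<^esub> a') \<bullet> b = (a \<bullet> b) \<oplus>\<^bsub>TA\<^esub> (a' \<bullet> b)"
proof -
  have "Poly_Mapping.single (a, b) 1 + Poly_Mapping.single (a', b) 1 \<in> carrier PT"
    using assms by (simp add: PT_closed)
  then show ?thesis
    unfolding pure_tensor_def using assms bil_relsI(1)[of a a' b]
    by (subst T.quot_add) (simp_all add: diff_diff_eq TA_coset_eqI)
qed

lemma pure_add_r:
  assumes "a \<in> carrier A" "b' \<in> carrier B" "b \<in> carrier B"
  shows "a \<bullet> (b \<oplus>\<^bsub>B\<^esub> b') = (a \<bullet> b) \<oplus>\<^bsub>TA\<^esub> (a \<bullet> b')"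
proof -
  have "Poly_Mapping.single (a, b) 1 + Poly_Mapping.single (a, b') 1 \<in> carrier PT"
    using assms by (simp add: PT_closed)
  then show ?thesis
    unfolding pure_tensor_def using assms bil_relsI(2)[of a b b']
    by (subst T.quot_add) (simp_all add: diff_diff_eq TA_coset_eqI)
qed

lemma single_coset:
  assumes "a \<in> carrier A" "b \<in> carrier B"
  shows "TN +>\<^bsub>PT\<^esub> Poly_Mapping.single (a, b) c = c \<odot>\<^bsub>TA\<^esub> (a \<bullet> b)"
  using T.quot_smult[of "Poly_Mapping.single (a, b) 1" c] assms by (simp add: pure_tensor_def)

lemma pure_smult_l:
  assumes "a \<in> carrier A" "b \<in> carrier B"
  shows "(c \<odot>\<^bsub>A\<^esub> a) \<bullet> b = c \<odot>\<^bsub>TA\<^esub> (a \<bullet> b)"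
  unfolding single_coset[OF assms, symmetric] unfolding pure_tensor_def
  by (rule TA_coset_eqI) (use assms bil_relsI(3)[OF assms, of c] in simp_all)

lemma pure_smult_r:
  assumes "a \<in> carrier A" "b \<in> carrier B"
  shows "a \<bullet> (c \<odot>\<^bsub>B\<^esub> b) = c \<odot>\<^bsub>TA\<^esub> (a \<bullet> b)"
  unfolding single_coset[OF assms, symmetric] unfolding pure_tensor_def
  by (rule TA_coset_eqI) (use assms bil_relsI(4)[OF assms, of c] in simp_all)

lemma pure_zero [simp]:
  "b \<in> carrier B \<Longrightarrow> \<zero>\<^bsub>A\<^esub> \<bullet> b = \<zero>\<^bsub>TA\<^esub>" "a \<in> carrier A \<Longrightarrow> a \<bullet> \<zero>\<^bsub>B\<^esub> = \<zero>\<^bsub>TA\<^esub>"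
proof -
  interpret TA: kalg TA by (rule kalg_TA)
  show "b \<in> carrier B \<Longrightarrow> \<zero>\<^bsub>A\<^esub> \<bullet> b = \<zero>\<^bsub>TA\<^esub>"
    using pure_smult_l[of "\<zero>\<^bsub>A\<^esub>" b 0] by simp
  show "a \<in> carrier A \<Longrightarrow> a \<bullet> \<zero>\<^bsub>B\<^esub> = \<zero>\<^bsub>TA\<^esub>"
    using pure_smult_r[of a "\<zero>\<^bsub>B\<^esub>" 0] by simp
qed

text \<open>The functional \<phi> \<otimes> \<psi>: the linear extension of products of values kills
  the bilinearity relations. Such functionals extract scalar equations from equations in the tensor
  product, for which no basis is constructed.\<close>

lemma tensor_form_exists:
  assumes \<phi>: "linear_form A \<phi>" and \<psi>: "linear_form B \<psi>"
  obtains F where "\<And>X Y. X \<in> carrier TA \<Longrightarrow> Y \<in> carrier TA \<Longrightarrow> F (X \<oplus>\<^bsub>TA\<^esub> Y) = F X + F Y"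
    "\<And>c X. X \<in> carrier TA \<Longrightarrow> F (c \<odot>\<^bsub>TA\<^esub> X) = c * F X"
    "\<And>a b. a \<in> carrier A \<Longrightarrow> b \<in> carrier B \<Longrightarrow> F (a \<bullet> b) = \<phi> a * \<psi> b"
proof -
  define G where "G p = (\<Sum>x\<in>Poly_Mapping.keys p. Poly_Mapping.lookup p x * (\<phi> (fst x) * \<psi> (snd x)))" for p
  have G: "G p = (\<Sum>x\<in>S. Poly_Mapping.lookup p x * (\<phi> (fst x) * \<psi> (snd x)))" if "finite S" "Poly_Mapping.keys p \<subseteq> S" for p S
    unfolding G_def by (intro sum.mono_neutral_left) (use that in \<open>auto simp: in_keys_iff\<close>)
  have G_add: "G (p + q) = G p + G q" for p q
    using G[of "Poly_Mapping.keys p \<union> Poly_Mapping.keys q"] Poly_Mapping.keys_add[of p q]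
    by (simp add: lookup_add distrib_right sum.distrib)
  have G_scale: "G (c \<cdot> p) = c * G p" for c p
  proof -
    have "Poly_Mapping.keys (c \<cdot> p) \<subseteq> Poly_Mapping.keys p" by (auto simp: in_keys_iff)
    then show ?thesis using G[of "Poly_Mapping.keys p"] by (simp add: mult.assoc sum_distrib_left)
  qed
  have G_minus: "G (p - q) = G p - G q" for p q
    using G_add[of "p - q" q] by (simp add: algebra_simps)
  have G_single: "G (Poly_Mapping.single (a, b) c) = c * (\<phi> a * \<psi> b)" for a b c
    using G[of "{(a, b)}" "Poly_Mapping.single (a, b) c"] by simp
  have G_zero: "G 0 = 0" by (simp add: G_def)
  have "TN \<subseteq> {p. G p = 0}" unfolding tensor_null_def
  proof (rule pm.span_minimal)
    show "pm.subspace {p. G p = 0}" by (rule pm.subspaceI) (simp_all add: G_zero G_add G_scale)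
    show "bilinearity_rels A B \<subseteq> {p. G p = 0}"
    proof
      fix y assume "y \<in> bilinearity_rels A B"
      then show "y \<in> {p. G p = 0}"
        by (cases rule: bil_rels_cases)
          (use \<phi> \<psi> in \<open>simp_all add: linear_form_def G_minus G_scale G_single distrib_left distrib_right del: pm_scale_single\<close>)
    qed
  qed
  then have null: "G p = 0" if "p \<in> TN" for p using that by auto
  define F where "F X = the_elem (G ` X)" for X
  have F: "F (TN +>\<^bsub>PT\<^esub> p) = G p" if p: "p \<in> carrier PT" for p
  proof -
    have *: "G q = G p" if "q \<in> TN +>\<^bsub>PT\<^esub> p" for q
      using that by (auto simp: a_r_coset_def' G_add null)
    have "G ` (TN +>\<^bsub>PT\<^esub> p) = (\<lambda>_. G p) ` (TN +>\<^bsub>PT\<^esub> p)"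
      by (rule image_cong[OF refl]) (rule *)
    then have "G ` (TN +>\<^bsub>PT\<^esub> p) = {G p}" using T.a_rcos_self[OF p] by auto
    then show ?thesis by (simp add: F_def)
  qed
  show ?thesis
  proof (rule that[of F])
    fix X Y assume "X \<in> carrier TA" "Y \<in> carrier TA"
    then show "F (X \<oplus>\<^bsub>TA\<^esub> Y) = F X + F Y"
      by (elim T.cosetE) (simp add: T.quot_add F G_add PT_closed)
  next
    fix c X assume "X \<in> carrier TA"
    then show "F (c \<odot>\<^bsub>TA\<^esub> X) = c * F X"
      by (elim T.cosetE) (simp add: T.quot_smult F G_scale PT_closed)
  next
    fix a b assume "a \<in> carrier A" "b \<in> carrier B"
    then show "F (a \<bullet> b) = \<phi> a * \<psi> b" by (simp add: pure_tensor_def F G_single)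
  qed
qed

end

locale tensor_hom = D: tensor2 A B + C: tensor2 C D
  for A :: "('k::field, 'a, 'm) module_scheme" and B :: "('k, 'b, 'l) module_scheme"
    and C :: "('k, 'c, 'r) module_scheme" and D :: "('k, 'd, 's) module_scheme" +
  fixes f :: "'a \<Rightarrow> 'c" and g :: "'b \<Rightarrow> 'd"
  assumes f: "f \<in> alg_hom A C" and g: "g \<in> alg_hom B D"
begin

definition push :: "('a \<times> 'b \<Rightarrow>\<^sub>0 'k) \<Rightarrow> ('c \<times> 'd \<Rightarrow>\<^sub>0 'k)" where
  "push p = (\<Sum>(a, b)\<in>Poly_Mapping.keys p. Poly_Mapping.single (f a, g b) (Poly_Mapping.lookup p (a, b)))"

lemma push_superset:
  assumes "finite S" "Poly_Mapping.keys p \<subseteq> S"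
  shows "push p = (\<Sum>x\<in>S. Poly_Mapping.single (f (fst x), g (snd x)) (Poly_Mapping.lookup p x))"
  unfolding push_def case_prod_beta
  by (rule sum.mono_neutral_cong_left) (use assms in \<open>auto simp: in_keys_iff\<close>)

lemma push_add: "push (p + q) = push p + push q"
  using push_superset[of "Poly_Mapping.keys p \<union> Poly_Mapping.keys q"] Poly_Mapping.keys_add[of p q]
  by (simp add: lookup_add single_add sum.distrib)

lemma push_zero [simp]: "push 0 = 0"
  by (simp add: push_def)

lemma push_single: "push (Poly_Mapping.single (a, b) c) = Poly_Mapping.single (f a, g b) c"
  using push_superset[of "{(a, b)}" "Poly_Mapping.single (a, b) c"] by simp

lemma push_scale: "push (c \<cdot> p) = c \<cdot> push p"
proof -
  have "Poly_Mapping.keys p \<subseteq> UNIV" by simp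
  then show ?thesis
    by (induction p rule: pm_induct) (auto simp: push_single push_add pm_scale_add_right)
qed

lemma push_minus: "push (p - q) = push p - push q"
  using push_add[of "p - q" q] by (simp add: algebra_simps)

lemma push_closed: "p \<in> carrier D.PT \<Longrightarrow> push p \<in> carrier C.PT"
  unfolding D.PT_simps
proof (induction p rule: pm_induct)
  case (single w c)
  then show ?case using alg_homD(1)[OF f] alg_homD(1)[OF g] by (cases w) (auto simp: push_single)
next
  case (add p q)
  then show ?case using Poly_Mapping.keys_add[of "push p" "push q"] by (auto simp: push_add)
qed simp

lemma push_mult:
  assumes "p \<in> carrier D.PT" "q \<in> carrier D.PT"
  shows "push (p \<otimes>\<^bsub>D.PT\<^esub> q) = push p \<otimes>\<^bsub>C.PT\<^esub> push q"
proof -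
  have s: "push (Poly_Mapping.single x c \<otimes>\<^bsub>D.PT\<^esub> q) = push (Poly_Mapping.single x c) \<otimes>\<^bsub>C.PT\<^esub> push q"
    if "x \<in> carrier A \<times> carrier B" for x c
    using assms(2)[unfolded D.PT_simps]
  proof (induction q rule: pm_induct)
    case (single y d)
    then show ?case using that alg_homD(2)[OF f] alg_homD(2)[OF g]
      by (cases x; cases y) (auto simp: D.pmult_single C.pmult_single push_single D.ppr_def C.ppr_def)
  qed (simp_all add: push_add D.pmult_add_right C.pmult_add_right)
  show ?thesis
    using assms(1)[unfolded D.PT_simps]
    by (induction p rule: pm_induct) (simp_all add: s push_add D.pmult_add_left C.pmult_add_left)
qed

lemma push_null: "p \<in> D.TN \<Longrightarrow> push p \<in> C.TN"
proof -
  have "D.TN \<subseteq> {p. push p \<in> C.TN}"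
    unfolding tensor_null_def[of A B]
  proof (rule pm.span_minimal)
    show "pm.subspace {p. push p \<in> C.TN}"
      by (rule pm.subspaceI)
        (auto simp: push_add push_scale tensor_null_def pm.span_add pm.span_scale pm.span_zero)
    show "bilinearity_rels A B \<subseteq> {p. push p \<in> C.TN}"
    proof
      fix y assume "y \<in> bilinearity_rels A B"
      then have "push y \<in> bilinearity_rels C D"
        by (cases rule: D.bil_rels_cases)
          (simp_all add: push_minus push_scale push_single alg_homD[OF f] alg_homD[OF g] C.bil_relsI del: pm_scale_single)
      then show "y \<in> {p. push p \<in> C.TN}" by (simp add: tensor_null_def pm.span_base)
    qed
  qed
  then show "p \<in> D.TN \<Longrightarrow> push p \<in> C.TN" by auto
qed

text \<open>The union in \<open>tensor_map\<close> collapses because \<open>push\<close> sends null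
  tensors to null tensors.\<close>

lemma tensor_map_coset:
  assumes p: "p \<in> carrier D.PT"
  shows "tensor_map A B C D f g (D.TN +>\<^bsub>D.PT\<^esub> p) = C.TN +>\<^bsub>C.PT\<^esub> push p"
proof -
  have *: "C.TN +>\<^bsub>C.PT\<^esub> push q = C.TN +>\<^bsub>C.PT\<^esub> push p" if q: "q \<in> D.TN +>\<^bsub>D.PT\<^esub> p" for q
  proof -
    obtain r where r: "r \<in> D.TN" "q = r + p" using q by (auto simp: a_r_coset_def')
    have "r \<in> carrier D.PT" using r(1) D.TN_carrier by blast
    then have "q \<in> carrier D.PT" using p by (simp add: r(2) D.PT_closed)
    then show ?thesis
      using C.T.coset_eq_iff[OF push_closed push_closed, of q p] p r
      by (simp add: C.PT_minus[OF push_closed[OF p]] push_add push_null)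
  qed
  have "tensor_map A B C D f g (D.TN +>\<^bsub>D.PT\<^esub> p) = (\<Union>q\<in>D.TN +>\<^bsub>D.PT\<^esub> p. C.TN +>\<^bsub>C.PT\<^esub> push q)"
    using D.T.coset_closed[OF p] by (simp add: tensor_map_def push_def)
  also have "\<dots> = (\<Union>q\<in>D.TN +>\<^bsub>D.PT\<^esub> p. C.TN +>\<^bsub>C.PT\<^esub> push p)"
    by (rule SUP_cong[OF refl]) (rule *)
  also have "\<dots> = C.TN +>\<^bsub>C.PT\<^esub> push p" using D.T.a_rcos_self[OF p] by blast
  finally show ?thesis .
qed

lemma tensor_map_pure:
  "a \<in> carrier A \<Longrightarrow> b \<in> carrier B \<Longrightarrow>
    tensor_map A B C D f g (pure_tensor A B a b) = pure_tensor C D (f a) (g b)"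
  by (simp add: pure_tensor_def tensor_map_coset push_single)

lemma tensor_map_hom: "tensor_map A B C D f g \<in> alg_hom D.TA C.TA"
proof (rule alg_homI)
  fix X Y assume "X \<in> carrier D.TA" "Y \<in> carrier D.TA"
  then obtain p q where pq: "p \<in> carrier D.PT" "X = D.TN +>\<^bsub>D.PT\<^esub> p" "q \<in> carrier D.PT" "Y = D.TN +>\<^bsub>D.PT\<^esub> q"
    by (elim D.T.cosetE) blast
  have a: "p + q \<in> carrier D.PT" using D.T.add.m_closed[of p q] pq by simp
  note [simp del] = D.PT_simps(1) C.PT_simps(1)
  show "tensor_map A B C D f g (X \<otimes>\<^bsub>D.TA\<^esub> Y) = tensor_map A B C D f g X \<otimes>\<^bsub>C.TA\<^esub> tensor_map A B C D f g Y"
    using pq D.T.m_closed by (simp add: D.T.quot_mult tensor_map_coset C.T.quot_mult push_closed push_mult)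
  show "tensor_map A B C D f g (X \<oplus>\<^bsub>D.TA\<^esub> Y) = tensor_map A B C D f g X \<oplus>\<^bsub>C.TA\<^esub> tensor_map A B C D f g Y"
    using pq a by (simp add: D.T.quot_add tensor_map_coset C.T.quot_add push_closed push_add)
next
  fix X c assume "X \<in> carrier D.TA"
  then obtain p where p: "p \<in> carrier D.PT" "X = D.TN +>\<^bsub>D.PT\<^esub> p"
    by (elim D.T.cosetE) blast
  have a: "c \<cdot> p \<in> carrier D.PT" using D.T.smult_closed[of p c] p by simp
  note [simp del] = D.PT_simps(1) C.PT_simps(1)
  show "tensor_map A B C D f g X \<in> carrier C.TA" using p by (simp add: tensor_map_coset push_closed)
  show "tensor_map A B C D f g (c \<odot>\<^bsub>D.TA\<^esub> X) = c \<odot>\<^bsub>C.TA\<^esub> tensor_map A B C D f g X"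
    using p a by (simp add: D.T.quot_smult tensor_map_coset C.T.quot_smult push_closed push_scale)
next
  show "tensor_map A B C D f g \<one>\<^bsub>D.TA\<^esub> = \<one>\<^bsub>C.TA\<^esub>"
    using alg_homD(4)[OF f] alg_homD(4)[OF g] by (simp add: D.pure_one C.pure_one tensor_map_pure)
qed

end

section \<open>Roots of unity\<close>

lemma card_nth_roots_field:
  fixes c :: "'k::{alg_closed_field, field_char_0}"
  assumes "k > 0" "c \<noteq> 0"
  shows "card {x. x ^ k = c} = k" and "finite {x. x ^ k = c}"
proof -
  define p where "p = monom 1 k + [:- c:]"
  have deg: "degree p = k"
    using assms(1) by (simp add: p_def degree_add_eq_left degree_monom_eq)
  then have p0: "p \<noteq> 0" using assms(1) by auto
  have roots: "{x. poly p x = 0} = {x. x ^ k = c}"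
    by (simp add: p_def poly_monom)
  show fin: "finite {x. x ^ k = c}" using poly_roots_finite[OF p0] roots by simp
  obtain A where A: "size A = degree p" "p = Polynomial.smult (lead_coeff p) (\<Prod>x\<in>#A. [:- x, 1:])"
    using alg_closed_imp_factorization[OF p0] by metis
  have set: "set_mset A = {x. x ^ k = c}"
  proof -
    have "poly p x = lead_coeff p * (\<Prod>y\<in>#A. x - y)" for x
      by (subst A(2)) (simp add: poly_prod_mset image_mset.compositionality comp_def)
    then have "poly p x = 0 \<longleftrightarrow> x \<in># A" for x using p0 by auto
    then show ?thesis using roots by auto
  qed
  \<comment> \<open>A repeated linear factor would make \<open>x\<close> a root of the derivative
    \<open>k * x^(k-1)\<close>, which does not vanish at a nonzero \<open>x\<close> in
    characteristic 0.\<close>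
  have "count A x = 1" if x: "x \<in># A" for x
  proof (rule ccontr)
    assume "count A x \<noteq> 1"
    moreover obtain A' where A': "A = add_mset x A'" using multi_member_split[OF x] by blast
    ultimately have "x \<in># A'" by (auto simp: not_in_iff)
    then obtain A'' where A'': "A' = add_mset x A''" using multi_member_split by metis
    define q where "q = Polynomial.smult (lead_coeff p) (\<Prod>x\<in>#A''. [:- x, 1:])"
    have q: "p = [:- x, 1:] * ([:- x, 1:] * q)"
      by (subst A(2)) (simp only: A' A'' q_def image_mset_add_mset mult_smult_right prod_mset.add_mset)
    have "poly (pderiv ([:- x, 1:] * ([:- x, 1:] * q))) x = 0"
      by (simp only: pderiv_mult poly_mult poly_add) simp
    then have "poly (pderiv p) x = 0" using q by metis
    moreover have "poly (pderiv p) x = of_nat k * x ^ (k - 1)"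
      by (simp add: p_def pderiv_add pderiv_monom poly_monom pderiv_pCons)
    moreover have "x \<noteq> 0" using x set assms by (auto simp: zero_power)
    ultimately show False using assms(1) by simp
  qed
  then have "size A = card (set_mset A)" by (simp add: size_multiset_overloaded_eq)
  then show "card {x. x ^ k = c} = k" using set A(1) deg by simp
qed

text \<open>Quotients of two roots of \<open>c\<close> run through the roots of 1, so all
  \<open>k\<close>-th roots of unity satisfy \<open>x^r = 1\<close> for the remainder
  \<open>r\<close> of \<open>e\<close>; if \<open>0 < r < k\<close>, these are too many.
  Divisibility conditions on automorphisms are later read off in this way.\<close>

lemma all_roots_imp_dvd:
  assumes k: "k > 0" and c: "c \<noteq> (0 :: 'k::{alg_closed_field, field_char_0})"
    and all: "\<And>x. x ^ k = c \<Longrightarrow> x powi e = d"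
  shows "int k dvd e"
proof (rule ccontr)
  assume nd: "\<not> int k dvd e"
  define r where "r = nat (e mod int k)"
  have r: "0 < r" "r < k" "e mod int k = int r"
  proof -
    have "e mod int k \<noteq> 0" "0 \<le> e mod int k" "e mod int k < int k"
      using k nd by (simp_all add: dvd_eq_mod_eq_0)
    then show "0 < r" "r < k" "e mod int k = int r" by (simp_all add: r_def nat_less_iff)
  qed
  obtain x0 where x0: "x0 ^ k = c" using nth_root_exists[OF k, of c] by auto
  have x0nz: "x0 \<noteq> 0" using x0 c k by (auto simp: zero_power)
  have "{x::'k. x ^ k = 1} \<subseteq> {x. x ^ r = 1}"
  proof safe
    fix x :: 'k assume x: "x ^ k = 1"
    then have xnz: "x \<noteq> 0" using k by (auto simp: zero_power)
    have "(x0 * x) powi e = d" "x0 powi e = d" using all[of "x0 * x"] all[of x0] x x0 by (auto simp: power_mult_distrib)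
    then have "x powi e = 1" using x0nz by (auto simp: power_int_mult_distrib)
    moreover have "x powi e = (x powi int k) powi (e div int k) * x powi (e mod int k)"
      using xnz by (subst power_int_mult[symmetric], subst power_int_add[symmetric]) simp_all
    ultimately show "x ^ r = 1" using x r(3) by simp
  qed
  then have "card {x::'k. x ^ k = 1} \<le> card {x::'k. x ^ r = 1}"
    using card_nth_roots_field(2)[of r "1::'k"] r by (intro card_mono) auto
  then show False using card_nth_roots_field(1)[of r "1::'k"] card_nth_roots_field(1)[of k "1::'k"] r k by simp
qed

text \<open>Orthogonality of characters on a coset of the roots of unity: if \<open>k\<close> does
  not divide \<open>e\<close>, multiplying the summation variable by some \<open>w\<close> with
  \<open>w powi e \<noteq> 1\<close> rescales the sum without changing it.\<close>

lemma sum_roots_power_int: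
  assumes k: "k > 0" and c: "c \<noteq> (0 :: 'k::{alg_closed_field, field_char_0})"
  shows "(\<Sum>x | x ^ k = c. x powi e) = (if int k dvd e then of_nat k * c powi (e div int k) else 0)"
proof (cases "int k dvd e")
  case True
  then obtain q where q: "e = int k * q" by blast
  have "x powi e = c powi q" if "x ^ k = c" for x
    using that by (simp add: q power_int_mult)
  then have "(\<Sum>x | x ^ k = c. x powi e) = (\<Sum>x | x ^ k = c. c powi q)" by (intro sum.cong) auto
  then show ?thesis using True k q by (simp add: card_nth_roots_field[OF assms])
next
  case False
  obtain w :: 'k where w: "w ^ k = 1" "w powi e \<noteq> 1"
    using all_roots_imp_dvd[OF k, of "1::'k" e 1] False by (metis zero_neq_one)
  have wnz: "w \<noteq> 0" using w(1) k by (auto simp: zero_power)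
  let ?S = "\<Sum>x | x ^ k = c. x powi e"
  have "?S = (\<Sum>x | x ^ k = c. (w * x) powi e)"
    by (rule sum.reindex_bij_witness[of _ "\<lambda>x. w * x" "\<lambda>x. x / w"])
      (use w wnz in \<open>auto simp: power_divide power_mult_distrib\<close>)
  also have "\<dots> = w powi e * ?S" by (simp add: power_int_mult_distrib sum_distrib_left)
  finally have "(1 - w powi e) * ?S = 0" by (simp add: algebra_simps)
  then show ?thesis using w False by simp
qed

section \<open>Two-dimensional representations\<close>

datatype 'a m2 = M2 (m11: 'a) (m12: 'a) (m21: 'a) (m22: 'a)

instantiation m2 :: (ring_1) ring_1
begin

definition "0 = M2 0 0 0 0"
definition "1 = M2 1 0 0 1"
definition "a + b = M2 (m11 a + m11 b) (m12 a + m12 b) (m21 a + m21 b) (m22 a + m22 b)"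
definition "a - b = M2 (m11 a - m11 b) (m12 a - m12 b) (m21 a - m21 b) (m22 a - m22 b)"
definition "- a = M2 (- m11 a) (- m12 a) (- m21 a) (- m22 a)"
definition "a * b = M2 (m11 a * m11 b + m12 a * m21 b) (m11 a * m12 b + m12 a * m22 b)
   (m21 a * m11 b + m22 a * m21 b) (m21 a * m12 b + m22 a * m22 b)"

lemmas m2_defs = zero_m2_def one_m2_def plus_m2_def minus_m2_def uminus_m2_def times_m2_def

instance
  by standard (simp_all add: m2_defs m2.expand algebra_simps)

end

definition m2_scale :: "'k::field \<Rightarrow> 'k m2 \<Rightarrow> 'k m2" where
  "m2_scale c a = M2 (c * m11 a) (c * m12 a) (c * m21 a) (c * m22 a)"

definition m2_alg :: "('k::field, 'k m2) module" where
  "m2_alg = \<lparr>carrier = UNIV, mult = (*), one = 1, zero = 0, add = (+), smult = m2_scale\<rparr>"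

lemma m2_alg_simps [simp]:
  "carrier m2_alg = UNIV" "mult m2_alg = (*)" "one m2_alg = 1" "zero m2_alg = 0"
  "add m2_alg = (+)" "smult m2_alg = m2_scale"
  by (simp_all add: m2_alg_def)

lemma kalg_m2: "kalg (m2_alg :: ('k::field, 'k m2) module)"
proof -
  have "ring (m2_alg :: ('k::field, 'k m2) module)"
  proof (rule ringI)
    show "abelian_group (m2_alg :: ('k::field, 'k m2) module)"
    proof (rule abelian_groupI)
      show "\<exists>y\<in>carrier m2_alg. y \<oplus>\<^bsub>m2_alg\<^esub> x = \<zero>\<^bsub>m2_alg\<^esub>" for x :: "'k m2"
        by (auto intro: exI[of _ "- x"])
    qed (simp_all add: ac_simps)
    show "Group.monoid (m2_alg :: ('k::field, 'k m2) module)"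
      by (rule monoidI) (simp_all add: mult.assoc)
  qed (simp_all add: distrib_left distrib_right)
  then show ?thesis
    by (rule kalg.intro) (unfold_locales, simp_all add: m2_scale_def m2_defs algebra_simps)
qed

definition ev :: "(idx \<times> idx \<Rightarrow> 'k::field m2) \<Rightarrow> 'k sfree \<Rightarrow> 'k m2" where
  "ev g = free_lift m2_alg g"

interpretation m2: kalg "m2_alg :: ('k::field, 'k m2) module"
  by (rule kalg_m2)

lemma ev_simps [simp]:
  "ev g (p + q) = ev g p + ev g q" "ev g (p * q) = ev g p * ev g q" "ev g 1 = 1" "ev g 0 = 0"
  "ev g (c \<cdot> p) = m2_scale c (ev g p)" "ev g (gx i j) = g (i, j)"
  by (simp_all add: ev_def gx_def m2.free_lift_add[simplified] m2.free_lift_mult[simplified]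
      m2.free_lift_scale[simplified] m2.free_lift_one[simplified] m2.free_lift_zero[simplified] m2.free_lift_gen[simplified])

lemma ev_uminus [simp]: "ev g (- p) = - ev g p"
  using ev_simps(1)[of g p "- p"] by (simp add: eq_neg_iff_add_eq_0 add.commute)

lemma ev_minus [simp]: "ev g (p - q) = ev g p - ev g q"
  using ev_simps(1)[of g p "- q"] by simp

lemma ev_power [simp]: "ev g (p ^ k) = ev g p ^ k"
  by (induction k) simp_all

lemma ev_hom: "ev g \<in> alg_hom free_alg m2_alg"
  by (rule alg_homI) simp_all

text \<open>The parameters separate the scale \<open>u\<close> from the ratio of the entries, so
  that products stay within the two families. Even words will evaluate to \<open>MD\<close>, odd
  words to \<open>MJ\<close>.\<close>

definition MD :: "'k::field \<Rightarrow> 'k \<Rightarrow> 'k m2" where "MD u d = M2 (u * d) 0 0 (u / d)"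
definition MJ :: "'k::field \<Rightarrow> 'k \<Rightarrow> 'k m2" where "MJ u a = M2 0 (u / a) (u * a) 0"

lemma MDJ_mult:
  "MJ u a * MJ v b = MD (u * v) (b / a)" "MD u d * MJ v a = MJ (u * v) (a / d)"
  "MD u d * MD v e = MD (u * v) (d * e)"
  by (simp_all add: MD_def MJ_def times_m2_def)

lemma MD_one: "MD 1 1 = 1" by (simp add: MD_def one_m2_def)

lemma MD_power: "MD u d ^ k = MD (u ^ k) (d ^ k)"
  by (induction k) (simp_all add: MD_one MDJ_mult)

text \<open>\<open>fl\<close> selects the block: letters with equal indices for
  \<open>False\<close>, with distinct indices for \<open>True\<close>. The other two letters act as
  0, as products of letters of different parity must vanish.\<close>

definition gfam :: "bool \<Rightarrow> 'k::field \<Rightarrow> 'k \<Rightarrow> 'k \<Rightarrow> idx \<times> idx \<Rightarrow> 'k m2" where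
  "gfam fl u a b = (\<lambda>(i, j). if (i \<noteq> j) = fl then MJ u (if i = One then a else b) else 0)"

lemma gfam_simps [simp]:
  "gfam False u a b (One, One) = MJ u a" "gfam False u a b (Two, Two) = MJ u b"
  "gfam False u a b (One, Two) = 0" "gfam False u a b (Two, One) = 0"
  "gfam True u a b (One, Two) = MJ u a" "gfam True u a b (Two, One) = MJ u b"
  "gfam True u a b (One, One) = 0" "gfam True u a b (Two, Two) = 0"
  by (simp_all add: gfam_def)

lemma gfam_eqI:
  assumes "f (One, One) = gfam fl u a b (One, One)" "f (Two, Two) = gfam fl u a b (Two, Two)"
    "f (One, Two) = gfam fl u a b (One, Two)" "f (Two, One) = gfam fl u a b (Two, One)"
  shows "f = gfam fl u a b"
proof
  fix l :: "idx \<times> idx"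
  obtain i j where "l = (i, j)" by (cases l)
  then show "f l = gfam fl u a b l" using assms by (cases i; cases j) auto
qed

lemma ev_gfam_sq: "a \<noteq> 0 \<Longrightarrow> b \<noteq> 0 \<Longrightarrow> (i \<noteq> j) = fl \<Longrightarrow> ev (gfam fl u a b) (gx i j ^ (2 * s)) = MD (u ^ (2 * s)) 1"
  by (simp add: gfam_def power_mult power2_eq_square[of "MJ _ _"] MDJ_mult MD_power power2_eq_square)

lemma ev_gfam_neq: "(i \<noteq> j) \<noteq> fl \<Longrightarrow> k > 0 \<Longrightarrow> ev (gfam fl u a b) (gx i j ^ k) = 0"
  by (auto simp: gfam_def power_0_left)

lemma swap_neq [simp]: "swap i = swap j \<longleftrightarrow> i = j" "swap (swap i) = i" "swap i \<noteq> i" "i \<noteq> swap i"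
  by (cases i; cases j; simp)+

lemma ev_gfam_chi_neq: "(i \<noteq> j) \<noteq> fl \<Longrightarrow> k > 0 \<Longrightarrow> ev (gfam fl u a b) (chi i j k) = 0"
  by (cases k) (auto simp: gfam_def)

lemma ev_gfam_chi:
  fixes u a b :: "'k::field"
  assumes "a \<noteq> 0" "b \<noteq> 0" "(i \<noteq> j) = fl"
  defines "c \<equiv> if i = One then a else b" and "d \<equiv> if i = One then b else a"
  shows "ev (gfam fl u a b) (chi i j (2 * k)) = MD (u ^ (2 * k)) ((d / c) ^ k)"
    and "ev (gfam fl u a b) (chi i j (Suc (2 * k))) = MJ (u ^ Suc (2 * k)) (c * (c / d) ^ k)"
proof -
  have *: "gfam fl u a b (i, j) = MJ u c" "gfam fl u a b (swap i, swap j) = MJ u d"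
    unfolding c_def d_def assms(3)[symmetric] by (cases i; cases j; simp add: gfam_def)+
  have c: "c \<noteq> 0" "d \<noteq> 0" using assms by (auto simp: c_def d_def)
  show e: "ev (gfam fl u a b) (chi i j (2 * k)) = MD (u ^ (2 * k)) ((d / c) ^ k)" for k
    by (induction k) (simp_all add: * MD_one MDJ_mult mult.assoc[symmetric])
  \<comment> \<open>After an even number of letters the alternation is back at
    \<open>gx i j\<close>, so an odd word is an even one with this letter appended.\<close>
  have "chi i j (Suc (2 * k)) = chi i j (2 * k) * (gx i j :: 'k sfree)"
    by (induction k) (simp_all add: mult.assoc)
  then have "ev (gfam fl u a b) (chi i j (Suc (2 * k))) = MD (u ^ (2 * k)) ((d / c) ^ k) * MJ u c"
    by (simp only: ev_simps e *)
  also have "\<dots> = MJ (u ^ Suc (2 * k)) (c * (c / d) ^ k)"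
    using c by (simp add: MDJ_mult power_divide mult.commute)
  finally show "ev (gfam fl u a b) (chi i j (Suc (2 * k))) = MJ (u ^ Suc (2 * k)) (c * (c / d) ^ k)" .
qed

section \<open>The Suzuki relations at a representation\<close>

locale suzuki_params =
  fixes N n :: nat and \<mu> lam :: "'k::{alg_closed_field, field_char_0}"
  assumes N: "N \<ge> 1" and n: "n \<ge> 2" and mu: "\<mu> \<in> {1, -1}" and lam: "lam \<in> {1, -1}"
begin

lemma mu_sq [simp]: "\<mu> * \<mu> = 1" "\<mu>\<^sup>2 = 1" "\<mu> \<noteq> 0" "\<mu> * (\<mu> * x) = x"
  using mu by auto

lemma lam_sq [simp]: "lam * lam = 1" "lam\<^sup>2 = 1" "lam \<noteq> 0" "lam * (lam * x) = x"
  using lam by auto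

text \<open>\<open>muf\<close> and \<open>lamf\<close> are the values that the relations prescribe
  in the block \<open>fl\<close> for the power \<open>2*N\<close> of the scale and for the power
  \<open>n\<close> of the ratio.\<close>

definition muf :: "bool \<Rightarrow> 'k" where "muf fl = (if fl then \<mu> else 1)"
definition lamf :: "bool \<Rightarrow> 'k" where "lamf fl = (if fl then lam else 1)"

lemma muf_simps [simp]: "muf False = 1" "muf True = \<mu>" "muf fl * muf fl = 1" "muf fl \<noteq> 0" "(muf fl)\<^sup>2 = 1"
  by (auto simp: muf_def)

lemma lamf_simps [simp]: "lamf False = 1" "lamf True = lam" "lamf fl * lamf fl = 1" "lamf fl \<noteq> 0" "(lamf fl)\<^sup>2 = 1"
  by (auto simp: lamf_def)

lemma odd_power_lamf: "odd t \<Longrightarrow> lamf fl ^ t = lamf fl" "odd t \<Longrightarrow> muf fl ^ t = muf fl"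
  by (auto elim!: oddE simp: power_mult)

definition sat :: "(idx \<times> idx \<Rightarrow> 'k m2) \<Rightarrow> bool" where
  "sat g \<longleftrightarrow> (\<forall>r\<in>suzuki_rels N n \<mu> lam. ev g r = 0)"

lemma satD:
  assumes "sat g"
  shows "g (One, One) * g (One, One) = g (Two, Two) * g (Two, Two)"
    and "g (One, Two) * g (One, Two) = g (Two, One) * g (Two, One)"
    and "ev g (chi Two One n) = m2_scale lam (ev g (chi One Two n))"
    and "ev g (chi One One n) = ev g (chi Two Two n)"
    and "g (One, One) ^ (2 * N) + m2_scale \<mu> (g (One, Two) ^ (2 * N)) = 1"
    and "odd (idx_nat i + idx_nat j + idx_nat k + idx_nat l) \<Longrightarrow> g (i, j) * g (k, l) = 0"
proof -
  have r: "ev g r = 0" if "r \<in> suzuki_rels N n \<mu> lam" for r using assms that by (auto simp: sat_def)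
  show "g (One, One) * g (One, One) = g (Two, Two) * g (Two, Two)"
    using r[of "x11^2 - x22^2"] by (simp add: suzuki_rels_def power2_eq_square)
  show "g (One, Two) * g (One, Two) = g (Two, One) * g (Two, One)"
    using r[of "x12^2 - x21^2"] by (simp add: suzuki_rels_def power2_eq_square)
  show "ev g (chi Two One n) = m2_scale lam (ev g (chi One Two n))"
    using r[of "chi Two One n - lam \<cdot> chi One Two n"] by (simp add: suzuki_rels_def)
  show "ev g (chi One One n) = ev g (chi Two Two n)"
    using r[of "chi One One n - chi Two Two n"] by (simp add: suzuki_rels_def)
  show "g (One, One) ^ (2 * N) + m2_scale \<mu> (g (One, Two) ^ (2 * N)) = 1"
    using r[of "x11^(2*N) + \<mu> \<cdot> x12^(2*N) - 1"] by (simp add: suzuki_rels_def)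
  assume "odd (idx_nat i + idx_nat j + idx_nat k + idx_nat l)"
  then have "gx i j * gx k l \<in> suzuki_rels N n \<mu> lam" unfolding suzuki_rels_def by blast
  then show "g (i, j) * g (k, l) = 0" using r[of "gx i j * gx k l"] by simp
qed

lemma satI:
  assumes "g (One, One) * g (One, One) = g (Two, Two) * g (Two, Two)"
    and "g (One, Two) * g (One, Two) = g (Two, One) * g (Two, One)"
    and "ev g (chi Two One n) = m2_scale lam (ev g (chi One Two n))"
    and "ev g (chi One One n) = ev g (chi Two Two n)"
    and "g (One, One) ^ (2 * N) + m2_scale \<mu> (g (One, Two) ^ (2 * N)) = 1"
    and "\<And>i j k l. odd (idx_nat i + idx_nat j + idx_nat k + idx_nat l) \<Longrightarrow> g (i, j) * g (k, l) = 0"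
  shows "sat g"
proof -
  have "ev g r = 0" if "r \<in> {gx i j * gx k l | i j k l. odd (idx_nat i + idx_nat j + idx_nat k + idx_nat l)}" for r
    using that assms(6) by (elim CollectE exE conjE) (simp only: ev_simps)
  then show ?thesis
    unfolding sat_def suzuki_rels_def ball_Un using assms(1-5) by (simp add: power2_eq_square)
qed

lemma m2_scale_MDJ [simp]: "m2_scale c (MD u d) = MD (c * u) d" "m2_scale c (MJ u d) = MJ (c * u) d"
  "m2_scale c 0 = 0"
  by (simp_all add: m2_scale_def MD_def MJ_def zero_m2_def)

lemma MDJ_zero [simp]: "MD 0 d = 0" "MJ 0 d = 0"
  by (simp_all add: MD_def MJ_def zero_m2_def)

lemma idx_parity: "odd (idx_nat i + idx_nat j + idx_nat k + idx_nat l) \<longleftrightarrow> (i = j) \<noteq> (k = l)"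
  by (cases i; cases j; cases k; cases l) auto

lemma sq_sq_eq: "MD u 1 = 1 \<longleftrightarrow> u = 1"
  by (simp add: MD_def one_m2_def)

text \<open>Both words have the same diagonal or antidiagonal shape; one entry yields the condition
  on \<open>a / b\<close>, the other the condition on \<open>b / a\<close>.\<close>

lemma gfam_chi_rel:
  assumes ab: "a \<noteq> 0" "b \<noteq> 0" and u: "u \<noteq> 0"
  shows "ev (gfam fl u a b) (chi Two (if fl then One else Two) n)
       = m2_scale c (ev (gfam fl u a b) (chi One (if fl then Two else One) n)) \<longleftrightarrow>
     (a / b) ^ n = c \<and> (b / a) ^ n = c"
proof (cases "even n")
  case True
  then obtain k where k: "n = 2 * k" by blast
  show ?thesis
    using ab u unfolding k
    by (subst (1 2) ev_gfam_chi(1)) (auto simp: m2_scale_def MD_def power_mult power2_eq_square field_simps)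
next
  case False
  then obtain k where k: "n = Suc (2 * k)" by (auto elim: oddE)
  have "u * u ^ (2 * k) \<noteq> 0" using u by simp
  then show ?thesis
    using ab u unfolding k
    by (subst (1 2) ev_gfam_chi(2)) (auto simp: m2_scale_def MJ_def power_mult power2_eq_square field_simps)
qed

lemma sat_gfam_iff:
  assumes ab: "a \<noteq> 0" "b \<noteq> 0"
  shows "sat (gfam fl u a b) \<longleftrightarrow> u ^ (2 * N) = muf fl \<and> (b / a) ^ n = lamf fl"
proof -
  \<comment> \<open>The right-hand side is 1 or -1, hence its own inverse, and the two conditions
    coincide.\<close>
  have inv: "(a / b) ^ n = lamf fl \<and> (b / a) ^ n = lamf fl \<longleftrightarrow> (b / a) ^ n = lamf fl"
  proof -
    have "(a / b) ^ n = inverse ((b / a) ^ n)" using ab by (simp add: field_simps)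
    then show ?thesis using lam by (auto simp: lamf_def)
  qed
  have sq: "MJ u a * MJ u a = MD (u * u) 1" "MJ u b * MJ u b = MD (u * u) 1" using ab by (simp_all add: MDJ_mult)
  have pw: "MJ u a ^ (2 * N) = MD (u ^ (2 * N)) 1"
    using sq by (simp add: power_mult power2_eq_square MD_power)
  have N0: "2 * N \<noteq> 0" using N by simp
  have chi0: "ev (gfam False u a b) (chi Two One n) = 0" "ev (gfam False u a b) (chi One Two n) = 0"
    "ev (gfam True u a b) (chi Two Two n) = 0" "ev (gfam True u a b) (chi One One n) = 0"
    using n by (auto intro!: ev_gfam_chi_neq)
  have uN: "u \<noteq> 0" if "u ^ (2 * N) = muf fl"
    using that N0 by (cases "u = 0") (auto simp: zero_power)
  have mu1: "\<mu> * x = 1 \<longleftrightarrow> x = \<mu>" for x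
    by (metis mu_sq(1) mu_sq(4) mult.right_neutral)
  have n2: "(gfam fl u a b (One, One)) ^ (2 * N) + m2_scale \<mu> (gfam fl u a b (One, Two) ^ (2 * N)) = 1
      \<longleftrightarrow> u ^ (2 * N) = muf fl"
    using N0 by (cases fl) (simp_all add: pw power_0_left sq_sq_eq mu1)
  show ?thesis
  proof
    assume s: "sat (gfam fl u a b)"
    have u: "u ^ (2 * N) = muf fl" using satD(5)[OF s] n2 by simp
    show "u ^ (2 * N) = muf fl \<and> (b / a) ^ n = lamf fl"
      using gfam_chi_rel[OF ab uN[OF u], of fl "lamf fl"] satD(3,4)[OF s] u inv
      by (cases fl) (auto simp: m2_scale_def)
  next
    assume u: "u ^ (2 * N) = muf fl \<and> (b / a) ^ n = lamf fl"
    have "(a / b) ^ n = lamf fl \<and> (b / a) ^ n = lamf fl" using inv u by blast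
    then have e: "ev (gfam fl u a b) (chi Two (if fl then One else Two) n)
       = m2_scale (lamf fl) (ev (gfam fl u a b) (chi One (if fl then Two else One) n))"
      using gfam_chi_rel[OF ab uN[OF conjunct1[OF u]]] by blast
    have m2_scale_one: "m2_scale 1 x = x" for x :: "'k m2" by (simp add: m2_scale_def)
    show "sat (gfam fl u a b)"
    proof (rule satI)
      show "gfam fl u a b (i, j) * gfam fl u a b (k, l) = 0"
        if "odd (idx_nat i + idx_nat j + idx_nat k + idx_nat l)" for i j k l
        using that unfolding idx_parity by (auto simp: gfam_def)
      show "ev (gfam fl u a b) (chi Two One n) = m2_scale lam (ev (gfam fl u a b) (chi One Two n))"
        "ev (gfam fl u a b) (chi One One n) = ev (gfam fl u a b) (chi Two Two n)"
        using e chi0 m2_scale_one by (cases fl; simp)+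
      show "gfam fl u a b (One, One) * gfam fl u a b (One, One) = gfam fl u a b (Two, Two) * gfam fl u a b (Two, Two)"
        "gfam fl u a b (One, Two) * gfam fl u a b (One, Two) = gfam fl u a b (Two, One) * gfam fl u a b (Two, One)"
        using sq by (cases fl; simp)+
      show "gfam fl u a b (One, One) ^ (2 * N) + m2_scale \<mu> (gfam fl u a b (One, Two) ^ (2 * N)) = 1"
        using n2 u by blast
    qed
  qed
qed

section \<open>The Suzuki algebra: basis and dual basis\<close>


abbreviation I :: "'k sfree set" where "I \<equiv> suzuki_ideal N n \<mu> lam"
abbreviation SA where "SA \<equiv> suzuki_alg N n \<mu> lam"
abbreviation cls :: "'k sfree \<Rightarrow> 'k sfree set" where "cls \<equiv> suzuki_class N n \<mu> lam"

lemma ideal_I: "ideal I free_alg"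
proof -
  interpret kalg "free_alg :: ('k, (idx \<times> idx) word \<Rightarrow>\<^sub>0 'k) module" by (rule kalg_free_alg)
  show ?thesis unfolding suzuki_ideal_def by (rule genideal_ideal) simp
qed

lemma rels_I: "r \<in> suzuki_rels N n \<mu> lam \<Longrightarrow> r \<in> I"
proof -
  interpret kalg "free_alg :: ('k, (idx \<times> idx) word \<Rightarrow>\<^sub>0 'k) module" by (rule kalg_free_alg)
  show "r \<in> suzuki_rels N n \<mu> lam \<Longrightarrow> r \<in> I"
    unfolding suzuki_ideal_def using genideal_self by auto
qed

lemma I_minimal: "ideal J free_alg \<Longrightarrow> suzuki_rels N n \<mu> lam \<subseteq> J \<Longrightarrow> I \<subseteq> J"
proof -
  interpret kalg "free_alg :: ('k, (idx \<times> idx) word \<Rightarrow>\<^sub>0 'k) module" by (rule kalg_free_alg)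
  show "ideal J free_alg \<Longrightarrow> suzuki_rels N n \<mu> lam \<subseteq> J \<Longrightarrow> I \<subseteq> J"
    unfolding suzuki_ideal_def by (rule genideal_minimal)
qed

lemma hom_vanishes_I:
  assumes "h \<in> alg_hom free_alg B" "kalg B" "\<And>r. r \<in> suzuki_rels N n \<mu> lam \<Longrightarrow> h r = \<zero>\<^bsub>B\<^esub>" "p \<in> I"
  shows "h p = \<zero>\<^bsub>B\<^esub>"
proof -
  have "I \<subseteq> {x \<in> carrier free_alg. h x = \<zero>\<^bsub>B\<^esub>}"
    by (rule I_minimal[OF ideal_kernel[OF assms(1) kalg_free_alg assms(2)]]) (use assms(3) in auto)
  then show ?thesis using assms(4) by auto
qed

lemma ev_I: "sat g \<Longrightarrow> p \<in> I \<Longrightarrow> ev g p = 0"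
  using hom_vanishes_I[OF ev_hom kalg_m2] by (simp add: sat_def)

sublocale A: kalg_ideal I free_alg
  rewrites "quot_alg free_alg I \<equiv> SA"
    by (simp add: kalg_ideal_def kalg_free_alg ideal_I) (simp add: suzuki_alg_def)

lemma kalg_SA: "kalg SA" by (rule A.kalg_quot)

lemma cls_def: "cls p = I +>\<^bsub>free_alg\<^esub> p" by (simp add: suzuki_class_def)

definition eqv :: "'k sfree \<Rightarrow> 'k sfree \<Rightarrow> bool" (infix \<open>\<sim>\<^sub>I\<close> 50) where "p \<sim>\<^sub>I q \<longleftrightarrow> p - q \<in> I"

lemma cls_eq_iff: "cls p = cls q \<longleftrightarrow> p \<sim>\<^sub>I q"
  unfolding cls_def eqv_def using A.coset_eq_iff[of p q] by simp

lemma cls_simps: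
  "cls p \<otimes>\<^bsub>SA\<^esub> cls q = cls (p * q)" "cls p \<oplus>\<^bsub>SA\<^esub> cls q = cls (p + q)" "c \<odot>\<^bsub>SA\<^esub> cls p = cls (c \<cdot> p)"
  "\<one>\<^bsub>SA\<^esub> = cls 1" "\<zero>\<^bsub>SA\<^esub> = cls 0"
  unfolding cls_def
  by (simp_all add: A.quot_mult[simplified] A.quot_add[simplified] A.quot_smult[simplified] A.quot_one A.quot_zero'
        del: A.a_coset_add_zero)

lemma carrier_SA: "carrier SA = range cls"
  unfolding A.carrier_quot_alg cls_def by simp

lemma cls_closed [simp, intro]: "cls p \<in> carrier SA"
  by (simp add: carrier_SA)

lemma I_zero: "0 \<in> I"
  using additive_subgroup.zero_closed[OF A.additive_subgroup_axioms] by simp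

lemma I_add: "p \<in> I \<Longrightarrow> q \<in> I \<Longrightarrow> p + q \<in> I"
  using additive_subgroup.a_closed[OF A.additive_subgroup_axioms, of p q] by simp

lemma I_mult: "p \<in> I \<Longrightarrow> r * p \<in> I" "p \<in> I \<Longrightarrow> p * r \<in> I"
  using A.I_l_closed[of p r] A.I_r_closed[of p r] by simp_all

lemma I_scale: "p \<in> I \<Longrightarrow> c \<cdot> p \<in> I"
  using A.smult_in_ideal[of p c] by simp

lemma I_uminus: "p \<in> I \<Longrightarrow> - p \<in> I"
  using I_scale[of p "- 1"] by simp

lemma eqv_refl [simp, intro]: "p \<sim>\<^sub>I p" by (simp add: eqv_def I_zero)

lemma eqv_sym: "p \<sim>\<^sub>I q \<Longrightarrow> q \<sim>\<^sub>I p" using I_uminus[of "p - q"] by (simp add: eqv_def)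

lemma eqv_trans [trans]: "p \<sim>\<^sub>I q \<Longrightarrow> q \<sim>\<^sub>I r \<Longrightarrow> p \<sim>\<^sub>I r"
  using I_add[of "p - q" "q - r"] by (simp add: eqv_def)

lemma eqv_mult: "p \<sim>\<^sub>I p' \<Longrightarrow> q \<sim>\<^sub>I q' \<Longrightarrow> p * q \<sim>\<^sub>I p' * q'"
  using I_add[of "(p - p') * q" "p' * (q - q')"] I_mult(2)[of "p - p'" q] I_mult(1)[of "q - q'" p'] by (simp add: eqv_def algebra_simps)

lemma eqv_mult_l: "q \<sim>\<^sub>I q' \<Longrightarrow> p * q \<sim>\<^sub>I p * q'" by (rule eqv_mult) simp_all
lemma eqv_mult_r: "p \<sim>\<^sub>I p' \<Longrightarrow> p * q \<sim>\<^sub>I p' * q" by (rule eqv_mult) simp_all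

lemma eqv_add: "p \<sim>\<^sub>I p' \<Longrightarrow> q \<sim>\<^sub>I q' \<Longrightarrow> p + q \<sim>\<^sub>I p' + q'"
  using I_add[of "p - p'" "q - q'"] by (simp add: eqv_def algebra_simps)

lemma eqv_scale: "p \<sim>\<^sub>I p' \<Longrightarrow> c \<cdot> p \<sim>\<^sub>I c \<cdot> p'"
  using I_scale[of "p - p'" c] by (simp add: eqv_def pm_scale_diff)

lemma eqv_power: "p \<sim>\<^sub>I p' \<Longrightarrow> p ^ k \<sim>\<^sub>I p' ^ k"
  by (induction k) (auto intro: eqv_mult)

lemma eqv_sum: "(\<And>b. b \<in> S \<Longrightarrow> f b \<sim>\<^sub>I g b) \<Longrightarrow> sum f S \<sim>\<^sub>I sum g S"
  by (induction S rule: infinite_finite_induct) (auto intro: eqv_add)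

lemma ev_eqv: "sat g \<Longrightarrow> p \<sim>\<^sub>I q \<Longrightarrow> ev g p = ev g q"
  using ev_I[of g "p - q"] by (simp add: eqv_def)

lemma gx_sq: "gx i j * gx i j \<sim>\<^sub>I gx (swap i) (swap j) * gx (swap i) (swap j)"
proof -
  have "x11 * x11 \<sim>\<^sub>I x22 * x22" "x12 * x12 \<sim>\<^sub>I x21 * x21"
    unfolding eqv_def by (rule rels_I, simp add: suzuki_rels_def power2_eq_square)+
  then show ?thesis using eqv_sym by (cases i; cases j) simp_all
qed

lemma gx_neq: "(i = j) \<noteq> (k = l) \<Longrightarrow> gx i j * gx k l \<sim>\<^sub>I 0"
  unfolding eqv_def idx_parity[symmetric] diff_zero by (rule rels_I) (auto simp: suzuki_rels_def)

lemma chi_n: "chi (swap i) (swap j) n \<sim>\<^sub>I lamf (i \<noteq> j) \<cdot> chi i j n"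
proof -
  have 1: "chi One One n \<sim>\<^sub>I chi Two Two n" "chi Two One n \<sim>\<^sub>I lam \<cdot> chi One Two n"
    unfolding eqv_def by (rule rels_I, simp add: suzuki_rels_def)+
  have "chi One Two n = lam \<cdot> lam \<cdot> chi One Two n" by (simp add: pm_scale_scale)
  also have "\<dots> \<sim>\<^sub>I lam \<cdot> chi Two One n" by (rule eqv_scale[OF eqv_sym[OF 1(2)]])
  finally show ?thesis using 1 1[THEN eqv_sym] by (cases i; cases j) simp_all
qed

lemma gx_pow_neq:
  assumes "(i = j) \<noteq> (k = l)" "m > 0" shows "gx i j ^ m * gx k l \<sim>\<^sub>I 0"
proof -
  obtain m' where "m = Suc m'" using assms(2) by (cases m) auto
  then have "gx i j ^ m * gx k l = gx i j ^ m' * (gx i j * gx k l)" by (simp only: power_Suc2 mult.assoc)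
  also have "\<dots> \<sim>\<^sub>I gx i j ^ m' * 0" using assms(1) by (intro eqv_mult_l gx_neq)
  finally show ?thesis by simp
qed

lemma gx_sq_pow: "gx i j ^ (2 * s) \<sim>\<^sub>I gx (swap i) (swap j) ^ (2 * s)"
  unfolding power_mult power2_eq_square by (intro eqv_power gx_sq)

lemma one_eqv: "1 \<sim>\<^sub>I x11 ^ (2 * N) + \<mu> \<cdot> x12 ^ (2 * N)"
proof -
  have "x11 ^ (2 * N) + \<mu> \<cdot> x12 ^ (2 * N) \<sim>\<^sub>I 1"
    unfolding eqv_def by (rule rels_I, simp add: suzuki_rels_def)
  then show ?thesis by (rule eqv_sym)
qed

text \<open>Multiplying the relation for the unit by \<open>gx i j\<close> kills one of its two
  summands. What remains makes powers periodic in steps of \<open>2*N\<close>, up to \<mu>.\<close>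

lemma gx_2N: "gx i j ^ (2 * N) * gx i j \<sim>\<^sub>I muf (i \<noteq> j) \<cdot> gx i j"
proof -
  have N0: "2 * N > 0" using N by simp
  have *: "gx i j \<sim>\<^sub>I x11 ^ (2 * N) * gx i j + \<mu> \<cdot> (x12 ^ (2 * N) * gx i j)"
    using eqv_mult_r[OF one_eqv, of "gx i j"] by (simp add: distrib_right pm_scale_mult_left)
  show ?thesis
  proof (cases "i = j")
    case True
    have "x11 ^ (2 * N) * gx i j + \<mu> \<cdot> (x12 ^ (2 * N) * gx i j) \<sim>\<^sub>I gx i j ^ (2 * N) * gx i j + \<mu> \<cdot> 0"
    proof (intro eqv_add eqv_scale gx_pow_neq N0 eqv_mult_r)
      show "x11 ^ (2 * N) \<sim>\<^sub>I gx i j ^ (2 * N)" using True gx_sq_pow[of One One N] by (cases i) auto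
    qed (use True in auto)
    from eqv_sym[OF eqv_trans[OF * this]] show ?thesis using True by simp
  next
    case False
    have "x11 ^ (2 * N) * gx i j + \<mu> \<cdot> (x12 ^ (2 * N) * gx i j) \<sim>\<^sub>I 0 + \<mu> \<cdot> (gx i j ^ (2 * N) * gx i j)"
    proof (intro eqv_add eqv_scale gx_pow_neq N0 eqv_mult_r)
      show "x12 ^ (2 * N) \<sim>\<^sub>I gx i j ^ (2 * N)" using False gx_sq_pow[of One Two N] by (cases i; cases j) auto
    qed (use False in auto)
    from eqv_scale[OF eqv_sym[OF eqv_trans[OF * this]], of \<mu>] show ?thesis using False by (simp add: pm_scale_scale)
  qed
qed

section \<open>Reduced words span the algebra\<close>

text \<open>Power and alternating word start with the same letter, which makes the four elements for
  fixed \<open>s\<close> and \<open>t\<close> a comultiplicative matrix. Even powers suffice, since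
  a remaining letter can be counted as the first letter of the word. For this reason
  \<open>t\<close> runs up to \<open>n\<close> inclusive, at the price of proportional elements at
  \<open>t = 0\<close> and \<open>t = n\<close>.\<close>

definition bas :: "nat \<Rightarrow> nat \<Rightarrow> idx \<Rightarrow> idx \<Rightarrow> 'k sfree" where
  "bas s t i j = gx i j ^ (2 * s) * chi i j t"

definition Bset :: "'k sfree set" where
  "Bset = {bas s t i j | s t i j. 1 \<le> s \<and> s \<le> N \<and> t \<le> n}"

definition Sp :: "'k sfree set" where "Sp = {p. \<exists>q\<in>pm.span Bset. p \<sim>\<^sub>I q}"

lemma SpI: "q \<in> pm.span Bset \<Longrightarrow> p \<sim>\<^sub>I q \<Longrightarrow> p \<in> Sp" by (auto simp: Sp_def)

lemma Sp_eqv: "q \<in> Sp \<Longrightarrow> p \<sim>\<^sub>I q \<Longrightarrow> p \<in> Sp" unfolding Sp_def using eqv_trans by blast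

lemma Sp_subspace: "pm.subspace Sp"
proof (rule pm.subspaceI)
  show "0 \<in> Sp" by (rule SpI[OF pm.span_zero]) simp
  show "x \<in> Sp \<Longrightarrow> y \<in> Sp \<Longrightarrow> x + y \<in> Sp" for x y unfolding Sp_def by (blast intro: pm.span_add eqv_add)
  show "x \<in> Sp \<Longrightarrow> c \<cdot> x \<in> Sp" for x c unfolding Sp_def by (blast intro: pm.span_scale eqv_scale)
qed

lemma Sp_scale: "p \<in> Sp \<Longrightarrow> c \<cdot> p \<in> Sp" using pm.subspace_scale[OF Sp_subspace] by blast

lemma bas_Suc_N: "bas (Suc N) t i j \<sim>\<^sub>I muf (i \<noteq> j) \<cdot> bas 1 t i j"
proof -
  have "bas (Suc N) t i j = gx i j ^ (2 * N) * gx i j * (gx i j * chi i j t)"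
    by (simp only: bas_def mult_Suc_right add_2_eq_Suc power_Suc2 mult.assoc)
  also have "\<dots> \<sim>\<^sub>I (muf (i \<noteq> j) \<cdot> gx i j) * (gx i j * chi i j t)" by (intro eqv_mult_r gx_2N)
  also have "\<dots> = muf (i \<noteq> j) \<cdot> bas 1 t i j"
    by (simp add: bas_def pm_scale_mult_left mult.assoc power2_eq_square)
  finally show ?thesis .
qed

lemma bas_Sp: "1 \<le> s \<Longrightarrow> s \<le> N \<Longrightarrow> t \<le> n \<Longrightarrow> bas s t i j \<in> Sp"
  by (rule SpI[OF pm.span_base eqv_refl]) (auto simp: Bset_def)

text \<open>Multiplication by a letter can raise \<open>s\<close> to \<open>N + 1\<close>; there
  \<open>bas_Suc_N\<close> wraps around to \<open>s = 1\<close>.\<close>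

lemma bas_Sp_Suc: "1 \<le> s \<Longrightarrow> s \<le> Suc N \<Longrightarrow> t \<le> n \<Longrightarrow> bas s t i j \<in> Sp"
  using bas_Sp[of s t i j] bas_Sp[of 1 t i j] N Sp_eqv[OF Sp_scale bas_Suc_N[of t i j]]
  by (cases "s = Suc N") auto

lemma mult_power_shift: "x * (x ^ k * y) = x ^ k * (x * y)" for x y :: "'k sfree"
  by (simp only: mult.assoc[symmetric] power_commutes)

lemma gx_bas_same_0: "gx i j * bas s 0 i j = bas s 1 i j"
  by (simp add: bas_def power_commutes)

text \<open>The new letter meets the first letter of the alternating word. Their product is a
  square, which both letters of the block share and which is absorbed into the power.\<close>

lemma gx_bas_same_Suc: "gx i j * bas s (Suc t) i j \<sim>\<^sub>I bas (Suc s) t (swap i) (swap j)"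
proof -
  let ?x = "gx i j :: 'k sfree" and ?y = "gx (swap i) (swap j) :: 'k sfree"
  have "?x * bas s (Suc t) i j = ?x ^ (2 * s) * ((?x * ?x) * chi (swap i) (swap j) t)"
    unfolding bas_def by (simp only: chi.simps mult.assoc mult_power_shift)
  also have "\<dots> \<sim>\<^sub>I ?y ^ (2 * s) * ((?y * ?y) * chi (swap i) (swap j) t)"
    by (intro eqv_mult gx_sq gx_sq_pow eqv_refl)
  also have "\<dots> = bas (Suc s) t (swap i) (swap j)"
    by (simp only: bas_def mult_Suc_right add_2_eq_Suc power_Suc2 mult.assoc)
  finally show ?thesis .
qed

lemma gx_bas_other: "gx (swap i) (swap j) * bas s t i j \<sim>\<^sub>I bas s (Suc t) (swap i) (swap j)"
proof -
  let ?y = "gx (swap i) (swap j) :: 'k sfree"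
  have "?y * bas s t i j \<sim>\<^sub>I ?y * (?y ^ (2 * s) * chi i j t)"
    unfolding bas_def by (intro eqv_mult_l eqv_mult_r gx_sq_pow)
  also have "\<dots> = bas s (Suc t) (swap i) (swap j)"
    unfolding bas_def by (simp only: chi.simps mult_power_shift swap_neq)
  finally show ?thesis .
qed

lemma bas_n: "bas s n (swap i) (swap j) \<sim>\<^sub>I lamf (i \<noteq> j) \<cdot> bas s n i j"
proof -
  have "bas s n (swap i) (swap j) \<sim>\<^sub>I gx i j ^ (2 * s) * (lamf (i \<noteq> j) \<cdot> chi i j n)"
    unfolding bas_def by (intro eqv_mult chi_n eqv_sym[OF gx_sq_pow])
  then show ?thesis by (simp add: bas_def pm_scale_mult_right)
qed

lemma bas_0: "bas s 0 (swap i) (swap j) \<sim>\<^sub>I bas s 0 i j"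
  unfolding bas_def by (simp add: eqv_sym[OF gx_sq_pow])

lemma gx_bas_neq: "(i = j) \<noteq> (k = l) \<Longrightarrow> s \<ge> 1 \<Longrightarrow> gx k l * bas s t i j \<sim>\<^sub>I 0"
proof -
  assume a: "(i = j) \<noteq> (k = l)" "s \<ge> 1"
  then obtain s' where s: "2 * s = Suc s'" by (cases s) auto
  have "gx k l * bas s t i j = gx k l * gx i j * (gx i j ^ s' * chi i j t)"
    unfolding bas_def s by (simp add: mult.assoc)
  also have "\<dots> \<sim>\<^sub>I 0 * (gx i j ^ s' * chi i j t)" using a by (intro eqv_mult_r gx_neq) auto
  finally show ?thesis by simp
qed

lemma gx_bas_Sp:
  assumes s: "1 \<le> s" "s \<le> N" and t: "t \<le> n"
  shows "gx k l * bas s t i j \<in> Sp"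
proof -
  have same: "gx i j * bas s t i j \<in> Sp" if "t \<le> n" for t i j
  proof (cases t)
    case 0
    then show ?thesis using gx_bas_same_0 bas_Sp[OF s, of 1] n by simp
  next
    case (Suc t')
    show ?thesis unfolding Suc
      by (rule Sp_eqv[OF bas_Sp_Suc gx_bas_same_Suc]) (use s that Suc in auto)
  qed
  consider "(i = j) \<noteq> (k = l)" | "k = i" "l = j" | "k = swap i" "l = swap j"
    by (cases i; cases j; cases k; cases l) auto
  then show ?thesis
  proof cases
    case 1
    show ?thesis by (rule Sp_eqv[OF _ gx_bas_neq[OF 1 s(1)]]) (rule pm.subspace_0[OF Sp_subspace])
  next
    case 2
    then show ?thesis using same t by simp
  next
    case 3
    show ?thesis
    proof (cases "t = n")
      \<comment> \<open>A word of length \<open>n\<close> cannot grow. The relation for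
        \<open>chi\<close> first rewrites it as a multiple of the word starting with the other
        letter, where the new letter is absorbed.\<close>
      case True
      have "gx k l * bas s t i j \<sim>\<^sub>I gx k l * (lamf (k \<noteq> l) \<cdot> bas s n k l)"
        using bas_n[of s k l] True 3 by (intro eqv_mult_l) simp
      then have "gx k l * bas s t i j \<sim>\<^sub>I lamf (k \<noteq> l) \<cdot> (gx k l * bas s n k l)"
        by (simp add: pm_scale_mult_right)
      from Sp_eqv[OF Sp_scale[OF same[OF order_refl]] this] show ?thesis .
    next
      case False
      show ?thesis unfolding 3
        by (rule Sp_eqv[OF bas_Sp gx_bas_other]) (use s t False in auto)
    qed
  qed
qed

lemma all_Sp: "p \<in> Sp"
proof (induction p rule: word_induct)
  case 1
  \<comment> \<open>The unit enters the span through the relation that expresses it with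
    \<open>s = N\<close> and \<open>t = 0\<close>.\<close>
  have "bas N 0 One One + \<mu> \<cdot> bas N 0 One Two \<in> Sp"
    using bas_Sp N Sp_scale by (intro pm.subspace_add[OF Sp_subspace]) auto
  then show ?case by (rule Sp_eqv) (use one_eqv in \<open>simp add: bas_def\<close>)
next
  case (2 l p)
  then obtain q where q: "q \<in> pm.span Bset" "p \<sim>\<^sub>I q" by (auto simp: Sp_def)
  obtain i j where l: "l = (i, j)" by (cases l)
  have "pm.span Bset \<subseteq> {q. gx i j * q \<in> Sp}"
  proof (rule pm.span_minimal)
    show "Bset \<subseteq> {q. gx i j * q \<in> Sp}" by (auto simp: Bset_def intro: gx_bas_Sp)
    show "pm.subspace {q. gx i j * q \<in> Sp}"
      by (rule pm.subspaceI) (auto simp: distrib_left pm_scale_mult_right intro: pm.subspace_add[OF Sp_subspace] pm.subspace_0[OF Sp_subspace] Sp_scale)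
  qed
  then have "gx i j * q \<in> Sp" using q by auto
  then have "gx i j * p \<in> Sp" by (rule Sp_eqv[OF _ eqv_mult_l[OF q(2)]])
  then show ?case by (simp add: l gx_def)
next
  case (3 p q)
  then show ?case by (rule pm.subspace_add[OF Sp_subspace])
next
  case (4 c p)
  then show ?case by (rule Sp_scale)
qed

text \<open>
  The values of the form \<open>Lf fl w r\<close> on the spanning set are monomials \<open>w\<^sup>2\<^sup>s\<^sup>+\<^sup>t r\<^sup>e\<close> with exponent
  \<open>e = bexp t i\<close>; the dual functionals \<open>Ef\<close> are the corresponding Fourier coefficients.
\<close>

definition bexp :: "nat \<Rightarrow> idx \<Rightarrow> int" where
  "bexp t i = (if i = One then int (t div 2) else - int ((t + 1) div 2))"

text \<open>The first row is concentrated in its first entry for even words and in its second entry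
  for odd ones, so the row sum captures both parities.\<close>

definition Lf :: "bool \<Rightarrow> 'k \<Rightarrow> 'k \<Rightarrow> 'k sfree \<Rightarrow> 'k" where
  "Lf fl w r p = m11 (ev (gfam fl w 1 r) p) + m12 (ev (gfam fl w 1 r) p)"

lemma Lf_linear: "Lf fl w r (p + q) = Lf fl w r p + Lf fl w r q" "Lf fl w r (c \<cdot> p) = c * Lf fl w r p"
  by (simp_all add: Lf_def plus_m2_def m2_scale_def algebra_simps)

lemma powi_bexp:
  fixes r :: 'k
  shows
  "r powi bexp (2 * k) i = (if i = One then r ^ k else inverse (r ^ k))"
  "r powi bexp (Suc (2 * k)) i = (if i = One then r ^ k else inverse (r ^ Suc k))"
  by (simp_all add: bexp_def power_int_minus del: of_nat_Suc power_Suc)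

lemma Lf_bas:
  assumes r: "r \<noteq> 0" and s: "s \<ge> 1"
  shows "Lf fl w r (bas s t i j) = (if (i \<noteq> j) = fl then w powi int (2 * s + t) * r powi bexp t i else 0)"
proof (cases "(i \<noteq> j) = fl")
  case True
  have sq: "ev (gfam fl w 1 r) (gx i j ^ (2 * s)) = MD (w ^ (2 * s)) 1" using True r by (intro ev_gfam_sq) auto
  show ?thesis
  proof (cases "even t")
    case ev: True
    then obtain k where k: "t = 2 * k" by blast
    have "ev (gfam fl w 1 r) (bas s t i j) = MD (w ^ (2 * s + t)) (((if i = One then r else 1) / (if i = One then 1 else r)) ^ k)"
      using True r unfolding bas_def k ev_simps(2) sq by (subst ev_gfam_chi(1)) (auto simp: MDJ_mult power_add)
    then show ?thesis
      using True r unfolding k Lf_def power_int_of_nat powi_bexp by (simp add: MD_def field_simps)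
  next
    case False
    then obtain k where k: "t = Suc (2 * k)" by (auto elim: oddE)
    have "ev (gfam fl w 1 r) (bas s t i j) = MJ (w ^ (2 * s + t))
        ((if i = One then 1 else r) * ((if i = One then 1 else r) / (if i = One then r else 1)) ^ k)"
      using True r unfolding bas_def k ev_simps(2) sq by (subst ev_gfam_chi(2)) (auto simp: MDJ_mult power_add mult_ac)
    then show ?thesis
      using True r unfolding k Lf_def power_int_of_nat powi_bexp by (simp add: MJ_def field_simps)
  qed
next
  case False
  then have "ev (gfam fl w 1 r) (gx i j ^ (2 * s)) = 0" using s by (intro ev_gfam_neq) auto
  then have "ev (gfam fl w 1 r) (bas s t i j) = 0" by (simp only: bas_def ev_simps(2) mult_zero_left)
  then show ?thesis using False by (simp add: Lf_def zero_m2_def)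
qed

definition Ef :: "nat \<times> nat \<times> idx \<times> idx \<Rightarrow> 'k sfree \<Rightarrow> 'k" where
  "Ef = (\<lambda>(s, t, i, j) p. (\<Sum>w | w ^ (2 * N) = muf (i \<noteq> j). \<Sum>r | r ^ n = lamf (i \<noteq> j).
     w powi (- int (2 * s + t)) * r powi (- bexp t i) * Lf (i \<noteq> j) w r p) / of_nat (2 * N * n))"

lemma Ef_linear: "Ef b (p + q) = Ef b p + Ef b q" "Ef b (c \<cdot> p) = c * Ef b p"
  by (cases b; simp add: Ef_def Lf_linear algebra_simps sum.distrib sum_distrib_left add_divide_distrib)+

lemma root_nz: "w ^ (2 * N) = muf fl \<Longrightarrow> w \<noteq> 0" "r ^ n = lamf fl \<Longrightarrow> r \<noteq> 0"
  using N n by (auto simp: zero_power)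

lemma sat_point: "w ^ (2 * N) = muf fl \<Longrightarrow> r ^ n = lamf fl \<Longrightarrow> sat (gfam fl w 1 r)"
  using root_nz(2) by (subst sat_gfam_iff) auto

lemma Ef_I: "p \<in> I \<Longrightarrow> Ef b p = 0"
  using ev_I[OF sat_point] by (cases b) (auto simp: Ef_def Lf_def zero_m2_def intro!: sum.neutral)

lemma Ef_diff: "Ef b (p - q) = Ef b p - Ef b q"
  using Ef_linear(1)[of b "p - q" q] by simp

lemma Ef_eqv: "p \<sim>\<^sub>I q \<Longrightarrow> Ef b p = Ef b q"
  using Ef_I[of "p - q" b] by (simp add: eqv_def Ef_diff)

lemma powi_shift:
  fixes w r :: 'k
  assumes "w \<noteq> 0" "r \<noteq> 0"
  shows "w powi (- a) * r powi (- b) * (w powi a' * r powi b') = w powi (a' - a) * r powi (b' - b)"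
  using assms by (simp add: power_int_diff power_int_minus field_simps)

text \<open>The sums over \<open>w\<close> and \<open>r\<close> separate into orthogonality sums, so
  a nonzero value requires \<open>2*N\<close> to divide the difference of the
  \<open>w\<close>-exponents and \<open>n\<close> that of the \<open>r\<close>-exponents. The
  assumption on \<open>i\<close> excludes the ends \<open>t = t' = 0\<close> and
  \<open>t = t' = n\<close> with different rows, where the two elements are proportional.\<close>

lemma Ef_bas:
  assumes s: "s \<in> {1..N}" "s' \<in> {1..N}" and t: "t \<le> n" "t' \<le> n"
    and i: "i = i' \<or> (0 < t + t' \<and> t + t' < 2 * n)"
  shows "Ef (s, t, i, j) (bas s' t' i' j') = (if s = s' \<and> t = t' \<and> i = i' \<and> j = j' then 1 else 0)"
proof (cases "(i \<noteq> j) = (i' \<noteq> j')")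
  case False
  then have "Lf (i \<noteq> j) w r (bas s' t' i' j') = 0" if "r ^ n = lamf (i \<noteq> j)" for w r
    using s root_nz(2)[OF that] by (subst Lf_bas) auto
  then have "Ef (s, t, i, j) (bas s' t' i' j') = 0" by (auto simp: Ef_def intro!: sum.neutral)
  then show ?thesis using False by auto
next
  case fl: True
  define e where "e = int (2 * s' + t') - int (2 * s + t)"
  define m where "m = bexp t' i' - bexp t i"
  have *: "w powi (- int (2 * s + t)) * r powi (- bexp t i) * Lf (i \<noteq> j) w r (bas s' t' i' j') = w powi e * r powi m"
    if "w ^ (2 * N) = muf (i \<noteq> j)" "r ^ n = lamf (i \<noteq> j)" for w r
  proof -
    have "Lf (i \<noteq> j) w r (bas s' t' i' j') = w powi int (2 * s' + t') * r powi bexp t' i'"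
      using s root_nz(2)[OF that(2)] fl by (subst Lf_bas) auto
    then show ?thesis
      unfolding e_def m_def by (simp only: powi_shift[OF root_nz(1)[OF that(1)] root_nz(2)[OF that(2)]])
  qed
  have "Ef (s, t, i, j) (bas s' t' i' j') = (\<Sum>w | w ^ (2 * N) = muf (i \<noteq> j). \<Sum>r | r ^ n = lamf (i \<noteq> j). w powi e * r powi m) / of_nat (2 * N * n)"
    unfolding Ef_def prod.case by (intro arg_cong2[where f = "(/)"] sum.cong refl *) auto
  also have "\<dots> = (\<Sum>w | w ^ (2 * N) = muf (i \<noteq> j). w powi e) * (\<Sum>r | r ^ n = lamf (i \<noteq> j). r powi m) / of_nat (2 * N * n)"
    by (simp add: sum_product)
  finally have E: "Ef (s, t, i, j) (bas s' t' i' j') = \<dots>" .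
  show ?thesis
  proof (cases "s = s' \<and> t = t' \<and> i = i' \<and> j = j'")
    case True
    then have "e = 0" "m = 0" by (auto simp: e_def m_def)
    then show ?thesis using True E N n by (simp add: card_nth_roots_field)
  next
    case False
    have "\<not> (int (2 * N) dvd e \<and> int n dvd m)"
    proof
      assume d: "int (2 * N) dvd e \<and> int n dvd m"
      then obtain q where "e = int (2 * N) * q" by blast
      then have "even e" by simp
      then have par: "even t \<longleftrightarrow> even t'" by (simp add: e_def)
      \<comment> \<open>For lengths of equal parity the \<open>r\<close>-exponents differ by less
        than \<open>n\<close>, so divisibility by \<open>n\<close> becomes equality.\<close>
      have m: "m = 0"
      proof -
        have "\<bar>m\<bar> < int n"
          using t n i par unfolding m_def bexp_def
          by (cases "even t") (auto elim!: evenE oddE split: if_splits)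
        then show ?thesis using d dvd_imp_le_int[of m "int n"] by auto
      qed
      have ii: "i = i'" "t = t'"
      proof -
        have "i = i' \<and> t = t'"
          using m i par unfolding m_def bexp_def
          by (cases i; cases i'; cases "even t") (auto elim!: evenE oddE)
        then show "i = i'" "t = t'" by auto
      qed
      then have "e = 2 * (int s' - int s)" by (simp add: e_def)
      then have "int N dvd int s' - int s" using d
        by (metis dvd_times_left_cancel_iff of_nat_mult of_nat_numeral zero_neq_numeral)
      moreover have "\<bar>int s' - int s\<bar> < int N" using s by auto
      ultimately have "s = s'" using dvd_imp_le_int[of "int s' - int s" "int N"] by auto
      moreover have "j = j'" using fl ii by (cases i; cases j; cases j') auto
      ultimately show False using False ii by simp
    qed
    then show ?thesis using E False N n
      by (auto simp: sum_roots_power_int simp del: of_nat_mult)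
  qed
qed

text \<open>At \<open>t = 0\<close> and \<open>t = n\<close> the rows \<open>One\<close> and
  \<open>Two\<close> are proportional and only the first is kept. This leaves \<open>4*N*n\<close>
  indices, the dimension of the algebra.\<close>

definition Idx :: "(nat \<times> nat \<times> idx \<times> idx) set" where
  "Idx = {(s, t, i, j). s \<in> {1..N} \<and> t \<le> n \<and> (0 < t \<and> t < n \<or> i = One)}"

abbreviation basp :: "nat \<times> nat \<times> idx \<times> idx \<Rightarrow> 'k sfree" where
  "basp \<equiv> \<lambda>(s, t, i, j). bas s t i j"

lemma UNIV_idx: "(UNIV :: idx set) = {One, Two}"
  by (auto intro: idx.exhaust)

lemma finite_Idx [simp]: "finite Idx"
proof (rule finite_subset)
  show "Idx \<subseteq> {1..N} \<times> {..n} \<times> UNIV \<times> UNIV" by (auto simp: Idx_def)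
qed (simp add: UNIV_idx)

lemma Ef_basp:
  assumes "b \<in> Idx" "b' \<in> Idx"
  shows "Ef b (basp b') = (if b = b' then 1 else 0)"
proof -
  obtain s t i j s' t' i' j' where b: "b = (s, t, i, j)" "b' = (s', t', i', j')" by (cases b; cases b')
  have "i = i' \<or> (0 < t + t' \<and> t + t' < 2 * n)"
    using assms by (cases i; cases i') (auto simp: Idx_def b)
  then show ?thesis using assms by (auto simp: b Idx_def Ef_bas)
qed

text \<open>The elements satisfying the formula form a subspace closed under congruence. It contains
  the indexed elements by duality, hence the dropped boundary rows, hence everything.\<close>

lemma basis_expansion: "p \<sim>\<^sub>I (\<Sum>b\<in>Idx. Ef b p \<cdot> basp b)"
proof -
  define Q where "Q p \<longleftrightarrow> p \<sim>\<^sub>I (\<Sum>b\<in>Idx. Ef b p \<cdot> basp b)" for p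
  have Q_eqv: "Q q" if "Q p" "q \<sim>\<^sub>I p" for p q
    using that eqv_trans[OF that(2)] unfolding Q_def by (simp add: Ef_eqv[OF that(2)])
  have Q_add: "Q (p + q)" if "Q p" "Q q" for p q
    using eqv_add[OF that[unfolded Q_def]] by (simp add: Q_def Ef_linear pm_scale_add_left sum.distrib)
  have Q_scale: "Q (c \<cdot> p)" if "Q p" for p c
    using eqv_scale[OF that[unfolded Q_def], of c] by (simp add: Q_def Ef_linear pm.scale_sum_right pm_scale_scale)
  have Q_Idx: "Q (basp b)" if b: "b \<in> Idx" for b
  proof -
    have "(\<Sum>b'\<in>Idx. Ef b' (basp b) \<cdot> basp b') = (\<Sum>b'\<in>Idx. if b' = b then basp b else 0)"
      using b by (intro sum.cong) (auto simp: Ef_basp)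
    also have "\<dots> = basp b" using b by simp
    finally show ?thesis by (simp add: Q_def)
  qed
  have Q_One: "Q (bas s t i j)" if "1 \<le> s" "s \<le> N" "t \<le> n" "0 < t \<and> t < n \<or> i = One" for s t i j
    using Q_Idx[of "(s, t, i, j)"] that by (auto simp: Idx_def)
  have Q_B: "Q (bas s t i j)" if "1 \<le> s" "s \<le> N" "t \<le> n" for s t i j
  proof (cases "0 < t \<and> t < n \<or> i = One")
    case False
    then have i: "swap One = i" by (cases i) auto
    show ?thesis
    proof (cases "t = 0")
      case True
      show ?thesis
        using Q_eqv[OF Q_One bas_0[of s One "swap j"]] that i True by simp
    next
      case False
      then have "t = n" using \<open>\<not> (0 < t \<and> t < n \<or> i = One)\<close> that by auto
      then show ?thesis
        using Q_eqv[OF Q_scale[OF Q_One] bas_n[of s One "swap j"]] that i by simp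
    qed
  qed (use Q_One that in blast)
  obtain q where q: "q \<in> pm.span Bset" "p \<sim>\<^sub>I q" using all_Sp[of p] by (auto simp: Sp_def)
  have "pm.span Bset \<subseteq> {q. Q q}"
  proof (rule pm.span_minimal)
    show "pm.subspace {q. Q q}"
      using Q_scale[OF Q_B[of 1 0 One One], of 0] N by (intro pm.subspaceI) (auto intro: Q_add Q_scale)
  qed (auto simp: Bset_def intro: Q_B)
  then have "Q p" using Q_eqv q by blast
  then show ?thesis by (simp add: Q_def)
qed

text \<open>Every coordinate functional is assembled from values at points, so agreement at all
  points gives equal coordinates.\<close>

lemma faithful:
  assumes "\<And>fl w r. w ^ (2 * N) = muf fl \<Longrightarrow> r ^ n = lamf fl \<Longrightarrow> ev (gfam fl w 1 r) p = ev (gfam fl w 1 r) q"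
  shows "p \<sim>\<^sub>I q"
proof -
  have "Ef b (p - q) = 0" for b
    by (cases b) (auto simp: Ef_def Lf_def assms zero_m2_def intro!: sum.neutral)
  then have "p - q \<sim>\<^sub>I 0" using basis_expansion[of "p - q"] by simp
  then show ?thesis by (simp add: eqv_def)
qed

end

section \<open>The Hopf algebra structure\<close>

instance idx :: finite
  by standard (metis UNIV_I finite.emptyI finite.insertI finite_subset idx.exhaust insertCI subsetI)

context suzuki_params
begin

abbreviation H where "H \<equiv> suzuki N n \<mu> lam"

lemma H_simps [simp]:
  "carrier H = carrier SA" "mult H = mult SA" "one H = one SA" "zero H = zero SA" "add H = add SA" "smult H = smult SA"
  "comult H = suzuki_comult N n \<mu> lam" "counit H = suzuki_counit N n \<mu> lam" "antipode H = suzuki_antipode N n \<mu> lam"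
  by (simp_all add: suzuki_def Let_def)

lemma alg_hom_H [simp]: "alg_hom H H = alg_hom SA SA"
  by (simp add: alg_hom_def ring_hom_def)

lemma tensor_map_H [simp]: "tensor_map H H H H = tensor_map SA SA SA SA"
proof -
  have 1: "pre_tensor H H = pre_tensor SA SA" by (simp add: pre_tensor_def)
  have "bilinearity_rels H H = bilinearity_rels SA SA" by (simp add: bilinearity_rels_def)
  then have 2: "tensor_null H H = tensor_null SA SA" by (simp add: tensor_null_def)
  show ?thesis by (intro ext) (simp add: tensor_map_def tensor_alg_def 1 2)
qed

sublocale T2: tensor2 SA SA
  using kalg_SA by (simp add: tensor2_def)

abbreviation TA where "TA \<equiv> tensor_alg SA SA"

interpretation TAk: kalg TA by (rule T2.kalg_TA)

definition pt :: "'k sfree \<Rightarrow> 'k sfree \<Rightarrow> ('k sfree set \<times> 'k sfree set \<Rightarrow>\<^sub>0 'k) set" where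
  "pt p q = pure_tensor SA SA (cls p) (cls q)"

lemma pt_closed [simp, intro]: "pt p q \<in> carrier TA"
  by (simp add: pt_def)

lemma pt_simps:
  "pt (p + p') q = pt p q \<oplus>\<^bsub>TA\<^esub> pt p' q" "pt p (q + q') = pt p q \<oplus>\<^bsub>TA\<^esub> pt p q'"
  "pt (c \<cdot> p) q = c \<odot>\<^bsub>TA\<^esub> pt p q" "pt p (c \<cdot> q) = c \<odot>\<^bsub>TA\<^esub> pt p q"
  "pt p q \<otimes>\<^bsub>TA\<^esub> pt p' q' = pt (p * p') (q * q')" "\<one>\<^bsub>TA\<^esub> = pt 1 1" "pt 0 q = \<zero>\<^bsub>TA\<^esub>" "pt p 0 = \<zero>\<^bsub>TA\<^esub>"
  by (simp_all add: pt_def T2.pure_mult T2.pure_one T2.pure_add_l T2.pure_add_r T2.pure_smult_l T2.pure_smult_r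
      cls_simps(4) flip: cls_simps(1-3,5))

lemma pt_cong: "p \<sim>\<^sub>I p' \<Longrightarrow> q \<sim>\<^sub>I q' \<Longrightarrow> pt p q = pt p' q'"
  by (simp add: pt_def flip: cls_eq_iff)

lemma pt_zero: "p \<sim>\<^sub>I 0 \<Longrightarrow> pt p q = \<zero>\<^bsub>TA\<^esub>" "q \<sim>\<^sub>I 0 \<Longrightarrow> pt p q = \<zero>\<^bsub>TA\<^esub>"
  using pt_cong[of p 0 q q] pt_cong[of p p q 0] by (simp_all add: pt_simps)

lemma alg_hom_SA_eqI:
  assumes "h \<in> alg_hom SA B" "h' \<in> alg_hom SA B" "\<And>i j. h (cls (gx i j)) = h' (cls (gx i j))" "X \<in> carrier SA"
  shows "h X = h' X"
proof -
  have c: "cls \<in> alg_hom free_alg SA" by (rule alg_homI) (simp_all add: cls_simps)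
  obtain p where p: "X = cls p" using assms(4) by (auto simp: carrier_SA)
  have "(h \<circ> cls) p = (h' \<circ> cls) p"
    by (rule alg_hom_free_eqI[OF alg_hom_compose[OF c assms(1)] alg_hom_compose[OF c assms(2)]])
      (use assms(3) in \<open>auto simp: gx_def\<close>)
  then show ?thesis by (simp add: p)
qed

section \<open>Comultiplication of words\<close>

definition sh :: "bool \<Rightarrow> idx \<Rightarrow> idx" where "sh \<kappa> i = (if \<kappa> then swap i else i)"

text \<open>A word survives modulo the relations only if its letters lie in one block; it is then
  determined by the block \<kappa> and the sequence of first indices.\<close>

fun mon :: "bool \<Rightarrow> idx list \<Rightarrow> 'k sfree" where
  "mon \<kappa> [] = 1"
| "mon \<kappa> (a # u) = gx a (sh \<kappa> a) * mon \<kappa> u"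

definition Dgen :: "idx \<times> idx \<Rightarrow> ('k sfree set \<times> 'k sfree set \<Rightarrow>\<^sub>0 'k) set" where
  "Dgen = (\<lambda>(i, j). pt (gx i One) (gx One j) \<oplus>\<^bsub>TA\<^esub> pt (gx i Two) (gx Two j))"

lemma Dgen_closed [simp, intro]: "Dgen l \<in> carrier TA"
  by (cases l) (simp add: Dgen_def)

definition \<Delta>0 where "\<Delta>0 = free_lift TA Dgen"

lemma \<Delta>0_hom: "\<Delta>0 \<in> alg_hom free_alg TA"
  unfolding \<Delta>0_def by (rule TAk.free_lift_hom) simp

lemma \<Delta>0_simps:
  "\<Delta>0 (p + q) = \<Delta>0 p \<oplus>\<^bsub>TA\<^esub> \<Delta>0 q" "\<Delta>0 (p * q) = \<Delta>0 p \<otimes>\<^bsub>TA\<^esub> \<Delta>0 q" "\<Delta>0 (c \<cdot> p) = c \<odot>\<^bsub>TA\<^esub> \<Delta>0 p"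
  "\<Delta>0 1 = pt 1 1" "\<Delta>0 (gx i j) = Dgen (i, j)" "\<Delta>0 p \<in> carrier TA"
  using alg_homD[OF \<Delta>0_hom] by (simp_all add: pt_simps(6)) (simp add: \<Delta>0_def gx_def TAk.free_lift_gen)

lemma mon_zero: "\<kappa> \<noteq> \<kappa>' \<Longrightarrow> u \<noteq> [] \<Longrightarrow> gx a (sh \<kappa> a) * mon \<kappa>' u \<sim>\<^sub>I 0"
proof -
  assume a: "\<kappa> \<noteq> \<kappa>'" "u \<noteq> []"
  then obtain b v where u: "u = b # v" by (cases u) auto
  have "gx a (sh \<kappa> a) * gx b (sh \<kappa>' b) * mon \<kappa>' v \<sim>\<^sub>I 0 * mon \<kappa>' v"
    using a by (intro eqv_mult_r gx_neq) (cases \<kappa>; auto simp: sh_def)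
  then show ?thesis by (simp add: u mult.assoc)
qed

text \<open>Of the many products of tensor terms only two survive, because in the first tensor
  factor all letters must lie in one block. The empty word is different: its comultiplication has
  the single term \<open>pt 1 1\<close>.\<close>

lemma \<Delta>0_mon:
  assumes "u \<noteq> []"
  shows "\<Delta>0 (mon \<kappa> u) = pt (mon False u) (mon \<kappa> u) \<oplus>\<^bsub>TA\<^esub> pt (mon True u) (mon (\<not> \<kappa>) (map swap u))"
  using assms
proof (induction u)
  case (Cons a u)
  let ?x = "pt (gx a a) (gx a (sh \<kappa> a))" and ?y = "pt (gx a (swap a)) (gx (swap a) (sh \<kappa> a))"
  have D: "\<Delta>0 (gx a (sh \<kappa> a)) = ?x \<oplus>\<^bsub>TA\<^esub> ?y"
    by (cases a) (simp_all add: \<Delta>0_simps Dgen_def TAk.a_comm)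
  show ?case
  proof (cases "u = []")
    case True
    then show ?thesis using D by (cases \<kappa>; cases a) (auto simp: sh_def)
  next
    case False
    let ?v = "pt (mon False u) (mon \<kappa> u)" and ?w = "pt (mon True u) (mon (\<not> \<kappa>) (map swap u))"
    have "?x \<otimes>\<^bsub>TA\<^esub> ?w = \<zero>\<^bsub>TA\<^esub>" "?y \<otimes>\<^bsub>TA\<^esub> ?v = \<zero>\<^bsub>TA\<^esub>"
      unfolding pt_simps using mon_zero[OF _ False, of False True a] mon_zero[OF _ False, of True False a]
      by (auto intro!: pt_zero(1) simp: sh_def)
    then have "\<Delta>0 (mon \<kappa> (a # u)) = ?x \<otimes>\<^bsub>TA\<^esub> ?v \<oplus>\<^bsub>TA\<^esub> ?y \<otimes>\<^bsub>TA\<^esub> ?w"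
      using Cons.IH[OF False] by (simp add: \<Delta>0_simps(2) D TAk.l_distr TAk.r_distr)
    moreover have "gx (swap a) (sh \<kappa> a) = gx (swap a) (sh (\<not> \<kappa>) (swap a))" by (simp add: sh_def)
    ultimately show ?thesis by (simp add: pt_simps sh_def)
  qed
qed simp

text \<open>When \<open>swap\<close> exchanges the index sequences of the two rows, the two terms
  surviving in \<open>\<Delta>0_mon\<close> are the summands of a matrix comultiplication. Powers,
  alternating words and \<open>bas\<close> are instances.\<close>

lemma \<Delta>0_fam:
  assumes F: "\<And>i j. F i j = mon (i \<noteq> j) (l i)" and l: "l Two = map swap (l One)" "l One \<noteq> []"
  shows "\<Delta>0 (F i j) = pt (F i One) (F One j) \<oplus>\<^bsub>TA\<^esub> pt (F i Two) (F Two j)"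
proof -
  have l': "l One = map swap (l Two)" using l by (simp add: comp_def)
  have ne: "l i \<noteq> []" for i using l by (cases i) auto
  show ?thesis
    unfolding F using ne \<Delta>0_mon[OF ne, of "i \<noteq> j"]
    by (cases i; cases j) (simp_all add: TAk.a_comm flip: l(1) l')
qed

fun alt :: "idx \<Rightarrow> nat \<Rightarrow> idx list" where
  "alt i 0 = []"
| "alt i (Suc m) = i # alt (swap i) m"

lemma map_swap_alt: "map swap (alt i m) = alt (swap i) m"
  by (induction m arbitrary: i) auto

lemma chi_mon: "chi i j m = mon (i \<noteq> j) (alt i m)"
  by (induction m arbitrary: i j) (auto simp: sh_def, (case_tac i; case_tac j; simp)+)

lemma gx_pow_mon: "gx i j ^ m = mon (i \<noteq> j) (replicate m i)"
  by (induction m) (cases i; cases j; simp add: sh_def)+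

lemma mon_append: "mon \<kappa> (u @ v) = mon \<kappa> u * mon \<kappa> v"
  by (induction u) (auto simp: mult.assoc)

lemma bas_mon: "bas s t i j = mon (i \<noteq> j) (replicate (2 * s) i @ alt i t)"
  by (simp add: bas_def mon_append chi_mon gx_pow_mon)

lemma \<Delta>0_chi: "m \<ge> 1 \<Longrightarrow> \<Delta>0 (chi i j m) = pt (chi i One m) (chi One j m) \<oplus>\<^bsub>TA\<^esub> pt (chi i Two m) (chi Two j m)"
  by (rule \<Delta>0_fam[OF chi_mon]) (cases m; simp add: map_swap_alt)+

lemma \<Delta>0_gx_pow: "m \<ge> 1 \<Longrightarrow> \<Delta>0 (gx i j ^ m) = pt (gx i One ^ m) (gx One j ^ m) \<oplus>\<^bsub>TA\<^esub> pt (gx i Two ^ m) (gx Two j ^ m)"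
  by (rule \<Delta>0_fam[OF gx_pow_mon]) auto

lemma \<Delta>0_bas: "s \<ge> 1 \<Longrightarrow> \<Delta>0 (bas s t i j) = pt (bas s t i One) (bas s t One j) \<oplus>\<^bsub>TA\<^esub> pt (bas s t i Two) (bas s t Two j)"
  by (rule \<Delta>0_fam[OF bas_mon]) (auto simp: map_swap_alt)

lemma \<Delta>0_diff: "\<Delta>0 p = \<Delta>0 q \<Longrightarrow> \<Delta>0 (p - q) = \<zero>\<^bsub>TA\<^esub>"
  using alg_hom_minus[OF \<Delta>0_hom kalg_free_alg T2.kalg_TA, of p q] \<Delta>0_simps(6)[of q]
  by (simp add: TAk.minus_eq TAk.r_neg)

lemma suzuki_rels_cases:
  assumes "r \<in> suzuki_rels N n \<mu> lam"
  obtains "r = x11^2 - x22^2" | "r = x12^2 - x21^2" | "r = chi Two One n - lam \<cdot> chi One Two n"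
    | "r = chi One One n - chi Two Two n" | "r = x11^(2*N) + \<mu> \<cdot> x12^(2*N) - 1"
    | i j k l where "r = gx i j * gx k l" "(i = j) \<noteq> (k = l)"
  using assms unfolding suzuki_rels_def idx_parity by blast

lemma \<Delta>0_rels:
  assumes "r \<in> suzuki_rels N n \<mu> lam" shows "\<Delta>0 r = \<zero>\<^bsub>TA\<^esub>"
proof -
  have n1: "n \<ge> 1" and N1: "2 * N \<ge> 1" using n N by auto
  note sq = gx_sq_pow[of _ _ 1, simplified]
  from assms show ?thesis
  proof (cases rule: suzuki_rels_cases)
    case 1
    show ?thesis unfolding 1
      using pt_cong[OF sq[of One One] sq[of One One]] pt_cong[OF sq[of One Two] sq[of Two One]]
      by (intro \<Delta>0_diff) (simp add: \<Delta>0_gx_pow TAk.a_comm)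
  next
    case 2
    show ?thesis unfolding 2
      using pt_cong[OF sq[of One One] sq[of One Two]] pt_cong[OF sq[of One Two] sq[of Two Two]]
      by (intro \<Delta>0_diff) (simp add: \<Delta>0_gx_pow TAk.a_comm)
  next
    case 3
    have c: "chi Two One n \<sim>\<^sub>I lam \<cdot> chi One Two n" "chi Two Two n \<sim>\<^sub>I chi One One n"
      using chi_n[of One Two] chi_n[of One One] by simp_all
    have "pt (chi Two One n) (chi One One n) = lam \<odot>\<^bsub>TA\<^esub> pt (chi One Two n) (chi Two Two n)"
      "pt (chi Two Two n) (chi Two One n) = lam \<odot>\<^bsub>TA\<^esub> pt (chi One One n) (chi One Two n)"
      using pt_cong[OF c(1) eqv_sym[OF c(2)]] pt_cong[OF c(2) c(1)] by (simp_all add: pt_simps)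
    then show ?thesis unfolding 3
      by (intro \<Delta>0_diff) (simp add: \<Delta>0_simps \<Delta>0_chi[OF n1] TAk.smult_r_distr TAk.a_comm)
  next
    case 4
    have c: "chi Two One n \<sim>\<^sub>I lam \<cdot> chi One Two n" "chi Two Two n \<sim>\<^sub>I chi One One n" "chi One Two n \<sim>\<^sub>I lam \<cdot> chi Two One n"
      using chi_n[of One Two] chi_n[of One One] chi_n[of Two One] by simp_all
    have "pt (chi One Two n) (chi Two One n) = pt (chi Two One n) (chi One Two n)"
      using pt_cong[OF c(3) c(1)] by (simp add: pt_simps TAk.smult_smult)
    moreover have "pt (chi One One n) (chi One One n) = pt (chi Two Two n) (chi Two Two n)"
      using pt_cong[OF c(2) c(2)] by simp
    ultimately show ?thesis unfolding 4
      by (intro \<Delta>0_diff) (simp add: \<Delta>0_chi[OF n1] TAk.a_comm)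
  next
    case 5
    let ?a = "x11 ^ (2 * N) :: 'k sfree" and ?b = "x12 ^ (2 * N) :: 'k sfree"
    have b: "gx Two One ^ (2 * N) \<sim>\<^sub>I ?b" "gx Two Two ^ (2 * N) \<sim>\<^sub>I ?a"
      using gx_sq_pow[of Two One N] gx_sq_pow[of Two Two N] by simp_all
    \<comment> \<open>The relation is inserted for the unit in both tensor factors; because \<mu>
      squares to 1, the terms regroup into the comultiplication of the left-hand side.\<close>
    have "pt 1 1 = pt (?a + \<mu> \<cdot> ?b) (?a + \<mu> \<cdot> ?b)" by (rule pt_cong[OF one_eqv one_eqv])
    also have "\<dots> = (pt ?a ?a \<oplus>\<^bsub>TA\<^esub> pt ?b ?b) \<oplus>\<^bsub>TA\<^esub> \<mu> \<odot>\<^bsub>TA\<^esub> (pt ?a ?b \<oplus>\<^bsub>TA\<^esub> pt ?b ?a)"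
      by (simp add: pt_simps TAk.smult_smult TAk.smult_r_distr TAk.a_ac)
    also have "\<dots> = \<Delta>0 (?a + \<mu> \<cdot> ?b)"
      using pt_cong[OF eqv_refl b(1), of ?b] pt_cong[OF eqv_refl b(2), of ?b]
      by (simp add: \<Delta>0_simps \<Delta>0_gx_pow[OF N1])
    finally show ?thesis unfolding 5 by (intro \<Delta>0_diff) (simp add: \<Delta>0_simps)
  next
    case (6 i j k l)
    \<comment> \<open>If the letters in the left tensor factor have equal parity, those in the right
      one have not, so every term has a vanishing factor.\<close>
    have "pt (gx i a * gx k b) (gx a j * gx b l) = \<zero>\<^bsub>TA\<^esub>" for a b
    proof (cases "(i = a) = (k = b)")
      case False
      then show ?thesis by (intro pt_zero(1) gx_neq)
    next
      case True
      then have "(a = j) \<noteq> (b = l)" using 6(2) by (cases i; cases j; cases k; cases l; cases a; cases b) auto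
      then show ?thesis by (intro pt_zero(2) gx_neq)
    qed
    then show ?thesis
      by (simp add: 6(1) \<Delta>0_simps Dgen_def TAk.l_distr TAk.r_distr pt_simps(5))
  qed
qed

lemma \<Delta>0_I: "p \<in> I \<Longrightarrow> \<Delta>0 p = \<zero>\<^bsub>TA\<^esub>"
  by (rule hom_vanishes_I[OF \<Delta>0_hom T2.kalg_TA \<Delta>0_rels])

lemma suzuki_comult_eq: "suzuki_comult N n \<mu> lam = quot_lift I TA Dgen"
  by (simp add: suzuki_comult_def Let_def Dgen_def pt_def)

lemma comult_cls: "suzuki_comult N n \<mu> lam (cls p) = \<Delta>0 p"
  unfolding suzuki_comult_eq cls_def \<Delta>0_def
  by (rule quot_lift_coset[OF ideal_I T2.kalg_TA]) (use \<Delta>0_I in \<open>auto simp: \<Delta>0_def\<close>)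

lemma quot_SA: "quot_alg free_alg I = SA" by (simp add: suzuki_alg_def)

lemma comult_hom: "suzuki_comult N n \<mu> lam \<in> alg_hom SA TA"
proof -
  have "quot_lift I TA Dgen \<in> alg_hom (quot_alg free_alg I) TA"
    by (rule quot_lift_hom[OF ideal_I T2.kalg_TA]) (use \<Delta>0_I in \<open>auto simp: \<Delta>0_def\<close>)
  then show ?thesis by (simp only: suzuki_comult_eq quot_SA)
qed

subsection \<open>The counit\<close>

definition \<epsilon>0 :: "'k sfree \<Rightarrow> 'k" where
  "\<epsilon>0 = free_lift field_alg (\<lambda>(i, j). if i = j then 1 else 0)"

lemma \<epsilon>0_hom: "\<epsilon>0 \<in> alg_hom free_alg field_alg"
  unfolding \<epsilon>0_def by (rule kalg.free_lift_hom[OF kalg_field_alg]) (simp add: field_alg_def)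

lemma \<epsilon>0_simps [simp]:
  "\<epsilon>0 (p + q) = \<epsilon>0 p + \<epsilon>0 q" "\<epsilon>0 (p * q) = \<epsilon>0 p * \<epsilon>0 q" "\<epsilon>0 (c \<cdot> p) = c * \<epsilon>0 p" "\<epsilon>0 1 = 1"
  "\<epsilon>0 (gx i j) = (if i = j then 1 else 0)"
proof -
  show "\<epsilon>0 (gx i j) = (if i = j then 1 else 0)"
    using kalg.free_lift_gen[OF kalg_field_alg, of "\<lambda>(i, j). if i = j then 1 else 0" "(i, j)"]
    by (simp add: \<epsilon>0_def gx_def field_alg_def)
qed (use alg_homD[OF \<epsilon>0_hom] in \<open>simp_all add: field_alg_def\<close>)

lemma \<epsilon>0_more [simp]: "\<epsilon>0 (p - q) = \<epsilon>0 p - \<epsilon>0 q" "\<epsilon>0 (p ^ k) = \<epsilon>0 p ^ k"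
  using \<epsilon>0_simps(1)[of "p - q" q] by (simp, induction k) simp_all

lemma \<epsilon>0_chi_Suc: "\<epsilon>0 (chi i j (Suc m)) = (if i = j then 1 else 0)"
proof (induction m arbitrary: i j)
  case (Suc m)
  show ?case using Suc.IH[of "swap i" "swap j"] by (simp del: chi.simps add: chi.simps(2)[of i j "Suc m"])
qed simp

lemma \<epsilon>0_chi: "m \<ge> 1 \<Longrightarrow> \<epsilon>0 (chi i j m) = (if i = j then 1 else 0)"
  using \<epsilon>0_chi_Suc[of i j "m - 1"] by (cases m) (simp_all del: chi.simps)

lemma \<epsilon>0_bas: "s \<ge> 1 \<Longrightarrow> \<epsilon>0 (bas s t i j) = (if i = j then 1 else 0)"
  by (cases "t = 0") (auto simp: bas_def \<epsilon>0_chi power_0_left)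

lemma \<epsilon>0_I: "p \<in> I \<Longrightarrow> \<epsilon>0 p = 0"
proof -
  have "\<epsilon>0 r = 0" if "r \<in> suzuki_rels N n \<mu> lam" for r
    using that n N by (cases rule: suzuki_rels_cases) (auto simp: \<epsilon>0_chi power_0_left)
  then show "p \<in> I \<Longrightarrow> \<epsilon>0 p = 0"
    using hom_vanishes_I[OF \<epsilon>0_hom kalg_field_alg, of p] by (simp add: field_alg_def)
qed

lemma counit_cls: "suzuki_counit N n \<mu> lam (cls p) = \<epsilon>0 p"
  unfolding suzuki_counit_def cls_def \<epsilon>0_def
  by (rule quot_lift_coset[OF ideal_I kalg_field_alg]) (use \<epsilon>0_I in \<open>auto simp: \<epsilon>0_def field_alg_def\<close>)

lemma counit_hom: "suzuki_counit N n \<mu> lam \<in> alg_hom SA field_alg"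
  unfolding suzuki_counit_def quot_SA[symmetric]
  by (rule quot_lift_hom[OF ideal_I kalg_field_alg]) (use \<epsilon>0_I in \<open>auto simp: \<epsilon>0_def field_alg_def\<close>)

subsection \<open>The antipode\<close>

definition \<sigma>0 :: "'k sfree \<Rightarrow> 'k sfree" where
  "\<sigma>0 = free_lift (op_alg free_alg) (\<lambda>(i, j). gx j i ^ (4 * N - 1))"

lemma \<sigma>0_hom: "\<sigma>0 \<in> alg_hom free_alg (op_alg free_alg)"
  unfolding \<sigma>0_def by (rule kalg.free_lift_hom[OF kalg_op_alg[OF kalg_free_alg]]) (simp add: op_alg_def)

lemma \<sigma>0_simps [simp]:
  "\<sigma>0 (p + q) = \<sigma>0 p + \<sigma>0 q" "\<sigma>0 (p * q) = \<sigma>0 q * \<sigma>0 p" "\<sigma>0 (c \<cdot> p) = c \<cdot> \<sigma>0 p" "\<sigma>0 1 = 1"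
  "\<sigma>0 (gx i j) = gx j i ^ (4 * N - 1)"
proof -
  have "free_lift (op_alg free_alg) (\<lambda>(i, j). gx j i ^ (4 * N - 1)) (gx i j) = (\<lambda>(i, j). gx j i ^ (4 * N - 1)) (i, j)"
    unfolding gx_def[of i j] by (rule kalg.free_lift_gen[OF kalg_op_alg[OF kalg_free_alg]]) (simp add: op_alg_def)
  then show "\<sigma>0 (gx i j) = gx j i ^ (4 * N - 1)"
    by (simp add: \<sigma>0_def)
qed (use alg_homD[OF \<sigma>0_hom] in \<open>simp_all add: op_alg_def\<close>)

text \<open>Transposition is antimultiplicative; applied after the antipode it gives an algebra map,
  which is determined on generators.\<close>

definition tr2 :: "'k m2 \<Rightarrow> 'k m2" where "tr2 a = M2 (m11 a) (m21 a) (m12 a) (m22 a)"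

lemma tr2_simps [simp]:
  "tr2 (a + b) = tr2 a + tr2 b" "tr2 (a * b) = tr2 b * tr2 a" "tr2 (m2_scale c a) = m2_scale c (tr2 a)"
  "tr2 1 = 1" "tr2 0 = 0" "tr2 (tr2 a) = a" "tr2 (MD u d) = MD u d"
  by (simp_all add: tr2_def m2_defs m2_scale_def MD_def mult.commute)

lemma tr2_MJ [simp]: "tr2 (MJ u d) = MJ u (1 / d)"
  by (simp add: tr2_def MJ_def)

text \<open>Since \<open>u^(4*N)\<close> is the square of a sign, the exponent
  \<open>4*N - 1\<close> in the antipode inverts the scale.\<close>

lemma MJ_pow_inverse:
  assumes "u ^ (2 * N) = muf fl" "a \<noteq> 0"
  shows "MJ u a ^ (4 * N - 1) = MJ (1 / u) a"
proof -
  have u: "u \<noteq> 0" using root_nz(1)[OF assms(1)] .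
  have "4 * N - 1 = 2 * (2 * N - 1) + 1" using N by simp
  then have "MJ u a ^ (4 * N - 1) = (MJ u a * MJ u a) ^ (2 * N - 1) * MJ u a"
    by (simp only: power_add power_mult power2_eq_square power_one_right)
  also have "\<dots> = MJ (u ^ (2 * (2 * N - 1) + 1)) a"
    using assms(2) by (simp add: MDJ_mult MD_power power_mult power2_eq_square mult.commute)
  also have "u ^ (2 * (2 * N - 1) + 1) = 1 / u"
  proof -
    have "Suc (2 * (2 * N - 1) + 1) = 2 * N + 2 * N" using N by simp
    then have "u ^ (2 * (2 * N - 1) + 1) * u = u ^ (2 * N + 2 * N)"
      by (metis power_Suc2)
    also have "\<dots> = 1" by (simp only: power_add assms(1) muf_simps)
    finally show ?thesis using u by (simp add: field_simps)
  qed
  finally show ?thesis .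
qed

text \<open>
  The antipode is anti-multiplicative, so it is evaluated at a point by transposing its values at
  another point.
\<close>

definition dualpt :: "bool \<Rightarrow> 'k \<Rightarrow> 'k \<Rightarrow> 'k \<Rightarrow> idx \<times> idx \<Rightarrow> 'k m2" where
  "dualpt fl u a b = gfam fl (1 / u) (if fl then 1 / b else 1 / a) (if fl then 1 / a else 1 / b)"

lemma ev_\<sigma>0:
  assumes "u ^ (2 * N) = muf fl" "a \<noteq> 0" "b \<noteq> 0"
  shows "ev (gfam fl u a b) (\<sigma>0 p) = tr2 (ev (dualpt fl u a b) p)"
proof -
  have "tr2 (ev (gfam fl u a b) (\<sigma>0 p)) = ev (dualpt fl u a b) p"
  proof (rule alg_hom_free_eqI[OF _ ev_hom])
    show "(\<lambda>p. tr2 (ev (gfam fl u a b) (\<sigma>0 p))) \<in> alg_hom free_alg m2_alg"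
      by (rule alg_homI) simp_all
    fix l :: "idx \<times> idx"
    obtain i j where l: "l = (i, j)" by (cases l)
    have "tr2 (gfam fl u a b (j, i) ^ (4 * N - 1)) = dualpt fl u a b (i, j)"
      using assms N MJ_pow_inverse[OF assms(1)]
      by (cases fl; cases i; cases j) (auto simp: dualpt_def power_0_left)
    then have "tr2 (ev (gfam fl u a b) (\<sigma>0 (gx i j))) = ev (dualpt fl u a b) (gx i j)" by simp
    then show "tr2 (ev (gfam fl u a b) (\<sigma>0 (Poly_Mapping.single (Word [l]) 1))) = ev (dualpt fl u a b) (Poly_Mapping.single (Word [l]) 1)"
      by (simp only: l gx_def)
  qed
  then show ?thesis by (metis tr2_simps(6))
qed

lemma sat_dualpt:
  assumes "u ^ (2 * N) = muf fl" "r ^ n = lamf fl"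
  shows "sat (dualpt fl u 1 r)"
proof -
  have r: "r \<noteq> 0" using root_nz(2)[OF assms(2)] .
  have i: "1 / muf fl = muf fl" "1 / lamf fl = lamf fl" by (simp_all add: divide_eq_eq)
  have "(1 / u) ^ (2 * N) = muf fl" using assms(1) i by (simp add: power_divide)
  moreover have "(1 / r) ^ n = lamf fl" using assms(2) i by (simp add: power_divide)
  ultimately show ?thesis
    unfolding dualpt_def using r assms by (subst sat_gfam_iff) auto
qed

lemma \<sigma>0_I: "p \<in> I \<Longrightarrow> \<sigma>0 p \<in> I"
proof -
  assume p: "p \<in> I"
  have "\<sigma>0 p \<sim>\<^sub>I 0"
  proof (rule faithful)
    fix fl w r assume wr: "w ^ (2 * N) = muf fl" "r ^ n = lamf fl"
    show "ev (gfam fl w 1 r) (\<sigma>0 p) = ev (gfam fl w 1 r) 0"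
      using ev_\<sigma>0[OF wr(1) one_neq_zero root_nz(2)[OF wr(2)]] ev_I[OF sat_dualpt[OF wr] p] by simp
  qed
  then show ?thesis by (simp add: eqv_def)
qed

lemma free_lift_op_cls: "free_lift (op_alg SA) (\<lambda>(i, j). cls (gx j i ^ (4 * N - 1))) p = cls (\<sigma>0 p)"
proof -
  interpret O: kalg "op_alg SA" by (rule kalg_op_alg[OF kalg_SA])
  let ?g = "\<lambda>(i, j). cls (gx j i ^ (4 * N - 1))"
  have g: "?g l \<in> carrier (op_alg SA)" for l by (cases l) (simp add: op_alg_def)
  have "free_lift (op_alg SA) ?g p = (\<lambda>p. cls (\<sigma>0 p)) p"
  proof (rule alg_hom_free_eqI[OF O.free_lift_hom])
    show "?g l \<in> carrier (op_alg SA)" for l by (rule g)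
    show "(\<lambda>p. cls (\<sigma>0 p)) \<in> alg_hom free_alg (op_alg SA)"
      by (rule alg_homI) (simp_all add: op_alg_def cls_simps)
    show "free_lift (op_alg SA) ?g (Poly_Mapping.single (Word [l]) 1) = cls (\<sigma>0 (Poly_Mapping.single (Word [l]) 1))" for l
      using \<sigma>0_simps(5)[of "fst l" "snd l"] by (subst O.free_lift_gen[OF g]) (simp add: gx_def case_prod_beta)
  qed
  then show ?thesis .
qed

lemma antipode_cls: "suzuki_antipode N n \<mu> lam (cls p) = cls (\<sigma>0 p)"
proof -
  have "suzuki_antipode N n \<mu> lam (cls p) = free_lift (op_alg SA) (\<lambda>(i, j). cls (gx j i ^ (4 * N - 1))) p"
    unfolding suzuki_antipode_def cls_def[of p]
  proof (rule quot_lift_coset[OF ideal_I kalg_op_alg[OF kalg_SA]])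
    show "(\<lambda>(i, j). cls (gx j i ^ (4 * N - 1))) l \<in> carrier (op_alg SA)" for l by (cases l) (simp add: op_alg_def)
    show "q \<in> I \<Longrightarrow> free_lift (op_alg SA) (\<lambda>(i, j). cls (gx j i ^ (4 * N - 1))) q = \<zero>\<^bsub>op_alg SA\<^esub>" for q
      unfolding free_lift_op_cls using \<sigma>0_I[of q] by (simp add: op_alg_def cls_simps cls_eq_iff eqv_def)
  qed
  then show ?thesis by (simp only: free_lift_op_cls)
qed

section \<open>The antipode on comultiplicative matrices\<close>

text \<open>The value of a \<open>bas\<close> element at a point: \<open>u\<close> is the total
  scale, \<open>c\<close> the parameter of the first letter of the word, \<open>d\<close> that of
  the other letter.\<close>

definition Mx :: "nat \<Rightarrow> 'k \<Rightarrow> 'k \<Rightarrow> 'k \<Rightarrow> 'k m2" where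
  "Mx t u c d = (if even t then MD u ((d / c) ^ (t div 2)) else MJ u (c * (c / d) ^ (t div 2)))"

lemma ev_bas:
  assumes "a \<noteq> 0" "b \<noteq> 0" "(i \<noteq> j) = fl"
  shows "ev (gfam fl u a b) (bas s t i j) = Mx t (u ^ (2 * s + t)) (if i = One then a else b) (if i = One then b else a)"
proof (cases "even t")
  case True
  then obtain k where k: "t = 2 * k" by blast
  show ?thesis
    unfolding bas_def ev_simps(2) ev_gfam_sq[OF assms] using assms unfolding k
    by (subst ev_gfam_chi(1)) (auto simp: MDJ_mult power_add Mx_def)
next
  case False
  then obtain k where k: "t = Suc (2 * k)" by (auto elim: oddE)
  show ?thesis
    unfolding bas_def ev_simps(2) ev_gfam_sq[OF assms] using assms unfolding k
    by (subst ev_gfam_chi(2)) (auto simp: MDJ_mult power_add mult_ac Mx_def)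
qed

lemma ev_bas_neq:
  assumes "s \<ge> 1" "(i \<noteq> j) \<noteq> fl"
  shows "ev (gfam fl u a b) (bas s t i j) = 0"
  unfolding bas_def ev_simps(2) using assms by (subst ev_gfam_neq) auto

lemma Mx_inverse:
  assumes "u \<noteq> 0" "c \<noteq> 0" "d \<noteq> 0"
  shows "tr2 (Mx t (1 / u) (1 / c) (1 / d)) * Mx t u c d = 1"
  using assms by (auto simp: Mx_def MD_def MJ_def tr2_def times_m2_def one_m2_def power_divide)

text \<open>The two complementary idempotents that cut the algebra into its blocks.\<close>

definition ide :: "bool \<Rightarrow> 'k sfree" where "ide fl = (if fl then \<mu> \<cdot> x12 ^ (2 * N) else x11 ^ (2 * N))"

lemma ide_sum: "ide (i \<noteq> One) + ide (i \<noteq> Two) \<sim>\<^sub>I 1"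
  using eqv_sym[OF one_eqv] by (cases i) (simp_all add: ide_def add.commute)

lemma ev_ide:
  assumes "w ^ (2 * N) = muf fl" "r \<noteq> 0"
  shows "ev (gfam fl w 1 r) (ide fl') = (if fl = fl' then 1 else 0)"
proof -
  have *: "ev (gfam fl w 1 r) (gx One (if fl then Two else One) ^ (2 * N)) = MD (muf fl) 1"
    using assms by (subst ev_gfam_sq) auto
  show ?thesis
  proof (cases "fl = fl'")
    case True
    then show ?thesis using * by (cases fl) (simp_all add: ide_def sq_sq_eq del: ev_power)
  next
    case False
    then show ?thesis using N by (cases fl) (auto simp: ide_def power_0_left)
  qed
qed

text \<open>For a fixed middle index \<open>b\<close> only one block contributes, so an idempotent
  appears; the unit arises after summation over \<open>b\<close>.\<close>

lemma antipode_bas: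
  assumes s: "s \<ge> 1"
  shows "\<sigma>0 (bas s t a b) * bas s t b d \<sim>\<^sub>I (if a = d then ide (a \<noteq> b) else 0)"
proof (rule faithful)
  fix fl w r assume wr: "w ^ (2 * N) = muf fl" "r ^ n = lamf fl"
  have r: "r \<noteq> 0" using root_nz(2)[OF wr(2)] .
  have w: "w \<noteq> 0" using root_nz(1)[OF wr(1)] .
  note S = ev_\<sigma>0[OF wr(1) one_neq_zero r]
  show "ev (gfam fl w 1 r) (\<sigma>0 (bas s t a b) * bas s t b d) = ev (gfam fl w 1 r) (if a = d then ide (a \<noteq> b) else 0)"
  proof (cases "(a \<noteq> b) = fl")
    case False
    then show ?thesis using ev_ide[OF wr(1) r] s
      by (auto simp: S dualpt_def ev_bas_neq)
  next
    case fl: True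
    show ?thesis
    proof (cases "a = d")
      case False
      then have "(b \<noteq> d) \<noteq> fl" using fl by (cases a; cases b; cases d) auto
      then show ?thesis using False s by (auto simp: ev_bas_neq)
    next
      case True
      have "ev (dualpt fl w 1 r) (bas s t a b) = Mx t (1 / w ^ (2 * s + t)) (1 / (if b = One then 1 else r)) (1 / (if b = One then r else 1))"
        unfolding dualpt_def using fl r by (subst ev_bas) (cases a; cases b; auto simp: power_divide)+
      moreover have "ev (gfam fl w 1 r) (bas s t b a) = Mx t (w ^ (2 * s + t)) (if b = One then 1 else r) (if b = One then r else 1)"
        using fl r by (subst ev_bas) auto
      ultimately show ?thesis
        using True Mx_inverse[of "w ^ (2 * s + t)" "if b = One then 1 else r" "if b = One then r else 1" t] r w fl ev_ide[OF wr(1) r, of fl]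
        by (simp add: S)
    qed
  qed
qed

lemma antipode_gen:
  "gx i k * \<sigma>0 (gx k j) \<sim>\<^sub>I (if i = j then ide (i \<noteq> k) else 0)"
proof (rule faithful)
  fix fl w r assume wr: "w ^ (2 * N) = muf fl" "r ^ n = lamf fl"
  have r: "r \<noteq> 0" using root_nz(2)[OF wr(2)] .
  have w: "w \<noteq> 0" using root_nz(1)[OF wr(1)] .
  have p: "0 ^ (4 * N - 1) = (0 :: 'k m2)" using N by (simp add: power_0_left)
  show "ev (gfam fl w 1 r) (gx i k * \<sigma>0 (gx k j)) = ev (gfam fl w 1 r) (if i = j then ide (i \<noteq> k) else 0)"
    using r w MJ_pow_inverse[OF wr(1)] p ev_ide[OF wr(1) r]
    by (cases fl; cases i; cases j; cases k) (simp_all add: MDJ_mult MD_one)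
qed

section \<open>Coalgebra maps between matrix coalgebras\<close>

lemma sum_idx: "(\<Sum>k\<in>UNIV. f k) = f One + (f Two :: 'a::comm_monoid_add)"
  by (simp add: UNIV_idx)

definition conj_gen :: "nat \<Rightarrow> nat \<Rightarrow> (idx \<Rightarrow> idx \<Rightarrow> 'k) \<Rightarrow> (idx \<Rightarrow> idx \<Rightarrow> 'k) \<Rightarrow> idx \<Rightarrow> idx \<Rightarrow> 'k sfree" where
  "conj_gen s t P Q i j = (\<Sum>k\<in>UNIV. \<Sum>l\<in>UNIV. (P i k * Q l j) \<cdot> bas s t k l)"

text \<open>In a product of two conjugated matrices the inner factor \<open>Q P\<close> collapses to
  the identity; \<open>m\<close> is the inner summation index.\<close>

lemma sandwich:
  assumes "kalg K" "\<And>l k. X l k \<in> carrier K"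
    and "\<And>l k. q l One * p One k + q l Two * p Two k = (if l = k then 1 else (0::'k))"
  shows "(\<Oplus>\<^bsub>K\<^esub>m\<in>(UNIV :: idx set). \<Oplus>\<^bsub>K\<^esub>l\<in>(UNIV :: idx set). \<Oplus>\<^bsub>K\<^esub>k\<in>(UNIV :: idx set). (q l m * p m k) \<odot>\<^bsub>K\<^esub> X l k)
     = X One One \<oplus>\<^bsub>K\<^esub> X Two Two"
proof -
  interpret K: kalg K by fact
  have s: "(\<Oplus>\<^bsub>K\<^esub>m\<in>(UNIV :: idx set). f m) = f One \<oplus>\<^bsub>K\<^esub> f Two" if "\<And>i. f i \<in> carrier K" for f
    using that by (simp add: UNIV_idx)
  have "(\<Oplus>\<^bsub>K\<^esub>m\<in>(UNIV :: idx set). \<Oplus>\<^bsub>K\<^esub>l\<in>(UNIV :: idx set). \<Oplus>\<^bsub>K\<^esub>k\<in>(UNIV :: idx set). (q l m * p m k) \<odot>\<^bsub>K\<^esub> X l k)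
     = (q One One * p One One + q One Two * p Two One) \<odot>\<^bsub>K\<^esub> X One One \<oplus>\<^bsub>K\<^esub>
       (q One One * p One Two + q One Two * p Two Two) \<odot>\<^bsub>K\<^esub> X One Two \<oplus>\<^bsub>K\<^esub>
       ((q Two One * p One One + q Two Two * p Two One) \<odot>\<^bsub>K\<^esub> X Two One \<oplus>\<^bsub>K\<^esub>
       (q Two One * p One Two + q Two Two * p Two Two) \<odot>\<^bsub>K\<^esub> X Two Two)"
    using assms(2) by (simp add: s K.smult_l_distr K.a_ac)
  then show ?thesis using assms(2) by (simp add: assms(3))
qed

lemma pt_sandwich:
  assumes QP: "\<And>l k. Q l One * P One k + Q l Two * P Two k = (if l = k then 1 else (0::'k))"
  shows "pt (Q One One \<cdot> b One + Q Two One \<cdot> b Two) (P One One \<cdot> c One + P One Two \<cdot> c Two) \<oplus>\<^bsub>TA\<^esub>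
         pt (Q One Two \<cdot> b One + Q Two Two \<cdot> b Two) (P Two One \<cdot> c One + P Two Two \<cdot> c Two)
       = pt (b One) (c One) \<oplus>\<^bsub>TA\<^esub> pt (b Two) (c Two)"
proof -
  have s: "(\<Oplus>\<^bsub>TA\<^esub>m\<in>(UNIV :: idx set). f m) = f One \<oplus>\<^bsub>TA\<^esub> f Two" if "\<And>i. f i \<in> carrier TA" for f
    using that by (simp add: UNIV_idx)
  show ?thesis
    using sandwich[OF T2.kalg_TA, of "\<lambda>l k. pt (b l) (c k)" Q P] QP
    by (simp add: s pt_simps TAk.smult_r_distr TAk.smult_smult TAk.a_ac mult.commute)
qed

lemma conj_gen_left: "conj_gen s t P Q i j =
   Q One j \<cdot> (\<Sum>k\<in>UNIV. P i k \<cdot> bas s t k One) + Q Two j \<cdot> (\<Sum>k\<in>UNIV. P i k \<cdot> bas s t k Two)"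
  by (simp add: conj_gen_def sum_idx pm_scale_add_right pm_scale_scale mult.commute add_ac)

lemma conj_gen_right: "conj_gen s t P Q i j =
   P i One \<cdot> (\<Sum>l\<in>UNIV. Q l j \<cdot> bas s t One l) + P i Two \<cdot> (\<Sum>l\<in>UNIV. Q l j \<cdot> bas s t Two l)"
  by (simp add: conj_gen_def sum_idx pm_scale_add_right pm_scale_scale add_ac)

lemma \<Delta>0_conj_gen:
  assumes s: "s \<ge> 1" and QP: "\<And>l k. Q l One * P One k + Q l Two * P Two k = (if l = k then 1 else (0::'k))"
  shows "\<Delta>0 (conj_gen s t P Q i j) =
    pt (conj_gen s t P Q i One) (conj_gen s t P Q One j) \<oplus>\<^bsub>TA\<^esub> pt (conj_gen s t P Q i Two) (conj_gen s t P Q Two j)"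
proof -
  define b where "b l = (\<Sum>k\<in>UNIV. P i k \<cdot> bas s t k l)" for l
  define c where "c k = (\<Sum>l\<in>UNIV. Q l j \<cdot> bas s t k l)" for k
  have "pt (conj_gen s t P Q i One) (conj_gen s t P Q One j) \<oplus>\<^bsub>TA\<^esub> pt (conj_gen s t P Q i Two) (conj_gen s t P Q Two j)
     = pt (b One) (c One) \<oplus>\<^bsub>TA\<^esub> pt (b Two) (c Two)"
    using pt_sandwich[OF QP, of b c] unfolding b_def c_def conj_gen_left[of s t P Q i] conj_gen_right[of s t P Q _ j] .
  also have "\<dots> = \<Delta>0 (conj_gen s t P Q i j)"
    unfolding b_def c_def conj_gen_def sum_idx
    by (simp add: \<Delta>0_simps \<Delta>0_bas[OF s] pt_simps TAk.smult_r_distr TAk.smult_smult TAk.a_ac mult.commute)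
  finally show ?thesis ..
qed

lemma \<epsilon>0_conj_gen:
  assumes s: "s \<ge> 1" and PQ: "\<And>i j. P i One * Q One j + P i Two * Q Two j = (if i = j then 1 else (0::'k))"
  shows "\<epsilon>0 (conj_gen s t P Q i j) = (if i = j then 1 else 0)"
  using PQ[of i j] by (simp add: conj_gen_def sum_idx \<epsilon>0_bas[OF s])

text \<open>\<open>Q P = 1\<close> removes the inner matrices, \<open>antipode_bas\<close> evaluates
  the core, and \<open>P Q = 1\<close> removes the outer matrices.\<close>

lemma \<sigma>0_conj_gen:
  assumes s: "s \<ge> 1" and QP: "\<And>l k. Q l One * P One k + Q l Two * P Two k = (if l = k then 1 else (0::'k))"
    and PQ: "\<And>i j. P i One * Q One j + P i Two * Q Two j = (if i = j then 1 else (0::'k))"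
  shows "\<sigma>0 (conj_gen s t P Q i One) * conj_gen s t P Q One j + \<sigma>0 (conj_gen s t P Q i Two) * conj_gen s t P Q Two j
     \<sim>\<^sub>I (if i = j then 1 else 0)"
proof -
  define b where "b l = \<sigma>0 (\<Sum>k\<in>UNIV. P i k \<cdot> bas s t k l)" for l
  define c where "c k = (\<Sum>l\<in>UNIV. Q l j \<cdot> bas s t k l)" for k
  have "\<sigma>0 (conj_gen s t P Q i One) * conj_gen s t P Q One j + \<sigma>0 (conj_gen s t P Q i Two) * conj_gen s t P Q Two j
    = (Q One One * P One One + Q One Two * P Two One) \<cdot> (b One * c One) + (Q One One * P One Two + Q One Two * P Two Two) \<cdot> (b One * c Two)
    + (Q Two One * P One One + Q Two Two * P Two One) \<cdot> (b Two * c One) + (Q Two One * P One Two + Q Two Two * P Two Two) \<cdot> (b Two * c Two)"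
    unfolding conj_gen_left[of s t P Q i] conj_gen_right[of s t P Q _ j] \<sigma>0_simps b_def[symmetric] c_def[symmetric]
    by (simp add: algebra_simps pm_scale_mult_left pm_scale_mult_right pm_scale_scale pm_scale_add_left)
  also have "\<dots> = b One * c One + b Two * c Two" by (simp add: QP)
  also have "\<dots> = (\<Sum>k\<in>UNIV. \<Sum>l\<in>UNIV. (P i k * Q l j) \<cdot> (\<Sum>m\<in>UNIV. \<sigma>0 (bas s t k m) * bas s t m l))"
    by (simp add: b_def c_def sum_idx distrib_left distrib_right pm_scale_mult_left pm_scale_mult_right pm_scale_scale
        pm_scale_add_right add_ac mult.commute[of "Q _ _"])
  also have "\<dots> \<sim>\<^sub>I (\<Sum>k\<in>UNIV. \<Sum>l\<in>UNIV. (P i k * Q l j) \<cdot> (if k = l then 1 else 0))"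
  proof (intro eqv_sum eqv_scale)
    fix k l :: idx
    have "(\<Sum>m\<in>UNIV. \<sigma>0 (bas s t k m) * bas s t m l) \<sim>\<^sub>I (\<Sum>m\<in>UNIV. if k = l then ide (k \<noteq> m) else 0)"
      by (intro eqv_sum antipode_bas s)
    also have "\<dots> \<sim>\<^sub>I (if k = l then 1 else 0)"
      using ide_sum by (simp add: sum_idx)
    finally show "(\<Sum>m\<in>UNIV. \<sigma>0 (bas s t k m) * bas s t m l) \<sim>\<^sub>I (if k = l then 1 else 0)" .
  qed
  also have "\<dots> = (P i One * Q One j + P i Two * Q Two j) \<cdot> 1" by (simp add: sum_idx pm_scale_add_left)
  also have "\<dots> = (if i = j then 1 else 0)" by (simp add: PQ)
  finally show ?thesis .
qed

lemma conj_gen_hopf: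
  assumes s: "s \<ge> 1" and QP: "\<And>l k. Q l One * P One k + Q l Two * P Two k = (if l = k then 1 else (0::'k))"
    and PQ: "\<And>i j. P i One * Q One j + P i Two * Q Two j = (if i = j then 1 else (0::'k))"
    and f: "f \<in> alg_hom SA SA" "\<And>i j. f (cls (gx i j)) = cls (conj_gen s t P Q i j)"
    and X: "X \<in> carrier SA"
  shows "suzuki_comult N n \<mu> lam (f X) = tensor_map SA SA SA SA f f (suzuki_comult N n \<mu> lam X)"
    and "suzuki_counit N n \<mu> lam (f X) = suzuki_counit N n \<mu> lam X"
    and "suzuki_antipode N n \<mu> lam (f X) = f (suzuki_antipode N n \<mu> lam X)"
proof -
  let ?y = "conj_gen s t P Q"
  interpret th: tensor_hom SA SA SA SA f f
    using f(1) T2.tensor2_axioms by (simp add: tensor_hom_def tensor_hom_axioms_def)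
  have tm: "tensor_map SA SA SA SA f f (pt (gx i k) (gx k j)) = pt (?y i k) (?y k j)" for i j k
    unfolding pt_def by (subst th.tensor_map_pure) (simp_all add: f(2))
  have "(suzuki_comult N n \<mu> lam \<circ> f) X = (tensor_map SA SA SA SA f f \<circ> suzuki_comult N n \<mu> lam) X"
  proof (rule alg_hom_SA_eqI[OF alg_hom_compose[OF f(1) comult_hom] alg_hom_compose[OF comult_hom th.tensor_map_hom] _ X])
    show "(suzuki_comult N n \<mu> lam \<circ> f) (cls (gx i j)) = (tensor_map SA SA SA SA f f \<circ> suzuki_comult N n \<mu> lam) (cls (gx i j))" for i j
      using alg_homD(3)[OF th.tensor_map_hom, of "pt (gx i One) (gx One j)" "pt (gx i Two) (gx Two j)"]
      by (simp add: f(2) comult_cls \<Delta>0_conj_gen[OF s QP] \<Delta>0_simps(5) Dgen_def tm)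
  qed
  then show "suzuki_comult N n \<mu> lam (f X) = tensor_map SA SA SA SA f f (suzuki_comult N n \<mu> lam X)" by simp
  have "(suzuki_counit N n \<mu> lam \<circ> f) X = suzuki_counit N n \<mu> lam X"
    by (rule alg_hom_SA_eqI[OF alg_hom_compose[OF f(1) counit_hom] counit_hom _ X])
      (simp add: f(2) counit_cls \<epsilon>0_conj_gen[OF s PQ])
  then show "suzuki_counit N n \<mu> lam (f X) = suzuki_counit N n \<mu> lam X" by simp
  have S: "suzuki_antipode N n \<mu> lam \<in> alg_hom SA (op_alg SA)"
    by (rule alg_homI) (auto simp: carrier_SA cls_simps antipode_cls op_alg_def)
  have f': "f \<in> alg_hom (op_alg SA) (op_alg SA)"
    by (rule alg_homI) (use alg_homD[OF f(1)] in \<open>auto simp: op_alg_def\<close>)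
  \<comment> \<open>The matrix \<open>?y\<close> has the left inverse with entries
    \<open>\<sigma>0 (?y i j)\<close> and the right inverse \<open>v\<close>, whose entries
    represent \<open>f\<close> of the antipodes of the generators. The two inverses of a matrix
    agree.\<close>
  have "(suzuki_antipode N n \<mu> lam \<circ> f) X = (f \<circ> suzuki_antipode N n \<mu> lam) X"
  proof (rule alg_hom_SA_eqI[OF alg_hom_compose[OF f(1) S] alg_hom_compose[OF S f'] _ X])
    fix i j
    have "\<exists>v. f (cls (\<sigma>0 (gx i j))) = cls v" for i j
      using alg_homD(1)[OF f(1) cls_closed] by (auto simp: carrier_SA)
    then obtain v where v: "f (cls (\<sigma>0 (gx i j))) = cls (v i j)" for i j by metis
    have V: "?y i One * v One j + ?y i Two * v Two j \<sim>\<^sub>I (if i = j then 1 else 0)" for i j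
    proof -
      have "gx i One * \<sigma>0 (gx One j) + gx i Two * \<sigma>0 (gx Two j) \<sim>\<^sub>I (if i = j then ide (i \<noteq> One) else 0) + (if i = j then ide (i \<noteq> Two) else 0)"
        by (intro eqv_add antipode_gen)
      also have "\<dots> \<sim>\<^sub>I (if i = j then 1 else 0)" using ide_sum by simp
      finally have "cls (gx i One * \<sigma>0 (gx One j) + gx i Two * \<sigma>0 (gx Two j)) = cls (if i = j then 1 else 0)"
        by (simp only: cls_eq_iff)
      then have "f (cls (gx i One * \<sigma>0 (gx One j) + gx i Two * \<sigma>0 (gx Two j))) = f (cls (if i = j then 1 else 0))" by simp
      moreover have "f (cls (gx i One * \<sigma>0 (gx One j) + gx i Two * \<sigma>0 (gx Two j))) = cls (?y i One * v One j + ?y i Two * v Two j)"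
        by (simp only: cls_simps[symmetric] alg_homD[OF f(1)] cls_closed T2.A.m_closed f(2) v)
      moreover have "f (cls (if i = j then 1 else 0)) = cls (if i = j then 1 else 0)"
        using alg_homD(4)[OF f(1)] alg_hom_zero[OF f(1) kalg_SA kalg_SA] by (simp add: cls_simps)
      ultimately show ?thesis by (simp only: cls_eq_iff)
    qed
    let ?z = "\<lambda>i j. \<sigma>0 (?y i j)"
    note Z = \<sigma>0_conj_gen[OF s QP PQ, of t]
    have "?z i j = ?z i One * (if One = j then 1 else 0) + ?z i Two * (if Two = j then 1 else 0)"
      by (cases j) simp_all
    also have "\<dots> \<sim>\<^sub>I ?z i One * (?y One One * v One j + ?y One Two * v Two j) + ?z i Two * (?y Two One * v One j + ?y Two Two * v Two j)"
      by (intro eqv_add eqv_mult_l) (rule eqv_sym[OF V])+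
    also have "\<dots> = (?z i One * ?y One One + ?z i Two * ?y Two One) * v One j + (?z i One * ?y One Two + ?z i Two * ?y Two Two) * v Two j"
      by (simp add: algebra_simps)
    also have "\<dots> \<sim>\<^sub>I (if i = One then 1 else 0) * v One j + (if i = Two then 1 else 0) * v Two j"
      by (intro eqv_add eqv_mult_r Z)
    also have "\<dots> = v i j" by (cases i) simp_all
    finally show "(suzuki_antipode N n \<mu> lam \<circ> f) (cls (gx i j)) = (f \<circ> suzuki_antipode N n \<mu> lam) (cls (gx i j))"
      by (simp add: f(2) antipode_cls v cls_eq_iff del: \<sigma>0_simps(5))
  qed
  then show "suzuki_antipode N n \<mu> lam (f X) = f (suzuki_antipode N n \<mu> lam X)" by simp
qed

section \<open>Endomorphisms given on generators\<close>


definition sub :: "(idx \<times> idx \<Rightarrow> 'k sfree) \<Rightarrow> 'k sfree \<Rightarrow> 'k sfree" where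
  "sub y = free_lift free_alg y"

lemma sub_hom: "sub y \<in> alg_hom free_alg free_alg"
  unfolding sub_def by (rule kalg.free_lift_hom[OF kalg_free_alg]) simp

lemma sub_gx [simp]: "sub y (gx i j) = y (i, j)"
  unfolding sub_def gx_def by (rule kalg.free_lift_gen[OF kalg_free_alg]) simp

lemma ev_sub: "ev g (sub y p) = ev (\<lambda>l. ev g (y l)) p"
proof -
  have "(ev g \<circ> sub y) p = ev (\<lambda>l. ev g (y l)) p"
  proof (rule alg_hom_free_eqI[OF alg_hom_compose[OF sub_hom ev_hom] ev_hom])
    fix l :: "idx \<times> idx"
    obtain i j where l: "l = (i, j)" by (cases l)
    show "(ev g \<circ> sub y) (Poly_Mapping.single (Word [l]) 1) = ev (\<lambda>l. ev g (y l)) (Poly_Mapping.single (Word [l]) 1)"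
      using ev_simps(6)[of "\<lambda>l. ev g (y l)" i j] sub_gx[of y i j] by (simp add: l gx_def)
  qed
  then show ?thesis by simp
qed

text \<open>The condition that makes substitution of \<open>y\<close> descend to the quotient, with
  membership in the ideal tested at the points.\<close>

definition good :: "(idx \<times> idx \<Rightarrow> 'k sfree) \<Rightarrow> bool" where
  "good y \<longleftrightarrow> (\<forall>fl w r. w ^ (2 * N) = muf fl \<longrightarrow> r ^ n = lamf fl \<longrightarrow> sat (\<lambda>l. ev (gfam fl w 1 r) (y l)))"

definition endo :: "(idx \<times> idx \<Rightarrow> 'k sfree) \<Rightarrow> 'k sfree set \<Rightarrow> 'k sfree set" where
  "endo y = quot_lift I SA (\<lambda>l. cls (y l))"

lemma sub_I: "good y \<Longrightarrow> p \<in> I \<Longrightarrow> sub y p \<in> I"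
proof -
  assume y: "good y" "p \<in> I"
  have "sub y p \<sim>\<^sub>I 0"
    by (rule faithful) (use y ev_I in \<open>simp add: ev_sub good_def\<close>)
  then show ?thesis by (simp add: eqv_def)
qed

lemma free_lift_SA: "free_lift SA (\<lambda>l. cls (y l)) p = cls (sub y p)"
proof -
  have c: "cls \<in> alg_hom free_alg SA" by (rule alg_homI) (simp_all add: cls_simps)
  have "free_lift SA (\<lambda>l. cls (y l)) p = (cls \<circ> sub y) p"
  proof (rule alg_hom_free_eqI[OF _ alg_hom_compose[OF sub_hom c]])
    show "free_lift SA (\<lambda>l. cls (y l)) \<in> alg_hom free_alg SA"
      by (rule kalg.free_lift_hom[OF kalg_SA]) simp
    show "free_lift SA (\<lambda>l. cls (y l)) (Poly_Mapping.single (Word [l]) 1) = (cls \<circ> sub y) (Poly_Mapping.single (Word [l]) 1)" for l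
      using kalg.free_lift_gen[OF kalg_SA, of "\<lambda>l. cls (y l)" l] sub_gx[of y "fst l" "snd l"] by (simp add: gx_def)
  qed
  then show ?thesis by simp
qed

lemma endo_cls: "good y \<Longrightarrow> endo y (cls p) = cls (sub y p)"
  unfolding endo_def cls_def[of p] free_lift_SA[symmetric]
  by (rule quot_lift_coset[OF ideal_I kalg_SA]) (auto simp: free_lift_SA cls_simps cls_eq_iff eqv_def sub_I)

lemma endo_hom:
  assumes "good y" shows "endo y \<in> alg_hom SA SA"
proof -
  have "quot_lift I SA (\<lambda>l. cls (y l)) \<in> alg_hom (quot_alg free_alg I) SA"
    by (rule quot_lift_hom[OF ideal_I kalg_SA]) (use assms in \<open>auto simp: free_lift_SA cls_simps cls_eq_iff eqv_def sub_I\<close>)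
  then show ?thesis by (simp add: endo_def quot_SA)
qed

lemma endo_ext: "endo y \<in> extensional (carrier SA)"
  by (simp add: endo_def quot_lift_def quot_SA)

text \<open>To evaluate a composite at a point, the outer map moves the point and the inner images
  are evaluated there. That \<open>y3\<close> respects the relations follows from the same
  comparison.\<close>

lemma endo_compose:
  assumes "good y1" "good y2"
    and "\<And>fl w r. w ^ (2 * N) = muf fl \<Longrightarrow> r ^ n = lamf fl \<Longrightarrow>
      (\<lambda>l. ev (\<lambda>l. ev (gfam fl w 1 r) (y1 l)) (y2 l)) = (\<lambda>l. ev (gfam fl w 1 r) (y3 l))"
  shows "compose (carrier SA) (endo y1) (endo y2) = endo y3"
proof -
  have eq: "y3 l \<sim>\<^sub>I sub y1 (y2 l)" for l
    by (rule faithful) (simp only: ev_sub fun_cong[OF assms(3), of _ _ _ l])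
  have g3: "good y3"
    unfolding good_def
  proof (intro allI impI)
    fix fl w r assume wr: "w ^ (2 * N) = muf fl" "r ^ n = lamf fl"
    let ?g = "\<lambda>l. ev (gfam fl w 1 r) (y1 l)"
    have g: "sat ?g" using assms(1) wr by (simp add: good_def)
    have "ev (\<lambda>l. ev ?g (y2 l)) r' = 0" if "r' \<in> suzuki_rels N n \<mu> lam" for r'
      using ev_I[OF g sub_I[OF assms(2) rels_I[OF that]]] by (simp add: ev_sub)
    then show "sat (\<lambda>l. ev (gfam fl w 1 r) (y3 l))"
      using assms(3)[OF wr] by (simp add: sat_def)
  qed
  show ?thesis
  proof (rule extensionalityI[OF compose_extensional endo_ext])
    fix X assume X: "X \<in> carrier SA"
    have "(endo y1 \<circ> endo y2) X = endo y3 X"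
    proof (rule alg_hom_SA_eqI[OF alg_hom_compose[OF endo_hom endo_hom] endo_hom _ X])
      show "(endo y1 \<circ> endo y2) (cls (gx i j)) = endo y3 (cls (gx i j))" for i j
        using eqv_sym[OF eq] by (simp add: endo_cls assms(1,2) g3 cls_eq_iff)
    qed (use assms g3 in auto)
    then show "compose (carrier SA) (endo y1) (endo y2) X = endo y3 X" using X by (simp add: compose_eq)
  qed
qed

text \<open>The argument order is 11, 22, 12, 21, as in \<open>suzuki_endo\<close>.\<close>

definition gens :: "'k sfree \<Rightarrow> 'k sfree \<Rightarrow> 'k sfree \<Rightarrow> 'k sfree \<Rightarrow> idx \<times> idx \<Rightarrow> 'k sfree" where
  "gens a b c d = (\<lambda>(i, j). if i = One then (if j = One then a else c) else (if j = One then d else b))"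

lemma gens_simps [simp]:
  "gens a b c d (One, One) = a" "gens a b c d (Two, Two) = b" "gens a b c d (One, Two) = c" "gens a b c d (Two, One) = d"
  by (simp_all add: gens_def)

lemma suzuki_endo_eq: "suzuki_endo N n \<mu> lam a b c d = endo (gens a b c d)"
proof -
  have "(\<lambda>l. cls (case l of (One, One) \<Rightarrow> a | (Two, Two) \<Rightarrow> b | (One, Two) \<Rightarrow> c | (Two, One) \<Rightarrow> d))
      = (\<lambda>l. cls (gens a b c d l))"
    by (auto simp: gens_def fun_eq_iff split: idx.splits)
  then show ?thesis by (simp add: suzuki_endo_def endo_def)
qed

definition yPsi :: "nat \<Rightarrow> nat \<Rightarrow> 'k \<Rightarrow> idx \<times> idx \<Rightarrow> 'k sfree" where
  "yPsi s t \<xi> = gens (x11^(2*s) * chi One One t) (x11^(2*s) * chi Two Two t)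
    (\<xi> \<cdot> (x12^(2*s) * chi One Two t)) (inverse \<xi> \<cdot> (x12^(2*s) * chi Two One t))"

definition yPhi :: "nat \<Rightarrow> nat \<Rightarrow> 'k \<Rightarrow> idx \<times> idx \<Rightarrow> 'k sfree" where
  "yPhi s t \<xi> = gens (x11^(2*s) * chi Two Two t) (x11^(2*s) * chi One One t)
    (\<xi> \<cdot> (x12^(2*s) * chi Two One t)) (inverse \<xi> \<cdot> (x12^(2*s) * chi One Two t))"

definition yGamma :: "nat \<Rightarrow> 'k \<Rightarrow> 'k \<Rightarrow> idx \<times> idx \<Rightarrow> 'k sfree" where
  "yGamma s \<zeta>1 \<zeta>2 = gens
    ((1/2) \<cdot> (x11^(2*s) * (x11 + x22) + x12^(2*s) * (\<zeta>2 \<cdot> x12 + inverse \<zeta>2 \<cdot> x21)))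
    ((1/2) \<cdot> (x11^(2*s) * (x11 + x22) - x12^(2*s) * (\<zeta>2 \<cdot> x12 + inverse \<zeta>2 \<cdot> x21)))
    ((\<zeta>1/2) \<cdot> (x11^(2*s) * (x11 - x22) - x12^(2*s) * (\<zeta>2 \<cdot> x12 - inverse \<zeta>2 \<cdot> x21)))
    ((inverse \<zeta>1/2) \<cdot> (x11^(2*s) * (x11 - x22) + x12^(2*s) * (\<zeta>2 \<cdot> x12 - inverse \<zeta>2 \<cdot> x21)))"

lemma suzuki_maps_eq:
  "suzuki_Psi N n \<mu> lam s t \<xi> = endo (yPsi s t \<xi>)"
  "suzuki_Phi N n \<mu> lam s t \<xi> = endo (yPhi s t \<xi>)"
  "suzuki_Gamma N n \<mu> lam s \<zeta>1 \<zeta>2 = endo (yGamma s \<zeta>1 \<zeta>2)"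
  by (simp_all add: suzuki_Psi_def suzuki_Phi_def suzuki_Gamma_def suzuki_endo_eq yPsi_def yPhi_def yGamma_def)

subsection \<open>Action of \<open>\<Psi>\<close> and \<open>\<Phi>\<close> on points\<close>

text \<open>A point with an additional twist \<open>x\<close> between the two letters of its block,
  which is the effect of the parameter \<xi>; \<open>gfam\<close> is the case
  \<open>x = 1\<close>.\<close>

definition g3 :: "bool \<Rightarrow> 'k \<Rightarrow> 'k \<Rightarrow> 'k \<Rightarrow> 'k \<Rightarrow> idx \<times> idx \<Rightarrow> 'k m2" where
  "g3 fl x u a b = (\<lambda>(i, j). if (i \<noteq> j) = fl then (if i = One then MJ (x * u) a else MJ (u / x) b) else 0)"

lemma g3_simps [simp]:
  "g3 False x u a b (One, One) = MJ (x * u) a" "g3 False x u a b (Two, Two) = MJ (u / x) b"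
  "g3 False x u a b (One, Two) = 0" "g3 False x u a b (Two, One) = 0"
  "g3 True x u a b (One, Two) = MJ (x * u) a" "g3 True x u a b (Two, One) = MJ (u / x) b"
  "g3 True x u a b (One, One) = 0" "g3 True x u a b (Two, Two) = 0"
  by (simp_all add: g3_def)

lemma gfam_g3: "gfam fl u a b = g3 fl 1 u a b"
  by (auto simp: gfam_def g3_def)

text \<open>For a fourth root of unity \<open>1 / x = x * x^2\<close>, which moves the twist into
  the ratio.\<close>

lemma g3_gfam:
  assumes "x ^ 4 = 1" shows "g3 fl x u a b = gfam fl (x * u) a (x ^ 2 * b)"
proof -
  have x: "x \<noteq> 0" using assms by auto
  have "x * x * x = 1 / x" using x assms by (simp add: field_simps power4_eq_xxxx)
  then have "MJ (u / x) b = MJ (x * u) (x ^ 2 * b)"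
    using x by (simp add: MJ_def power2_eq_square field_simps)
  then show ?thesis by (auto simp: g3_def gfam_def)
qed

lemma sat_g3:
  assumes "x ^ 4 = 1" "x ^ (2 * N) = 1" "x ^ (2 * n) = 1" "a \<noteq> 0" "b \<noteq> 0" "u ^ (2 * N) = muf fl" "(b / a) ^ n = lamf fl"
  shows "sat (g3 fl x u a b)"
proof -
  have x: "x \<noteq> 0" using assms(1) by auto
  have "(x\<^sup>2 * b / a) ^ n = x ^ (2 * n) * (b / a) ^ n" by (simp add: power_mult_distrib power_divide power_mult)
  then show ?thesis
    unfolding g3_gfam[OF assms(1)] using assms x by (subst sat_gfam_iff) (auto simp: power_mult_distrib)
qed

lemma ev_g3_chi:
  assumes "a \<noteq> 0" "b \<noteq> 0" "x \<noteq> 0" "t = Suc (2 * m)"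
  shows "(i \<noteq> j) = fl \<Longrightarrow> ev (g3 fl x u a b) (chi i j t) =
      (if i = One then MJ (x * u ^ t) (a * (a / b) ^ m) else MJ (u ^ t / x) (b * (b / a) ^ m))"
    and "(i \<noteq> j) \<noteq> fl \<Longrightarrow> ev (g3 fl x u a b) (chi i j t) = 0"
proof -
  assume fl: "(i \<noteq> j) = fl"
  let ?c = "if i = One then a else b" and ?d = "if i = One then b else a"
  have 1: "g3 fl x u a b (i, j) = MJ (if i = One then x * u else u / x) ?c"
    "g3 fl x u a b (swap i, swap j) = MJ (if i = One then u / x else x * u) ?d"
    unfolding fl[symmetric] by (cases i; cases j; simp add: g3_def)+
  have e: "ev (g3 fl x u a b) (chi i j (2 * k)) = MD (u ^ (2 * k)) ((?d / ?c) ^ k)" for k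
    using assms(3) by (induction k) (auto simp: 1 MD_one MDJ_mult mult.assoc[symmetric])
  have "chi i j (Suc (2 * m)) = chi i j (2 * m) * (gx i j :: 'k sfree)"
    by (induction m) (simp_all add: mult.assoc)
  then have "ev (g3 fl x u a b) (chi i j t) = MD (u ^ (2 * m)) ((?d / ?c) ^ m) * MJ (if i = One then x * u else u / x) ?c"
    by (simp only: assms(4) ev_simps e 1)
  then show "ev (g3 fl x u a b) (chi i j t) =
      (if i = One then MJ (x * u ^ t) (a * (a / b) ^ m) else MJ (u ^ t / x) (b * (b / a) ^ m))"
    using assms by (auto simp: MDJ_mult power_divide mult_ac)
next
  assume "(i \<noteq> j) \<noteq> fl"
  then show "ev (g3 fl x u a b) (chi i j t) = 0" by (auto simp: assms(4) g3_def)
qed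

lemma ev_g3_word:
  assumes "a \<noteq> 0" "b \<noteq> 0" "x \<noteq> 0" "t = Suc (2 * m)"
  shows "(i \<noteq> j) = fl \<Longrightarrow> (One \<noteq> j') = fl \<Longrightarrow> ev (g3 fl x u a b) (gx One j' ^ (2 * s) * chi i j t) =
      (if i = One then MJ ((x * u) ^ (2 * s) * (x * u ^ t)) (a * (a / b) ^ m)
       else MJ ((x * u) ^ (2 * s) * (u ^ t / x)) (b * (b / a) ^ m))"
    and "(i \<noteq> j) \<noteq> fl \<Longrightarrow> ev (g3 fl x u a b) (gx One j' ^ (2 * s) * chi i j t) = 0"
proof -
  assume fl: "(i \<noteq> j) = fl" "(One \<noteq> j') = fl"
  have "g3 fl x u a b (One, j') ^ (2 * s) = MD ((x * u) ^ (2 * s)) 1"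
    using assms fl by (simp add: g3_def power_mult power2_eq_square[of "MJ _ _"] MDJ_mult MD_power power2_eq_square)
  then show "ev (g3 fl x u a b) (gx One j' ^ (2 * s) * chi i j t) =
      (if i = One then MJ ((x * u) ^ (2 * s) * (x * u ^ t)) (a * (a / b) ^ m)
       else MJ ((x * u) ^ (2 * s) * (u ^ t / x)) (b * (b / a) ^ m))"
    by (simp add: ev_g3_chi(1)[OF assms fl(1)] MDJ_mult)
qed (simp add: ev_g3_chi(2)[OF assms])

lemma fourth_root_sq: "x ^ 4 = 1 \<Longrightarrow> x ^ (2 * s) * x ^ (2 * s) = (1::'k)"
proof -
  have "x ^ (2 * s) * x ^ (2 * s) = (x ^ 4) ^ s" by (simp flip: power_mult power_add)
  then show "x ^ 4 = 1 \<Longrightarrow> x ^ (2 * s) * x ^ (2 * s) = (1::'k)" by simp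
qed

lemma ev_g3_One:
  assumes "a \<noteq> 0" "b \<noteq> 0" "x \<noteq> 0" "t = Suc (2 * m)" "(One \<noteq> j) = fl" "(One \<noteq> j') = fl"
  shows "ev (g3 fl x u a b) (gx One j' ^ (2 * s) * chi One j t) = MJ ((x * u) ^ (2 * s) * (x * u ^ t)) (a * (a / b) ^ m)"
  using ev_g3_word(1)[OF assms(1-4), of One j fl j'] assms(5,6) by (simp only: if_True refl)

lemma ev_g3_Two:
  assumes "a \<noteq> 0" "b \<noteq> 0" "x \<noteq> 0" "t = Suc (2 * m)" "(Two \<noteq> j) = fl" "(One \<noteq> j') = fl"
  shows "ev (g3 fl x u a b) (gx One j' ^ (2 * s) * chi Two j t) = MJ ((x * u) ^ (2 * s) * (u ^ t / x)) (b * (b / a) ^ m)"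
  using ev_g3_word(1)[OF assms(1-4), of Two j fl j'] assms(5,6) by (simp only: if_False idx.distinct simp_thms)

lemma g3_eqI:
  assumes "fl \<Longrightarrow> f (One, Two) = MJ (x * u) a" "fl \<Longrightarrow> f (Two, One) = MJ (u / x) b" "fl \<Longrightarrow> f (One, One) = 0" "fl \<Longrightarrow> f (Two, Two) = 0"
    and "\<not> fl \<Longrightarrow> f (One, One) = MJ (x * u) a" "\<not> fl \<Longrightarrow> f (Two, Two) = MJ (u / x) b" "\<not> fl \<Longrightarrow> f (One, Two) = 0" "\<not> fl \<Longrightarrow> f (Two, One) = 0"
  shows "f = g3 fl x u a b"
proof
  fix l :: "idx \<times> idx"
  obtain i j where l: "l = (i, j)" by (cases l)
  show "f l = g3 fl x u a b l"
    unfolding l using assms by (cases fl; cases i; cases j) simp_all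
qed

text \<open>How points move: the scale is raised to the power \<open>2*s+t\<close>, the ratio
  \<open>b / a\<close> to the power \<open>t\<close>, and the twist becomes
  \<open>\<xi> * x^(2*s+1)\<close>. Iterating this gives the composition relations. The diagonal
  block carries no twist, hence the assumption on \<open>fl\<close> and \<open>x\<close>.\<close>

lemma Psi_g3:
  assumes "a \<noteq> 0" "b \<noteq> 0" "x ^ 4 = 1" "t = Suc (2 * m)" "\<xi> \<noteq> 0" "fl \<or> x = 1"
  shows "(\<lambda>l. ev (g3 fl x u a b) (yPsi s t \<xi> l)) =
    g3 fl (if fl then \<xi> * x ^ (2 * s + 1) else 1) (u ^ (2 * s + t)) (a * (a / b) ^ m) (b * (b / a) ^ m)"
proof -
  have x: "x \<noteq> 0" using assms(3) by auto
  have x4: "x ^ (2 * s) = 1 / x ^ (2 * s)" using x fourth_root_sq[OF assms(3), of s] by (simp add: field_simps)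
  have c1: "\<xi> * ((x * u) ^ (2 * s) * (x * u ^ t)) = \<xi> * x ^ (2 * s + 1) * u ^ (2 * s + t)"
    by (simp add: power_mult_distrib power_add mult_ac)
  have c2: "inverse \<xi> * ((x * u) ^ (2 * s) * (u ^ t / x)) = u ^ (2 * s + t) / (\<xi> * x ^ (2 * s + 1))"
    using x assms(5) by (subst power_mult_distrib, subst x4) (simp add: field_simps power_add)
  note W = ev_g3_One[OF assms(1,2) x assms(4)] ev_g3_Two[OF assms(1,2) x assms(4)] ev_g3_word(2)[OF assms(1,2) x assms(4)]
  show ?thesis
  proof (cases fl)
    case True
    have p: "(One \<noteq> Two) = fl" "(Two \<noteq> One) = fl" "(One \<noteq> One) \<noteq> fl" "(Two \<noteq> Two) \<noteq> fl" using True by simp_all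
    show ?thesis
    proof (rule g3_eqI, goal_cases)
      case 1
      show ?case by (simp only: yPsi_def gens_simps ev_simps(5) W(1)[OF p(1) p(1)] m2_scale_MDJ c1) (simp only: True if_True)
    next
      case 2
      show ?case by (simp only: yPsi_def gens_simps ev_simps(5) W(2)[OF p(2) p(1)] m2_scale_MDJ c2) (simp only: True if_True)
    qed (simp_all (no_asm) only: yPsi_def gens_simps W(3)[OF p(3)] W(3)[OF p(4)], simp_all only: True simp_thms)
  next
    case False
    have p: "(One \<noteq> One) = fl" "(Two \<noteq> Two) = fl" "(One \<noteq> Two) \<noteq> fl" "(Two \<noteq> One) \<noteq> fl" using False by simp_all
    have x1: "x = 1" using assms(6) False by simp
    show ?thesis
    proof (rule g3_eqI, goal_cases)
      case 5
      show ?case by (simp only: yPsi_def gens_simps W(1)[OF p(1) p(1)]) (simp add: False x1 power_add)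
    next
      case 6
      show ?case by (simp only: yPsi_def gens_simps W(2)[OF p(2) p(1)]) (simp add: False x1 power_add)
    qed (simp_all (no_asm) only: yPsi_def gens_simps ev_simps(5) W(3)[OF p(3)] W(3)[OF p(4)] m2_scale_MDJ, simp_all only: False simp_thms)
  qed
qed

text \<open>The letters of each block are exchanged, so the alternating word contributes
  \<open>1 / x\<close> instead of \<open>x\<close> and the twist becomes
  \<open>\<xi> * x^(2*s-1)\<close>; \<open>s \<ge> 1\<close> keeps the truncated subtraction
  exact.\<close>

lemma Phi_g3:
  assumes "a \<noteq> 0" "b \<noteq> 0" "x ^ 4 = 1" "t = Suc (2 * m)" "\<xi> \<noteq> 0" "fl \<or> x = 1" "s \<ge> 1"
  shows "(\<lambda>l. ev (g3 fl x u a b) (yPhi s t \<xi> l)) =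
    g3 fl (if fl then \<xi> * x ^ (2 * s - 1) else 1) (u ^ (2 * s + t)) (b * (b / a) ^ m) (a * (a / b) ^ m)"
proof -
  have x: "x \<noteq> 0" using assms(3) by auto
  have xs: "x ^ (2 * s) = x ^ (2 * s - 1) * x" using assms(7) by (cases s) (simp_all add: mult.commute)
  have x4: "x ^ (2 * s) = 1 / x ^ (2 * s)" using x fourth_root_sq[OF assms(3), of s] by (simp add: field_simps)
  have c1: "\<xi> * ((x * u) ^ (2 * s) * (u ^ t / x)) = \<xi> * x ^ (2 * s - 1) * u ^ (2 * s + t)"
    using x by (subst power_mult_distrib, subst xs) (simp add: power_add field_simps)
  have c2: "inverse \<xi> * ((x * u) ^ (2 * s) * (x * u ^ t)) = u ^ (2 * s + t) / (\<xi> * x ^ (2 * s - 1))"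
    using x assms(5) by (subst power_mult_distrib, subst x4, subst xs) (simp add: field_simps power_add)
  note W = ev_g3_Two[OF assms(1,2) x assms(4)] ev_g3_One[OF assms(1,2) x assms(4)] ev_g3_word(2)[OF assms(1,2) x assms(4)]
  show ?thesis
  proof (cases fl)
    case True
    have p: "(One \<noteq> Two) = fl" "(Two \<noteq> One) = fl" "(One \<noteq> One) \<noteq> fl" "(Two \<noteq> Two) \<noteq> fl" using True by simp_all
    show ?thesis
    proof (rule g3_eqI, goal_cases)
      case 1
      show ?case by (simp only: yPhi_def gens_simps ev_simps(5) W(1)[OF p(2) p(1)] m2_scale_MDJ c1) (simp only: True if_True)
    next
      case 2
      show ?case by (simp only: yPhi_def gens_simps ev_simps(5) W(2)[OF p(1) p(1)] m2_scale_MDJ c2) (simp only: True if_True)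
    qed (simp_all (no_asm) only: yPhi_def gens_simps W(3)[OF p(3)] W(3)[OF p(4)], simp_all only: True simp_thms)
  next
    case False
    have p: "(One \<noteq> One) = fl" "(Two \<noteq> Two) = fl" "(One \<noteq> Two) \<noteq> fl" "(Two \<noteq> One) \<noteq> fl" using False by simp_all
    have x1: "x = 1" using assms(6) False by simp
    show ?thesis
    proof (rule g3_eqI, goal_cases)
      case 5
      show ?case by (simp only: yPhi_def gens_simps W(1)[OF p(2) p(1)]) (simp add: False x1 power_add)
    next
      case 6
      show ?case by (simp only: yPhi_def gens_simps W(2)[OF p(1) p(1)]) (simp add: False x1 power_add)
    qed (simp_all (no_asm) only: yPhi_def gens_simps ev_simps(5) W(3)[OF p(3)] W(3)[OF p(4)] m2_scale_MDJ, simp_all only: False simp_thms)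
  qed
qed

section \<open>Composition of \<Psi> and \<Phi>\<close>

text \<open>The conditions on \<xi> come, in this order, from \<open>x12^2 = x21^2\<close>, from the
  relation for the unit and from the relation for \<open>chi\<close>; they treat both parities of
  \<open>n\<close> alike. No upper bounds are imposed on \<open>s\<close> and \<open>t\<close>,
  because composites leave the index ranges.\<close>

definition okP :: "nat \<Rightarrow> nat \<Rightarrow> 'k \<Rightarrow> bool" where
  "okP s t \<xi> \<longleftrightarrow> s \<ge> 1 \<and> odd t \<and> \<xi> ^ 4 = 1 \<and> \<xi> ^ (2 * N) = 1 \<and> \<xi> ^ (2 * n) = 1"

lemma okPD:
  assumes "okP s t \<xi>"
  shows "s \<ge> 1" "t = Suc (2 * (t div 2))" "\<xi> \<noteq> 0" "\<xi> ^ 4 = 1" "\<xi> ^ (2 * N) = 1" "\<xi> ^ (2 * n) = 1"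
  using assms by (auto simp: okP_def elim!: oddE)

text \<open>The new ratio is the \<open>t\<close>-th power of the old one or the inverse of that;
  for odd \<open>t\<close> both have the sign \<open>lamf fl\<close> as \<open>n\<close>-th
  power.\<close>

lemma ratio_pow:
  assumes "(b / a) ^ n = lamf fl" "t = Suc (2 * m)" "a \<noteq> 0" "b \<noteq> (0::'k)"
  shows "((b * (b / a) ^ m) / (a * (a / b) ^ m)) ^ n = lamf fl"
    and "((a * (a / b) ^ m) / (b * (b / a) ^ m)) ^ n = lamf fl"
proof -
  have "(b * (b / a) ^ m) / (a * (a / b) ^ m) = (b / a) ^ t"
    using assms(3,4) by (simp add: assms(2) field_simps power_mult power2_eq_square power_mult_distrib)
  then have *: "((b * (b / a) ^ m) / (a * (a / b) ^ m)) ^ n = ((b / a) ^ n) ^ t"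
    by (simp add: mult.commute flip: power_mult)
  then show 1: "((b * (b / a) ^ m) / (a * (a / b) ^ m)) ^ n = lamf fl"
    using assms(1,2) odd_power_lamf(1)[of t fl] by simp
  have "((a * (a / b) ^ m) / (b * (b / a) ^ m)) ^ n = inverse (((b * (b / a) ^ m) / (a * (a / b) ^ m)) ^ n)"
    by (simp flip: power_inverse)
  then show "((a * (a / b) ^ m) / (b * (b / a) ^ m)) ^ n = lamf fl"
    unfolding 1 by (simp add: inverse_eq_iff_eq inverse_unique)
qed

lemma pow_muf:
  assumes "w ^ (2 * N) = muf fl" "odd t" shows "(w ^ (2 * s + t)) ^ (2 * N) = muf fl"
proof -
  have "(w ^ (2 * s + t)) ^ (2 * N) = (w ^ (2 * N)) ^ (2 * s + t)" by (simp add: mult.commute flip: power_mult)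
  then show ?thesis using assms odd_power_lamf(2)[of "2 * s + t" fl] by simp
qed

lemma Psi_pt:
  assumes "r \<noteq> 0" "t = Suc (2 * m)" "\<xi> \<noteq> 0"
  shows "(\<lambda>l. ev (gfam fl w 1 r) (yPsi s t \<xi> l)) =
    g3 fl (if fl then \<xi> else 1) (w ^ (2 * s + t)) (1 * (1 / r) ^ m) (r * (r / 1) ^ m)"
  unfolding gfam_g3 using assms by (subst Psi_g3[OF _ _ _ assms(2,3)]) simp_all

lemma Phi_pt:
  assumes "r \<noteq> 0" "t = Suc (2 * m)" "\<xi> \<noteq> 0" "s \<ge> 1"
  shows "(\<lambda>l. ev (gfam fl w 1 r) (yPhi s t \<xi> l)) =
    g3 fl (if fl then \<xi> else 1) (w ^ (2 * s + t)) (r * (r / 1) ^ m) (1 * (1 / r) ^ m)"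
  unfolding gfam_g3 using assms by (subst Phi_g3[OF _ _ _ assms(2,3)]) simp_all

lemma good_Psi: "okP s t \<xi> \<Longrightarrow> good (yPsi s t \<xi>)"
  unfolding good_def
proof (intro allI impI)
  fix fl w r assume ok: "okP s t \<xi>" and wr: "w ^ (2 * N) = muf fl" "r ^ n = lamf fl"
  note d = okPD[OF ok]
  have r: "r \<noteq> 0" using root_nz(2)[OF wr(2)] .
  show "sat (\<lambda>l. ev (gfam fl w 1 r) (yPsi s t \<xi> l))"
    unfolding Psi_pt[OF r d(2,3)]
    using d r wr(2) ok by (intro sat_g3 pow_muf ratio_pow[OF _ d(2)] wr) (auto simp: okP_def)
qed

lemma good_Phi: "okP s t \<xi> \<Longrightarrow> good (yPhi s t \<xi>)"
  unfolding good_def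
proof (intro allI impI)
  fix fl w r assume ok: "okP s t \<xi>" and wr: "w ^ (2 * N) = muf fl" "r ^ n = lamf fl"
  note d = okPD[OF ok]
  have r: "r \<noteq> 0" using root_nz(2)[OF wr(2)] .
  show "sat (\<lambda>l. ev (gfam fl w 1 r) (yPhi s t \<xi> l))"
    unfolding Phi_pt[OF r d(2,3,1)]
    using d r wr(2) ok by (intro sat_g3 pow_muf ratio_pow[OF _ d(2)] wr) (auto simp: okP_def)
qed

context
  fixes s1 t1 s2 t2 :: nat and \<xi>1 \<xi>2 :: 'k
  assumes ok1: "okP s1 t1 \<xi>1" and ok2: "okP s2 t2 \<xi>2"
begin

text \<open>Expresses the number \<open>m\<close> of the composite, half of an odd product rounded
  down, by the halves of the factors.\<close>

lemma t12: "t1 * t2 = Suc (2 * (2 * (t1 div 2) * (t2 div 2) + t1 div 2 + t2 div 2))"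
  by (subst (1) okPD(2)[OF ok1], subst (1) okPD(2)[OF ok2]) (simp add: algebra_simps)

lemma expo12: "(w ^ (2 * s1 + t1)) ^ (2 * s2 + t2) = (w :: 'k) ^ (2 * (s1 * (2 * s2 + t2) + s2 * t1) + t1 * t2)"
  by (simp add: algebra_simps flip: power_mult)

lemma ratio12:
  assumes "a \<noteq> 0" "b \<noteq> (0::'k)"
  defines "m1 \<equiv> t1 div 2" and "m2 \<equiv> t2 div 2"
  shows "a * (a / b) ^ m1 * (a * (a / b) ^ m1 / (b * (b / a) ^ m1)) ^ m2 = a * (a / b) ^ (2 * m1 * m2 + m1 + m2)"
proof -
  have "a * (a / b) ^ m1 / (b * (b / a) ^ m1) = (a / b) ^ (2 * m1 + 1)"
    using assms by (simp add: field_simps power_mult power2_eq_square power_mult_distrib)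
  then have "a * (a / b) ^ m1 * (a * (a / b) ^ m1 / (b * (b / a) ^ m1)) ^ m2 = a * (a / b) ^ (m1 + (2 * m1 + 1) * m2)"
    by (simp only: mult.assoc flip: power_mult power_add)
  also have "m1 + (2 * m1 + 1) * m2 = 2 * m1 * m2 + m1 + m2" by (simp add: algebra_simps)
  finally show ?thesis .
qed

text \<open>Scales are compared by \<open>expo12\<close>, ratios by \<open>ratio12\<close> and
  twists by the rules for moving points. Two exchanges of letters cancel, so the square of \<Phi> is
  a \<Psi>.\<close>

lemma compose_PP:
  "compose (carrier SA) (endo (yPsi s1 t1 \<xi>1)) (endo (yPsi s2 t2 \<xi>2)) = endo (yPsi (s1 * (2 * s2 + t2) + s2 * t1) (t1 * t2) (\<xi>1 ^ (2 * s2 + 1) * \<xi>2))"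
  "compose (carrier SA) (endo (yPhi s1 t1 \<xi>1)) (endo (yPhi s2 t2 \<xi>2)) = endo (yPsi (s1 * (2 * s2 + t2) + s2 * t1) (t1 * t2) (\<xi>1 ^ (2 * s2 - 1) * \<xi>2))"
  "compose (carrier SA) (endo (yPsi s1 t1 \<xi>1)) (endo (yPhi s2 t2 \<xi>2)) = endo (yPhi (s1 * (2 * s2 + t2) + s2 * t1) (t1 * t2) (\<xi>1 ^ (2 * s2 - 1) * \<xi>2))"
  "compose (carrier SA) (endo (yPhi s1 t1 \<xi>1)) (endo (yPsi s2 t2 \<xi>2)) = endo (yPhi (s1 * (2 * s2 + t2) + s2 * t1) (t1 * t2) (\<xi>1 ^ (2 * s2 + 1) * \<xi>2))"
proof -
  note d1 = okPD[OF ok1] and d2 = okPD[OF ok2]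
  have s12: "(s1 * (2 * s2 + t2) + s2 * t1) \<ge> 1" using d1(1) d2(2) by (cases t2) auto
  have A0: "(1::'k) * (1 / r) ^ k \<noteq> 0" "r * (r / 1) ^ k \<noteq> 0" if "r \<noteq> 0" for r k using that by auto
  have x4: "(if fl then \<xi>1 else 1) ^ 4 = 1" for fl using d1 by simp
  have x1: "fl \<or> (if fl then \<xi>1 else 1) = 1" for fl by simp
  have x0: "\<xi>1 ^ k * \<xi>2 \<noteq> 0" for k using d1(3) d2(3) by simp
  show "compose (carrier SA) (endo (yPsi s1 t1 \<xi>1)) (endo (yPsi s2 t2 \<xi>2)) = endo (yPsi (s1 * (2 * s2 + t2) + s2 * t1) (t1 * t2) (\<xi>1 ^ (2 * s2 + 1) * \<xi>2))"
  proof (rule endo_compose[OF good_Psi[OF ok1] good_Psi[OF ok2]])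
    fix fl w r assume "w ^ (2 * N) = muf fl" "r ^ n = lamf fl"
    then have r: "r \<noteq> 0" using root_nz(2) by blast
    show "(\<lambda>l. ev (\<lambda>l. ev (gfam fl w 1 r) (yPsi s1 t1 \<xi>1 l)) (yPsi s2 t2 \<xi>2 l)) =
      (\<lambda>l. ev (gfam fl w 1 r) (yPsi (s1 * (2 * s2 + t2) + s2 * t1) (t1 * t2) (\<xi>1 ^ (2 * s2 + 1) * \<xi>2) l))"
      unfolding Psi_pt[OF r d1(2,3)] Psi_g3[OF A0(1)[OF r] A0(2)[OF r] x4 d2(2,3) x1] Psi_pt[OF r t12 x0] expo12
        ratio12[OF one_neq_zero r] ratio12[OF r one_neq_zero]
      by (cases fl) (simp_all add: mult.commute)
  qed
  show "compose (carrier SA) (endo (yPhi s1 t1 \<xi>1)) (endo (yPhi s2 t2 \<xi>2)) = endo (yPsi (s1 * (2 * s2 + t2) + s2 * t1) (t1 * t2) (\<xi>1 ^ (2 * s2 - 1) * \<xi>2))"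
  proof (rule endo_compose[OF good_Phi[OF ok1] good_Phi[OF ok2]])
    fix fl w r assume "w ^ (2 * N) = muf fl" "r ^ n = lamf fl"
    then have r: "r \<noteq> 0" using root_nz(2) by blast
    show "(\<lambda>l. ev (\<lambda>l. ev (gfam fl w 1 r) (yPhi s1 t1 \<xi>1 l)) (yPhi s2 t2 \<xi>2 l)) =
      (\<lambda>l. ev (gfam fl w 1 r) (yPsi (s1 * (2 * s2 + t2) + s2 * t1) (t1 * t2) (\<xi>1 ^ (2 * s2 - 1) * \<xi>2) l))"
      unfolding Phi_pt[OF r d1(2,3,1)] Phi_g3[OF A0(2)[OF r] A0(1)[OF r] x4 d2(2,3) x1 d2(1)] Psi_pt[OF r t12 x0] expo12
        ratio12[OF one_neq_zero r] ratio12[OF r one_neq_zero]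
      by (cases fl) (simp_all add: mult.commute)
  qed
  show "compose (carrier SA) (endo (yPsi s1 t1 \<xi>1)) (endo (yPhi s2 t2 \<xi>2)) = endo (yPhi (s1 * (2 * s2 + t2) + s2 * t1) (t1 * t2) (\<xi>1 ^ (2 * s2 - 1) * \<xi>2))"
  proof (rule endo_compose[OF good_Psi[OF ok1] good_Phi[OF ok2]])
    fix fl w r assume "w ^ (2 * N) = muf fl" "r ^ n = lamf fl"
    then have r: "r \<noteq> 0" using root_nz(2) by blast
    show "(\<lambda>l. ev (\<lambda>l. ev (gfam fl w 1 r) (yPsi s1 t1 \<xi>1 l)) (yPhi s2 t2 \<xi>2 l)) =
      (\<lambda>l. ev (gfam fl w 1 r) (yPhi (s1 * (2 * s2 + t2) + s2 * t1) (t1 * t2) (\<xi>1 ^ (2 * s2 - 1) * \<xi>2) l))"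
      unfolding Psi_pt[OF r d1(2,3)] Phi_g3[OF A0(1)[OF r] A0(2)[OF r] x4 d2(2,3) x1 d2(1)] Phi_pt[OF r t12 x0 s12] expo12
        ratio12[OF one_neq_zero r] ratio12[OF r one_neq_zero]
      by (cases fl) (simp_all add: mult.commute)
  qed
  show "compose (carrier SA) (endo (yPhi s1 t1 \<xi>1)) (endo (yPsi s2 t2 \<xi>2)) = endo (yPhi (s1 * (2 * s2 + t2) + s2 * t1) (t1 * t2) (\<xi>1 ^ (2 * s2 + 1) * \<xi>2))"
  proof (rule endo_compose[OF good_Phi[OF ok1] good_Psi[OF ok2]])
    fix fl w r assume "w ^ (2 * N) = muf fl" "r ^ n = lamf fl"
    then have r: "r \<noteq> 0" using root_nz(2) by blast
    show "(\<lambda>l. ev (\<lambda>l. ev (gfam fl w 1 r) (yPhi s1 t1 \<xi>1 l)) (yPsi s2 t2 \<xi>2 l)) =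
      (\<lambda>l. ev (gfam fl w 1 r) (yPhi (s1 * (2 * s2 + t2) + s2 * t1) (t1 * t2) (\<xi>1 ^ (2 * s2 + 1) * \<xi>2) l))"
      unfolding Phi_pt[OF r d1(2,3,1)] Psi_g3[OF A0(2)[OF r] A0(1)[OF r] x4 d2(2,3) x1] Phi_pt[OF r t12 x0 s12] expo12
        ratio12[OF one_neq_zero r] ratio12[OF r one_neq_zero]
      by (cases fl) (simp_all add: mult.commute)
  qed
qed

end


subsection \<open>Bijectivity\<close>

text \<open>\<open>g\<close> has the left inverse \<open>f\<close> and the right inverse
  \<open>h\<close>; these agree, so \<open>g\<close> is a two-sided inverse of
  \<open>f\<close>.\<close>

lemma bij_from_inverses:
  assumes "compose S f g = (\<lambda>x\<in>S. x)" "compose S g h = (\<lambda>x\<in>S. x)"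
    and "f \<in> S \<rightarrow> S" "g \<in> S \<rightarrow> S" "h \<in> S \<rightarrow> S"
  shows "bij_betw f S S"
proof (rule bij_betw_byWitness[where f' = g])
  have fg: "f (g x) = x" and gh: "g (h x) = x" if "x \<in> S" for x
    using assms(1,2) that by (metis compose_eq restrict_apply')+
  show "\<forall>x\<in>S. f (g x) = x" using fg by blast
  show "\<forall>x\<in>S. g (f x) = x"
  proof
    fix x assume x: "x \<in> S"
    have "f (g (h x)) = h x" using fg assms(5) x by blast
    then show "g (f x) = x" using gh[OF x] by simp
  qed
qed (use assms(3,4) in auto)

lemma endo_funcset: "good y \<Longrightarrow> endo y \<in> carrier SA \<rightarrow> carrier SA"
  using alg_homD(1)[OF endo_hom] by blast

lemma okP_odd: "okP s t \<xi> \<Longrightarrow> odd t" by (simp add: okP_def)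

text \<open>\<lambda> and \<mu> are signs, so \<open>r^(2*n) = 1\<close> and
  \<open>w^(4*N) = 1\<close> at all points. The modulus for \<open>T\<close> is \<open>4*n\<close>
  because \<open>r\<close> only sees half of \<open>T - 1\<close>.\<close>

lemma Psi_identity:
  assumes "S \<ge> 1" "T = 4 * n * q + 1" "2 * S + T = 4 * N * q' + 1"
  shows "endo (yPsi S T 1) = (\<lambda>X\<in>carrier SA. X)"
proof -
  have T: "T = Suc (2 * (2 * n * q))" using assms(2) by simp
  have ok: "okP S T 1" using assms(1) T by (simp add: okP_def)
  have eq: "yPsi S T 1 (i, j) \<sim>\<^sub>I gx i j" for i j
  proof (rule faithful)
    fix fl w r assume wr: "w ^ (2 * N) = muf fl" "r ^ n = lamf fl"
    have r: "r \<noteq> 0" using root_nz(2)[OF wr(2)] .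
    have "r ^ (2 * n * q) = ((r ^ n)\<^sup>2) ^ q" by (simp add: mult_ac flip: power_mult)
    then have r1: "r ^ (2 * n * q) = 1" by (simp add: wr)
    have "w ^ (4 * N * q' + 1) = ((w ^ (2 * N))\<^sup>2) ^ q' * w" by (simp add: mult_ac flip: power_mult)
    then have w1: "w ^ (2 * S + T) = w" by (simp add: assms(3) wr)
    have "(\<lambda>l. ev (gfam fl w 1 r) (yPsi S T 1 l)) = gfam fl w 1 r"
      unfolding Psi_pt[OF r T one_neq_zero] w1 using r1 by (simp add: power_divide gfam_g3)
    then show "ev (gfam fl w 1 r) (yPsi S T 1 (i, j)) = ev (gfam fl w 1 r) (gx i j)"
      by (metis ev_simps(6))
  qed
  show ?thesis
  proof (rule extensionalityI[OF endo_ext])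
    fix X assume X: "X \<in> carrier SA"
    have "endo (yPsi S T 1) X = (\<lambda>X. X) X"
    proof (rule alg_hom_SA_eqI[OF endo_hom[OF good_Psi[OF ok]] _ _ X])
      show "(\<lambda>X. X) \<in> alg_hom SA SA" by (rule alg_homI) auto
      show "endo (yPsi S T 1) (cls (gx i j)) = cls (gx i j)" for i j
        using eq by (simp add: endo_cls[OF good_Psi[OF ok]] cls_eq_iff)
    qed
    then show "endo (yPsi S T 1) X = (\<lambda>X\<in>carrier SA. X) X" using X by simp
  qed simp
qed

lemma coprime_odd_4: "odd x \<Longrightarrow> coprime x (4::nat)"
  using coprime_power_right_iff[of x 2 2] by (simp add: coprime_right_2_iff_odd)

lemma coprime_mult_Suc: "coprime (k * m + 1) (m::nat)"
  using gcd_add_mult[of m k 1] by (simp add: coprime_iff_gcd_eq_1 gcd.commute)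

text \<open>\<open>t'\<close> inverts \<open>t\<close> modulo \<open>4*n\<close>,
  \<open>2*s' + t'\<close> inverts \<open>2*s + t\<close> modulo \<open>4*N\<close>, and
  \<open>\<xi>'\<close> cancels the twist. Coprimality to the factor 4 is automatic for odd
  numbers.\<close>

lemma Psi_right_inverse:
  assumes ok: "okP s t \<xi>" and cop: "coprime (2 * s + t) N" "coprime n t"
  obtains s' t' \<xi>' where "okP s' t' \<xi>'" "coprime (2 * s' + t') N" "coprime n t'"
    "compose (carrier SA) (endo (yPsi s t \<xi>)) (endo (yPsi s' t' \<xi>')) = (\<lambda>X\<in>carrier SA. X)"
proof -
  have t: "odd t" "t \<noteq> 0" using okP_odd[OF ok] by (auto elim: oddE)
  have "coprime t (4 * n)" using cop(2) coprime_odd_4[OF t(1)] by (simp add: coprime_commute)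
  obtain t' q where q: "t * t' = 4 * n * q + 1"
    using bezout_nat[OF t(2), of "4 * n"] \<open>coprime t (4 * n)\<close> by auto
  let ?u = "2 * s + t"
  have "coprime ?u (4 * N)" using cop(1) coprime_odd_4[of ?u] t(1) by simp
  then obtain v q0 where q0: "?u * v = 4 * N * q0 + 1"
    using bezout_nat[of ?u "4 * N"] t(2) by auto
  \<comment> \<open>Adding a multiple of the modulus keeps the inverse and makes \<open>v'\<close>
    exceed \<open>t'\<close> by at least 2, so that \<open>s'\<close> is a positive natural
    number.\<close>
  define v' where "v' = v + 4 * N * (t' + 2)"
  define q' where "q' = q0 + ?u * (t' + 2)"
  have q': "?u * v' = 4 * N * q' + 1" unfolding v'_def q'_def using q0 by (simp add: algebra_simps)
  have odd: "odd t'" "odd v'"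
    using arg_cong[OF q, of odd] arg_cong[OF q', of odd] by simp_all
  have "v' \<ge> t' + 2" unfolding v'_def using mult_le_mono1[of 1 "4 * N" "t' + 2"] N by simp
  define s' where "s' = (v' - t') div 2"
  have v': "v' = 2 * s' + t'" "s' \<ge> 1"
    using odd \<open>v' \<ge> t' + 2\<close> unfolding s'_def by auto
  define \<xi>' where "\<xi>' = inverse (\<xi> ^ (2 * s' + 1))"
  note d = okPD[OF ok]
  have pw: "(\<xi> ^ (2 * s' + 1)) ^ k = 1" if "\<xi> ^ k = 1" for k
    using that by (metis mult.commute power_mult power_one)
  have ok': "okP s' t' \<xi>'"
    using v'(2) odd(1) d(4-6)[THEN pw] by (simp add: okP_def \<xi>'_def power_inverse del: power_Suc)
  have cop': "coprime (2 * s' + t') N" "coprime n t'"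
  proof -
    have "coprime (?u * v') N" unfolding q' using coprime_mult_Suc[of "4 * q'" N] by (simp add: ac_simps)
    then show "coprime (2 * s' + t') N" by (simp add: v')
    have "coprime n (t * t')" unfolding q using coprime_mult_Suc[of "4 * q" n] by (simp add: ac_simps coprime_commute)
    then show "coprime n t'" by simp
  qed
  have e: "2 * (s * (2 * s' + t') + s' * t) + t * t' = ?u * v'" unfolding v' by (simp add: algebra_simps)
  have "compose (carrier SA) (endo (yPsi s t \<xi>)) (endo (yPsi s' t' \<xi>')) = endo (yPsi (s * (2 * s' + t') + s' * t) (t * t') 1)"
  proof -
    have "\<xi> ^ (2 * s' + 1) * \<xi>' = 1" unfolding \<xi>'_def by (rule right_inverse) (use d(3) in simp)
    then show ?thesis unfolding compose_PP(1)[OF ok ok'] by (simp only:)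
  qed
  also have "\<dots> = (\<lambda>X\<in>carrier SA. X)"
    by (rule Psi_identity[OF _ q]) (use e q' d(1) odd in \<open>auto elim: oddE\<close>)
  finally show ?thesis using that ok' cop' by blast
qed

lemma Psi_bij:
  assumes ok: "okP s t \<xi>" and cop: "coprime (2 * s + t) N" "coprime n t"
  shows "bij_betw (endo (yPsi s t \<xi>)) (carrier SA) (carrier SA)"
proof -
  obtain s' t' \<xi>' where 1: "okP s' t' \<xi>'" "coprime (2 * s' + t') N" "coprime n t'"
    "compose (carrier SA) (endo (yPsi s t \<xi>)) (endo (yPsi s' t' \<xi>')) = (\<lambda>X\<in>carrier SA. X)"
    using Psi_right_inverse[OF assms] .
  obtain s'' t'' \<xi>'' where 2: "okP s'' t'' \<xi>''"
    "compose (carrier SA) (endo (yPsi s' t' \<xi>')) (endo (yPsi s'' t'' \<xi>'')) = (\<lambda>X\<in>carrier SA. X)"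
    using Psi_right_inverse[OF 1(1-3)] .
  show ?thesis
    by (rule bij_from_inverses[OF 1(4) 2(2)]) (use ok 1 2 endo_funcset good_Psi in blast)+
qed

lemma bij_from_compose:
  assumes "bij_betw (compose S f g) S S" "bij_betw (compose S h f) S S" "f \<in> S \<rightarrow> S" "g \<in> S \<rightarrow> S"
  shows "bij_betw f S S"
proof -
  have "inj_on f S"
  proof (rule inj_onI)
    fix x y assume "x \<in> S" "y \<in> S" "f x = f y"
    then show "x = y" using assms(2) by (metis bij_betw_imp_inj_on compose_eq inj_onD)
  qed
  moreover have "f ` S = S"
  proof
    show "f ` S \<subseteq> S" using assms(3) by auto
    show "S \<subseteq> f ` S"
    proof
      fix y assume "y \<in> S"
      then obtain x where "x \<in> S" "compose S f g x = y" using assms(1) unfolding bij_betw_def by (metis imageE)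
      then show "y \<in> f ` S" using assms(4) by (auto simp: compose_eq)
    qed
  qed
  ultimately show ?thesis by (simp add: bij_betw_def)
qed

text \<open>The square of \<Phi> is a \<Psi> satisfying the same coprimality conditions, because its
  \<open>2*S + T\<close> is the square of \<open>2*s + t\<close>.\<close>

lemma Phi_bij:
  assumes ok: "okP s t \<xi>" and cop: "coprime (2 * s + t) N" "coprime n t"
  shows "bij_betw (endo (yPhi s t \<xi>)) (carrier SA) (carrier SA)"
proof -
  let ?S = "s * (2 * s + t) + s * t" and ?X = "\<xi> ^ (2 * s - 1) * \<xi>"
  note d = okPD[OF ok]
  have X: "?X = \<xi> ^ (2 * s)" using d(1) by (cases s) (simp_all add: mult.commute)
  have pw: "(\<xi> ^ (2 * s)) ^ k = 1" if "\<xi> ^ k = 1" for k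
    using that by (metis mult.commute power_mult power_one)
  have ok': "okP ?S (t * t) ?X"
  proof -
    have "?S \<ge> 1" using d(1) okP_odd[OF ok] by (cases t) auto
    then show ?thesis unfolding X using okP_odd[OF ok] d(4-6)[THEN pw] by (simp add: okP_def)
  qed
  have e: "2 * ?S + t * t = (2 * s + t) * (2 * s + t)" by (simp add: algebra_simps)
  have b: "bij_betw (compose (carrier SA) (endo (yPhi s t \<xi>)) (endo (yPhi s t \<xi>))) (carrier SA) (carrier SA)"
    unfolding compose_PP(2)[OF ok ok]
    by (rule Psi_bij[OF ok']) (use cop in \<open>simp_all only: e coprime_mult_left_iff coprime_mult_right_iff\<close>)
  show ?thesis by (rule bij_from_compose[OF b b]) (use good_Phi[OF ok] endo_funcset in blast)+
qed

subsection \<open>Membership in the automorphism group\<close>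

lemma endo_hopf_auto:
  assumes y: "good y" "bij_betw (endo y) (carrier SA) (carrier SA)"
    and s: "s \<ge> 1" and QP: "\<And>l k. Q l One * P One k + Q l Two * P Two k = (if l = k then 1 else (0::'k))"
    and PQ: "\<And>i j. P i One * Q One j + P i Two * Q Two j = (if i = j then 1 else (0::'k))"
    and yc: "\<And>i j. y (i, j) \<sim>\<^sub>I conj_gen s t P Q i j"
  shows "endo y \<in> hopf_auto H"
proof -
  have f: "endo y (cls (gx i j)) = cls (conj_gen s t P Q i j)" for i j
    using yc by (simp add: endo_cls[OF y(1)] cls_eq_iff)
  show ?thesis
    unfolding hopf_auto_def
    using conj_gen_hopf[OF s QP PQ endo_hom[OF y(1)] f] endo_hom[OF y(1)] y(2) endo_ext
    by (simp add: Bij_def)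
qed

text \<open>The defining formulas write the powers with \<open>x11\<close> and \<open>x12\<close>
  throughout; even powers of the two letters of a block agree.\<close>

lemma bas_One_Two: "x12 ^ (2 * s) * chi Two One t \<sim>\<^sub>I bas s t Two One" "x11 ^ (2 * s) * chi Two Two t \<sim>\<^sub>I bas s t Two Two"
  using eqv_mult_r[OF gx_sq_pow[of One Two s], of "chi Two One t"] eqv_mult_r[OF gx_sq_pow[of One One s], of "chi Two Two t"]
  by (simp_all add: bas_def)

lemma Psi_auto:
  assumes ok: "okP s t \<xi>" and cop: "coprime (2 * s + t) N" "coprime n t"
  shows "endo (yPsi s t \<xi>) \<in> hopf_auto H"
proof -
  note d = okPD[OF ok]
  define P where "P = (\<lambda>i j. if i = j then (if i = One then 1 else inverse \<xi>) else (0::'k))"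
  define Q where "Q = (\<lambda>i j. if i = j then (if i = One then 1 else \<xi>) else (0::'k))"
  show ?thesis
  proof (rule endo_hopf_auto[OF good_Psi[OF ok] Psi_bij[OF assms] d(1), of Q P])
    show "yPsi s t \<xi> (i, j) \<sim>\<^sub>I conj_gen s t P Q i j" for i j
      using d(3) bas_One_Two[of s t] by (cases i; cases j) (auto simp: yPsi_def conj_gen_def sum_idx P_def Q_def bas_def intro: eqv_scale)
    show "Q l One * P One k + Q l Two * P Two k = (if l = k then 1 else 0)" for l k
      using d(3) by (cases l; cases k) (auto simp: P_def Q_def)
    show "P l One * Q One k + P l Two * Q Two k = (if l = k then 1 else 0)" for l k
      using d(3) by (cases l; cases k) (auto simp: P_def Q_def)
  qed
qed

lemma Phi_auto:
  assumes ok: "okP s t \<xi>" and cop: "coprime (2 * s + t) N" "coprime n t"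
  shows "endo (yPhi s t \<xi>) \<in> hopf_auto H"
proof -
  note d = okPD[OF ok]
  define P where "P = (\<lambda>i j. if i = j then 0 else (if i = One then 1 else inverse \<xi>) :: 'k)"
  define Q where "Q = (\<lambda>i j. if i = j then 0 else (if i = One then \<xi> else 1) :: 'k)"
  show ?thesis
  proof (rule endo_hopf_auto[OF good_Phi[OF ok] Phi_bij[OF assms] d(1), of Q P])
    show "yPhi s t \<xi> (i, j) \<sim>\<^sub>I conj_gen s t P Q i j" for i j
      using d(3) bas_One_Two[of s t] by (cases i; cases j) (auto simp: yPhi_def conj_gen_def sum_idx P_def Q_def bas_def intro: eqv_scale)
    show "Q l One * P One k + Q l Two * P Two k = (if l = k then 1 else 0)" for l k
      using d(3) by (cases l; cases k) (auto simp: P_def Q_def)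
    show "P l One * Q One k + P l Two * Q Two k = (if l = k then 1 else 0)" for l k
      using d(3) by (cases l; cases k) (auto simp: P_def Q_def)
  qed
qed

subsection \<open>The maps \<open>\<Gamma>\<close>\<close>

lemma fourth_root_inverse: "z ^ 4 = 1 \<Longrightarrow> inverse z = z ^ 3" for z :: 'k
  by (rule inverse_unique) (simp add: numeral_eq_Suc)

text \<open>For \<open>n = 2\<close> and \<lambda> = 1 all ratios are signs, and a sign moves into
  the scale. All letters become multiples of \<open>MJ 1 1\<close>, so evaluating \<Gamma> is scalar
  arithmetic.\<close>

lemma MJ_sign: "e\<^sup>2 = 1 \<Longrightarrow> MJ u e = MJ (e * u) 1" for e :: 'k
  by (auto simp: power2_eq_1_iff MJ_def)

lemma MJ_add: "MJ u 1 + MJ v 1 = MJ (u + v) (1::'k)" "MJ u 1 - MJ v 1 = MJ (u - v) (1::'k)"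
  by (simp_all add: MJ_def m2_defs)

lemma MD_MJ_one [simp]: "MD u 1 * MJ v a = MJ (u * v) a"
  by (simp add: MDJ_mult)

lemma MJ_pow_even: "MJ u 1 ^ (2 * s) = MD (u ^ (2 * s)) (1::'k)"
  by (simp add: power_mult power2_eq_square MDJ_mult MD_power)

lemma Gamma_point_False:
  assumes e: "e\<^sup>2 = 1" and s: "s \<ge> 1"
  shows "ev (gfam False u 1 e) (yGamma s z1 z2 (One, One)) = MJ (u ^ (2 * s) * (u + e * u) / 2) 1"
    and "ev (gfam False u 1 e) (yGamma s z1 z2 (Two, Two)) = MJ (u ^ (2 * s) * (u + e * u) / 2) 1"
    and "ev (gfam False u 1 e) (yGamma s z1 z2 (One, Two)) = MJ (z1 * (u ^ (2 * s) * (u - e * u)) / 2) 1"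
    and "ev (gfam False u 1 e) (yGamma s z1 z2 (Two, One)) = MJ (inverse z1 * (u ^ (2 * s) * (u - e * u)) / 2) 1"
  using s by (simp_all add: yGamma_def MJ_sign[OF e] MJ_add MJ_pow_even power_0_left)

lemma Gamma_point_True:
  assumes e: "e\<^sup>2 = 1" and s: "s \<ge> 1"
  shows "ev (gfam True u 1 e) (yGamma s z1 z2 (One, One)) = MJ (u ^ (2 * s) * (z2 * u + inverse z2 * (e * u)) / 2) 1"
    and "ev (gfam True u 1 e) (yGamma s z1 z2 (Two, Two)) = MJ (- (u ^ (2 * s) * (z2 * u + inverse z2 * (e * u)) / 2)) 1"
    and "ev (gfam True u 1 e) (yGamma s z1 z2 (One, Two)) = MJ (- (z1 * (u ^ (2 * s) * (z2 * u - inverse z2 * (e * u))) / 2)) 1"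
    and "ev (gfam True u 1 e) (yGamma s z1 z2 (Two, One)) = MJ (inverse z1 * (u ^ (2 * s) * (z2 * u - inverse z2 * (e * u))) / 2) 1"
proof -
  have m: "- MJ v 1 = MJ (- v) (1::'k)" "0 - MJ v 1 = MJ (- v) (1::'k)" for v by (simp_all add: MJ_def m2_defs)
  show "ev (gfam True u 1 e) (yGamma s z1 z2 (One, One)) = MJ (u ^ (2 * s) * (z2 * u + inverse z2 * (e * u)) / 2) 1"
    "ev (gfam True u 1 e) (yGamma s z1 z2 (Two, Two)) = MJ (- (u ^ (2 * s) * (z2 * u + inverse z2 * (e * u)) / 2)) 1"
    "ev (gfam True u 1 e) (yGamma s z1 z2 (One, Two)) = MJ (- (z1 * (u ^ (2 * s) * (z2 * u - inverse z2 * (e * u))) / 2)) 1"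
    "ev (gfam True u 1 e) (yGamma s z1 z2 (Two, One)) = MJ (inverse z1 * (u ^ (2 * s) * (z2 * u - inverse z2 * (e * u))) / 2) 1"
    using s by (simp_all add: yGamma_def MJ_sign[OF e] MJ_add MJ_pow_even power_0_left m)
qed

lemma gfam_True_eqI:
  fixes e U x y p q :: 'k
  assumes "f (One, One) = MJ x 1" "f (Two, Two) = MJ y 1" "f (One, Two) = MJ p 1" "f (Two, One) = MJ q 1"
    and "e\<^sup>2 = 1" "x = 0" "y = 0" "p = U" "q = e * U"
  shows "f = gfam True U 1 e"
  by (rule gfam_eqI) (use assms MJ_sign[OF assms(5), of U] in simp_all)

lemma gfam_False_eqI:
  fixes e U x y p q :: 'k
  assumes "f (One, One) = MJ p 1" "f (Two, Two) = MJ q 1" "f (One, Two) = MJ x 1" "f (Two, One) = MJ y 1"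
    and "e\<^sup>2 = 1" "x = 0" "y = 0" "p = U" "q = e * U"
  shows "f = gfam False U 1 e"
  by (rule gfam_eqI) (use assms MJ_sign[OF assms(5), of U] in simp_all)

lemma fourth_root_inverse_mult: "z ^ 4 = 1 \<Longrightarrow> inverse z * x = z\<^sup>2 * (z * x)" for z x :: 'k
  by (simp add: fourth_root_inverse power3_eq_cube power2_eq_square)

lemma fourth_root_sqsq: "z ^ 4 = 1 \<Longrightarrow> (z\<^sup>2)\<^sup>2 = (1::'k)" "z ^ 4 = 1 \<Longrightarrow> (- (z\<^sup>2))\<^sup>2 = (1::'k)"
  by (simp_all flip: power_mult)

text \<open>\<Gamma> moves four families of points, one lemma for each. Diagonal ratio 1 stays;
  diagonal ratio -1 goes to off-diagonal ratio \<open>z1^2\<close>; off-diagonal ratio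
  \<open>z2^2\<close> goes to diagonal ratio -1, and \<open>-(z2^2)\<close> to off-diagonal
  \<open>-(z1^2)\<close>.\<close>

lemma Gamma_F1:
  assumes "s \<ge> 1"
  shows "(\<lambda>l. ev (gfam False u 1 1) (yGamma s z1 z2 l)) = gfam False (u ^ (2 * s + 1)) 1 1"
  by (rule gfam_False_eqI, (rule Gamma_point_False[OF _ assms], simp)+) simp_all

lemma Gamma_F2:
  assumes "s \<ge> 1" "z1 ^ 4 = 1"
  shows "(\<lambda>l. ev (gfam False u 1 (- 1)) (yGamma s z1 z2 l)) = gfam True (z1 * u ^ (2 * s + 1)) 1 (z1\<^sup>2)"
  by (rule gfam_True_eqI, (rule Gamma_point_False[OF _ assms(1)], simp)+)
    (simp_all add: fourth_root_sqsq assms(2) fourth_root_inverse_mult)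

lemma Gamma_T1:
  assumes "s \<ge> 1" "z2 ^ 4 = 1" "e = z2\<^sup>2"
  shows "(\<lambda>l. ev (gfam True u 1 e) (yGamma s z1 z2 l)) = gfam False (z2 * u ^ (2 * s + 1)) 1 (- 1)"
proof -
  have e: "e\<^sup>2 = 1" using assms(2,3) by (simp add: fourth_root_sqsq)
  have z: "inverse z2 * (e * u) = z2 * u" using assms(2,3) by (auto simp: power2_eq_square field_simps)
  show ?thesis
    by (rule gfam_False_eqI, (rule Gamma_point_True[OF e assms(1)])+) (simp_all add: z)
qed

lemma Gamma_T2:
  assumes "s \<ge> 1" "z1 ^ 4 = 1" "z2 ^ 4 = 1" "e = - (z2\<^sup>2)"
  shows "(\<lambda>l. ev (gfam True u 1 e) (yGamma s z1 z2 l)) = gfam True (- (z1 * z2 * u ^ (2 * s + 1))) 1 (- (z1\<^sup>2))"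
proof -
  have e: "e\<^sup>2 = 1" using assms(3,4) fourth_root_sqsq by simp
  have z: "inverse z2 * (e * u) = - (z2 * u)" using assms(3,4) by (auto simp: power2_eq_square field_simps)
  show ?thesis
    by (rule gfam_True_eqI, (rule Gamma_point_True[OF e assms(1)])+)
      (simp_all add: z assms(2) fourth_root_sqsq[OF assms(2)] fourth_root_inverse_mult[OF assms(2)])
qed

lemma PsiPhi_point:
  assumes e: "e\<^sup>2 = 1" and s: "s \<ge> 1"
  shows "ev (gfam False u 1 e) (yPsi s 1 \<xi> (One, One)) = MJ (u ^ (2 * s) * u) 1"
    "ev (gfam False u 1 e) (yPsi s 1 \<xi> (Two, Two)) = MJ (u ^ (2 * s) * (e * u)) 1"
    "ev (gfam False u 1 e) (yPsi s 1 \<xi> (One, Two)) = MJ 0 1"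
    "ev (gfam False u 1 e) (yPsi s 1 \<xi> (Two, One)) = MJ 0 1"
    "ev (gfam True u 1 e) (yPsi s 1 \<xi> (One, One)) = MJ 0 1"
    "ev (gfam True u 1 e) (yPsi s 1 \<xi> (Two, Two)) = MJ 0 1"
    "ev (gfam True u 1 e) (yPsi s 1 \<xi> (One, Two)) = MJ (\<xi> * (u ^ (2 * s) * u)) 1"
    "ev (gfam True u 1 e) (yPsi s 1 \<xi> (Two, One)) = MJ (inverse \<xi> * (u ^ (2 * s) * (e * u))) 1"
    "ev (gfam False u 1 e) (yPhi s 1 \<xi> (One, One)) = MJ (u ^ (2 * s) * (e * u)) 1"
    "ev (gfam False u 1 e) (yPhi s 1 \<xi> (Two, Two)) = MJ (u ^ (2 * s) * u) 1"
    "ev (gfam False u 1 e) (yPhi s 1 \<xi> (One, Two)) = MJ 0 1"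
    "ev (gfam False u 1 e) (yPhi s 1 \<xi> (Two, One)) = MJ 0 1"
    "ev (gfam True u 1 e) (yPhi s 1 \<xi> (One, One)) = MJ 0 1"
    "ev (gfam True u 1 e) (yPhi s 1 \<xi> (Two, Two)) = MJ 0 1"
    "ev (gfam True u 1 e) (yPhi s 1 \<xi> (One, Two)) = MJ (\<xi> * (u ^ (2 * s) * (e * u))) 1"
    "ev (gfam True u 1 e) (yPhi s 1 \<xi> (Two, One)) = MJ (inverse \<xi> * (u ^ (2 * s) * u)) 1"
  using s by (simp_all add: yPsi_def yPhi_def MJ_sign[OF e] MJ_pow_even power_0_left)

lemma Psi_F:
  assumes "e\<^sup>2 = 1" "s \<ge> 1"
  shows "(\<lambda>l. ev (gfam False u 1 e) (yPsi s 1 \<xi> l)) = gfam False (u ^ (2 * s + 1)) 1 e"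
  by (rule gfam_False_eqI, (rule PsiPhi_point[OF assms])+) (simp_all add: assms(1))

lemma Psi_T:
  assumes "e\<^sup>2 = 1" "s \<ge> 1" "\<xi> ^ 4 = 1"
  shows "(\<lambda>l. ev (gfam True u 1 e) (yPsi s 1 \<xi> l)) = gfam True (\<xi> * u ^ (2 * s + 1)) 1 (\<xi>\<^sup>2 * e)"
  by (rule gfam_True_eqI, (rule PsiPhi_point[OF assms(1,2)])+)
    (use assms(1,3) in \<open>simp_all add: power_mult_distrib fourth_root_sqsq fourth_root_inverse_mult mult_ac\<close>)

lemma Phi_F:
  assumes "e\<^sup>2 = 1" "s \<ge> 1"
  shows "(\<lambda>l. ev (gfam False u 1 e) (yPhi s 1 \<xi> l)) = gfam False (e * u ^ (2 * s + 1)) 1 e"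
proof -
  have e: "e * (e * x) = x" for x using assms(1) by (simp add: power2_eq_square mult.assoc[symmetric])
  show ?thesis
    by (rule gfam_False_eqI, (rule PsiPhi_point[OF assms])+) (simp_all add: assms(1) e)
qed

lemma Phi_T:
  assumes "e\<^sup>2 = 1" "s \<ge> 1" "\<xi> ^ 4 = 1"
  shows "(\<lambda>l. ev (gfam True u 1 e) (yPhi s 1 \<xi> l)) = gfam True (\<xi> * e * u ^ (2 * s + 1)) 1 (\<xi>\<^sup>2 * e)"
proof -
  have e: "e * (e * x) = x" for x using assms(1) by (simp add: power2_eq_square mult.assoc[symmetric])
  have q: "inverse \<xi> * (u ^ (2 * s) * u) = \<xi>\<^sup>2 * e * (\<xi> * e * u ^ (2 * s + 1))"
    using e[of "\<xi> ^ 3 * u ^ (2 * s + 1)"] by (simp add: fourth_root_inverse[OF assms(3)] power3_eq_cube power2_eq_square[of \<xi>] mult_ac)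
  show ?thesis
    by (rule gfam_True_eqI, (rule PsiPhi_point[OF assms(1,2)])+)
      (use assms(1,3) q in \<open>simp_all add: power_mult_distrib fourth_root_sqsq\<close>)
qed

text \<open>The ratios \<open>z1^2\<close> and \<open>z2^2\<close> have to be signs, hence the
  fourth powers; passing between the blocks has to match \<open>w^(2*N) = 1\<close> with
  \<open>w^(2*N) = \<mu>\<close>, hence the last two conditions.\<close>

definition okQ :: "nat \<Rightarrow> 'k \<Rightarrow> 'k \<Rightarrow> bool" where
  "okQ s z1 z2 \<longleftrightarrow> s \<ge> 1 \<and> z1 ^ 4 = 1 \<and> z2 ^ 4 = 1 \<and> z1 ^ (2 * N) = \<mu> \<and> z2 ^ (2 * N) = \<mu>"

text \<open>The conjugating matrices of \<Gamma> for \<open>t = 1\<close>; their common scalar is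
  fixed by the first entry 1 of \<open>gamP\<close>.\<close>

definition gamP :: "'k \<Rightarrow> 'k \<Rightarrow> idx \<Rightarrow> idx \<Rightarrow> 'k" where
  "gamP z1 z2 i j = (if i = One then (if j = One then 1 else inverse z2) else (if j = One then inverse z1 else - (inverse z1 * inverse z2)))"

definition gamQ :: "'k \<Rightarrow> 'k \<Rightarrow> idx \<Rightarrow> idx \<Rightarrow> 'k" where
  "gamQ z1 z2 i j = (if i = One then (if j = One then 1 / 2 else z1 / 2) else (if j = One then z2 / 2 else - (z1 * z2 / 2)))"

context
  assumes n2: "n = 2" and lam1: "lam = 1"
begin

lemma lamf_one: "lamf fl = 1" unfolding lamf_def unfolding lam1 by simp

lemma sat_sign: "e\<^sup>2 = 1 \<Longrightarrow> u ^ (2 * N) = muf fl \<Longrightarrow> sat (gfam fl u 1 e)"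
  by (subst sat_gfam_iff) (auto simp: lamf_one n2)

lemma okQD:
  assumes "okQ s z1 z2"
  shows "s \<ge> 1" "z1 ^ 4 = 1" "z2 ^ 4 = 1" "z1 ^ (2 * N) = \<mu>" "z2 ^ (2 * N) = \<mu>"
  using assms by (auto simp: okQ_def)

lemma fourth_root_cases: "z ^ 4 = 1 \<Longrightarrow> z\<^sup>2 = 1 \<or> z\<^sup>2 = (- 1 :: 'k)"
  using fourth_root_sqsq(1)[of z] power2_eq_1_iff[of "z\<^sup>2"] by simp

lemma sign_facts:
  assumes "r ^ n = lamf fl"
  shows "r\<^sup>2 = 1" "r = 1 \<or> r = - 1" "z ^ 4 = (1::'k) \<Longrightarrow> r = z\<^sup>2 \<or> r = - (z\<^sup>2)"
proof -
  show 1: "r\<^sup>2 = 1" using assms unfolding lamf_one unfolding n2 .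
  then show 2: "r = 1 \<or> r = - 1" by (simp add: power2_eq_1_iff)
  show "z ^ 4 = (1::'k) \<Longrightarrow> r = z\<^sup>2 \<or> r = - (z\<^sup>2)" using 2 fourth_root_cases[of z] by auto
qed

lemma good_Gamma:
  assumes ok: "okQ s z1 z2" shows "good (yGamma s z1 z2)"
  unfolding good_def
proof (intro allI impI)
  fix fl w r assume wr: "w ^ (2 * N) = muf fl" "r ^ n = lamf fl"
  note d = okQD[OF ok]
  note pw = pow_muf[OF wr(1) odd_one, of s]
  note sg = sign_facts[OF wr(2)]
  show "sat (\<lambda>l. ev (gfam fl w 1 r) (yGamma s z1 z2 l))"
  proof (cases fl)
    case False
    show ?thesis
    proof (cases "r = 1")
      case True
      show ?thesis using False pw unfolding True by (simp add: Gamma_F1[OF d(1)] sat_sign del: power_Suc)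
    next
      case r: False
      then have r: "r = - 1" using sg(2) by simp
      show ?thesis using False pw d(4) fourth_root_sqsq[OF d(2)] unfolding r
        by (simp add: Gamma_F2[OF d(1,2)] sat_sign power_mult_distrib del: power_Suc)
    qed
  next
    case True
    show ?thesis
    proof (cases "r = z2\<^sup>2")
      case r: True
      show ?thesis using True pw d(5) Gamma_T1[OF d(1,3) r]
        by (simp add: sat_sign power_mult_distrib del: power_Suc)
    next
      case False
      then have r: "r = - (z2\<^sup>2)" using sg(3)[OF d(3)] by blast
      show ?thesis using True pw d(4,5) Gamma_T2[OF d(1-3) r] fourth_root_sqsq[OF d(2)]
        by (simp add: sat_sign power_mult_distrib del: power_Suc)
    qed
  qed
qed

lemma okP_1: "s \<ge> 1 \<Longrightarrow> \<xi> ^ 4 = 1 \<Longrightarrow> \<xi> ^ (2 * N) = 1 \<Longrightarrow> okP s 1 \<xi>"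
  unfolding okP_def unfolding n2 by simp

lemma odd_pow_four: "z ^ 4 = 1 \<Longrightarrow> (z ^ (2 * s + 1))\<^sup>2 = (z::'k)\<^sup>2"
proof -
  assume z: "z ^ 4 = 1"
  have "(z ^ (2 * s + 1))\<^sup>2 = (z ^ (2 * s) * z ^ (2 * s)) * z\<^sup>2" by (simp add: power2_eq_square mult_ac)
  then show ?thesis using fourth_root_sq[OF z] by simp
qed

lemma odd_pow_minus: "s \<ge> 1 \<Longrightarrow> z ^ (2 * s - 1) * z\<^sup>2 = (z::'k) ^ (2 * s + 1)"
  by (simp flip: power_add)

lemma expo_n2: "(w ^ (2 * s1 + 1)) ^ (2 * s2 + 1) = (w::'k) ^ (2 * (s1 * (2 * s2 + 1) + s2) + 1)"
proof -
  have "(2 * s1 + 1) * (2 * s2 + 1) = 2 * (s1 * (2 * s2 + 1) + s2) + 1" by (simp add: algebra_simps)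
  then show ?thesis by (metis power_mult)
qed

section \<open>Compositions involving \<Gamma>\<close>

text \<open>The off-diagonal ratios are \<open>z^2\<close> and \<open>-(z^2)\<close> for any fourth
  root of unity \<open>z\<close>. Naming them so avoids deciding which one is 1, and
  \<open>z\<close> can be chosen to fit the formulas for \<Gamma>.\<close>

lemma endo_compose_sign:
  assumes "good y1" "good y2"
    and "\<And>w. (\<lambda>l. ev (\<lambda>l. ev (gfam False w 1 1) (y1 l)) (y2 l)) = (\<lambda>l. ev (gfam False w 1 1) (y3 l))"
    and "\<And>w. (\<lambda>l. ev (\<lambda>l. ev (gfam False w 1 (- 1)) (y1 l)) (y2 l)) = (\<lambda>l. ev (gfam False w 1 (- 1)) (y3 l))"
    and "\<And>w e. e = z\<^sup>2 \<Longrightarrow> (\<lambda>l. ev (\<lambda>l. ev (gfam True w 1 e) (y1 l)) (y2 l)) = (\<lambda>l. ev (gfam True w 1 e) (y3 l))"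
    and "\<And>w e. e = - (z\<^sup>2) \<Longrightarrow> (\<lambda>l. ev (\<lambda>l. ev (gfam True w 1 e) (y1 l)) (y2 l)) = (\<lambda>l. ev (gfam True w 1 e) (y3 l))"
    and z: "z ^ 4 = (1::'k)"
  shows "compose (carrier SA) (endo y1) (endo y2) = endo y3"
proof (rule endo_compose[OF assms(1,2)])
  fix fl w r assume wr: "w ^ (2 * N) = muf fl" "r ^ n = lamf fl"
  show "(\<lambda>l. ev (\<lambda>l. ev (gfam fl w 1 r) (y1 l)) (y2 l)) = (\<lambda>l. ev (gfam fl w 1 r) (y3 l))"
    using sign_facts(2)[OF wr(2)] sign_facts(3)[OF wr(2) z] assms(3-6) by (cases fl) auto
qed

lemma gfam_cong: "U = U' \<Longrightarrow> E = E' \<Longrightarrow> gfam fl U 1 E = gfam fl U' 1 E'"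
  by simp

lemma neg_odd_power: "(- x) ^ (2 * s + 1) = - ((x::'k) ^ (2 * s + 1))"
  by (rule power_minus_odd) simp

context
  fixes s1 s2 a1 a2 b1 b2 A1 A2
  assumes A: "okQ s1 a1 a2" and B: "okQ s2 b1 b2"
  defines "A1 \<equiv> a1 ^ (2 * s2 + 1)" and "A2 \<equiv> a2 ^ (2 * s2 + 1)"
begin

lemma GG_F1:
  "(\<lambda>l. ev (\<lambda>l. ev (gfam False w 1 1) (yGamma s1 a1 a2 l)) (yGamma s2 b1 b2 l)) = gfam False (w ^ (2 * (s1 * (2 * s2 + 1) + s2) + 1)) 1 1"
  unfolding Gamma_F1[OF okQD(1)[OF A]] Gamma_F1[OF okQD(1)[OF B]] expo_n2 ..

text \<open>The outer map sends this point to an off-diagonal one of ratio \<open>a1^2\<close>;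
  whether the inner map returns it to the diagonal block depends on the sign between
  \<open>a1^2\<close> and \<open>b2^2\<close>. This is the case distinction of the composition
  law.\<close>

lemma GG_F2:
  "b2\<^sup>2 = a1\<^sup>2 \<Longrightarrow> (\<lambda>l. ev (\<lambda>l. ev (gfam False w 1 (- 1)) (yGamma s1 a1 a2 l)) (yGamma s2 b1 b2 l))
    = gfam False (b2 * A1 * w ^ (2 * (s1 * (2 * s2 + 1) + s2) + 1)) 1 (- 1)"
  "b2\<^sup>2 = - (a1\<^sup>2) \<Longrightarrow> (\<lambda>l. ev (\<lambda>l. ev (gfam False w 1 (- 1)) (yGamma s1 a1 a2 l)) (yGamma s2 b1 b2 l))
    = gfam True (- (b1 * b2 * A1 * w ^ (2 * (s1 * (2 * s2 + 1) + s2) + 1))) 1 (- (b1\<^sup>2))"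
proof -
  note dA = okQD[OF A] and dB = okQD[OF B]
  show "b2\<^sup>2 = a1\<^sup>2 \<Longrightarrow> (\<lambda>l. ev (\<lambda>l. ev (gfam False w 1 (- 1)) (yGamma s1 a1 a2 l)) (yGamma s2 b1 b2 l))
    = gfam False (b2 * A1 * w ^ (2 * (s1 * (2 * s2 + 1) + s2) + 1)) 1 (- 1)"
    unfolding Gamma_F2[OF dA(1,2)] A1_def
    by (subst Gamma_T1[OF dB(1,3)]) (simp_all only: power_mult_distrib expo_n2 mult.assoc)
  assume "b2\<^sup>2 = - (a1\<^sup>2)"
  then have "a1\<^sup>2 = - (b2\<^sup>2)" by simp
  then show "(\<lambda>l. ev (\<lambda>l. ev (gfam False w 1 (- 1)) (yGamma s1 a1 a2 l)) (yGamma s2 b1 b2 l))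
    = gfam True (- (b1 * b2 * A1 * w ^ (2 * (s1 * (2 * s2 + 1) + s2) + 1))) 1 (- (b1\<^sup>2))"
    unfolding Gamma_F2[OF dA(1,2)] A1_def
    by (subst Gamma_T2[OF dB(1-3)]) (simp_all only: power_mult_distrib expo_n2 mult.assoc)
qed

lemma GG_T1:
  "e = a2\<^sup>2 \<Longrightarrow> (\<lambda>l. ev (\<lambda>l. ev (gfam True w 1 e) (yGamma s1 a1 a2 l)) (yGamma s2 b1 b2 l))
    = gfam True (b1 * A2 * w ^ (2 * (s1 * (2 * s2 + 1) + s2) + 1)) 1 (b1\<^sup>2)"
  using okQD[OF A] okQD[OF B] unfolding A2_def
  by (simp only: Gamma_T1 Gamma_F2 power_mult_distrib expo_n2 mult.assoc)

lemma GG_T2: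
  "e = - (a2\<^sup>2) \<Longrightarrow> b2\<^sup>2 = a1\<^sup>2 \<Longrightarrow> (\<lambda>l. ev (\<lambda>l. ev (gfam True w 1 e) (yGamma s1 a1 a2 l)) (yGamma s2 b1 b2 l))
    = gfam True (b1 * b2 * A1 * A2 * w ^ (2 * (s1 * (2 * s2 + 1) + s2) + 1)) 1 (- (b1\<^sup>2))"
  "e = - (a2\<^sup>2) \<Longrightarrow> b2\<^sup>2 = - (a1\<^sup>2) \<Longrightarrow> (\<lambda>l. ev (\<lambda>l. ev (gfam True w 1 e) (yGamma s1 a1 a2 l)) (yGamma s2 b1 b2 l))
    = gfam False (- (b2 * A1 * A2 * w ^ (2 * (s1 * (2 * s2 + 1) + s2) + 1))) 1 (- 1)"
proof -
  note dA = okQD[OF A] and dB = okQD[OF B]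
  assume e: "e = - (a2\<^sup>2)"
  show "(\<lambda>l. ev (\<lambda>l. ev (gfam True w 1 e) (yGamma s1 a1 a2 l)) (yGamma s2 b1 b2 l))
    = gfam True (b1 * b2 * A1 * A2 * w ^ (2 * (s1 * (2 * s2 + 1) + s2) + 1)) 1 (- (b1\<^sup>2))" if b: "b2\<^sup>2 = a1\<^sup>2"
    unfolding Gamma_T2[OF dA(1-3) e] A1_def A2_def
    by (subst Gamma_T2[OF dB(1-3)]) (simp_all only: b neg_odd_power power_mult_distrib expo_n2 mult.assoc mult_minus_right minus_minus)
  show "(\<lambda>l. ev (\<lambda>l. ev (gfam True w 1 e) (yGamma s1 a1 a2 l)) (yGamma s2 b1 b2 l))
    = gfam False (- (b2 * A1 * A2 * w ^ (2 * (s1 * (2 * s2 + 1) + s2) + 1))) 1 (- 1)" if b: "b2\<^sup>2 = - (a1\<^sup>2)"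
    unfolding Gamma_T2[OF dA(1-3) e] A1_def A2_def
    by (subst Gamma_T1[OF dB(1,3)]) (simp_all only: b neg_odd_power power_mult_distrib expo_n2 mult.assoc mult_minus_right minus_minus)
qed

lemma GG_sq:
  "A1\<^sup>2 = a1\<^sup>2" "A2\<^sup>2 = a2\<^sup>2" "a1 ^ 4 = 1" "a2 ^ 4 = 1" "b1 ^ 4 = 1" "b2 ^ 4 = 1"
  using okQD[OF A] okQD[OF B] by (simp_all only: A1_def A2_def odd_pow_four)

lemma GG_S: "s1 * (2 * s2 + 1) + s2 \<ge> 1"
  using okQD(1)[OF A] by simp

text \<open>Squares of fourth roots of unity are signs, so \<open>(a1 * b2)^2\<close> tells whether
  \<open>a1^2\<close> and \<open>b2^2\<close> agree.\<close>

lemma GG_eq: "(a1 * b2)\<^sup>2 = 1 \<Longrightarrow> b2\<^sup>2 = a1\<^sup>2" "(a1 * b2)\<^sup>2 = - 1 \<Longrightarrow> b2\<^sup>2 = - (a1\<^sup>2)"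
  using fourth_root_cases[OF GG_sq(3)] fourth_root_cases[OF GG_sq(6)] by (auto simp: power_mult_distrib)

text \<open>For \<open>a1^2 = b2^2\<close> the two exchanges of blocks cancel, and diagonal points
  of ratio -1 are scaled by \<open>A1 * b2\<close>: the value 1 is the action of \<Psi>, the value
  -1 that of \<Phi>.\<close>

lemma GG_Psi:
  assumes "a1 ^ (2 * s2) * a1 * b2 = 1" "(a1 * b2)\<^sup>2 = 1"
  shows "compose (carrier SA) (endo (yGamma s1 a1 a2)) (endo (yGamma s2 b1 b2))
    = endo (yPsi (s1 * (2 * s2 + 1) + s2) 1 (a2 ^ (2 * s2 + 1) * b1))"
proof -
  note sq = GG_sq and b = GG_eq(1)[OF assms(2)]
  have h: "A1 * b2 = 1" using assms(1) by (simp add: A1_def mult_ac)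
  have hW: "b1 * b2 * A1 * A2 * W = A2 * b1 * W" for W using h by Groebner_Basis.algebra
  have X4: "(A2 * b1) ^ 4 = 1" using sq(2,4,5) by Groebner_Basis.algebra
  have e2: "e\<^sup>2 = 1" if "e = a2\<^sup>2 \<or> e = - (a2\<^sup>2)" for e using that fourth_root_sqsq[OF sq(4)] by auto
  show ?thesis
    unfolding A2_def[symmetric]
  proof (rule endo_compose_sign[OF good_Gamma[OF A] good_Gamma[OF B], where z = a2], goal_cases)
    case (1 w)
    show ?case unfolding GG_F1 Psi_F[OF power_one GG_S] ..
  next
    case (2 w)
    show ?case unfolding GG_F2(1)[OF b] by (subst Psi_F[OF _ GG_S]) (use h in \<open>simp_all add: mult.commute\<close>)
  next
    case (3 w e)
    show ?case unfolding GG_T1[OF 3]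
      by (subst Psi_T[OF e2 GG_S X4], use 3 in simp) (rule gfam_cong, simp add: mult_ac, use 3 sq in Groebner_Basis.algebra)
  next
    case (4 w e)
    show ?case unfolding GG_T2(1)[OF 4 b]
      by (subst Psi_T[OF e2 GG_S X4], use 4 in simp) (rule gfam_cong, rule hW, use 4 sq in Groebner_Basis.algebra)
  qed (rule sq(4))
qed

lemma GG_Phi:
  assumes "a1 ^ (2 * s2) * a1 * b2 = - 1" "(a1 * b2)\<^sup>2 = 1"
  shows "compose (carrier SA) (endo (yGamma s1 a1 a2)) (endo (yGamma s2 b1 b2))
    = endo (yPhi (s1 * (2 * s2 + 1) + s2) 1 (a2 ^ (2 * s2 - 1) * b1))"
proof -
  note sq = GG_sq and b = GG_eq(1)[OF assms(2)]
  \<comment> \<open>Stands for the power with truncated exponent; the identities below only involve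
    it through \<open>C * a2^2 = A2\<close>.\<close>
  define C where "C = a2 ^ (2 * s2 - 1)"
  have C: "C * a2\<^sup>2 = A2" unfolding C_def A2_def by (rule odd_pow_minus[OF okQD(1)[OF B]])
  have h: "A1 * b2 = - 1" using assms(1) by (simp add: A1_def mult_ac)
  have hW1: "b1 * A2 * W = C * b1 * a2\<^sup>2 * W" for W unfolding C[symmetric] by (simp only: mult_ac)
  have hW2: "b1 * b2 * A1 * A2 * W = C * b1 * - (a2\<^sup>2) * W" for W
  proof -
    have "b1 * b2 * A1 * A2 * W = b1 * (A1 * b2) * A2 * W" by (simp only: mult_ac)
    then show ?thesis unfolding h C[symmetric] by (simp add: mult_ac)
  qed
  have X4: "(C * b1) ^ 4 = 1" using sq(2,4,5) C by Groebner_Basis.algebra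
  have e2: "e\<^sup>2 = 1" if "e = a2\<^sup>2 \<or> e = - (a2\<^sup>2)" for e using that fourth_root_sqsq[OF sq(4)] by auto
  show ?thesis
    unfolding C_def[symmetric]
  proof (rule endo_compose_sign[OF good_Gamma[OF A] good_Gamma[OF B], where z = a2], goal_cases)
    case (1 w)
    show ?case unfolding GG_F1 Phi_F[OF power_one GG_S] by simp
  next
    case (2 w)
    show ?case unfolding GG_F2(1)[OF b] by (subst Phi_F[OF _ GG_S]) (use h in \<open>simp_all add: mult.commute\<close>)
  next
    case (3 w e)
    show ?case unfolding GG_T1[OF 3]
      by (subst Phi_T[OF e2 GG_S X4], use 3 in simp) (rule gfam_cong, simp only: 3 hW1, use 3 sq C in Groebner_Basis.algebra)
  next
    case (4 w e)
    show ?case unfolding GG_T2(1)[OF 4 b]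
      by (subst Phi_T[OF e2 GG_S X4], use 4 in simp) (rule gfam_cong, simp only: 4 hW2, use 4 sq C in Groebner_Basis.algebra)
  qed (rule sq(4))
qed

lemma GG_Gamma:
  assumes "(a1 * b2)\<^sup>2 = - 1"
  shows "compose (carrier SA) (endo (yGamma s1 a1 a2)) (endo (yGamma s2 b1 b2))
    = endo (yGamma (s1 * (2 * s2 + 1) + s2) (- (b1 * a1 ^ (2 * s2) * a1 * b2)) (- ((a1 * a2) ^ (2 * s2 + 1) * b2)))"
proof -
  note sq = GG_sq and b = GG_eq(2)[OF assms]
  \<comment> \<open>The new parameters are the scale factors that the composite produces at diagonal
    ratio -1 and at off-diagonal ratio \<open>-(a2^2)\<close>.\<close>
  define Z1 where "Z1 = - (b1 * A1 * b2)"
  define Z2 where "Z2 = - (A1 * A2 * b2)"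
  have Z: "- (b1 * a1 ^ (2 * s2) * a1 * b2) = Z1" "- ((a1 * a2) ^ (2 * s2 + 1) * b2) = Z2"
    by (simp_all add: Z1_def Z2_def A1_def A2_def power_mult_distrib mult_ac)
  have Z1sq: "Z1\<^sup>2 = - (b1\<^sup>2)" unfolding Z1_def using sq b by Groebner_Basis.algebra
  have Z2sq: "Z2\<^sup>2 = - (a2\<^sup>2)" unfolding Z2_def using sq b by Groebner_Basis.algebra
  have hW: "b1 * A2 * W = - (Z1 * Z2 * W)" for W unfolding Z1_def Z2_def using sq(1,3) b by Groebner_Basis.algebra
  have Z4: "Z1 ^ 4 = 1" "Z2 ^ 4 = 1" using Z1sq Z2sq sq(4,5) by Groebner_Basis.algebra+
  show ?thesis
    unfolding Z
  proof (rule endo_compose_sign[OF good_Gamma[OF A] good_Gamma[OF B], where z = a2], goal_cases)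
    case (1 w)
    show ?case unfolding GG_F1 Gamma_F1[OF GG_S] ..
  next
    case (2 w)
    show ?case unfolding GG_F2(2)[OF b] Gamma_F2[OF GG_S Z4(1)] Z1sq by (simp add: Z1_def mult_ac)
  next
    case (3 w e)
    have e: "e = - (Z2\<^sup>2)" using 3 Z2sq by simp
    show ?case unfolding GG_T1[OF 3] Gamma_T2[OF GG_S Z4 e]
      by (rule gfam_cong, rule hW, simp add: Z1sq)
  next
    case (4 w e)
    have e: "e = Z2\<^sup>2" using 4 Z2sq by simp
    show ?case unfolding GG_T2(2)[OF 4 b] Gamma_T1[OF GG_S Z4(2) e]
      by (rule gfam_cong) (simp_all add: Z2_def mult_ac)
  qed (rule sq(4))
qed

text \<open>\<open>(a1 * b2)^2\<close> is a sign, as its square is 1, and \<open>A1 * b2\<close> has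
  the same square; if that is 1, then \<open>A1 * b2\<close> is itself a sign.\<close>

lemma GG_trichotomy:
  "a1 ^ (2 * s2) * a1 * b2 = 1 \<and> (a1 * b2)\<^sup>2 = 1 \<or> a1 ^ (2 * s2) * a1 * b2 = - 1 \<and> (a1 * b2)\<^sup>2 = 1 \<or> (a1 * b2)\<^sup>2 = - 1"
proof -
  have "((a1 * b2)\<^sup>2)\<^sup>2 = 1" using GG_sq(3,6) by Groebner_Basis.algebra
  then have 1: "(a1 * b2)\<^sup>2 = 1 \<or> (a1 * b2)\<^sup>2 = - 1" using power2_eq_1_iff by blast
  have "(A1 * b2)\<^sup>2 = (a1 * b2)\<^sup>2" using GG_sq(1) by Groebner_Basis.algebra
  then have "A1 * b2 = 1 \<or> A1 * b2 = - 1" if "(a1 * b2)\<^sup>2 = 1" using that power2_eq_1_iff by metis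
  moreover have "A1 * b2 = a1 ^ (2 * s2) * a1 * b2" by (simp add: A1_def mult_ac)
  ultimately show ?thesis using 1 by auto
qed

end

context
  fixes s1 s2 z1 z2 \<xi>
  assumes A: "okQ s1 z1 z2" and B: "okP s2 1 \<xi>"
begin

lemma GP_S: "s1 * (2 * s2 + 1) + s2 \<ge> 1" "s2 * (2 * s1 + 1) + s1 = s1 * (2 * s2 + 1) + s2"
  using okQD(1)[OF A] by (simp_all add: algebra_simps)

lemma Gamma_Psi:
  "compose (carrier SA) (endo (yGamma s1 z1 z2)) (endo (yPsi s2 1 \<xi>))
    = endo (yGamma (s1 * (2 * s2 + 1) + s2) (z1 ^ (2 * s2 + 1) * \<xi>) (z2 ^ (2 * s2 + 1)))"
proof -
  note dA = okQD[OF A] and dB = okPD[OF B]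
  define A1 where "A1 = z1 ^ (2 * s2 + 1)"
  define A2 where "A2 = z2 ^ (2 * s2 + 1)"
  have sq: "A1\<^sup>2 = z1\<^sup>2" "A2\<^sup>2 = z2\<^sup>2" using dA by (simp_all only: A1_def A2_def odd_pow_four)
  have Z4: "(A1 * \<xi>) ^ 4 = 1" using sq(1) dA(2) dB(4) by Groebner_Basis.algebra
  have Z4': "A2 ^ 4 = 1" using sq(2) dA(3) by Groebner_Basis.algebra
  have e2: "e\<^sup>2 = 1" if "e = z1\<^sup>2 \<or> e = - (z1\<^sup>2)" for e using that fourth_root_sqsq[OF dA(2)] by auto
  show ?thesis
    unfolding A1_def[symmetric] A2_def[symmetric]
  proof (rule endo_compose_sign[OF good_Gamma[OF A] good_Psi[OF B], where z = z2], goal_cases)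
    case (1 w)
    show ?case unfolding Gamma_F1[OF dA(1)] Gamma_F1[OF GP_S(1)] Psi_F[OF power_one dB(1)] expo_n2 ..
  next
    case (2 w)
    show ?case unfolding Gamma_F2[OF dA(1,2)] Gamma_F2[OF GP_S(1) Z4]
      by (subst Psi_T[OF e2 dB(1,4)], simp)
        (rule gfam_cong, simp only: power_mult_distrib expo_n2 A1_def[symmetric] mult.left_commute[of \<xi>] mult.assoc, use sq(1) in Groebner_Basis.algebra)
  next
    case (3 w e)
    have e: "e = A2\<^sup>2" using 3 sq by simp
    show ?case unfolding Gamma_T1[OF dA(1,3) 3] Gamma_T1[OF GP_S(1) Z4' e]
      by (subst Psi_F[OF _ dB(1)], simp) (simp only: power_mult_distrib expo_n2 A2_def)
  next
    case (4 w e)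
    have e: "e = - (A2\<^sup>2)" using 4 sq by simp
    show ?case unfolding Gamma_T2[OF dA(1-3) 4] Gamma_T2[OF GP_S(1) Z4 Z4' e]
      by (subst Psi_T[OF e2 dB(1,4)], simp)
        (rule gfam_cong, simp only: neg_odd_power power_mult_distrib expo_n2 A1_def[symmetric] A2_def[symmetric] mult_minus_right mult.left_commute[of \<xi>] mult.assoc, use sq(1) in Groebner_Basis.algebra)
  qed (rule dA(3))
qed

lemma Gamma_Phi:
  "compose (carrier SA) (endo (yGamma s1 z1 z2)) (endo (yPhi s2 1 \<xi>))
    = endo (yGamma (s1 * (2 * s2 + 1) + s2) (\<xi> * inverse (z1 ^ (2 * s2 + 1))) (- (z2 ^ (2 * s2 + 1))))"
proof -
  note dA = okQD[OF A] and dB = okPD[OF B]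
  define A1 where "A1 = z1 ^ (2 * s2 + 1)"
  define A2 where "A2 = z2 ^ (2 * s2 + 1)"
  have sq: "A1\<^sup>2 = z1\<^sup>2" "A2\<^sup>2 = z2\<^sup>2" using dA by (simp_all only: A1_def A2_def odd_pow_four)
  have A4: "A1 ^ 4 = 1" using sq(1) dA(2) by Groebner_Basis.algebra
  have inv: "\<xi> * inverse A1 = \<xi> * z1\<^sup>2 * A1"
    unfolding fourth_root_inverse[OF A4] using sq(1) by Groebner_Basis.algebra
  have Z4: "(\<xi> * z1\<^sup>2 * A1) ^ 4 = 1" using A4 dA(2) dB(4) by Groebner_Basis.algebra
  have Z4': "(- A2) ^ 4 = 1" using sq(2) dA(3) by Groebner_Basis.algebra
  have sqZ: "\<xi>\<^sup>2 * z1\<^sup>2 = (\<xi> * z1\<^sup>2 * A1)\<^sup>2" "\<xi>\<^sup>2 * - (z1\<^sup>2) = - ((\<xi> * z1\<^sup>2 * A1)\<^sup>2)"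
    using sq(1) dA(2) by Groebner_Basis.algebra+
  have e2: "e\<^sup>2 = 1" if "e = z1\<^sup>2 \<or> e = - (z1\<^sup>2)" for e using that fourth_root_sqsq[OF dA(2)] by auto
  show ?thesis
    unfolding A1_def[symmetric] A2_def[symmetric] inv
  proof (rule endo_compose_sign[OF good_Gamma[OF A] good_Phi[OF B], where z = z2], goal_cases)
    case (1 w)
    show ?case unfolding Gamma_F1[OF dA(1)] Gamma_F1[OF GP_S(1)] Phi_F[OF power_one dB(1)] expo_n2 by simp
  next
    case (2 w)
    show ?case unfolding Gamma_F2[OF dA(1,2)] Gamma_F2[OF GP_S(1) Z4]
      by (subst Phi_T[OF e2 dB(1,4)], simp)
        (rule gfam_cong, simp only: power_mult_distrib expo_n2 A1_def[symmetric] mult.assoc, rule sqZ)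
  next
    case (3 w e)
    have e: "e = (- A2)\<^sup>2" using 3 sq by simp
    show ?case unfolding Gamma_T1[OF dA(1,3) 3] Gamma_T1[OF GP_S(1) Z4' e]
      by (subst Phi_F[OF _ dB(1)], simp) (simp only: power_mult_distrib expo_n2 A2_def mult_minus_left mult_1)
  next
    case (4 w e)
    have e: "e = - ((- A2)\<^sup>2)" using 4 sq by simp
    show ?case unfolding Gamma_T2[OF dA(1-3) 4] Gamma_T2[OF GP_S(1) Z4 Z4' e]
      by (subst Phi_T[OF e2 dB(1,4)], simp)
        (rule gfam_cong, simp only: neg_odd_power power_mult_distrib expo_n2 A1_def[symmetric] A2_def[symmetric] mult_minus_right mult_minus_left minus_minus mult.assoc, rule sqZ)
  qed (rule dA(3))
qed

text \<open>Here \<Psi> moves the point first and multiplies off-diagonal ratios by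
  \<open>\<xi>^2\<close>, so the ratios are named through the second parameter of the
  composite.\<close>

lemma Psi_Gamma:
  "compose (carrier SA) (endo (yPsi s2 1 \<xi>)) (endo (yGamma s1 z1 z2))
    = endo (yGamma (s1 * (2 * s2 + 1) + s2) z1 (\<xi> ^ (2 * s1 + 1) * z2))"
proof -
  note dA = okQD[OF A] and dB = okPD[OF B]
  define X where "X = \<xi> ^ (2 * s1 + 1)"
  have sq: "X\<^sup>2 = \<xi>\<^sup>2" using dB(4) by (simp only: X_def odd_pow_four)
  have Z4: "(X * z2) ^ 4 = 1" using sq dA(3) dB(4) by Groebner_Basis.algebra
  note ex = expo_n2[of _ s2 s1, unfolded GP_S(2)]
  have e2: "e\<^sup>2 = 1" if "e = (X * z2)\<^sup>2 \<or> e = - ((X * z2)\<^sup>2)" for e using that fourth_root_sqsq[OF Z4] by auto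
  show ?thesis
    unfolding X_def[symmetric]
  proof (rule endo_compose_sign[OF good_Psi[OF B] good_Gamma[OF A], where z = "X * z2"], goal_cases)
    case (1 w)
    show ?case unfolding Psi_F[OF power_one dB(1)] Gamma_F1[OF dA(1)] Gamma_F1[OF GP_S(1)] ex ..
  next
    case (2 w)
    show ?case unfolding Gamma_F2[OF GP_S(1) dA(2)]
      by (subst Psi_F[OF _ dB(1)], simp) (simp only: Gamma_F2[OF dA(1,2)] ex)
  next
    case (3 w e)
    have e: "\<xi>\<^sup>2 * e = z2\<^sup>2" using 3 sq dB(4) by Groebner_Basis.algebra
    show ?case unfolding Psi_T[OF e2[OF disjI1[OF 3]] dB(1,4)] Gamma_T1[OF dA(1,3) e] Gamma_T1[OF GP_S(1) Z4 3]
      by (simp only: power_mult_distrib ex X_def[symmetric] mult.assoc) (simp only: mult_ac)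
  next
    case (4 w e)
    have e: "\<xi>\<^sup>2 * e = - (z2\<^sup>2)" using 4 sq dB(4) by Groebner_Basis.algebra
    show ?case unfolding Psi_T[OF e2[OF disjI2[OF 4]] dB(1,4)] Gamma_T2[OF dA(1-3) e] Gamma_T2[OF GP_S(1) dA(2) Z4 4]
      by (simp only: power_mult_distrib ex X_def[symmetric] mult.assoc) (simp only: mult_ac)
  qed (rule Z4)
qed

lemma Phi_Gamma:
  "compose (carrier SA) (endo (yPhi s2 1 \<xi>)) (endo (yGamma s1 z1 z2))
    = endo (yGamma (s1 * (2 * s2 + 1) + s2) (- z1) (\<xi> ^ (2 * s1 - 1) * inverse z2))"
proof -
  note dA = okQD[OF A] and dB = okPD[OF B]
  define X where "X = \<xi> ^ (2 * s1 + 1)"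
  define Y where "Y = \<xi> ^ (2 * s1 - 1)"
  have Y: "Y * \<xi>\<^sup>2 = X" unfolding X_def Y_def by (rule odd_pow_minus[OF dA(1)])
  have sq: "X\<^sup>2 = \<xi>\<^sup>2" using dB(4) by (simp only: X_def odd_pow_four)
  \<comment> \<open>\<open>z2 ^ 3\<close> is the inverse of \<open>z2\<close>; writing it as a power
    keeps all identities polynomial.\<close>
  define Z where "Z = Y * z2 ^ 3"
  have Zsq: "Z\<^sup>2 = \<xi>\<^sup>2 * z2\<^sup>2" using Z_def Y sq dA(3) dB(4) by Groebner_Basis.algebra
  have Z4: "Z ^ 4 = 1" using Zsq dA(3) dB(4) by Groebner_Basis.algebra
  have m4: "(- z1) ^ 4 = 1" using dA(2) by simp
  note ex = expo_n2[of _ s2 s1, unfolded GP_S(2)]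
  have e2: "e\<^sup>2 = 1" if "e = Z\<^sup>2 \<or> e = - (Z\<^sup>2)" for e using that fourth_root_sqsq[OF Z4] by auto
  have eo: "e ^ (2 * s1 + 1) = e" if "e = Z\<^sup>2 \<or> e = - (Z\<^sup>2)" for e using e2[OF that] by (simp add: power_mult)
  show ?thesis
    unfolding Y_def[symmetric] fourth_root_inverse[OF dA(3)] Z_def[symmetric]
  proof (rule endo_compose_sign[OF good_Phi[OF B] good_Gamma[OF A], where z = Z], goal_cases)
    case (1 w)
    show ?case unfolding Phi_F[OF power_one dB(1)] mult_1 Gamma_F1[OF dA(1)] Gamma_F1[OF GP_S(1)] ex ..
  next
    case (2 w)
    show ?case unfolding Gamma_F2[OF GP_S(1) m4]
      by (subst Phi_F[OF _ dB(1)], simp) (simp only: Gamma_F2[OF dA(1,2)] mult_minus_left mult_1 neg_odd_power ex mult_minus_right power2_minus)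
  next
    case (3 w e)
    have e: "\<xi>\<^sup>2 * e = z2\<^sup>2" using 3 Zsq dB(4) by Groebner_Basis.algebra
    have c: "z2 * (X * e) = Z" using 3 Z_def Zsq Y dA(3) dB(4) by Groebner_Basis.algebra
    show ?case unfolding Phi_T[OF e2[OF disjI1[OF 3]] dB(1,4)] Gamma_T1[OF dA(1,3) e] Gamma_T1[OF GP_S(1) Z4 3]
      by (simp only: power_mult_distrib ex X_def[symmetric] eo[OF disjI1[OF 3]] c[symmetric] mult.assoc)
  next
    case (4 w e)
    have e: "\<xi>\<^sup>2 * e = - (z2\<^sup>2)" using 4 Zsq dB(4) by Groebner_Basis.algebra
    have c: "z2 * (X * e) = - Z" using 4 Z_def Zsq Y dA(3) dB(4) by Groebner_Basis.algebra
    have c': "- (z1 * z2 * (X * e * v)) = - (- z1 * Z * v)" for v using c by Groebner_Basis.algebra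
    show ?case unfolding Phi_T[OF e2[OF disjI2[OF 4]] dB(1,4)] Gamma_T2[OF dA(1-3) e] Gamma_T2[OF GP_S(1) m4 Z4 4]
      by (simp only: power_mult_distrib ex X_def[symmetric] eo[OF disjI2[OF 4]] c' power2_minus)
  qed (rule Z4)
qed

end

section \<open>\<Gamma> as a Hopf automorphism\<close>

text \<open>An odd square is 1 modulo 4.\<close>

lemma okQ_pow: "z ^ 4 = 1 \<Longrightarrow> (z::'k) ^ ((2 * s + 1) * (2 * s + 1)) = z"
proof -
  assume z: "z ^ 4 = 1"
  have "(2 * s + 1) * (2 * s + 1) = 4 * (s * s + s) + 1" by (simp add: algebra_simps)
  then have "z ^ ((2 * s + 1) * (2 * s + 1)) = (z ^ 4) ^ (s * s + s) * z" by (simp only: power_add power_mult power_one_right)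
  then show ?thesis using z by simp
qed

lemma inverse_odd_pow:
  assumes "z ^ 4 = 1" "z ^ (2 * N) = \<mu>"
  shows "inverse (z ^ (2 * s + 1)) ^ 4 = 1" "inverse (z ^ (2 * s + 1)) ^ (2 * N) = \<mu>"
proof -
  have "(z ^ (2 * s + 1)) ^ k = (z ^ k) ^ (2 * s + 1)" for k by (simp only: mult.commute flip: power_mult)
  then have "(z ^ (2 * s + 1)) ^ 4 = 1" "(z ^ (2 * s + 1)) ^ (2 * N) = \<mu>"
    using assms odd_power_lamf(2)[of "2 * s + 1" True] by simp_all
  moreover have "inverse \<mu> = \<mu>" by (rule inverse_unique) simp
  ultimately show "inverse (z ^ (2 * s + 1)) ^ 4 = 1" "inverse (z ^ (2 * s + 1)) ^ (2 * N) = \<mu>"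
    by (simp_all only: power_inverse inverse_1)
qed

text \<open>Partners on both sides are chosen so that the composites fall under the first case of
  the composition law and are maps \<Psi>: \<open>c\<close> inverts \<open>z1^(2*s+1)\<close> for
  the right partner, \<open>c'\<close> inverts \<open>z2^(2*s+1)\<close> for the left one.\<close>

lemma Gamma_bij:
  assumes ok: "okQ s z1 z2" and cop: "coprime (2 * s + 1) N"
  shows "bij_betw (endo (yGamma s z1 z2)) (carrier SA) (carrier SA)"
proof -
  note d = okQD[OF ok]
  let ?k = "2 * s + 1"
  have e: "2 * (s * ?k + s) + 1 = ?k * ?k" by (simp add: algebra_simps)
  have bij: "bij_betw (endo (yPsi (s * ?k + s) 1 (x ^ ?k * y))) (carrier SA) (carrier SA)"
    if "x ^ 4 = 1" "y ^ 4 = 1" "x ^ (2 * N) = \<mu>" "y ^ (2 * N) = \<mu>" for x y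
  proof (rule Psi_bij[OF okP_1])
    show "s * ?k + s \<ge> 1" using d(1) by simp
    have "(x ^ ?k) ^ m = (x ^ m) ^ ?k" for m by (simp only: mult.commute flip: power_mult)
    then have xk: "(x ^ ?k) ^ 4 = 1" "(x ^ ?k) ^ (2 * N) = \<mu>"
      using that odd_power_lamf(2)[of ?k True] by (simp_all only: power_one muf_simps odd_two_times_div_two_succ even_mult_iff even_numeral simp_thms odd_one even_add)
    show "(x ^ ?k * y) ^ 4 = 1" "(x ^ ?k * y) ^ (2 * N) = 1"
      unfolding power_mult_distrib xk that by simp_all
    show "coprime (2 * (s * ?k + s) + 1) N" unfolding e using cop by (simp only: coprime_mult_left_iff)
  qed simp
  define c where "c = inverse (z1 ^ ?k)"
  define c' where "c' = inverse (z2 ^ ?k)"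
  have oc: "okQ s z1 c" using d inverse_odd_pow[OF d(2,4), of s] by (simp add: okQ_def c_def)
  have oc': "okQ s c' z2" using d inverse_odd_pow[OF d(3,5), of s] by (simp add: okQ_def c'_def)
  have z0: "z1 \<noteq> 0" "z2 \<noteq> 0" using d(2,3) by auto
  have h1: "z1 ^ (2 * s) * z1 * c = 1" unfolding c_def using z0 by (simp add: field_simps)
  have h2: "c' ^ (2 * s) * c' * z2 = 1"
  proof -
    have "c' ^ (2 * s) * c' = c' ^ ?k" by simp
    also have "\<dots> = inverse (z2 ^ (?k * ?k))" unfolding c'_def by (simp only: power_inverse power_mult)
    finally show ?thesis using okQ_pow[OF d(3), of s] z0 by simp
  qed
  have sq1: "(z1 * c)\<^sup>2 = 1"
  proof -
    have "(z1 ^ ?k)\<^sup>2 = z1\<^sup>2" by (rule odd_pow_four[OF d(2)])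
    then show ?thesis unfolding c_def power_mult_distrib power_inverse using z0 by simp
  qed
  have sq2: "(c' * z2)\<^sup>2 = 1"
  proof -
    have "(z2 ^ ?k)\<^sup>2 = z2\<^sup>2" by (rule odd_pow_four[OF d(3)])
    then show ?thesis unfolding c'_def power_mult_distrib power_inverse using z0 by simp
  qed
  show ?thesis
  proof (rule bij_from_compose)
    show "bij_betw (compose (carrier SA) (endo (yGamma s z1 z2)) (endo (yGamma s z1 c))) (carrier SA) (carrier SA)"
      unfolding GG_Psi[OF ok oc h1 sq1] by (rule bij) (use d in auto)
    show "bij_betw (compose (carrier SA) (endo (yGamma s c' z2)) (endo (yGamma s z1 z2))) (carrier SA) (carrier SA)"
      unfolding GG_Psi[OF oc' ok h2 sq2] by (rule bij) (use d in auto)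
  qed (use good_Gamma ok oc endo_funcset in blast)+
qed

lemma yGamma_conj_gen:
  assumes ok: "okQ s z1 z2"
  shows "yGamma s z1 z2 (i, j) \<sim>\<^sub>I conj_gen s 1 (gamP z1 z2) (gamQ z1 z2) i j"
proof -
  note d = okQD[OF ok]
  have z0: "z1 \<noteq> 0" "z2 \<noteq> 0" using d(2,3) by auto
  show ?thesis
  proof (rule faithful)
    fix fl w r assume wr: "w ^ (2 * N) = muf fl" "r ^ n = lamf fl"
    have b: "ev (gfam fl w 1 r) (bas s 1 k l) = (if (k \<noteq> l) = fl then MJ (w ^ (2 * s + 1) * (if k = One then 1 else r)) 1 else 0)" for k l
      using sign_facts(1,2)[OF wr(2)] ev_bas_neq[OF d(1), of k l fl w 1 r 1] ev_bas[of 1 r k l fl w s 1]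
      by (cases "(k \<noteq> l) = fl") (auto simp: Mx_def MJ_def)
    have bT: "ev (gfam True w 1 r) (bas s (Suc 0) k l) = (if k \<noteq> l then MJ (w ^ (2 * s + 1) * (if k = One then 1 else r)) 1 else 0)" if fl for k l
      using b[of k l] that by simp
    have bF: "ev (gfam False w 1 r) (bas s (Suc 0) k l) = (if k = l then MJ (w ^ (2 * s + 1) * (if k = One then 1 else r)) 1 else 0)" if "\<not> fl" for k l
      using b[of k l] that by simp
    have fin: "m2_scale c (MJ v 1) + m2_scale c' (MJ v' 1) = MJ (c * v + c' * v') 1" for c v c' v' :: 'k
      by (simp add: MJ_add)
    have fin2: "MJ v 1 + MJ v' 1 = MJ (v + v') 1" for v v' :: 'k
      using fin[of 1 v 1 v'] by simp
    have neg: "- MJ v 1 = MJ (- v) 1" for v :: 'k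
      using MJ_add(2)[of 0 v] by (simp add: MJ_def m2_defs)
    show "ev (gfam fl w 1 r) (yGamma s z1 z2 (i, j)) = ev (gfam fl w 1 r) (conj_gen s 1 (gamP z1 z2) (gamQ z1 z2) i j)"
      using sign_facts(1)[OF wr(2)] d(1) z0
      by (cases fl; cases i; cases j)
        (simp_all add: Gamma_point_True Gamma_point_False conj_gen_def sum_idx bT bF fin fin2 neg gamP_def gamQ_def field_simps)
  qed
qed

lemma Gamma_auto:
  assumes ok: "okQ s z1 z2" and cop: "coprime (2 * s + 1) N"
  shows "endo (yGamma s z1 z2) \<in> hopf_auto H"
proof -
  note d = okQD[OF ok]
  have z0: "z1 \<noteq> 0" "z2 \<noteq> 0" using d(2,3) by auto
  show ?thesis
  proof (rule endo_hopf_auto[OF good_Gamma[OF ok] Gamma_bij[OF assms] d(1), of "gamQ z1 z2" "gamP z1 z2"])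
    show "gamQ z1 z2 l One * gamP z1 z2 One k + gamQ z1 z2 l Two * gamP z1 z2 Two k = (if l = k then 1 else 0)" for l k
      using z0 by (cases l; cases k) (auto simp: gamP_def gamQ_def field_simps)
    show "gamP z1 z2 l One * gamQ z1 z2 One k + gamP z1 z2 l Two * gamQ z1 z2 Two k = (if l = k then 1 else 0)" for l k
      using z0 by (cases l; cases k) (auto simp: gamP_def gamQ_def field_simps)
  qed (rule yGamma_conj_gen[OF ok])
qed

end

end

section \<open>Hopf automorphisms and matrix coalgebras\<close>

text \<open>The matrices \<open>r k l\<close> are matrix units. \<open>r One One\<close> times the
  nonzero \<open>r Two Two\<close> is 0, so \<open>r One One\<close> has determinant 0 and is a
  column times a row. The columns of \<open>r k One\<close> and the rows of \<open>r One l\<close>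
  at the same place give \<open>P\<close> and \<open>Q\<close>.\<close>

lemma matrix_units_obtain:
  fixes r :: "idx \<Rightarrow> idx \<Rightarrow> idx \<Rightarrow> idx \<Rightarrow> 'k::field"
  assumes mul: "\<And>k l k' l' i j. r k l i One * r k' l' One j + r k l i Two * r k' l' Two j = (if l = k' then r k l' i j else 0)"
    and nz: "r k0 l0 i0 j0 \<noteq> 0"
  obtains P Q where "\<And>k l i j. r k l i j = P i k * Q l j"
    "\<And>l k. Q l One * P One k + Q l Two * P Two k = (if l = k then 1 else 0)"
    "\<And>i j. P i One * Q One j + P i Two * Q Two j = (if i = j then 1 else 0)"
proof -
  have fac: "r k l i j = r k m i One * r m l One j + r k m i Two * r m l Two j" for k l m i j
    using mul[of k m i m l j] by simp
  \<comment> \<open>Every unit factors through each diagonal unit, so one nonzero entry forces all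
    diagonal units to be nonzero.\<close>
  have nz': "\<exists>i j. r m m i j \<noteq> 0" for m
  proof (rule ccontr)
    assume "\<not> ?thesis"
    then have "r m m i j = 0" for i j by blast
    then have "r k m i j = 0" for k i j using fac[of k m i j m] by simp
    then show False using nz fac[of k0 l0 i0 j0 m] by simp
  qed
  obtain i1 j1 where c: "r One One i1 j1 \<noteq> 0" using nz'[of One] by blast
  obtain i2 j2 where c2: "r Two Two i2 j2 \<noteq> 0" using nz'[of Two] by blast
  have det: "r One One One One * r One One Two Two = r One One One Two * r One One Two One"
  proof -
    have z: "r One One i One * r Two Two One j + r One One i Two * r Two Two Two j = 0" for i j
      using mul[of One One i Two Two j] by simp
    let ?d = "r One One One One * r One One Two Two - r One One One Two * r One One Two One"
    have "?d * r Two Two One j2 = 0" "?d * r Two Two Two j2 = 0"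
      using z[of One j2] z[of Two j2] by Groebner_Basis.algebra+
    then have "?d * r Two Two i2 j2 = 0" by (cases i2) simp_all
    then show ?thesis using c2 by simp
  qed
  \<comment> \<open>A nonzero entry in the chosen row and column normalizes the one against the
    other.\<close>
  define c where "c = r One One i1 j1"
  have c0: "c \<noteq> 0" using c by (simp add: c_def)
  define P where "P i k = r k One i j1" for i k
  define Q where "Q l j = r One l i1 j / c" for l j
  have rank1: "r One One i j = P i One * Q One j" for i j
  proof -
    have "r One One i j * r One One i1 j1 = r One One i j1 * r One One i1 j"
      using det by (cases i; cases j; cases i1; cases j1) (simp_all add: mult_ac)
    then show ?thesis using c0 by (simp add: P_def Q_def field_simps c_def)
  qed
  have P: "P i k = r k One i One * P One One + r k One i Two * P Two One" for i k
    unfolding P_def by (rule fac)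
  have Q: "Q l j = Q One One * r One l One j + Q One Two * r One l Two j" for l j
    unfolding Q_def using fac[of One l i1 j One] by (simp add: add_divide_distrib)
  have r: "r k l i j = P i k * Q l j" for k l i j
  proof -
    have "r One l m j = P m One * Q l j" for m
      using fac[of One l m j One] unfolding rank1 Q[of l j] by (simp add: algebra_simps)
    then show ?thesis using fac[of k l i j One] unfolding P[of i k] by (simp add: algebra_simps)
  qed
  have QP: "Q l One * P One k + Q l Two * P Two k = (if l = k then 1 else 0)" for l k
  proof -
    have "Q l One * P One k + Q l Two * P Two k = (r One l i1 One * r k One One j1 + r One l i1 Two * r k One Two j1) / c"
      by (simp add: P_def Q_def add_divide_distrib)
    also have "\<dots> = (if l = k then 1 else 0)" using c0 unfolding mul by (simp add: c_def)
    finally show ?thesis .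
  qed
  have PQ: "P i One * Q One j + P i Two * Q Two j = (if i = j then 1 else 0)" for i j
  proof -
    have e: "Q One One * P One One + Q One Two * P Two One = 1" "Q One One * P One Two + Q One Two * P Two Two = 0"
      "Q Two One * P One One + Q Two Two * P Two One = 0" "Q Two One * P One Two + Q Two Two * P Two Two = 1"
      by (simp_all add: QP)
    have "P One One * Q One One + P One Two * Q Two One = 1" "P One One * Q One Two + P One Two * Q Two Two = 0"
      "P Two One * Q One One + P Two Two * Q Two One = 0" "P Two One * Q One Two + P Two Two * Q Two Two = 1"
      using e by Groebner_Basis.algebra+
    then show ?thesis by (cases i; cases j) simp_all
  qed
  show ?thesis using that r QP PQ by blast
qed

context suzuki_params
begin

section \<open>Coefficients of a comultiplicative matrix\<close>

lemma linear_expansion: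
  assumes "\<And>p q. G (p + q) = G p + G q" "\<And>c p. G (c \<cdot> p) = c * G p" "\<And>p. p \<in> I \<Longrightarrow> G p = (0::'k)"
  shows "G p = (\<Sum>b\<in>Idx. Ef b p * G (basp b))"
proof -
  have sum: "G (\<Sum>b\<in>S. c b \<cdot> x b) = (\<Sum>b\<in>S. c b * G (x b))" if "finite S" for c x and S :: "(nat \<times> nat \<times> idx \<times> idx) set"
    using that assms(2)[of 0 0] by (induction S) (simp_all add: assms(1,2))
  have "G (p - (\<Sum>b\<in>Idx. Ef b p \<cdot> basp b)) = 0"
    using basis_expansion[of p] by (intro assms(3)) (simp add: eqv_def)
  then have "G p = G (\<Sum>b\<in>Idx. Ef b p \<cdot> basp b)"
    using assms(1)[of "p - (\<Sum>b\<in>Idx. Ef b p \<cdot> basp b)" "\<Sum>b\<in>Idx. Ef b p \<cdot> basp b"] by simp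
  then show ?thesis by (simp only: sum[OF finite_Idx])
qed

text \<open>Coordinates are constant on cosets, so the chosen representative is immaterial.\<close>

definition cf :: "nat \<times> nat \<times> idx \<times> idx \<Rightarrow> 'k sfree set \<Rightarrow> 'k" where
  "cf b X = Ef b (SOME p. cls p = X)"

lemma cf_cls [simp]: "cf b (cls p) = Ef b p"
proof -
  have "cls (SOME q. cls q = cls p) = cls p" by (rule someI[of _ p]) simp
  then show ?thesis unfolding cf_def cls_eq_iff by (rule Ef_eqv)
qed

lemma linear_form_cf: "linear_form SA (cf b)"
  by (auto simp: linear_form_def carrier_SA cls_simps Ef_linear)

text \<open>\<open>G\<close> is \<phi> \<otimes> \<psi> after the comultiplication. It is described
  both through the basis and directly for a comultiplication with two terms; comparing the two
  descriptions yields equations between coefficients.\<close>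

lemma tensor_form:
  assumes "linear_form SA \<phi>" "linear_form SA \<psi>"
  shows "\<exists>G. (\<forall>p. G p = (\<Sum>b\<in>Idx. Ef b p * G (basp b))) \<and>
    (\<forall>p a b c d. \<Delta>0 p = pt a b \<oplus>\<^bsub>TA\<^esub> pt c d \<longrightarrow> G p = \<phi> (cls a) * \<psi> (cls b) + \<phi> (cls c) * \<psi> (cls d))"
proof -
  obtain F where F: "\<And>X Y. X \<in> carrier TA \<Longrightarrow> Y \<in> carrier TA \<Longrightarrow> F (X \<oplus>\<^bsub>TA\<^esub> Y) = F X + F Y"
    "\<And>c X. X \<in> carrier TA \<Longrightarrow> F (c \<odot>\<^bsub>TA\<^esub> X) = c * F X"
    "\<And>a b. a \<in> carrier SA \<Longrightarrow> b \<in> carrier SA \<Longrightarrow> F (pure_tensor SA SA a b) = \<phi> a * \<psi> b"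
    using T2.tensor_form_exists[OF assms] by blast
  have pt: "F (pt a b) = \<phi> (cls a) * \<psi> (cls b)" for a b by (simp add: pt_def F(3))
  have z: "F \<zero>\<^bsub>TA\<^esub> = 0"
    using F(2)[OF pt_closed, of 0 0 0] by (simp add: pt_simps(7)[symmetric, of 0] flip: pt_simps(3))
  show ?thesis
  proof (intro exI[of _ "\<lambda>p. F (\<Delta>0 p)"] conjI allI impI)
    show "F (\<Delta>0 p) = (\<Sum>b\<in>Idx. Ef b p * F (\<Delta>0 (basp b)))" for p
      by (rule linear_expansion) (simp_all add: \<Delta>0_simps F(1,2) \<Delta>0_I z)
    show "F (\<Delta>0 p) = \<phi> (cls a) * \<psi> (cls b) + \<phi> (cls c) * \<psi> (cls d)" if "\<Delta>0 p = pt a b \<oplus>\<^bsub>TA\<^esub> pt c d" for p a b c d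
      by (simp add: that F(1) pt)
  qed
qed

context
  fixes y :: "idx \<Rightarrow> idx \<Rightarrow> 'k sfree"
  assumes y: "\<And>i j. \<Delta>0 (y i j) = pt (y i One) (y One j) \<oplus>\<^bsub>TA\<^esub> pt (y i Two) (y Two j)"
begin

text \<open>The convolution product of two coordinate functionals is computed on basis elements,
  where it follows the rule of matrix units, and carried to \<open>y\<close> by linearity. For
  lengths strictly between 0 and \<open>n\<close> all four positions are independent, as duality
  requires.\<close>

lemma coef_mult:
  assumes b: "s \<in> {1..N}" "0 < t" "t < n" and b': "(s', t', k', l') \<in> Idx"
  shows "Ef (s, t, k, l) (y i One) * Ef (s', t', k', l') (y One j) + Ef (s, t, k, l) (y i Two) * Ef (s', t', k', l') (y Two j)
    = (if s = s' \<and> t = t' \<and> l = k' then Ef (s, t, k, l') (y i j) else 0)"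
proof -
  obtain G where G': "(\<forall>p. G p = (\<Sum>b\<in>Idx. Ef b p * G (basp b))) \<and> (\<forall>p a b c d. \<Delta>0 p = pt a b \<oplus>\<^bsub>TA\<^esub> pt c d \<longrightarrow>
      G p = cf (s, t, k, l) (cls a) * cf (s', t', k', l') (cls b) + cf (s, t, k, l) (cls c) * cf (s', t', k', l') (cls d))"
    by (rule exE[OF tensor_form[OF linear_form_cf linear_form_cf]])
  note G = conjunct1[OF G', rule_format] conjunct2[OF G', rule_format]
  have st: "(s, t, k, l') \<in> Idx" using b by (simp add: Idx_def)
  have Gb: "G (basp b) = (if b = (s, t, k, l') then (if s = s' \<and> t = t' \<and> l = k' then 1 else 0) else 0)" if bI: "b \<in> Idx" for b
  proof -
    obtain s2 t2 k2 l2 where b2: "b = (s2, t2, k2, l2)" by (cases b)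
    have i2: "s2 \<in> {1..N}" "t2 \<le> n" and i': "s' \<in> {1..N}" "t' \<le> n" using bI b' by (auto simp: b2 Idx_def)
    have e: "Ef (s, t, k, l) (bas s2 t2 k2 m) = (if s = s2 \<and> t = t2 \<and> k = k2 \<and> l = m then 1 else 0)" for m
      using b i2 by (intro Ef_bas) auto
    have e': "Ef (s', t', k', l') (bas s2 t2 m l2) = (if s' = s2 \<and> t' = t2 \<and> k' = m \<and> l' = l2 then 1 else 0)" if "t = t2" for m
      using b i' i2 that by (intro Ef_bas) auto
    have "s2 \<ge> 1" using i2 by simp
    from G(2)[OF \<Delta>0_bas[OF this, of t2 k2 l2]]
    have "G (basp b) = Ef (s, t, k, l) (bas s2 t2 k2 One) * Ef (s', t', k', l') (bas s2 t2 One l2)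
        + Ef (s, t, k, l) (bas s2 t2 k2 Two) * Ef (s', t', k', l') (bas s2 t2 Two l2)"
      by (simp only: b2 cf_cls prod.case)
    then show ?thesis
      unfolding b2 e by (cases "s = s2 \<and> t = t2"; cases l) (auto simp: e')
  qed
  have "G (y i j) = (\<Sum>b\<in>Idx. if b = (s, t, k, l') then Ef b (y i j) * (if s = s' \<and> t = t' \<and> l = k' then 1 else 0) else 0)"
    unfolding G(1)[of "y i j"] by (intro sum.cong) (auto simp: Gb)
  also have "\<dots> = Ef (s, t, k, l') (y i j) * (if s = s' \<and> t = t' \<and> l = k' then 1 else 0)"
    using st by (subst sum.delta[OF finite_Idx]) simp
  finally show ?thesis using G(2)[OF y, of i j] by (simp only: cf_cls) simp
qed

lemma conj_gen_of_interior:
  assumes b: "s \<in> {1..N}" "0 < t" "t < n" and nz: "Ef (s, t, k0, l0) (y i0 j0) \<noteq> 0"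
  obtains P Q where "\<And>i j. y i j \<sim>\<^sub>I conj_gen s t P Q i j"
    "\<And>l k. Q l One * P One k + Q l Two * P Two k = (if l = k then 1 else 0)"
    "\<And>i j. P i One * Q One j + P i Two * Q Two j = (if i = j then 1 else 0)"
proof -
  have st: "(s, t, k, l) \<in> Idx" for k l using b by (simp add: Idx_def)
  have mul: "Ef (s, t, k, l) (y i One) * Ef (s, t, k', l') (y One j) + Ef (s, t, k, l) (y i Two) * Ef (s, t, k', l') (y Two j)
    = (if l = k' then Ef (s, t, k, l') (y i j) else 0)" for k l k' l' i j
    using coef_mult[OF b st] by simp
  obtain P Q where PQ: "\<And>k l i j. Ef (s, t, k, l) (y i j) = P i k * Q l j"
    "\<And>l k. Q l One * P One k + Q l Two * P Two k = (if l = k then 1 else 0)"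
    "\<And>i j. P i One * Q One j + P i Two * Q Two j = (if i = j then 1 else 0)"
    using matrix_units_obtain[of "\<lambda>k l i j. Ef (s, t, k, l) (y i j)", OF mul nz] by metis
  \<comment> \<open>The units at \<open>(s, t)\<close> annihilate a coordinate at any other pair, so
    the rows of \<open>Q\<close> do; multiplying by \<open>P\<close> and using
    \<open>P Q = 1\<close> shows that it vanishes.\<close>
  have other: "Ef b' (y i j) = 0" if b': "b' \<in> Idx" "\<And>k l. b' \<noteq> (s, t, k, l)" for b' i j
  proof -
    obtain s' t' k' l' where bb: "b' = (s', t', k', l')" by (cases b')
    have z: "P i k * (Q k One * Ef b' (y One j) + Q k Two * Ef b' (y Two j)) = 0" for k i
      using coef_mult[OF b, of s' t' k' l' k k i j] b' unfolding bb PQ(1) by (auto simp: algebra_simps)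
    have P0: "P One k \<noteq> 0 \<or> P Two k \<noteq> 0" for k using PQ(2)[of k k] by auto
    have z': "Q k One * Ef b' (y One j) + Q k Two * Ef b' (y Two j) = 0" for k
      using z[of One k] z[of Two k] P0[of k] by (metis mult_eq_0_iff)
    have "Ef b' (y i j) = (P i One * Q One One + P i Two * Q Two One) * Ef b' (y One j) + (P i One * Q One Two + P i Two * Q Two Two) * Ef b' (y Two j)"
      unfolding PQ(3) by (cases i) simp_all
    also have "\<dots> = P i One * (Q One One * Ef b' (y One j) + Q One Two * Ef b' (y Two j)) + P i Two * (Q Two One * Ef b' (y One j) + Q Two Two * Ef b' (y Two j))"
      by (simp only: algebra_simps)
    finally show ?thesis by (simp add: z')
  qed
  have "y i j \<sim>\<^sub>I conj_gen s t P Q i j" for i j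
  proof -
    let ?S = "(\<lambda>(k, l). (s, t, k, l)) ` (UNIV \<times> UNIV)"
    have "(\<Sum>b\<in>Idx. Ef b (y i j) \<cdot> basp b) = (\<Sum>b\<in>?S. Ef b (y i j) \<cdot> basp b)"
      by (rule sum.mono_neutral_right) (use st in \<open>auto simp: other image_iff\<close>)
    also have "\<dots> = (\<Sum>(k, l)\<in>UNIV \<times> UNIV. (P i k * Q l j) \<cdot> bas s t k l)"
      by (subst sum.reindex) (auto simp: inj_on_def PQ(1) intro!: sum.cong)
    also have "\<dots> = conj_gen s t P Q i j" unfolding conj_gen_def by (rule sum.cartesian_product[symmetric])
    finally show ?thesis using basis_expansion[of "y i j"] by simp
  qed
  then show ?thesis using that PQ(2,3) by blast
qed

end

text \<open>At both ends the second row is the first with columns reversed, up to factors, and the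
  factor in the diagonal block is 1. This makes the comultiplication symmetric in its two tensor
  factors.\<close>

lemma boundary_cocommutative:
  assumes \<phi>: "linear_form SA \<phi>" and \<psi>: "linear_form SA \<psi>" and t: "t = 0 \<or> t = n"
  shows "\<phi> (cls (bas s t One One)) * \<psi> (cls (bas s t One l)) + \<phi> (cls (bas s t One Two)) * \<psi> (cls (bas s t Two l))
    = \<psi> (cls (bas s t One One)) * \<phi> (cls (bas s t One l)) + \<psi> (cls (bas s t One Two)) * \<phi> (cls (bas s t Two l))"
proof -
  have "\<exists>c. c (One \<noteq> One) = 1 \<and> (\<forall>l. bas s t Two l \<sim>\<^sub>I c (One \<noteq> swap l) \<cdot> bas s t One (swap l))"
    using t
  proof
    assume t: "t = 0"
    have "bas s t Two l \<sim>\<^sub>I 1 \<cdot> bas s t One (swap l)" for l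
      using bas_0[of s One "swap l"] by (simp add: t)
    then show ?thesis by (intro exI[of _ "\<lambda>_. 1"]) blast
  next
    assume t: "t = n"
    have "bas s t Two l \<sim>\<^sub>I lamf (One \<noteq> swap l) \<cdot> bas s t One (swap l)" for l
      using bas_n[of s One "swap l"] by (simp add: t)
    then show ?thesis by (intro exI[of _ lamf]) simp
  qed
  then obtain c where c: "c (One \<noteq> One) = 1" "cls (bas s t Two l) = c (One \<noteq> swap l) \<odot>\<^bsub>SA\<^esub> cls (bas s t One (swap l))" for l
    unfolding cls_eq_iff[symmetric] cls_simps(3)[symmetric] by metis
  have "\<phi> (cls (bas s t Two l)) = c (One \<noteq> swap l) * \<phi> (cls (bas s t One (swap l)))"
    "\<psi> (cls (bas s t Two l)) = c (One \<noteq> swap l) * \<psi> (cls (bas s t One (swap l)))" for l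
    using \<phi> \<psi> unfolding c(2) linear_form_def by simp_all
  then show ?thesis using c(1) by (cases l) (simp_all add: mult_ac)
qed

section \<open>Shape of a Hopf automorphism on generators\<close>

lemma hopf_autoD:
  assumes "f \<in> hopf_auto H"
  shows "f \<in> alg_hom SA SA" "f \<in> extensional (carrier SA)" "bij_betw f (carrier SA) (carrier SA)"
    "X \<in> carrier SA \<Longrightarrow> suzuki_comult N n \<mu> lam (f X) = tensor_map SA SA SA SA f f (suzuki_comult N n \<mu> lam X)"
  using assms by (auto simp: hopf_auto_def Bij_def)

lemma hopf_auto_gens:
  assumes f: "f \<in> hopf_auto H"
  shows "\<exists>y. (\<forall>i j. f (cls (gx i j)) = cls (y i j)) \<and>
    (\<forall>i j. \<Delta>0 (y i j) = pt (y i One) (y One j) \<oplus>\<^bsub>TA\<^esub> pt (y i Two) (y Two j))"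
proof -
  note d = hopf_autoD[OF f]
  interpret th: tensor_hom SA SA SA SA f f
    using d(1) T2.tensor2_axioms by (simp add: tensor_hom_def tensor_hom_axioms_def)
  have "\<exists>v. f (cls (gx i j)) = cls v" for i j
    using alg_homD(1)[OF d(1) cls_closed] by (auto simp: carrier_SA)
  then obtain y where y: "f (cls (gx i j)) = cls (y i j)" for i j by metis
  have tm: "tensor_map SA SA SA SA f f (pt (gx i k) (gx k j)) = pt (y i k) (y k j)" for i j k
    unfolding pt_def by (subst th.tensor_map_pure) (simp_all add: y)
  have "\<Delta>0 (y i j) = pt (y i One) (y One j) \<oplus>\<^bsub>TA\<^esub> pt (y i Two) (y Two j)" for i j
    using d(4)[OF cls_closed, of "gx i j"] alg_homD(3)[OF th.tensor_map_hom, of "pt (gx i One) (gx One j)" "pt (gx i Two) (gx Two j)"]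
    by (simp add: y comult_cls \<Delta>0_simps(5) Dgen_def tm)
  then show ?thesis using y by blast
qed

lemma gx_bas: "cls (gx i j) = muf (i \<noteq> j) \<odot>\<^bsub>SA\<^esub> cls (bas N 1 i j)"
proof -
  have "bas N 1 i j \<sim>\<^sub>I muf (i \<noteq> j) \<cdot> gx i j" using gx_2N[of i j] by (simp add: bas_def)
  from eqv_scale[OF this, of "muf (i \<noteq> j)"] have "gx i j \<sim>\<^sub>I muf (i \<noteq> j) \<cdot> bas N 1 i j"
    by (simp add: pm_scale_scale eqv_sym)
  then show ?thesis by (simp only: cls_simps cls_eq_iff)
qed

lemma hopf_auto_interior:
  assumes f: "f \<in> hopf_auto H" and y: "\<And>i j. f (cls (gx i j)) = cls (y i j)"
    "\<And>i j. \<Delta>0 (y i j) = pt (y i One) (y One j) \<oplus>\<^bsub>TA\<^esub> pt (y i Two) (y Two j)"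
  shows "\<exists>s\<in>{1..N}. \<exists>t k l i j. 0 < t \<and> t < n \<and> Ef (s, t, k, l) (y i j) \<noteq> 0"
proof (rule ccontr)
  assume no: "\<not> ?thesis"
  note d = hopf_autoD[OF f]
  define g where "g = inv_into (carrier SA) f"
  have gf: "g (f X) = X" if "X \<in> carrier SA" for X
    unfolding g_def using d(3) that by (meson bij_betw_inv_into_left)
  have lin: "linear_form SA (\<lambda>X. cf b (g X))" for b
  proof -
    have ex: "\<exists>Z\<in>carrier SA. X = f Z" if "X \<in> carrier SA" for X
      using d(3) that by (auto simp: bij_betw_def)
    have "cf b (g (X \<oplus>\<^bsub>SA\<^esub> Y)) = cf b (g X) + cf b (g Y)" if XY: "X \<in> carrier SA" "Y \<in> carrier SA" for X Y
    proof -
      obtain Z where Z: "Z \<in> carrier SA" "X = f Z" using ex[OF XY(1)] by blast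
      obtain W where W: "W \<in> carrier SA" "Y = f W" using ex[OF XY(2)] by blast
      have "X \<oplus>\<^bsub>SA\<^esub> Y = f (Z \<oplus>\<^bsub>SA\<^esub> W)" using alg_homD(3)[OF d(1), of Z W] Z W by simp
      then show ?thesis using linear_form_cf[of b] Z W by (simp add: gf linear_form_def)
    qed
    moreover have "cf b (g (c \<odot>\<^bsub>SA\<^esub> X)) = c * cf b (g X)" if X: "X \<in> carrier SA" for c X
    proof -
      obtain Z where Z: "Z \<in> carrier SA" "X = f Z" using ex X by blast
      have "c \<odot>\<^bsub>SA\<^esub> X = f (c \<odot>\<^bsub>SA\<^esub> Z)" using alg_homD(5)[OF d(1), of Z c] Z by simp
      then show ?thesis using linear_form_cf[of b] Z by (simp add: gf linear_form_def)
    qed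
    ultimately show ?thesis by (simp add: linear_form_def)
  qed
  have val: "cf (N, 1, k, l) (g (cls (y i j))) = muf (i \<noteq> j) * (if k = i \<and> l = j then 1 else 0)" for k l i j
  proof -
    have "g (cls (y i j)) = cls (gx i j)" using gf[OF cls_closed, of "gx i j"] by (simp add: y(1))
    moreover have "cf (N, 1, k, l) (cls (gx i j)) = muf (i \<noteq> j) * Ef (N, 1, k, l) (bas N 1 i j)"
      unfolding gx_bas using linear_form_cf[of "(N, 1, k, l)"] by (simp add: linear_form_def del: cf_cls) (simp add: cf_cls)
    moreover have "Ef (N, 1, k, l) (bas N 1 i j) = (if k = i \<and> l = j then 1 else 0)"
      using N n by (subst Ef_bas) auto
    ultimately show ?thesis by simp
  qed
  \<comment> \<open>The coordinates of \<open>x12\<close> and \<open>x21\<close>, pulled back along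
    the inverse of \<open>f\<close>. On the comultiplication of \<open>y One One\<close> one order
    of the two functionals gives \<open>\<mu> * \<mu> = 1\<close>, the other 0, which contradicts
    cocommutativity.\<close>
  let ?\<phi> = "\<lambda>X. cf (N, 1, One, Two) (g X)" and ?\<psi> = "\<lambda>X. cf (N, 1, Two, One) (g X)"
  obtain G where Gx: "(\<forall>p. G p = (\<Sum>b\<in>Idx. Ef b p * G (basp b))) \<and>
    (\<forall>p a b c d. \<Delta>0 p = pt a b \<oplus>\<^bsub>TA\<^esub> pt c d \<longrightarrow> G p = ?\<phi> (cls a) * ?\<psi> (cls b) + ?\<phi> (cls c) * ?\<psi> (cls d))"
    by (rule exE[OF tensor_form[OF lin lin]])
  note G = conjunct1[OF Gx, rule_format] conjunct2[OF Gx, rule_format]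
  obtain G' where G'x: "(\<forall>p. G' p = (\<Sum>b\<in>Idx. Ef b p * G' (basp b))) \<and>
    (\<forall>p a b c d. \<Delta>0 p = pt a b \<oplus>\<^bsub>TA\<^esub> pt c d \<longrightarrow> G' p = ?\<psi> (cls a) * ?\<phi> (cls b) + ?\<psi> (cls c) * ?\<phi> (cls d))"
    by (rule exE[OF tensor_form[OF lin lin]])
  note G' = conjunct1[OF G'x, rule_format] conjunct2[OF G'x, rule_format]
  have "G (y One One) = G' (y One One)"
    unfolding G(1)[of "y One One"] G'(1)[of "y One One"]
  proof (intro sum.cong refl)
    fix b assume bI: "b \<in> Idx"
    obtain s t k l where b: "b = (s, t, k, l)" by (cases b)
    show "Ef b (y One One) * G (basp b) = Ef b (y One One) * G' (basp b)"
    proof (cases "0 < t \<and> t < n")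
      case True
      have "s \<in> {1..N}" using bI by (simp add: b Idx_def)
      then have "Ef b (y One One) = 0" using no True unfolding b by blast
      then show ?thesis by simp
    next
      case False
      then have t: "t = 0 \<or> t = n" and k: "k = One" and s: "s \<ge> 1" using bI by (auto simp: b Idx_def)
      have "G (bas s t One l) = G' (bas s t One l)"
        unfolding G(2)[OF \<Delta>0_bas[OF s]] G'(2)[OF \<Delta>0_bas[OF s]] by (rule boundary_cocommutative[OF lin lin t])
      then show ?thesis by (simp add: b k)
    qed
  qed
  then show False unfolding G(2)[OF y(2)] G'(2)[OF y(2)] val by simp
qed

lemma hopf_auto_conj_gen:
  assumes f: "f \<in> hopf_auto H"
  obtains s t P Q where "s \<in> {1..N}" "0 < t" "t < n" "\<And>i j. f (cls (gx i j)) = cls (conj_gen s t P Q i j)"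
    "\<And>l k. Q l One * P One k + Q l Two * P Two k = (if l = k then 1 else 0)"
    "\<And>i j. P i One * Q One j + P i Two * Q Two j = (if i = j then 1 else 0)"
proof -
  obtain y where y': "(\<forall>i j. f (cls (gx i j)) = cls (y i j)) \<and>
    (\<forall>i j. \<Delta>0 (y i j) = pt (y i One) (y One j) \<oplus>\<^bsub>TA\<^esub> pt (y i Two) (y Two j))"
    by (rule exE[OF hopf_auto_gens[OF f]])
  note y = conjunct1[OF y', rule_format] conjunct2[OF y', rule_format]
  obtain s t k l i j where st: "s \<in> {1..N}" "0 < t" "t < n" "Ef (s, t, k, l) (y i j) \<noteq> 0"
    using hopf_auto_interior[OF f y] by blast
  show ?thesis
  proof (rule conj_gen_of_interior[OF y(2) st])
    fix P Q
    assume yPQ: "\<And>i j. y i j \<sim>\<^sub>I conj_gen s t P Q i j"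
      and QP: "\<And>l k. Q l One * P One k + Q l Two * P Two k = (if l = k then 1 else 0)"
      and PQ: "\<And>i j. P i One * Q One j + P i Two * Q Two j = (if i = j then 1 else 0)"
    have "f (cls (gx i j)) = cls (conj_gen s t P Q i j)" for i j
      unfolding y(1) cls_eq_iff by (rule yPQ)
    then show ?thesis by (rule that[OF st(1-3) _ QP PQ])
  qed
qed

section \<open>Every Hopf automorphism is one of the maps \<open>\<Psi>\<close>, \<open>\<Phi>\<close>, \<open>\<Gamma>\<close>\<close>


abbreviation img :: "(idx \<times> idx \<Rightarrow> 'k sfree) \<Rightarrow> bool \<Rightarrow> 'k \<Rightarrow> 'k \<Rightarrow> idx \<times> idx \<Rightarrow> 'k m2" where
  "img Y fl w r \<equiv> (\<lambda>l. ev (gfam fl w 1 r) (Y l))"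

text \<open>Injectivity of the induced endomorphism, phrased through the points it moves, where
  images are computable.\<close>

definition injective_gens :: "(idx \<times> idx \<Rightarrow> 'k sfree) \<Rightarrow> bool" where
  "injective_gens Y \<longleftrightarrow> (\<forall>p q.
    (\<forall>fl w r. w ^ (2 * N) = muf fl \<longrightarrow> r ^ n = lamf fl \<longrightarrow> ev (img Y fl w r) p = ev (img Y fl w r) q) \<longrightarrow> p \<sim>\<^sub>I q)"

lemma injective_gensD:
  assumes "injective_gens Y"
    and "\<And>fl w r. w ^ (2 * N) = muf fl \<Longrightarrow> r ^ n = lamf fl \<Longrightarrow> ev (img Y fl w r) p = ev (img Y fl w r) q"
    and "w ^ (2 * N) = muf fl" "r ^ n = lamf fl"
  shows "ev (gfam fl w 1 r) p = ev (gfam fl w 1 r) q"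
proof -
  have "p \<sim>\<^sub>I q" using assms(1,2) unfolding injective_gens_def by blast
  then show ?thesis by (rule ev_eqv[OF sat_point[OF assms(3,4)]])
qed

lemma good_sat: "good Y \<Longrightarrow> w ^ (2 * N) = muf fl \<Longrightarrow> r ^ n = lamf fl \<Longrightarrow> sat (img Y fl w r)"
  by (simp add: good_def)

lemma hopf_auto_endo:
  assumes f: "f \<in> hopf_auto H" and Y: "\<And>i j. f (cls (gx i j)) = cls (Y (i, j))"
  shows "good Y" "f = endo Y" "injective_gens Y"
proof -
  note d = hopf_autoD[OF f]
  have c: "cls \<in> alg_hom free_alg SA" by (rule alg_homI) (simp_all add: cls_simps)
  have fsub: "f (cls p) = cls (sub Y p)" for p
  proof -
    have "(f \<circ> cls) p = (cls \<circ> sub Y) p"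
    proof (rule alg_hom_free_eqI[OF alg_hom_compose[OF c d(1)] alg_hom_compose[OF sub_hom c]])
      fix l :: "idx \<times> idx"
      obtain i j where l: "l = (i, j)" by (cases l)
      show "(f \<circ> cls) (Poly_Mapping.single (Word [l]) 1) = (cls \<circ> sub Y) (Poly_Mapping.single (Word [l]) 1)"
        using Y[of i j] sub_gx[of Y i j] by (simp add: gx_def l)
    qed
    then show ?thesis by simp
  qed
  have sub0: "sub Y 0 = 0" unfolding sub_def by (simp add: free_lift_def)
  show g: "good Y"
    unfolding good_def sat_def
  proof (intro allI impI ballI)
    fix fl w r p assume wr: "w ^ (2 * N) = muf fl" "r ^ n = lamf fl" and p: "p \<in> suzuki_rels N n \<mu> lam"
    have "cls p = cls 0" using rels_I[OF p] by (simp add: cls_eq_iff eqv_def)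
    then have "f (cls p) = f (cls 0)" by simp
    then have "sub Y p \<sim>\<^sub>I 0" by (simp only: fsub sub0 cls_eq_iff)
    then show "ev (img Y fl w r) p = 0"
      using ev_eqv[OF sat_point[OF wr], of "sub Y p" 0] by (simp add: ev_sub)
  qed
  show "f = endo Y"
    by (rule extensionalityI[OF d(2) endo_ext]) (auto simp: carrier_SA fsub endo_cls[OF g])
  show "injective_gens Y"
    unfolding injective_gens_def
  proof (intro allI impI)
    fix p q
    assume pq: "\<forall>fl w r. w ^ (2 * N) = muf fl \<longrightarrow> r ^ n = lamf fl \<longrightarrow> ev (img Y fl w r) p = ev (img Y fl w r) q"
    have "sub Y p \<sim>\<^sub>I sub Y q" by (rule faithful) (use pq in \<open>simp add: ev_sub\<close>)
    then have "f (cls p) = f (cls q)" by (simp add: fsub cls_eq_iff)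
    then have "cls p = cls q" using d(3) by (auto simp: bij_betw_def dest: inj_onD)
    then show "p \<sim>\<^sub>I q" by (simp add: cls_eq_iff)
  qed
qed

text \<open>Injectivity carries the commutation back to \<open>x11\<close> and \<open>x22\<close>;
  at diagonal points this says \<open>r^2 = 1\<close> for all \<open>n\<close>-th roots of
  unity.\<close>

lemma commute_imp_n2:
  assumes inj: "injective_gens Y"
    and comm: "\<And>fl w r. w ^ (2 * N) = muf fl \<Longrightarrow> r ^ n = lamf fl \<Longrightarrow>
      img Y fl w r (One, One) * img Y fl w r (Two, Two) = img Y fl w r (Two, Two) * img Y fl w r (One, One)"
  shows "n = 2"
proof -
  have "r powi 2 = 1" if r: "r ^ n = (1::'k)" for r
  proof -
    have "ev (gfam False 1 1 r) (x11 * x22) = ev (gfam False 1 1 r) (x22 * x11)"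
      by (rule injective_gensD[OF inj]) (use comm r in simp_all)
    moreover have "r \<noteq> 0" using root_nz(2)[of r False] r by simp
    ultimately show ?thesis by (simp add: MDJ_mult MD_def power2_eq_square field_simps)
  qed
  then have "int n dvd 2" using all_roots_imp_dvd[of n "1::'k" 2 1] n by auto
  then have "n dvd 2" by presburger
  then show ?thesis using n by (auto dest: dvd_imp_le)
qed

lemma MJ_even_power: "a \<noteq> 0 \<Longrightarrow> MJ u a ^ (2 * k) = MD (u ^ (2 * k)) (1::'k)"
  by (simp add: power_mult power2_eq_square[of "MJ _ _"] MDJ_mult MD_power power2_eq_square)

text \<open>
  If \<open>d = gcd (2 s + t) N > 1\<close> and \<open>k = N / d\<close>, then \<open>x\<^sub>1\<^sub>1\<^sup>4\<^sup>k\<close> and \<open>x\<^sub>1\<^sub>1\<^sup>8\<^sup>k\<close> are distinct with equal images.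
\<close>

lemma coprime_if_periodic:
  assumes inj: "injective_gens Y" and t: "odd t" and z: "\<And>fl. z fl ^ 4 = (1::'k)"
    and per: "\<And>fl w r. w ^ (2 * N) = muf fl \<Longrightarrow> r ^ n = lamf fl \<Longrightarrow>
      img Y fl w r (One, One) = 0 \<or> (\<exists>a. a \<noteq> 0 \<and> img Y fl w r (One, One) = MJ (z fl * w ^ (2 * s + t)) a)"
  shows "coprime (2 * s + t) N"
proof -
  define d where "d = gcd (2 * s + t) N"
  obtain q where q: "2 * s + t = d * q" unfolding d_def by (meson dvdE gcd_dvd1)
  obtain k where k: "N = d * k" unfolding d_def by (meson dvdE gcd_dvd2)
  have k0: "k > 0" using k N by (cases k) auto
  have per': "ev (img Y fl w r) (x11 ^ (4 * k)) = ev (img Y fl w r) (x11 ^ (8 * k))"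
    if wr: "w ^ (2 * N) = muf fl" "r ^ n = lamf fl" for fl w r
    using per[OF wr]
  proof
    assume "img Y fl w r (One, One) = 0"
    then show ?thesis using k0 by (simp add: power_0_left)
  next
    assume "\<exists>a. a \<noteq> 0 \<and> img Y fl w r (One, One) = MJ (z fl * w ^ (2 * s + t)) a"
    then obtain a where a: "a \<noteq> 0" "img Y fl w r (One, One) = MJ (z fl * w ^ (2 * s + t)) a" by blast
    have "(2 * s + t) * (4 * k) = 2 * N * (2 * q)" unfolding q k by simp
    then have "(w ^ (2 * s + t)) ^ (4 * k) = (w ^ (2 * N)) ^ (2 * q)" by (simp only: flip: power_mult)
    also have "\<dots> = 1" unfolding wr(1) by (simp add: power_mult)
    finally have "(z fl * w ^ (2 * s + t)) ^ (4 * k) = 1" by (simp add: power_mult_distrib power_mult[of "z fl"] z)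
    then have *: "(z fl * w ^ (2 * s + t)) ^ (2 * (2 * k)) = 1" by simp
    have "(z fl * w ^ (2 * s + t)) ^ (2 * (4 * k)) = ((z fl * w ^ (2 * s + t)) ^ (2 * (2 * k)))\<^sup>2"
      by (simp only: mult.commute flip: power_mult) (simp add: mult_ac)
    then have **: "(z fl * w ^ (2 * s + t)) ^ (2 * (4 * k)) = 1" by (simp only: * power_one)
    have "img Y fl w r (One, One) ^ (2 * (2 * k)) = img Y fl w r (One, One) ^ (2 * (4 * k))"
      unfolding a(2) MJ_even_power[OF a(1)] * ** ..
    then show ?thesis by simp
  qed
  obtain r0 :: 'k where r0: "r0 ^ n = 1" by (rule that[of 1]) simp
  have "w powi int (4 * k) = 1" if w: "w ^ (2 * N) = (1::'k)" for w
  proof -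
    have "ev (gfam False w 1 1) (x11 ^ (4 * k)) = ev (gfam False w 1 1) (x11 ^ (8 * k))"
      by (rule injective_gensD[OF inj per']) (use w in simp_all)
    then have "MJ w 1 ^ (2 * (2 * k)) = MJ w 1 ^ (2 * (4 * k))" by simp
    then have "w ^ (4 * k) = w ^ (8 * k)" unfolding MJ_pow_even by (simp add: MD_def)
    also have "\<dots> = w ^ (4 * k) * w ^ (4 * k)" by (simp flip: power_add)
    finally have "w ^ (4 * k) = w ^ (4 * k) * w ^ (4 * k)" .
    moreover have "w \<noteq> 0" using root_nz(1)[of w False] w by simp
    ultimately show ?thesis by (simp only: power_int_of_nat) simp
  qed
  then have "int (2 * N) dvd int (4 * k)" by (intro all_roots_imp_dvd[of "2 * N" "1::'k" _ 1]) (use N in simp_all)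
  then have "2 * N dvd 4 * k" by (simp only: of_nat_dvd_iff)
  then have "2 * k * d dvd 2 * k * 2" unfolding k by (simp add: mult_ac)
  then have "d dvd 2" using k0 by (subst (asm) nat_mult_dvd_cancel1) simp_all
  have "odd (d * q)" using t by (simp flip: q)
  then have "odd d" by simp
  have "d \<le> 2" using \<open>d dvd 2\<close> by (rule dvd_imp_le) simp
  then have "d = 0 \<or> d = 1 \<or> d = 2" by auto
  then have "d = 1" using \<open>odd d\<close> by auto
  then show ?thesis by (simp add: d_def coprime_iff_gcd_eq_1)
qed

subsection \<open>The diagonal and antidiagonal cases\<close>

text \<open>\<Psi> and \<Phi> differ here only in whether the new ratio is \<open>r^t\<close> or its
  inverse. The conditions on \<xi> are read off at a single off-diagonal point, the coprimality
  conditions from injectivity.\<close>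

lemma g3_conditions:
  assumes good: "good Y" and inj: "injective_gens Y" and st: "s \<ge> 1" "odd t" and xi: "\<xi> \<noteq> 0"
    and g3: "\<And>fl w r. r \<noteq> 0 \<Longrightarrow> img Y fl w r = g3 fl (if fl then \<xi> else 1) (w ^ (2 * s + t)) (A r) (B r)"
    and AB: "\<And>r. r \<noteq> 0 \<Longrightarrow> A r \<noteq> 0 \<and> B r \<noteq> 0 \<and> (B r / A r = r ^ t \<or> A r / B r = r ^ t)"
  shows "okP s t \<xi>" "coprime (2 * s + t) N" "coprime n t"
proof -
  have g3': "ev (gfam fl w 1 r) (Y l) = g3 fl (if fl then \<xi> else 1) (w ^ (2 * s + t)) (A r) (B r) l" if "r \<noteq> 0" for fl w r l
    using fun_cong[OF g3[OF that]] .
  obtain w :: 'k where w: "w ^ (2 * N) = \<mu>" using nth_root_exists[of "2 * N" \<mu>] N by auto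
  obtain r :: 'k where r: "r ^ n = lam" using nth_root_exists[of n lam] n by auto
  have r0: "r \<noteq> 0" using root_nz(2)[of r True] r by simp
  have w0: "w \<noteq> 0" using root_nz(1)[of w True] w by simp
  let ?W = "w ^ (2 * s + t)"
  have s: "sat (g3 True \<xi> ?W (A r) (B r))"
    using good_sat[OF good, of w True r] w r unfolding g3[OF r0] by simp
  have x4: "\<xi> ^ 4 = 1"
  proof -
    have "MJ (\<xi> * ?W) (A r) * MJ (\<xi> * ?W) (A r) = MJ (?W / \<xi>) (B r) * MJ (?W / \<xi>) (B r)"
      using satD(2)[OF s] by simp
    then have "(\<xi> * ?W) * (\<xi> * ?W) = (?W / \<xi>) * (?W / \<xi>)"
      using AB[OF r0] by (simp add: MDJ_mult MD_def)
    then have "\<xi> ^ 4 * (?W * ?W) = ?W * ?W" using xi by (simp add: field_simps power4_eq_xxxx)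
    then show ?thesis using w0 by simp
  qed
  have nz: "A r \<noteq> 0" "\<xi>\<^sup>2 * B r \<noteq> 0" using AB[OF r0] xi by auto
  have s': "(\<xi> * ?W) ^ (2 * N) = \<mu>" "(\<xi>\<^sup>2 * B r / A r) ^ n = lam"
    using s unfolding g3_gfam[OF x4] sat_gfam_iff[OF nz] by simp_all
  have "?W ^ (2 * N) = \<mu>" using pow_muf[of w True t s] w st by simp
  then have xN: "\<xi> ^ (2 * N) = 1" using s'(1) by (simp add: power_mult_distrib)
  have "(B r / A r) ^ n = lam"
  proof -
    have rt: "(r ^ t) ^ n = lam"
    proof -
      have "(r ^ t) ^ n = (r ^ n) ^ t" by (simp add: mult.commute flip: power_mult)
      then show ?thesis using odd_power_lamf(1)[OF st(2), of True] r by simp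
    qed
    have "(B r / A r) ^ n = inverse ((A r / B r) ^ n)" by (simp add: power_divide)
    moreover have "inverse lam = lam" by (rule inverse_unique) simp
    ultimately show ?thesis using AB[OF r0] rt by auto
  qed
  moreover have "(\<xi>\<^sup>2 * B r / A r) ^ n = \<xi> ^ (2 * n) * (B r / A r) ^ n"
    by (simp only: power_mult power_mult_distrib flip: times_divide_eq_right)
  ultimately have "\<xi> ^ (2 * n) * lam = lam" using s'(2) by simp
  then have "\<xi> ^ (2 * n) = 1" by simp
  then show "okP s t \<xi>" using st x4 xN by (simp add: okP_def)
  show "coprime (2 * s + t) N"
  proof (rule coprime_if_periodic[OF inj st(2), of "\<lambda>_. 1"])
    fix fl w r assume "r ^ n = lamf fl"
    then have "r \<noteq> 0" by (rule root_nz(2))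
    then show "img Y fl w r (One, One) = 0 \<or> (\<exists>a. a \<noteq> 0 \<and> img Y fl w r (One, One) = MJ (1 * w ^ (2 * s + t)) a)"
      unfolding g3'[OF \<open>r \<noteq> 0\<close>] using AB[OF \<open>r \<noteq> 0\<close>] by (cases fl) auto
  qed simp
  \<comment> \<open>For \<open>k = n / d\<close> the elements \<open>(x11 * x22)^k\<close> and
    \<open>x11^(2*k)\<close> have equal images, since \<open>(r^t)^k\<close> is a power of
    \<open>r^n\<close>. Injectivity gives \<open>r^k = 1\<close> for all \<open>n\<close>-th roots
    of unity, so \<open>n\<close> divides \<open>k\<close>.\<close>
  define d where "d = gcd n t"
  obtain k where k: "n = d * k" unfolding d_def by (meson dvdE gcd_dvd1)
  obtain q where q: "t = d * q" unfolding d_def by (meson dvdE gcd_dvd2)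
  have k0: "k > 0" using k n by (cases k) auto
  have per: "ev (img Y fl w r) ((x11 * x22) ^ k) = ev (img Y fl w r) (x11 ^ (2 * k))"
    if wr: "w ^ (2 * N) = muf fl" "r ^ n = lamf fl" for fl w r
  proof -
    have r0: "r \<noteq> 0" using root_nz(2)[OF wr(2)] .
    show ?thesis
    proof (cases fl)
      case True
      then show ?thesis using k0 unfolding ev_power ev_simps g3[OF r0] by (simp add: power_0_left)
    next
      case False
      have "(r ^ t) ^ k = (r ^ n) ^ q" unfolding q k by (simp add: mult_ac flip: power_mult)
      then have "(r ^ t) ^ k = 1" using wr(2) False by simp
      moreover have "(B r / A r) ^ k = inverse ((A r / B r) ^ k)" by (simp add: power_divide)
      ultimately have "(B r / A r) ^ k = 1" using AB[OF r0] by auto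
      moreover have "(MJ W a * MJ W b) ^ k = MD (W ^ (2 * k)) ((b / a) ^ k)" for W a b :: 'k
        by (simp add: MDJ_mult MD_power power_mult power2_eq_square)
      ultimately show ?thesis
        using False AB[OF r0] unfolding ev_power ev_simps g3[OF r0] by (simp only: if_False g3_simps mult_1 div_by_1 MJ_even_power[OF conjunct1[OF AB[OF r0]]])
    qed
  qed
  have "r powi int k = 1" if r: "r ^ n = (1::'k)" for r
  proof -
    have r0: "r \<noteq> 0" using root_nz(2)[of r False] r by simp
    have "ev (gfam False 1 1 r) ((x11 * x22) ^ k) = ev (gfam False 1 1 r) (x11 ^ (2 * k))"
      by (rule injective_gensD[OF inj per]) (use r in simp_all)
    then have "MD 1 (r ^ k) = (MD 1 1 :: 'k m2)"
      by (simp add: MDJ_mult MD_power MJ_even_power)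
    then show ?thesis by (simp add: MD_def)
  qed
  then have "int n dvd int k" by (intro all_roots_imp_dvd[of n "1::'k" _ 1]) (use n in simp_all)
  then have "n dvd k" by (simp only: of_nat_dvd_iff)
  then have "n \<le> k" using k0 by (rule dvd_imp_le)
  then have "d = 1" using k k0 n by (cases d) auto
  then show "coprime n t" by (simp add: d_def coprime_iff_gcd_eq_1)
qed

lemma Psi_ratio: "r \<noteq> 0 \<Longrightarrow> t = Suc (2 * m) \<Longrightarrow> (r * (r / 1) ^ m) / (1 * (1 / r) ^ m) = (r::'k) ^ t"
  by (simp add: field_simps power_mult power2_eq_square power_mult_distrib)

lemma Psi_conditions:
  assumes f: "f \<in> hopf_auto H" and Y: "\<And>i j. f (cls (gx i j)) = cls (yPsi s t \<xi> (i, j))"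
    and st: "s \<ge> 1" "odd t" "\<xi> \<noteq> 0"
  shows "f = endo (yPsi s t \<xi>)" "okP s t \<xi>" "coprime (2 * s + t) N" "coprime n t"
proof -
  note g = hopf_auto_endo[OF f Y]
  obtain m where m: "t = Suc (2 * m)" using st(2) by (auto elim: oddE)
  show "f = endo (yPsi s t \<xi>)" by (rule g(2))
  have AB: "1 * (1 / r) ^ m \<noteq> 0 \<and> r * (r / 1) ^ m \<noteq> 0 \<and> ((r * (r / 1) ^ m) / (1 * (1 / r) ^ m) = r ^ t \<or> (1 * (1 / r) ^ m) / (r * (r / 1) ^ m) = r ^ t)" if "r \<noteq> 0" for r :: 'k
    by (intro conjI disjI1 Psi_ratio[OF that m]) (use that in simp_all)
  show "okP s t \<xi>" "coprime (2 * s + t) N" "coprime n t"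
    by (rule g3_conditions[OF g(1,3) st Psi_pt[OF _ m st(3)] AB], assumption+)+
qed

lemma Phi_conditions:
  assumes f: "f \<in> hopf_auto H" and Y: "\<And>i j. f (cls (gx i j)) = cls (yPhi s t \<xi> (i, j))"
    and st: "s \<ge> 1" "odd t" "\<xi> \<noteq> 0"
  shows "f = endo (yPhi s t \<xi>)" "okP s t \<xi>" "coprime (2 * s + t) N" "coprime n t"
proof -
  note g = hopf_auto_endo[OF f Y]
  obtain m where m: "t = Suc (2 * m)" using st(2) by (auto elim: oddE)
  show "f = endo (yPhi s t \<xi>)" by (rule g(2))
  have AB: "r * (r / 1) ^ m \<noteq> 0 \<and> 1 * (1 / r) ^ m \<noteq> 0 \<and> ((1 * (1 / r) ^ m) / (r * (r / 1) ^ m) = r ^ t \<or> (r * (r / 1) ^ m) / (1 * (1 / r) ^ m) = r ^ t)" if "r \<noteq> 0" for r :: 'k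
    by (intro conjI disjI2 Psi_ratio[OF that m]) (use that in simp_all)
  show "okP s t \<xi>" "coprime (2 * s + t) N" "coprime n t"
    by (rule g3_conditions[OF g(1,3) st Phi_pt[OF _ m st(3,1)] AB], assumption+)+
qed

subsection \<open>Conjugation matrices of automorphisms\<close>

context
  fixes f s t P Q
  assumes f: "f \<in> hopf_auto H" and s: "s \<ge> 1" and t: "0 < t" "t < n"
    and fy: "\<And>i j. f (cls (gx i j)) = cls (conj_gen s t P Q i j)"
    and QP: "\<And>l k. Q l One * P One k + Q l Two * P Two k = (if l = k then 1 else 0)"
    and PQ: "\<And>i j. P i One * Q One j + P i Two * Q Two j = (if i = j then 1 else 0)"
begin

abbreviation (input) Y where "Y \<equiv> (\<lambda>(i, j). conj_gen s t P Q i j)"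

lemma Y_endo: "good Y" "f = endo Y" "injective_gens Y"
  using hopf_auto_endo[OF f, of Y] fy by simp_all

lemma PQ_rels:
  "P One One * Q One One + P One Two * Q Two One = 1" "P One One * Q One Two + P One Two * Q Two Two = 0"
  "P Two One * Q One One + P Two Two * Q Two One = 0" "P Two One * Q One Two + P Two Two * Q Two Two = 1"
  "Q One One * P One One + Q One Two * P Two One = 1" "Q One One * P One Two + Q One Two * P Two Two = 0"
  "Q Two One * P One One + Q Two Two * P Two One = 0" "Q Two One * P One Two + Q Two Two * P Two Two = 1"
  by (simp_all add: PQ QP)

lemma PQ_diag: "P Two One * Q One Two = P One Two * Q Two One" "P Two Two * Q Two Two = P One One * Q One One"
  using PQ_rels by Groebner_Basis.algebra+

lemma img_Y:
  assumes "r \<noteq> 0"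
  shows "img Y fl w r (i, j) = m2_scale (P i One * Q (if fl then Two else One) j) (Mx t (w ^ (2 * s + t)) 1 r)
    + m2_scale (P i Two * Q (if fl then One else Two) j) (Mx t (w ^ (2 * s + t)) r 1)"
proof -
  have e: "ev (gfam fl w 1 r) (bas s t k l) = (if (k \<noteq> l) = fl then Mx t (w ^ (2 * s + t)) (if k = One then 1 else r) (if k = One then r else 1) else 0)" for k l
    using assms s by (simp add: ev_bas ev_bas_neq)
  show ?thesis unfolding prod.case conj_gen_def sum_idx ev_simps e by (cases fl) simp_all
qed

text \<open>For even \<open>t\<close> all images are diagonal matrices, hence commute and force
  \<open>n = 2\<close>; no even \<open>t\<close> lies strictly between 0 and 2.\<close>

lemma t_odd: "odd t"
proof
  assume ev: "even t"
  have "n = 2"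
  proof (rule commute_imp_n2[OF Y_endo(3)])
    fix fl w r assume "r ^ n = lamf fl"
    then have r: "r \<noteq> 0" by (rule root_nz(2))
    show "img Y fl w r (One, One) * img Y fl w r (Two, Two) = img Y fl w r (Two, Two) * img Y fl w r (One, One)"
      unfolding img_Y[OF r] using ev by (simp add: Mx_def MD_def m2_scale_def m2_defs mult.commute)
  qed
  then show False using t ev by (cases t) auto
qed

lemma Mx_odd: "r \<noteq> 0 \<Longrightarrow> \<exists>A B. A \<noteq> 0 \<and> B \<noteq> 0 \<and> B = r ^ t * A \<and> Mx t W 1 r = MJ W A \<and> Mx t W r 1 = MJ W B" for r W :: 'k
proof -
  assume r: "r \<noteq> 0"
  obtain m where m: "t = Suc (2 * m)" using t_odd by (auto elim: oddE)
  have "r * (r / 1) ^ m = r ^ t * (1 * (1 / r) ^ m)"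
    using Psi_ratio[OF r m] r by (simp add: field_simps)
  then show ?thesis
    using r t_odd by (intro exI[of _ "1 * (1 / r) ^ m"] exI[of _ "r * (r / 1) ^ m"]) (simp add: Mx_def m)
qed

text \<open>At a diagonal point with \<open>r^t \<noteq> 1\<close> the image of the letter
  \<open>(i, j)\<close> is invertible, so the relation that it is annihilated by \<open>x11\<close>
  kills the image of \<open>x11\<close>. As the two coefficients of that image sum to 1, this leaves
  \<open>r^t = -1\<close> and both equal to 1/2.\<close>

lemma off_diagonal_roots:
  assumes ij: "i \<noteq> j" and nz: "P i One * Q One j \<noteq> 0" and r: "r ^ n = (1::'k)" "r ^ t \<noteq> 1"
  shows "(r ^ t)\<^sup>2 = 1" "2 * (P One One * Q One One) = 1"
proof -
  have r0: "r \<noteq> 0" using root_nz(2)[of r False] r by simp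
  obtain A B where AB: "A \<noteq> 0" "B \<noteq> 0" "B = r ^ t * A" "Mx t 1 1 r = MJ 1 A" "Mx t 1 r 1 = MJ 1 B"
    using Mx_odd[OF r0] by blast
  have "sat (img Y False 1 r)" using r by (intro good_sat Y_endo) simp_all
  from satD(6)[OF this, of One One i j] have "img Y False 1 r (One, One) * img Y False 1 r (i, j) = 0"
    using ij by (cases i; cases j) simp_all
  moreover have z: "P i Two * Q Two j = - (P i One * Q One j)"
    using PQ[of i j] ij by (simp add: eq_neg_iff_add_eq_0 add.commute)
  ultimately have "(P One One * Q One One / A + P One Two * Q Two One / B) * (P i One * Q One j * (A - B)) = 0"
    "(P One One * Q One One * A + P One Two * Q Two One * B) * (P i One * Q One j * (1 / A - 1 / B)) = 0"
    unfolding img_Y[OF r0] if_False z using AB(4,5) by (simp_all add: MJ_def m2_scale_def m2_defs algebra_simps)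
  moreover have "A - B \<noteq> 0" "1 / A - 1 / B \<noteq> 0" using AB r by auto
  ultimately have 1: "P One One * Q One One / A + P One Two * Q Two One / B = 0" "P One One * Q One One * A + P One Two * Q Two One * B = 0"
    using nz by auto
  define a b \<rho> where "a = P One One * Q One One" and "b = P One Two * Q Two One" and "\<rho> = r ^ t"
  have \<rho>0: "\<rho> \<noteq> 0" using r0 by (simp add: \<rho>_def)
  have 2: "a * \<rho> + b = 0" using 1(1) AB \<rho>0 unfolding a_def[symmetric] b_def[symmetric] \<rho>_def[symmetric] by (simp add: field_simps)
  have "(a + b * \<rho>) * A = 0" using 1(2) AB(3) unfolding a_def[symmetric] b_def[symmetric] \<rho>_def[symmetric] by (simp add: algebra_simps)
  then have 3: "a + b * \<rho> = 0" using AB(1) by simp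
  have 4: "a + b = 1" using PQ_rels(1) by (simp add: a_def b_def)
  have "(1 + \<rho>) * (a + b) = 0" using 2 3 by Groebner_Basis.algebra
  then have "\<rho> = - 1" using 4 by (simp add: eq_neg_iff_add_eq_0 add.commute)
  then show "(r ^ t)\<^sup>2 = 1" "2 * (P One One * Q One One) = 1"
    using 2 4 by (simp_all add: \<rho>_def a_def[symmetric])
qed

lemma off_diagonal_imp_n2:
  assumes ij: "i \<noteq> j" and nz: "P i One * Q One j \<noteq> 0"
  shows "n = 2" "t = 1" "2 * (P One One * Q One One) = 1"
proof -
  have "\<not> int n dvd int t" using t by (auto dest: dvd_imp_le)
  then have "\<exists>r::'k. r ^ n = 1 \<and> r powi int t \<noteq> 1" using all_roots_imp_dvd[of n "1::'k" "int t" 1] n by auto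
  then obtain r :: 'k where r: "r ^ n = 1" "r ^ t \<noteq> 1" by auto
  show half: "2 * (P One One * Q One One) = 1" using off_diagonal_roots(2)[OF ij nz r] .
  then have half': "P One Two * Q Two One = P One One * Q One One" using PQ_rels(1) by Groebner_Basis.algebra
  show n2: "n = 2"
  proof (rule commute_imp_n2[OF Y_endo(3)])
    fix fl w r assume "r ^ n = lamf fl"
    then have r: "r \<noteq> 0" by (rule root_nz(2))
    \<comment> \<open>In the off-diagonal block \<open>Q P = 1\<close> makes the two images
      opposite; in the diagonal block all coefficients agree and the images are equal. Either way
      they commute.\<close>
    have "img Y fl w r (Two, Two) = img Y fl w r (One, One) \<or> img Y fl w r (Two, Two) = - img Y fl w r (One, One)"
    proof (cases fl)
      case True
      have "P Two One * Q Two Two = - (P One One * Q Two One)" "P Two Two * Q One Two = - (P One Two * Q One One)"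
        using PQ_rels by Groebner_Basis.algebra+
      then show ?thesis unfolding img_Y[OF r] using True by (simp add: m2_scale_def m2_defs)
    next
      case False
      then show ?thesis unfolding img_Y[OF r] using PQ_diag half' by simp
    qed
    then show "img Y fl w r (One, One) * img Y fl w r (Two, Two) = img Y fl w r (Two, Two) * img Y fl w r (One, One)"
      by auto
  qed
  show "t = 1" using t n2 by simp
qed

text \<open>The two vanishing products leave \<open>P\<close> and \<open>Q\<close> both diagonal or
  both antidiagonal, according to whether \<open>Q One One\<close> vanishes; \<xi> is then the
  coefficient in the image of \<open>x12\<close>.\<close>

lemma diagonal_case:
  assumes "P One One * Q One Two = 0" "P Two One * Q One One = 0"
  shows "\<exists>\<xi>. okP s t \<xi> \<and> coprime (2 * s + t) N \<and> coprime n t \<and> (f = endo (yPsi s t \<xi>) \<or> f = endo (yPhi s t \<xi>))"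
proof -
  note R = PQ_rels PQ_diag assms
  have zero: "P One Two * Q Two Two = 0" "P Two Two * Q Two One = 0" using R by Groebner_Basis.algebra+
  show ?thesis
  proof (cases "Q One One = 0")
    case False
    have nz: "Q One One \<noteq> 0" "P Two One = 0" using False assms by simp_all
    then have "P One One * Q One One = 1" using R by simp
    then have z: "Q One Two = 0" "P Two Two * Q Two Two = 1" "P One One \<noteq> 0" using R by auto
    then have z': "P One Two = 0" "Q Two One = 0" using zero by auto
    define \<xi> where "\<xi> = P One One * Q Two Two"
    have xi: "\<xi> \<noteq> 0" using z by (auto simp: \<xi>_def)
    have inv: "inverse \<xi> = P Two Two * Q One One"
      by (rule inverse_unique) (use z \<open>P One One * Q One One = 1\<close> in \<open>simp add: \<xi>_def mult_ac\<close>, metis mult.commute mult.left_commute mult_1_right)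
    have "f (cls (gx i j)) = cls (yPsi s t \<xi> (i, j))" for i j
      unfolding fy cls_eq_iff using bas_One_Two[of s t, THEN eqv_sym] z z' nz \<open>P One One * Q One One = 1\<close>
      by (cases i; cases j) (auto simp: yPsi_def conj_gen_def sum_idx inv \<xi>_def[symmetric] bas_def[of _ _ One] intro: eqv_scale)
    from Psi_conditions[OF f this s t_odd xi] show ?thesis by blast
  next
    case True
    then have b: "P One Two * Q Two One = 1" "P Two One * Q One Two = 1" using R by simp_all
    then have z: "P One One = 0" "Q Two Two = 0" "P Two Two = 0" using R zero by auto
    define \<xi> where "\<xi> = P One Two * Q One Two"
    have xi: "\<xi> \<noteq> 0" using b by (auto simp: \<xi>_def)
    have inv: "inverse \<xi> = P Two One * Q Two One"
      by (rule inverse_unique) (use b in \<open>simp add: \<xi>_def mult_ac\<close>, metis mult.commute mult.left_commute mult_1_right)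
    have "f (cls (gx i j)) = cls (yPhi s t \<xi> (i, j))" for i j
      unfolding fy cls_eq_iff using bas_One_Two[of s t, THEN eqv_sym] z b True
      by (cases i; cases j) (auto simp: yPhi_def conj_gen_def sum_idx inv \<xi>_def[symmetric] bas_def[of _ _ One] intro: eqv_scale)
    from Phi_conditions[OF f this s t_odd xi] show ?thesis by blast
  qed
qed

text \<open>All products \<open>P i k * Q k i\<close> equal 1/2, so \<open>Q\<close> is determined
  by \<open>P\<close>, and \<open>P\<close> up to a scalar by two ratios of its entries. Relations
  evaluated at well-chosen points supply the conditions on these ratios.\<close>

lemma off_diagonal_case:
  assumes ij: "i \<noteq> j" and nz: "P i One * Q One j \<noteq> 0"
  shows "n = 2 \<and> lam = 1 \<and> (\<exists>z1 z2. okQ s z1 z2 \<and> coprime (2 * s + 1) N \<and> f = endo (yGamma s z1 z2))"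
proof -
  note n2 = off_diagonal_imp_n2(1)[OF assms] and t1 = off_diagonal_imp_n2(2)[OF assms]
  have half: "P One One * Q One One = 1 / 2" using off_diagonal_imp_n2(3)[OF assms] by (simp add: field_simps)
  have half': "P One Two * Q Two One = 1 / 2" "P Two One * Q One Two = 1 / 2" "P Two Two * Q Two Two = 1 / 2"
  proof -
    have "2 * (P One Two * Q Two One) = 1" "2 * (P Two One * Q One Two) = 1" "2 * (P Two Two * Q Two Two) = 1"
      using PQ_rels(1) PQ_diag off_diagonal_imp_n2(3)[OF assms] by Groebner_Basis.algebra+
    then show "P One Two * Q Two One = 1 / 2" "P Two One * Q One Two = 1 / 2" "P Two Two * Q Two Two = 1 / 2"
      by (simp_all add: field_simps)
  qed
  have P0: "P One One \<noteq> 0" "P One Two \<noteq> 0" "P Two One \<noteq> 0" "P Two Two \<noteq> 0" using half half' by auto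
  have Qs: "Q One One = 1 / (2 * P One One)" "Q Two One = 1 / (2 * P One Two)" "Q One Two = 1 / (2 * P Two One)" "Q Two Two = 1 / (2 * P Two Two)"
    using half half' P0 by (simp_all add: field_simps)
  have P22: "P Two Two * P One One = - (P One Two * P Two One)"
    using PQ_rels(3) P0 unfolding Qs by (simp add: field_simps eq_neg_iff_add_eq_0)
  \<comment> \<open>Scaling \<open>P\<close> against \<open>Q\<close> does not affect the
    conjugation, so only ratios to the first entry of \<open>P\<close> matter.\<close>
  define z1 z2 where "z1 = P One One / P Two One" and "z2 = P One One / P One Two"
  have z0: "z1 \<noteq> 0" "z2 \<noteq> 0" using P0 by (simp_all add: z1_def z2_def)
  have P22': "P Two Two = - (P One Two * P Two One) / P One One" using P22 P0 by (simp add: field_simps)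
  have tab: "P i k * Q l j = gamP z1 z2 i k * gamQ z1 z2 l j" for i k l j
    unfolding gamP_def gamQ_def z1_def z2_def
    using P0 by (cases i; cases k; cases l; cases j) (simp_all add: Qs P22' field_simps)
  have X: "Mx t W 1 r = MJ W 1" "Mx t W r 1 = MJ W r" for W r by (simp_all add: t1 Mx_def)
  have val: "img Y fl w r (i, j) = m2_scale (gamP z1 z2 i One * gamQ z1 z2 (if fl then Two else One) j) (MJ (w ^ (2 * s + 1)) 1)
    + m2_scale (gamP z1 z2 i Two * gamQ z1 z2 (if fl then One else Two) j) (MJ (w ^ (2 * s + 1)) r)" if "r \<noteq> 0" for fl w r i j
    unfolding img_Y[OF that] tab X unfolding t1 ..
  obtain w :: 'k where w: "w ^ (2 * N) = \<mu>" using nth_root_exists[of "2 * N" \<mu>] N by auto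
  obtain r :: 'k where r: "r ^ n = lam" using nth_root_exists[of n lam] n by auto
  have r0: "r \<noteq> 0" using root_nz(2)[of r True] r by simp
  have w0: "w \<noteq> 0" using root_nz(1)[of w True] w by simp
  \<comment> \<open>The relation \<open>x11 * x12 = 0\<close> at an off-diagonal point gives two
    equations in \<open>z2^2\<close> and \<open>r\<close>. Together they force
    \<open>z2^4 = 1\<close> and \<open>r^2 = 1\<close>; as \<open>n = 2\<close>, the latter says
    \<lambda> = 1.\<close>
  have "sat (img Y True w r)" using w r by (intro good_sat Y_endo) simp_all
  from satD(6)[OF this, of One One One Two] have "img Y True w r (One, One) * img Y True w r (One, Two) = 0" by simp
  then have "(w ^ (2 * s + 1))\<^sup>2 * z1 * ((z2 + 1 / (z2 * r)) * (- z2 + r / z2)) = 0"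
    "(w ^ (2 * s + 1))\<^sup>2 * z1 * ((z2 + r / z2) * (- z2 + 1 / (z2 * r))) = 0"
    unfolding val[OF r0] using z0 r0
    by (simp_all add: gamP_def gamQ_def MJ_def m2_scale_def m2_defs power2_eq_square field_simps)
  then have "(z2 + 1 / (z2 * r)) * (- z2 + r / z2) = 0" "(z2 + r / z2) * (- z2 + 1 / (z2 * r)) = 0"
    using w0 z0 by simp_all
  moreover have frac: "z2 + 1 / (z2 * r) = (z2 * z2 * r + 1) / (z2 * r)" "- z2 + r / z2 = (r - z2 * z2) / z2"
    "z2 + r / z2 = (z2 * z2 + r) / z2" "- z2 + 1 / (z2 * r) = (1 - z2 * z2 * r) / (z2 * r)"
    using z0 r0 by (simp_all add: field_simps)
  ultimately have "(z2 * z2 * r + 1) * (r - z2 * z2) = 0" "(z2 * z2 + r) * (1 - z2 * z2 * r) = 0"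
    unfolding frac using z0 r0 by simp_all
  then have "2 * r * (z2 ^ 4 - 1) = 0" "2 * z2\<^sup>2 * (r\<^sup>2 - 1) = 0" by Groebner_Basis.algebra+
  then have z24: "z2 ^ 4 = 1" and rr: "r\<^sup>2 = 1" using r0 z0 by simp_all
  have lam1: "lam = 1" using r rr unfolding n2 by simp
  have lamf1: "lamf fl = 1" for fl by (rule lamf_one[OF n2 lam1])
  have m1: "(- 1::'k) ^ n = lamf False" unfolding n2 by simp
  have XX: "MJ W (- 1) = - MJ W (1::'k)" for W by (simp add: MJ_def m2_defs)
  \<comment> \<open>At scale 1 and ratio -1 in the diagonal block the image of \<open>x11\<close>
    vanishes, and the relations leave the conditions \<open>z1^4 = 1\<close> and
    \<open>z1^(2*N) = \<mu>\<close>.\<close>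
  have sF: "sat (img Y False 1 (- 1))" using m1 by (intro good_sat Y_endo) simp_all
  have vF: "img Y False 1 (- 1) (One, One) = 0" "img Y False 1 (- 1) (One, Two) = MJ z1 1" "img Y False 1 (- 1) (Two, One) = MJ (1 / z1) 1"
    unfolding val[OF neg_one_neq_zero] using z0
    by (simp_all add: gamP_def gamQ_def MJ_def m2_scale_def m2_defs field_simps)
  have "z1 * z1 = 1 / z1 * (1 / z1)"
    using satD(2)[OF sF] unfolding vF by (simp add: MDJ_mult MD_def)
  then have z14: "z1 ^ 4 = 1" using z0 by (simp add: field_simps power4_eq_xxxx)
  have mu1: "\<mu> * x = 1 \<Longrightarrow> x = \<mu>" for x by (metis mu_sq(1) mu_sq(4) mult.right_neutral)
  have N0: "2 * N \<noteq> 0" using N by simp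
  have z1N: "z1 ^ (2 * N) = \<mu>"
    using satD(5)[OF sF] N0 unfolding vF MJ_pow_even by (intro mu1) (simp add: power_0_left sq_sq_eq)
  have rz: "(z2\<^sup>2) ^ n = lamf True" using z24 unfolding n2 lamf1 by (simp flip: power_mult)
  \<comment> \<open>At off-diagonal ratio \<open>z2^2\<close> the image of \<open>x12\<close>
    vanishes, and the relation for the unit yields \<open>z2^(2*N) = \<mu>\<close>.\<close>
  have sT: "sat (img Y True w (z2\<^sup>2))" using w rz by (intro good_sat Y_endo) simp_all
  have z2sq: "MJ W (z2\<^sup>2) = MJ (z2\<^sup>2 * W) 1" for W by (rule MJ_sign) (use z24 in \<open>simp flip: power_mult\<close>)
  have z20: "z2\<^sup>2 \<noteq> 0" using z0 by simp
  have vT: "img Y True w (z2\<^sup>2) (One, One) = MJ (z2 * w ^ (2 * s + 1)) 1" "img Y True w (z2\<^sup>2) (One, Two) = 0"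
    unfolding val[OF z20] z2sq using z0
    by (simp_all add: gamP_def gamQ_def MJ_def m2_scale_def m2_defs field_simps power2_eq_square)
  have "(z2 * w ^ (2 * s + 1)) ^ (2 * N) = 1"
    using satD(5)[OF sT] N0 unfolding vT MJ_pow_even by (simp add: power_0_left sq_sq_eq)
  moreover have "(w ^ (2 * s + 1)) ^ (2 * N) = \<mu>" using pow_muf[of w True 1 s] w by simp
  ultimately have z2N: "z2 ^ (2 * N) = \<mu>" by (intro mu1) (simp only: power_mult_distrib mult.commute)
  have ok: "okQ s z1 z2" using s z14 z24 z1N z2N by (simp add: okQ_def)
  have "conj_gen s t P Q i j = conj_gen s 1 (gamP z1 z2) (gamQ z1 z2) i j" for i j
    unfolding conj_gen_def tab t1 ..
  then have fG: "f (cls (gx i j)) = cls (yGamma s z1 z2 (i, j))" for i j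
    unfolding fy cls_eq_iff using eqv_sym[OF yGamma_conj_gen[OF n2 lam1 ok]] by simp
  note g = hopf_auto_endo[OF f fG]
  have "coprime (2 * s + 1) N"
  proof (rule coprime_if_periodic[OF g(3), of 1 "\<lambda>fl. if fl then z2 else 1"])
    fix fl w r assume wr: "w ^ (2 * N) = muf fl" "r ^ n = lamf fl"
    note sg = sign_facts[OF n2 lam1 wr(2)]
    show "img (yGamma s z1 z2) fl w r (One, One) = 0 \<or> (\<exists>a. a \<noteq> 0 \<and> img (yGamma s z1 z2) fl w r (One, One) = MJ ((if fl then z2 else 1) * w ^ (2 * s + 1)) a)"
    proof (cases fl)
      case True
      show ?thesis
        using sg(3)[OF z24] fun_cong[OF Gamma_T1[OF s z24, of r w z1], of "(One, One)"] fun_cong[OF Gamma_T2[OF s z14 z24, of r w], of "(One, One)"] True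
        by (auto intro: exI[of _ 1])
    next
      case False
      show ?thesis
        using sg(2) fun_cong[OF Gamma_F1[OF s, of w z1 z2], of "(One, One)"] fun_cong[OF Gamma_F2[OF s z14, of w z2], of "(One, One)"] False
        by (auto intro: exI[of _ 1])
    qed
  qed (use z24 in auto)
  then show ?thesis using n2 lam1 ok g(2) by blast
qed

end

lemma hopf_auto_cases:
  assumes "f \<in> hopf_auto H"
  shows "(\<exists>s t \<xi>. s \<in> {1..N} \<and> t \<in> {1..n - 1} \<and> okP s t \<xi> \<and> coprime (2 * s + t) N \<and> coprime n t \<and>
      (f = endo (yPsi s t \<xi>) \<or> f = endo (yPhi s t \<xi>))) \<or>
    (n = 2 \<and> lam = 1 \<and> (\<exists>s z1 z2. s \<in> {1..N} \<and> okQ s z1 z2 \<and> coprime (2 * s + 1) N \<and> f = endo (yGamma s z1 z2)))"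
proof (rule hopf_auto_conj_gen[OF assms])
  fix s t P Q
  assume st: "s \<in> {1..N}" "0 < t" "t < n" and fy: "\<And>i j. f (cls (gx i j)) = cls (conj_gen s t P Q i j)"
    and QP: "\<And>l k. Q l One * P One k + Q l Two * P Two k = (if l = k then 1 else 0)"
    and PQ: "\<And>i j. P i One * Q One j + P i Two * Q Two j = (if i = j then 1 else 0)"
  have s1: "s \<ge> 1" using st by simp
  have tn: "t \<in> {1..n - 1}" using st by auto
  note ctx = assms s1 st(2,3) fy QP PQ
  show ?thesis
  proof (cases "P One One * Q One Two = 0 \<and> P Two One * Q One One = 0")
    case True
    then show ?thesis using diagonal_case[OF ctx] st(1) tn by blast
  next
    case False
    then obtain i j where "i \<noteq> j" "P i One * Q One j \<noteq> 0" by (metis idx.distinct(1))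
    from off_diagonal_case[OF ctx this] show ?thesis using st(1) by blast
  qed
qed

section \<open>The automorphism group\<close>


lemma Aut_mult:
  "f \<in> hopf_auto H \<Longrightarrow> g \<in> hopf_auto H \<Longrightarrow> f \<otimes>\<^bsub>Aut_Hopf H\<^esub> g = compose (carrier SA) f g"
  by (simp add: Aut_Hopf_def BijGroup_def hopf_auto_def)

lemma carrier_Aut: "carrier (Aut_Hopf H) = hopf_auto H"
  by (simp add: Aut_Hopf_def)

text \<open>Given \<open>\<xi>^4 = 1\<close>, the condition \<open>\<xi>^(2*n) = 1\<close> is
  automatic for even \<open>n\<close>, where 4 divides \<open>2*n\<close>, and means
  \<open>\<xi>^2 = 1\<close> for odd \<open>n\<close>.\<close>

lemma P_iff:
  "s \<in> {1..N} \<and> t \<in> {1..n-1} \<and> odd t \<and> gcd (2*s+t) N = 1 \<and> gcd n t = 1 \<and>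
     (if even n then \<xi>^(2*N) = 1 \<and> \<xi>^4 = 1 else \<xi>^2 = 1) \<longleftrightarrow>
   s \<in> {1..N} \<and> t \<in> {1..n-1} \<and> okP s t \<xi> \<and> coprime (2*s+t) N \<and> coprime n t"
proof -
  have "\<xi> ^ (2 * n) = 1" if "even n" "\<xi> ^ 4 = 1"
  proof -
    obtain m where "2 * n = 4 * m" using \<open>even n\<close> by (auto elim: evenE)
    then show ?thesis using that by (simp only: power_mult power_one)
  qed
  moreover have "\<xi>\<^sup>2 = 1" if "odd n" "\<xi> ^ 4 = 1" "\<xi> ^ (2 * n) = 1"
  proof -
    obtain m where "2 * n = 4 * m + 2" using \<open>odd n\<close> by (auto elim!: oddE)
    then have "\<xi> ^ (2 * n) = (\<xi> ^ 4) ^ m * \<xi>\<^sup>2" by (simp only: power_add power_mult)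
    then show ?thesis using that by simp
  qed
  moreover have "\<xi> ^ 4 = 1" if "\<xi>\<^sup>2 = 1"
    using power_mult[of \<xi> 2 2] that by simp
  ultimately show ?thesis
    by (auto simp: okP_def coprime_iff_gcd_eq_1 power_mult)
qed

lemma P2_iff:
  assumes "n = 2"
  shows "s \<in> {1..N} \<and> gcd (2*s+1) N = 1 \<and> \<xi>^(2*N) = 1 \<and> \<xi>^4 = 1 \<longleftrightarrow>
   s \<in> {1..N} \<and> okP s 1 \<xi> \<and> coprime (2*s+1) N"
  unfolding okP_def unfolding assms by (auto simp: coprime_iff_gcd_eq_1)

text \<open>Given \<open>z^4 = 1\<close>, the power \<open>z^(2*N)\<close> is 1 for even
  \<open>N\<close> and \<open>z^2\<close> for odd \<open>N\<close>; hence \<mu> must be 1 when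
  \<open>N\<close> is even.\<close>

lemma okQ_root_iff:
  "z ^ 4 = 1 \<and> z ^ (2 * N) = \<mu> \<longleftrightarrow> (if even N then z ^ 4 = \<mu> \<and> \<mu> = 1 else z\<^sup>2 = \<mu>)"
proof (cases "even N")
  case True
  then obtain m where "2 * N = 4 * m" by (auto elim: evenE)
  then have "z ^ (2 * N) = (z ^ 4) ^ m" by (simp only: power_mult)
  then show ?thesis using True by auto
next
  case False
  then obtain m where "2 * N = 4 * m + 2" by (auto elim!: oddE)
  then have *: "z ^ (2 * N) = (z ^ 4) ^ m * z\<^sup>2" by (simp only: power_add power_mult)
  have "z ^ 4 = 1" if "z\<^sup>2 = \<mu>"
    using power_mult[of z 2 2] that by simp
  then show ?thesis using False * by auto
qed

lemma Q_iff:
  "s \<in> {1..N} \<and> gcd (2*s+1) N = 1 \<and>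
     (if even N then \<zeta>1^4 = \<mu> \<and> \<zeta>2^4 = \<mu> \<and> \<mu> = 1 else \<zeta>1^2 = \<mu> \<and> \<zeta>2^2 = \<mu>) \<longleftrightarrow>
   s \<in> {1..N} \<and> okQ s \<zeta>1 \<zeta>2 \<and> coprime (2*s+1) N"
  using okQ_root_iff[of \<zeta>1] okQ_root_iff[of \<zeta>2]
  by (auto simp: okQ_def coprime_iff_gcd_eq_1)

end

theorem theorem3p14:
  fixes N n :: nat and \<mu> lam :: "'k::{alg_closed_field, field_char_0}"
  assumes "N \<ge> 1" and "n \<ge> 2" and "\<mu> \<in> {1, -1}" and "lam \<in> {1, -1}"
  shows
    "let G = Aut_Hopf (suzuki N n \<mu> lam);
         \<Psi> = suzuki_Psi N n \<mu> lam; \<Phi> = suzuki_Phi N n \<mu> lam; \<Gamma> = suzuki_Gamma N n \<mu> lam;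
         P = {(s::nat, t::nat, \<xi>::'k). s \<in> {1..N} \<and> t \<in> {1..n-1} \<and> odd t \<and>
                gcd (2*s+t) N = 1 \<and> gcd n t = 1 \<and>
                (if even n then \<xi>^(2*N) = 1 \<and> \<xi>^4 = 1 else \<xi>^2 = 1)};
         P\<^sub>2 = {(s::nat, \<xi>::'k). s \<in> {1..N} \<and> gcd (2*s+1) N = 1 \<and> \<xi>^(2*N) = 1 \<and> \<xi>^4 = 1};
         Q = {(s::nat, \<zeta>\<^sub>1::'k, \<zeta>\<^sub>2::'k). s \<in> {1..N} \<and> gcd (2*s+1) N = 1 \<and>
                (if even N then \<zeta>\<^sub>1^4 = \<mu> \<and> \<zeta>\<^sub>2^4 = \<mu> \<and> \<mu> = 1 else \<zeta>\<^sub>1^2 = \<mu> \<and> \<zeta>\<^sub>2^2 = \<mu>)}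
     in
     ((n, lam) \<noteq> (2, 1) \<or> ((n, lam, \<mu>) = (2, 1, -1) \<and> even N) \<longrightarrow>
        carrier G = {\<Psi> s t \<xi> | s t \<xi>. (s, t, \<xi>) \<in> P} \<union> {\<Phi> s t \<xi> | s t \<xi>. (s, t, \<xi>) \<in> P} \<and>
        (\<forall>(s\<^sub>1, t\<^sub>1, \<xi>\<^sub>1)\<in>P. \<forall>(s\<^sub>2, t\<^sub>2, \<xi>\<^sub>2)\<in>P.
           \<Psi> s\<^sub>1 t\<^sub>1 \<xi>\<^sub>1 \<otimes>\<^bsub>G\<^esub> \<Psi> s\<^sub>2 t\<^sub>2 \<xi>\<^sub>2
             = \<Psi> (s\<^sub>1*(2*s\<^sub>2+t\<^sub>2) + s\<^sub>2*t\<^sub>1) (t\<^sub>1*t\<^sub>2) (\<xi>\<^sub>1^(2*s\<^sub>2+1) * \<xi>\<^sub>2) \<and>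
           \<Phi> s\<^sub>1 t\<^sub>1 \<xi>\<^sub>1 \<otimes>\<^bsub>G\<^esub> \<Phi> s\<^sub>2 t\<^sub>2 \<xi>\<^sub>2
             = \<Psi> (s\<^sub>1*(2*s\<^sub>2+t\<^sub>2) + s\<^sub>2*t\<^sub>1) (t\<^sub>1*t\<^sub>2) (\<xi>\<^sub>1^(2*s\<^sub>2-1) * \<xi>\<^sub>2) \<and>
           \<Psi> s\<^sub>1 t\<^sub>1 \<xi>\<^sub>1 \<otimes>\<^bsub>G\<^esub> \<Phi> s\<^sub>2 t\<^sub>2 \<xi>\<^sub>2
             = \<Phi> (s\<^sub>1*(2*s\<^sub>2+t\<^sub>2) + s\<^sub>2*t\<^sub>1) (t\<^sub>1*t\<^sub>2) (\<xi>\<^sub>1^(2*s\<^sub>2-1) * \<xi>\<^sub>2) \<and>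
           \<Phi> s\<^sub>1 t\<^sub>1 \<xi>\<^sub>1 \<otimes>\<^bsub>G\<^esub> \<Psi> s\<^sub>2 t\<^sub>2 \<xi>\<^sub>2
             = \<Phi> (s\<^sub>1*(2*s\<^sub>2+t\<^sub>2) + s\<^sub>2*t\<^sub>1) (t\<^sub>1*t\<^sub>2) (\<xi>\<^sub>1^(2*s\<^sub>2+1) * \<xi>\<^sub>2)))
     \<and>
     ((n, lam) = (2, 1) \<and> \<not> (\<mu> = -1 \<and> even N) \<longrightarrow>
        carrier G = {\<Psi> s 1 \<xi> | s \<xi>. (s, \<xi>) \<in> P\<^sub>2} \<union> {\<Phi> s 1 \<xi> | s \<xi>. (s, \<xi>) \<in> P\<^sub>2}
                    \<union> {\<Gamma> s \<zeta>\<^sub>1 \<zeta>\<^sub>2 | s \<zeta>\<^sub>1 \<zeta>\<^sub>2. (s, \<zeta>\<^sub>1, \<zeta>\<^sub>2) \<in> Q} \<and>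
        (\<forall>(s\<^sub>1, \<xi>\<^sub>1)\<in>P\<^sub>2. \<forall>(s\<^sub>2, \<xi>\<^sub>2)\<in>P\<^sub>2.
           \<Psi> s\<^sub>1 1 \<xi>\<^sub>1 \<otimes>\<^bsub>G\<^esub> \<Psi> s\<^sub>2 1 \<xi>\<^sub>2 = \<Psi> (s\<^sub>1*(2*s\<^sub>2+1) + s\<^sub>2) 1 (\<xi>\<^sub>1^(2*s\<^sub>2+1) * \<xi>\<^sub>2) \<and>
           \<Phi> s\<^sub>1 1 \<xi>\<^sub>1 \<otimes>\<^bsub>G\<^esub> \<Phi> s\<^sub>2 1 \<xi>\<^sub>2 = \<Psi> (s\<^sub>1*(2*s\<^sub>2+1) + s\<^sub>2) 1 (\<xi>\<^sub>1^(2*s\<^sub>2-1) * \<xi>\<^sub>2) \<and>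
           \<Psi> s\<^sub>1 1 \<xi>\<^sub>1 \<otimes>\<^bsub>G\<^esub> \<Phi> s\<^sub>2 1 \<xi>\<^sub>2 = \<Phi> (s\<^sub>1*(2*s\<^sub>2+1) + s\<^sub>2) 1 (\<xi>\<^sub>1^(2*s\<^sub>2-1) * \<xi>\<^sub>2) \<and>
           \<Phi> s\<^sub>1 1 \<xi>\<^sub>1 \<otimes>\<^bsub>G\<^esub> \<Psi> s\<^sub>2 1 \<xi>\<^sub>2 = \<Phi> (s\<^sub>1*(2*s\<^sub>2+1) + s\<^sub>2) 1 (\<xi>\<^sub>1^(2*s\<^sub>2+1) * \<xi>\<^sub>2)) \<and>
        (\<forall>(s\<^sub>1, a\<^sub>1, a\<^sub>2)\<in>Q. \<forall>(s\<^sub>2, b\<^sub>1, b\<^sub>2)\<in>Q.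
           (a\<^sub>1^(2*s\<^sub>2) * a\<^sub>1 * b\<^sub>2 = 1 \<and> (a\<^sub>1*b\<^sub>2)^2 = 1 \<longrightarrow>
              \<Gamma> s\<^sub>1 a\<^sub>1 a\<^sub>2 \<otimes>\<^bsub>G\<^esub> \<Gamma> s\<^sub>2 b\<^sub>1 b\<^sub>2
                = \<Psi> (s\<^sub>1*(2*s\<^sub>2+1) + s\<^sub>2) 1 (a\<^sub>2^(2*s\<^sub>2+1) * b\<^sub>1)) \<and>
           (a\<^sub>1^(2*s\<^sub>2) * a\<^sub>1 * b\<^sub>2 = -1 \<and> (a\<^sub>1*b\<^sub>2)^2 = 1 \<longrightarrow>
              \<Gamma> s\<^sub>1 a\<^sub>1 a\<^sub>2 \<otimes>\<^bsub>G\<^esub> \<Gamma> s\<^sub>2 b\<^sub>1 b\<^sub>2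
                = \<Phi> (s\<^sub>1*(2*s\<^sub>2+1) + s\<^sub>2) 1 (a\<^sub>2^(2*s\<^sub>2-1) * b\<^sub>1)) \<and>
           ((a\<^sub>1*b\<^sub>2)^2 = -1 \<longrightarrow>
              \<Gamma> s\<^sub>1 a\<^sub>1 a\<^sub>2 \<otimes>\<^bsub>G\<^esub> \<Gamma> s\<^sub>2 b\<^sub>1 b\<^sub>2
                = \<Gamma> (s\<^sub>1*(2*s\<^sub>2+1) + s\<^sub>2)
                    (- (b\<^sub>1 * a\<^sub>1^(2*s\<^sub>2) * a\<^sub>1 * b\<^sub>2)) (- ((a\<^sub>1*a\<^sub>2)^(2*s\<^sub>2+1) * b\<^sub>2))) \<and>
           (a\<^sub>1^(2*s\<^sub>2) * a\<^sub>1 * b\<^sub>2 = 1 \<and> (a\<^sub>1*b\<^sub>2)^2 = 1 \<or>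
            a\<^sub>1^(2*s\<^sub>2) * a\<^sub>1 * b\<^sub>2 = -1 \<and> (a\<^sub>1*b\<^sub>2)^2 = 1 \<or> (a\<^sub>1*b\<^sub>2)^2 = -1)) \<and>
        (\<forall>(s\<^sub>1, \<zeta>\<^sub>1, \<zeta>\<^sub>2)\<in>Q. \<forall>(s\<^sub>2, \<xi>)\<in>P\<^sub>2.
           \<Gamma> s\<^sub>1 \<zeta>\<^sub>1 \<zeta>\<^sub>2 \<otimes>\<^bsub>G\<^esub> \<Psi> s\<^sub>2 1 \<xi>
             = \<Gamma> (s\<^sub>1*(2*s\<^sub>2+1) + s\<^sub>2) (\<zeta>\<^sub>1^(2*s\<^sub>2+1) * \<xi>) (\<zeta>\<^sub>2^(2*s\<^sub>2+1)) \<and>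
           \<Psi> s\<^sub>2 1 \<xi> \<otimes>\<^bsub>G\<^esub> \<Gamma> s\<^sub>1 \<zeta>\<^sub>1 \<zeta>\<^sub>2
             = \<Gamma> (s\<^sub>1*(2*s\<^sub>2+1) + s\<^sub>2) \<zeta>\<^sub>1 (\<xi>^(2*s\<^sub>1+1) * \<zeta>\<^sub>2) \<and>
           \<Phi> s\<^sub>2 1 \<xi> \<otimes>\<^bsub>G\<^esub> \<Gamma> s\<^sub>1 \<zeta>\<^sub>1 \<zeta>\<^sub>2
             = \<Gamma> (s\<^sub>1*(2*s\<^sub>2+1) + s\<^sub>2) (- \<zeta>\<^sub>1) (\<xi>^(2*s\<^sub>1-1) * inverse \<zeta>\<^sub>2) \<and>
           \<Gamma> s\<^sub>1 \<zeta>\<^sub>1 \<zeta>\<^sub>2 \<otimes>\<^bsub>G\<^esub> \<Phi> s\<^sub>2 1 \<xi>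
             = \<Gamma> (s\<^sub>1*(2*s\<^sub>2+1) + s\<^sub>2) (\<xi> * inverse (\<zeta>\<^sub>1^(2*s\<^sub>2+1))) (- (\<zeta>\<^sub>2^(2*s\<^sub>2+1)))))"
proof -
  interpret suzuki_params N n \<mu> lam by standard (fact assms)+
  let ?P = "{(s, t, \<xi>). s \<in> {1..N} \<and> t \<in> {1..n-1} \<and> okP s t \<xi> \<and> coprime (2*s+t) N \<and> coprime n t}"
  let ?P2 = "{(s, \<xi>). s \<in> {1..N} \<and> okP s 1 \<xi> \<and> coprime (2*s+1) N}"
  let ?Q = "{(s, \<zeta>1, \<zeta>2). s \<in> {1..N} \<and> okQ s \<zeta>1 \<zeta>2 \<and> coprime (2*s+1) N}"
  let ?G = "Aut_Hopf H"
  have P_comp: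
    "endo (yPsi s1 t1 \<xi>1) \<otimes>\<^bsub>?G\<^esub> endo (yPsi s2 t2 \<xi>2) = endo (yPsi (s1 * (2 * s2 + t2) + s2 * t1) (t1 * t2) (\<xi>1 ^ (2 * s2 + 1) * \<xi>2))"
    "endo (yPhi s1 t1 \<xi>1) \<otimes>\<^bsub>?G\<^esub> endo (yPhi s2 t2 \<xi>2) = endo (yPsi (s1 * (2 * s2 + t2) + s2 * t1) (t1 * t2) (\<xi>1 ^ (2 * s2 - 1) * \<xi>2))"
    "endo (yPsi s1 t1 \<xi>1) \<otimes>\<^bsub>?G\<^esub> endo (yPhi s2 t2 \<xi>2) = endo (yPhi (s1 * (2 * s2 + t2) + s2 * t1) (t1 * t2) (\<xi>1 ^ (2 * s2 - 1) * \<xi>2))"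
    "endo (yPhi s1 t1 \<xi>1) \<otimes>\<^bsub>?G\<^esub> endo (yPsi s2 t2 \<xi>2) = endo (yPhi (s1 * (2 * s2 + t2) + s2 * t1) (t1 * t2) (\<xi>1 ^ (2 * s2 + 1) * \<xi>2))"
    if "okP s1 t1 \<xi>1" "coprime (2 * s1 + t1) N" "coprime n t1" "okP s2 t2 \<xi>2" "coprime (2 * s2 + t2) N" "coprime n t2"
    for s1 t1 \<xi>1 s2 t2 \<xi>2
    using that by (simp_all only: Aut_mult Psi_auto Phi_auto compose_PP)
  have case1: "carrier ?G = {endo (yPsi s t \<xi>) | s t \<xi>. (s, t, \<xi>) \<in> ?P} \<union> {endo (yPhi s t \<xi>) | s t \<xi>. (s, t, \<xi>) \<in> ?P}"
    if c: "(n, lam) \<noteq> (2, 1) \<or> ((n, lam, \<mu>) = (2, 1, -1) \<and> even N)"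
  proof -
    \<comment> \<open>For even \<open>N\<close> and \<mu> = -1 the parameter conditions of \<Gamma>
      have no solution, so only the first alternative of \<open>hopf_auto_cases\<close>
      remains.\<close>
    have noQ: "\<not> (n = 2 \<and> lam = 1 \<and> okQ s z1 z2)" for s z1 z2
    proof
      assume a: "n = 2 \<and> lam = 1 \<and> okQ s z1 z2"
      then have "\<mu> = - 1" "even N" using c by auto
      moreover have "(1::'k) \<noteq> - 1" by simp
      ultimately show False using okQ_root_iff[of z1] a unfolding okQ_def by metis
    qed
    show ?thesis
      unfolding carrier_Aut
    proof (intro subset_antisym subsetI)
      fix f assume f: "f \<in> hopf_auto H"
      show "f \<in> {endo (yPsi s t \<xi>) | s t \<xi>. (s, t, \<xi>) \<in> ?P} \<union> {endo (yPhi s t \<xi>) | s t \<xi>. (s, t, \<xi>) \<in> ?P}"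
        using hopf_auto_cases[OF f] noQ by blast
    qed (auto intro: Psi_auto Phi_auto)
  qed
  have case2: "carrier ?G = {endo (yPsi s 1 \<xi>) | s \<xi>. (s, \<xi>) \<in> ?P2} \<union> {endo (yPhi s 1 \<xi>) | s \<xi>. (s, \<xi>) \<in> ?P2}
      \<union> {endo (yGamma s \<zeta>1 \<zeta>2) | s \<zeta>1 \<zeta>2. (s, \<zeta>1, \<zeta>2) \<in> ?Q}"
    if n2: "n = 2" and lam1: "lam = 1"
    unfolding carrier_Aut
  proof (intro subset_antisym subsetI)
    fix f assume f: "f \<in> hopf_auto H"
    have "t = 1" if "t \<in> {1..n - 1}" for t using that unfolding n2 by simp
    then show "f \<in> {endo (yPsi s 1 \<xi>) | s \<xi>. (s, \<xi>) \<in> ?P2} \<union> {endo (yPhi s 1 \<xi>) | s \<xi>. (s, \<xi>) \<in> ?P2}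
      \<union> {endo (yGamma s \<zeta>1 \<zeta>2) | s \<zeta>1 \<zeta>2. (s, \<zeta>1, \<zeta>2) \<in> ?Q}"
      using hopf_auto_cases[OF f] by blast
  next
    fix f assume "f \<in> {endo (yPsi s 1 \<xi>) | s \<xi>. (s, \<xi>) \<in> ?P2} \<union> {endo (yPhi s 1 \<xi>) | s \<xi>. (s, \<xi>) \<in> ?P2}
      \<union> {endo (yGamma s \<zeta>1 \<zeta>2) | s \<zeta>1 \<zeta>2. (s, \<zeta>1, \<zeta>2) \<in> ?Q}"
    then show "f \<in> hopf_auto H"
      using Psi_auto[of _ 1] Phi_auto[of _ 1] Gamma_auto[OF n2 lam1] by auto
  qed
  have G_comp:
    "a1 ^ (2 * s2) * a1 * b2 = 1 \<and> (a1 * b2)\<^sup>2 = 1 \<longrightarrow> endo (yGamma s1 a1 a2) \<otimes>\<^bsub>?G\<^esub> endo (yGamma s2 b1 b2)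
      = endo (yPsi (s1 * (2 * s2 + 1) + s2) 1 (a2 ^ (2 * s2 + 1) * b1))"
    "a1 ^ (2 * s2) * a1 * b2 = - 1 \<and> (a1 * b2)\<^sup>2 = 1 \<longrightarrow> endo (yGamma s1 a1 a2) \<otimes>\<^bsub>?G\<^esub> endo (yGamma s2 b1 b2)
      = endo (yPhi (s1 * (2 * s2 + 1) + s2) 1 (a2 ^ (2 * s2 - 1) * b1))"
    "(a1 * b2)\<^sup>2 = - 1 \<longrightarrow> endo (yGamma s1 a1 a2) \<otimes>\<^bsub>?G\<^esub> endo (yGamma s2 b1 b2)
      = endo (yGamma (s1 * (2 * s2 + 1) + s2) (- (b1 * a1 ^ (2 * s2) * a1 * b2)) (- ((a1 * a2) ^ (2 * s2 + 1) * b2)))"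
    "a1 ^ (2 * s2) * a1 * b2 = 1 \<and> (a1 * b2)\<^sup>2 = 1 \<or> a1 ^ (2 * s2) * a1 * b2 = - 1 \<and> (a1 * b2)\<^sup>2 = 1 \<or> (a1 * b2)\<^sup>2 = - 1"
    if n2: "n = 2" and lam1: "lam = 1"
      and Q: "okQ s1 a1 a2" "coprime (2 * s1 + 1) N" "okQ s2 b1 b2" "coprime (2 * s2 + 1) N"
    for s1 a1 a2 s2 b1 b2
    unfolding Aut_mult[OF Gamma_auto[OF n2 lam1 Q(1,2)] Gamma_auto[OF n2 lam1 Q(3,4)]]
    using GG_Psi[OF n2 lam1 Q(1,3)] GG_Phi[OF n2 lam1 Q(1,3)] GG_Gamma[OF n2 lam1 Q(1,3)] GG_trichotomy[OF n2 lam1 Q(1,3)]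
    by blast+
  have GP_comp:
    "endo (yGamma s1 \<zeta>1 \<zeta>2) \<otimes>\<^bsub>?G\<^esub> endo (yPsi s2 1 \<xi>) = endo (yGamma (s1 * (2 * s2 + 1) + s2) (\<zeta>1 ^ (2 * s2 + 1) * \<xi>) (\<zeta>2 ^ (2 * s2 + 1)))"
    "endo (yPsi s2 1 \<xi>) \<otimes>\<^bsub>?G\<^esub> endo (yGamma s1 \<zeta>1 \<zeta>2) = endo (yGamma (s1 * (2 * s2 + 1) + s2) \<zeta>1 (\<xi> ^ (2 * s1 + 1) * \<zeta>2))"
    "endo (yPhi s2 1 \<xi>) \<otimes>\<^bsub>?G\<^esub> endo (yGamma s1 \<zeta>1 \<zeta>2) = endo (yGamma (s1 * (2 * s2 + 1) + s2) (- \<zeta>1) (\<xi> ^ (2 * s1 - 1) * inverse \<zeta>2))"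
    "endo (yGamma s1 \<zeta>1 \<zeta>2) \<otimes>\<^bsub>?G\<^esub> endo (yPhi s2 1 \<xi>) = endo (yGamma (s1 * (2 * s2 + 1) + s2) (\<xi> * inverse (\<zeta>1 ^ (2 * s2 + 1))) (- (\<zeta>2 ^ (2 * s2 + 1))))"
    if n2: "n = 2" and lam1: "lam = 1"
      and Q: "okQ s1 \<zeta>1 \<zeta>2" "coprime (2 * s1 + 1) N" and P: "okP s2 1 \<xi>" "coprime (2 * s2 + 1) N"
    for s1 \<zeta>1 \<zeta>2 s2 \<xi>
    using Gamma_auto[OF n2 lam1 Q] Psi_auto[OF P coprime_1_right] Phi_auto[OF P coprime_1_right]
      Gamma_Psi[OF n2 lam1 Q(1) P(1)] Psi_Gamma[OF n2 lam1 Q(1) P(1)] Phi_Gamma[OF n2 lam1 Q(1) P(1)] Gamma_Phi[OF n2 lam1 Q(1) P(1)]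
    by (simp_all only: Aut_mult)
  have P1_comp: "endo (yPsi s1 1 \<xi>1) \<otimes>\<^bsub>?G\<^esub> endo (yPsi s2 1 \<xi>2) = endo (yPsi (s1 * (2 * s2 + 1) + s2) 1 (\<xi>1 ^ (2 * s2 + 1) * \<xi>2))"
    "endo (yPhi s1 1 \<xi>1) \<otimes>\<^bsub>?G\<^esub> endo (yPhi s2 1 \<xi>2) = endo (yPsi (s1 * (2 * s2 + 1) + s2) 1 (\<xi>1 ^ (2 * s2 - 1) * \<xi>2))"
    "endo (yPsi s1 1 \<xi>1) \<otimes>\<^bsub>?G\<^esub> endo (yPhi s2 1 \<xi>2) = endo (yPhi (s1 * (2 * s2 + 1) + s2) 1 (\<xi>1 ^ (2 * s2 - 1) * \<xi>2))"
    "endo (yPhi s1 1 \<xi>1) \<otimes>\<^bsub>?G\<^esub> endo (yPsi s2 1 \<xi>2) = endo (yPhi (s1 * (2 * s2 + 1) + s2) 1 (\<xi>1 ^ (2 * s2 + 1) * \<xi>2))"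
    if "okP s1 1 \<xi>1" "coprime (2 * s1 + 1) N" "okP s2 1 \<xi>2" "coprime (2 * s2 + 1) N" for s1 \<xi>1 s2 \<xi>2
    using P_comp[OF that(1,2) coprime_1_right that(3,4) coprime_1_right] by (simp_all only: mult_1_right mult_1)
  show ?thesis
    unfolding Let_def suzuki_maps_eq P_iff Q_iff
  proof (intro conjI impI, goal_cases)
    case 1
    then show ?case by (rule case1)
  next
    case 2
    show ?case unfolding Ball_def split_paired_All mem_Collect_eq prod.case
      by (intro allI impI, elim conjE, intro conjI; rule P_comp; assumption)
  next
    case 3
    then have n2: "n = 2" and lam1: "lam = 1" by simp_all
    show ?case unfolding P2_iff[OF n2] by (rule case2[OF n2 lam1])
  next
    case 4
    then have n2: "n = 2" by simp
    show ?case unfolding P2_iff[OF n2] using P1_comp by auto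
  next
    case 5
    then have n2: "n = 2" and lam1: "lam = 1" by simp_all
    show ?case unfolding Ball_def split_paired_All mem_Collect_eq prod.case
      by (intro allI impI, elim conjE, intro conjI; rule G_comp[OF n2 lam1]; assumption)
  next
    case 6
    then have n2: "n = 2" and lam1: "lam = 1" by simp_all
    show ?case unfolding P2_iff[OF n2] using GP_comp[OF n2 lam1] by auto
  qed
qed

end
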